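(* For all $d,\Delta\in\mathbb{N}$ and $\delta>0$ there exists $c>0$ such that, for all sufficiently large $n$, with bias $b$ Maker wins (a) the $\mathcal{H}(n,\Delta)$-universality game on $K_{(1+\delta)n}$ if $b\le c\big(\tfrac{n}{\log n}\big)^{1/\Delta}$; (b) the $\mathcal{H}'(n,\Delta)$-universality game on $K_n$ if $b\le c\big(\tfrac{n}{\log n}\big)^{1/\Delta}$; (c) the $\mathcal{H}(n,d,\Delta)$-universality game on $K_{(1+\delta)n}$ if $b\le c\big(\tfrac{n}{\log n}\big)^{1/(2d)}$; (d) the $\mathcal{H}'(n,d,\Delta)$-universality game on $K_n$ if $b\le c\big(\tfrac{n}{\log n}\big)^{1/(2d+1)}$.
   Context: Logarithms are to base $2$. $\mathcal{H}(n,\Delta)$ is the class of $n$-vertex graphs with maximum degree at most $\Delta$; $\mathcal{H}(n,d,\Delta)$ is the class of those which in addition have degeneracy at most $d$ (degeneracy: least $\ell$ such that every induced subgraph has minimum degree at most $\ell$). $\mathcal{H}'(n,\Delta)$ and $\mathcal{H}'(n,d,\Delta)$ are the subclasses of triangle-free graphs in $\mathcal{H}(n,\Delta)$ and $\mathcal{H}(n,d,\Delta)$ respectively. The Maker–Breaker $\mathcal{H}$-universality game on $K_N$ with bias $b$: Maker and Breaker alternately colour previously uncoloured edges of $K_N$ (Maker first), Maker colouring one edge red per turn and Breaker colouring $b$ edges blue per turn, until all edges are coloured; Maker wins if the red graph contains a copy of every $H\in\mathcal{H}$ simultaneously, otherwise Breaker wins. "Maker wins" means Maker has a winning strategy. 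*)

theory Defs
  imports Complex_Main "HOL-Library.Ramsey"
begin

section \<open>Finite simple graphs\<close>

type_synonym 'a graph = "'a set \<times> 'a set set"

abbreviation verts :: "'a graph \<Rightarrow> 'a set" where
  "verts \<equiv> fst"

abbreviation edges :: "'a graph \<Rightarrow> 'a set set" where
  "edges \<equiv> snd"

definition simple_graph :: "'a graph \<Rightarrow> bool" where
  "simple_graph G \<longleftrightarrow> finite (verts G) \<and> edges G \<subseteq> [verts G]\<^bsup>2\<^esup>"

definition degree :: "'a graph \<Rightarrow> 'a \<Rightarrow> nat" where
  "degree G v = card {e \<in> edges G. v \<in> e}"

(* Only meaningful for graphs with at least one vertex, as is min_degree. *)
definition max_degree :: "'a graph \<Rightarrow> nat" where
  "max_degree G = Max (degree G ` verts G)"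

definition min_degree :: "'a graph \<Rightarrow> nat" where
  "min_degree G = Min (degree G ` verts G)"

definition induced_subgraph :: "'a graph \<Rightarrow> 'a set \<Rightarrow> 'a graph" where
  "induced_subgraph G S = (S, {e \<in> edges G. e \<subseteq> S})"

definition degeneracy :: "'a graph \<Rightarrow> nat" where
  "degeneracy G =
     (LEAST l. \<forall>S. S \<subseteq> verts G \<and> S \<noteq> {} \<longrightarrow> min_degree (induced_subgraph G S) \<le> l)"

(* In a simple graph the three edges force x, y, z to be distinct. *)
definition triangle_free :: "'a graph \<Rightarrow> bool" where
  "triangle_free G \<longleftrightarrow>
     \<not> (\<exists>x y z. {x, y} \<in> edges G \<and> {y, z} \<in> edges G \<and> {x, z} \<in> edges G)"

(* Copies are subgraphs, not necessarily induced. *)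
definition contains_copy :: "'a graph \<Rightarrow> 'b graph \<Rightarrow> bool" where
  "contains_copy G H \<longleftrightarrow>
     (\<exists>f. inj_on f (verts H) \<and> f ` verts H \<subseteq> verts G \<and> (\<forall>e \<in> edges H. f ` e \<in> edges G))"

section \<open>The graph classes\<close>

(* Every finite graph is isomorphic to one whose vertices are natural numbers. *)
definition graphs_maxdeg :: "nat \<Rightarrow> nat \<Rightarrow> nat graph set" where
  "graphs_maxdeg n \<Delta> = {H. simple_graph H \<and> card (verts H) = n \<and> max_degree H \<le> \<Delta>}"

definition graphs_degen_maxdeg :: "nat \<Rightarrow> nat \<Rightarrow> nat \<Rightarrow> nat graph set" where
  "graphs_degen_maxdeg n d \<Delta> = {H \<in> graphs_maxdeg n \<Delta>. degeneracy H \<le> d}"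

definition tf_graphs_maxdeg :: "nat \<Rightarrow> nat \<Rightarrow> nat graph set" where
  "tf_graphs_maxdeg n \<Delta> = {H \<in> graphs_maxdeg n \<Delta>. triangle_free H}"

definition tf_graphs_degen_maxdeg :: "nat \<Rightarrow> nat \<Rightarrow> nat \<Rightarrow> nat graph set" where
  "tf_graphs_degen_maxdeg n d \<Delta> = {H \<in> graphs_degen_maxdeg n d \<Delta>. triangle_free H}"

section \<open>The Maker--Breaker game\<close>

(* The rounds played so far, oldest first: Maker's edge, then the set of edges taken by
   Breaker in reply. *)
type_synonym 'e history = "('e \<times> 'e set) list"

definition red :: "'e history \<Rightarrow> 'e set" where
  "red h = fst ` set h"

definition blue :: "'e history \<Rightarrow> 'e set" where
  "blue h = \<Union> (snd ` set h)"

definition uncoloured :: "'e set \<Rightarrow> 'e history \<Rightarrow> 'e set" where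
  "uncoloured X h = X - (red h \<union> blue h)"

(* The histories, after complete rounds, of the game on board X with bias b that can arise
   when Maker follows the strategy s and Breaker plays arbitrarily. Breaker takes exactly b
   uncoloured elements, or all of them if fewer than b remain. *)
inductive maker_play :: "'e set \<Rightarrow> nat \<Rightarrow> ('e history \<Rightarrow> 'e) \<Rightarrow> 'e history \<Rightarrow> bool"
  for X :: "'e set" and b :: nat and s :: "'e history \<Rightarrow> 'e"
where
  start: "maker_play X b s []"
| round: "\<lbrakk> maker_play X b s h; uncoloured X h \<noteq> {};
            F \<subseteq> uncoloured X h - {s h};
            card F = min b (card (uncoloured X h - {s h})) \<rbrakk>
          \<Longrightarrow> maker_play X b s (h @ [(s h, F)])"

(* Some strategy of Maker always makes legal moves and guarantees that the final red set
   satisfies P. On a finite board each legal round colours a new element, so play ends. *)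
definition maker_wins :: "'e set \<Rightarrow> nat \<Rightarrow> ('e set \<Rightarrow> bool) \<Rightarrow> bool" where
  "maker_wins X b P \<longleftrightarrow>
     (\<exists>s. \<forall>h. maker_play X b s h \<longrightarrow>
        (uncoloured X h \<noteq> {} \<longrightarrow> s h \<in> uncoloured X h) \<and>
        (uncoloured X h = {} \<longrightarrow> P (red h)))"

definition maker_wins_universality :: "nat \<Rightarrow> nat \<Rightarrow> nat graph set \<Rightarrow> bool" where
  "maker_wins_universality N b \<H> \<longleftrightarrow>
     maker_wins ([{..<N}]\<^bsup>2\<^esup>) b (\<lambda>R. \<forall>H \<in> \<H>. contains_copy ({..<N}, R) H)"

end

theory Submission
  imports Defs
begin

text \<open>Put \<open>\<tau> \<approx> 16 b / \<epsilon>\<close>. On each turn Maker reserves the \<open>\<tau>\<close> free edges that Breaker currently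
  threatens most and claims one of them; seen from the potentials below, the claimed edges behave like a
  random subgraph of density \<open>p = 1 / \<tau>\<close>, since the claimed edge can be chosen so that no average over
  the \<open>\<tau>\<close> candidates is exceeded, while Breaker's interference is absorbed by a box-game potential. Hence
  Maker's graph contains a pseudorandom graph: disjoint vertex sets \<open>A\<close>, \<open>B\<close> span at least
  \<open>(1 - \<epsilon>) p |A| |B|\<close> edges up to an error of order \<open>log N\<close> per vertex, and the common neighbourhoods of
  disjoint sets of at most \<open>\<Delta>\<close> vertices are not too large on average.

  Any such graph contains all the required graphs, so a single host serves all \<open>H\<close> at once. If \<open>p\<^sup>\<Delta> n\<close>
  is large compared with \<open>log n\<close>, the colour classes of the square of \<open>H\<close> can be embedded one after
  another by Hall's theorem, each into a region slightly larger than the class. For \<open>d\<close>-degenerate \<open>H\<close> the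
  vertices are embedded one by one in a degenerate order, derandomising a uniformly random choice by
  potentials. For spanning \<open>H\<close> a linear set of vertices of equal degree and at pairwise large distance is
  embedded last, again by Hall's theorem; the earlier vertices are embedded so that every host vertex
  remains available for many of these. As \<open>H\<close> is triangle-free, the neighbours of such a vertex are
  pairwise nonadjacent and their images are chosen almost independently. In case (d) the last vertices
  have degree at most \<open>2 d\<close>, because at least \<open>n / (2 d + 1)\<close> vertices do.\<close>

text \<open>Apart from the box-game potential, every potential below bounds a conditional
  expectation: a weighted exponential moment, summed over all events to be avoided, that does not
  increase on average over the choices at hand. The union bound runs over exponentially many sets
  and costs an error of order log N per vertex; all exponents arise from making it negligible. A
  Hall step needs p^\<Delta> n large against log N. In the embedding vertex by vertex, a candidate
  set has about p^d n vertices, so one step gives each candidate weight about 1 / (p^d n), while the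
  smallest sets whose consumption must be controlled have about p^(d') n vertices; hence p^(d + d')
  n must be large against log N. Candidate sets alone need d' = d, which gives 2 d. In the spanning
  case they are intersected with the neighbourhood of a prescribed host vertex, so d' = d + 1 and
  the exponent is 2 d + 1. In case (b) only the neighbours of the last vertices are embedded in this
  way; they are independent, so d is replaced by 0 and the Hall steps fix \<Delta>.\<close>

lemma maker_wins_positional:
  fixes Good :: "'e set \<Rightarrow> 'e set \<Rightarrow> bool"
  assumes start: "Good {} {}"
    and step: "\<And>R U. R \<subseteq> X \<Longrightarrow> U \<subseteq> X \<Longrightarrow> R \<inter> U = {} \<Longrightarrow> Good R U \<Longrightarrow> X - (R \<union> U) \<noteq> {} \<Longrightarrow>
      \<exists>e\<in>X - (R \<union> U). \<forall>F. F \<subseteq> X - (R \<union> U) - {e} \<longrightarrow> card F \<le> b \<longrightarrow> Good (insert e R) (U \<union> F)"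
    and final: "\<And>R U. R \<inter> U = {} \<Longrightarrow> R \<union> U = X \<Longrightarrow> Good R U \<Longrightarrow> P R"
  shows "maker_wins X b P"
proof -
  define win where "win R U e \<longleftrightarrow> e \<in> X - (R \<union> U) \<and>
    (\<forall>F. F \<subseteq> X - (R \<union> U) - {e} \<longrightarrow> card F \<le> b \<longrightarrow> Good (insert e R) (U \<union> F))" for R U e
  \<comment> \<open>Outside good positions the choice is arbitrary; \<open>inv\<close> shows that
    play following \<open>s\<close> never leaves them.\<close>
  define s where "s h = (SOME e. win (red h) (blue h) e)" for h :: "'e history"
  have s: "win (red h) (blue h) (s h)"
    if "red h \<subseteq> X" "blue h \<subseteq> X" "red h \<inter> blue h = {}" "Good (red h) (blue h)" "uncoloured X h \<noteq> {}" for h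
    unfolding s_def
  proof (rule someI_ex)
    show "\<exists>e. win (red h) (blue h) e"
      using step[of "red h" "blue h"] that unfolding win_def uncoloured_def by blast
  qed
  have inv: "red h \<subseteq> X \<and> blue h \<subseteq> X \<and> red h \<inter> blue h = {} \<and> Good (red h) (blue h)"
    if "maker_play X b s h" for h
    using that
  proof induction
    case start
    then show ?case using assms(1) by (simp add: red_def blue_def)
  next
    case (round h F)
    have w: "win (red h) (blue h) (s h)" using s round by blast
    have r: "red (h @ [(s h, F)]) = insert (s h) (red h)" "blue (h @ [(s h, F)]) = blue h \<union> F"
      by (auto simp: red_def blue_def)
    have "card F \<le> b" using round by simp
    then show ?case using w round unfolding r win_def uncoloured_def by blast
  qed
  show ?thesis
    unfolding maker_wins_def
  proof (intro exI[of _ s] allI impI conjI)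
    fix h assume h: "maker_play X b s h"
    show "s h \<in> uncoloured X h" if "uncoloured X h \<noteq> {}"
      using s[of h] inv[OF h] that unfolding win_def uncoloured_def by blast
    show "P (red h)" if "uncoloured X h = {}"
      using inv[OF h] that final[of "red h" "blue h"] unfolding uncoloured_def by blast
  qed
qed

section \<open>The exposure game\<close>

text \<open>Weight function of the biased box game, with \<open>E\<close> the edges reserved by
  Maker and \<open>U\<close> Breaker's edges. A weight of at most 1 says that Breaker's share of
  \<open>A i\<close> is at most proportional to the reserved part, up to a term depending on
  \<open>c i\<close>.\<close>

definition box_wt :: "('i \<Rightarrow> 'e set) \<Rightarrow> ('i \<Rightarrow> real) \<Rightarrow> real \<Rightarrow> real \<Rightarrow> 'e set \<Rightarrow> 'e set \<Rightarrow> 'i \<Rightarrow> real" where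
  "box_wt A c \<mu> \<nu> E U i = c i * (1 - \<nu>) ^ card (E \<inter> A i) * (1 + \<mu>) ^ card (U \<inter> A i)"

definition box_pot where
  "box_pot I A c \<mu> \<nu> E U = (\<Sum>i\<in>I. box_wt A c \<mu> \<nu> E U i)"

text \<open>First-order effect of \<open>e\<close> on the potential: reserving \<open>e\<close>
  lowers it by \<open>\<nu>\<close> times this amount, and Breaker's claiming \<open>e\<close>
  raises it by \<open>\<mu>\<close> times this amount.\<close>

definition danger where
  "danger I A c \<mu> \<nu> E U e = (\<Sum>i\<in>{i\<in>I. e \<in> A i}. box_wt A c \<mu> \<nu> E U i)"

locale box =
  fixes I :: "'i set" and A :: "'i \<Rightarrow> 'e set" and c :: "'i \<Rightarrow> real" and \<mu> \<nu> :: real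
  assumes finI: "finite I" and c_nonneg: "\<And>i. i \<in> I \<Longrightarrow> c i \<ge> 0"
    and \<mu>: "\<mu> \<ge> 0" and \<nu>: "0 \<le> \<nu>" "\<nu> \<le> 1"
begin

abbreviation "wt \<equiv> box_wt A c \<mu> \<nu>"
abbreviation "pot \<equiv> box_pot I A c \<mu> \<nu>"
abbreviation "dgr \<equiv> danger I A c \<mu> \<nu>"

lemma wt_nonneg: "i \<in> I \<Longrightarrow> wt E U i \<ge> 0"
  unfolding box_wt_def using c_nonneg \<mu> \<nu> by simp

lemma dgr_nonneg: "dgr E U e \<ge> 0"
  unfolding danger_def by (rule sum_nonneg) (use wt_nonneg in auto)

lemma dgr_le_pot: "dgr E U e \<le> pot E U"
  unfolding danger_def box_pot_def
  by (rule sum_mono2) (use finI wt_nonneg in auto)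

lemma wt_expose: "finite E \<Longrightarrow> e \<notin> E \<Longrightarrow> wt (insert e E) U i = (if e \<in> A i then (1 - \<nu>) * wt E U i else wt E U i)"
  unfolding box_wt_def by simp

lemma wt_claim: "finite U \<Longrightarrow> e \<notin> U \<Longrightarrow> wt E (insert e U) i = (if e \<in> A i then (1 + \<mu>) * wt E U i else wt E U i)"
  unfolding box_wt_def by simp

lemma pot_expose:
  assumes "finite E" "e \<notin> E"
  shows "pot (insert e E) U = pot E U - \<nu> * dgr E U e"
proof -
  have "pot (insert e E) U = (\<Sum>i\<in>I. wt E U i - (if e \<in> A i then \<nu> * wt E U i else 0))"
    unfolding box_pot_def by (rule sum.cong) (auto simp: wt_expose[OF assms] algebra_simps)
  also have "\<dots> = pot E U - \<nu> * dgr E U e"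
    unfolding box_pot_def danger_def using finI
    by (simp add: sum_subtractf sum.inter_filter sum_distrib_left if_distrib[of "(*) \<nu>"] cong: if_cong)
  finally show ?thesis .
qed

lemma pot_claim:
  assumes "finite U" "e \<notin> U"
  shows "pot E (insert e U) = pot E U + \<mu> * dgr E U e"
proof -
  have "pot E (insert e U) = (\<Sum>i\<in>I. wt E U i + (if e \<in> A i then \<mu> * wt E U i else 0))"
    unfolding box_pot_def by (rule sum.cong) (auto simp: wt_claim[OF assms] algebra_simps)
  also have "\<dots> = pot E U + \<mu> * dgr E U e"
    unfolding box_pot_def danger_def using finI
    by (simp add: sum.distrib sum.inter_filter sum_distrib_left if_distrib[of "(*) \<mu>"] cong: if_cong)
  finally show ?thesis .
qed

lemma dgr_expose:
  assumes "finite E" "e \<notin> E"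
  shows "dgr (insert e E) U f \<le> dgr E U f"
  unfolding danger_def
proof (rule sum_mono)
  fix i assume "i \<in> {i \<in> I. f \<in> A i}"
  then have "wt E U i \<ge> 0" using wt_nonneg by auto
  then show "wt (insert e E) U i \<le> wt E U i"
    using \<nu> by (auto simp: wt_expose[OF assms] mult_left_le_one_le)
qed

lemma dgr_claim:
  assumes "finite U" "e \<notin> U"
  shows "dgr E (insert e U) f \<le> (1 + \<mu>) * dgr E U f"
  unfolding danger_def sum_distrib_left
proof (rule sum_mono)
  fix i assume "i \<in> {i \<in> I. f \<in> A i}"
  then have "wt E U i \<ge> 0" using wt_nonneg by auto
  then show "wt E (insert e U) i \<le> (1 + \<mu>) * wt E U i"
    using \<mu> by (auto simp: wt_claim[OF assms] mult_le_cancel_right1)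
qed

text \<open>The most dangerous free edge is taken \<open>k\<close> times. Reserving an edge never
  raises a danger, so the successive maxima decrease; the last maximum \<open>g\<close> bounds every
  danger that is left, and each of the \<open>k\<close> steps lowered the potential by at least
  \<open>\<nu> * g\<close>. This gain pays for Breaker's reply.\<close>

lemma greedy_block:
  assumes "finite E" "finite fr" "fr \<inter> E = {}" "k \<le> card fr"
  shows "\<exists>D g. D \<subseteq> fr \<and> card D = k \<and> g \<ge> 0 \<and> pot (E \<union> D) U + \<nu> * real k * g \<le> pot E U
    \<and> (\<forall>f\<in>fr - D. dgr (E \<union> D) U f \<le> g)"
  using assms(4)
proof (induction k)
  case 0
  \<comment> \<open>With no edge taken the gain \<open>\<nu> * 0 * g\<close> vanishes, so the crude
    bound by the whole potential serves as \<open>g\<close>.\<close>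
  have "dgr E U f \<le> pot E U" for f by (rule dgr_le_pot)
  moreover have "pot E U \<ge> 0" unfolding box_pot_def by (rule sum_nonneg) (use wt_nonneg in auto)
  ultimately show ?case by (intro exI[of _ "{}"] exI[of _ "pot E U"]) auto
next
  case (Suc k)
  then obtain D g where D: "D \<subseteq> fr" "card D = k" "g \<ge> 0" "pot (E \<union> D) U + \<nu> * real k * g \<le> pot E U"
    "\<forall>f\<in>fr - D. dgr (E \<union> D) U f \<le> g" by auto
  have fD: "finite D" using D(1) assms(2) finite_subset by blast
  have ne: "fr - D \<noteq> {}" using Suc.prems D assms(2) fD
    by (metis Diff_eq_empty_iff card_mono not_less_eq_eq)
  obtain e where e: "e \<in> fr - D" "\<And>f. f \<in> fr - D \<Longrightarrow> dgr (E \<union> D) U f \<le> dgr (E \<union> D) U e"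
    using obtains_MAX[of "fr - D" "dgr (E \<union> D) U"] ne assms(2)
    by (metis Max_ge finite_Diff finite_imageI imageI)
  define g' where "g' = dgr (E \<union> D) U e"
  have eE: "e \<notin> E \<union> D" "finite (E \<union> D)" using e assms fD by auto
  have "g' \<le> g" using D(5) e(1) unfolding g'_def by blast
  have *: "pot (insert e (E \<union> D)) U = pot (E \<union> D) U - \<nu> * g'"
    unfolding g'_def by (rule pot_expose) (use eE in auto)
  have "\<nu> * real k * g' \<le> \<nu> * real k * g" using \<open>g' \<le> g\<close> \<nu> by (simp add: mult_left_mono)
  then have 1: "pot (insert e (E \<union> D)) U + \<nu> * real (Suc k) * g' \<le> pot E U"
    using * D(4) by (simp add: algebra_simps)
  have 2: "dgr (insert e (E \<union> D)) U f \<le> g'" if "f \<in> fr - insert e D" for f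
    using dgr_expose[OF eE(2,1), of U f] e(2)[of f] that unfolding g'_def by auto
  show ?case
    by (rule exI[of _ "insert e D"], rule exI[of _ g'])
      (use D e fD 1 2 in \<open>auto simp: g'_def dgr_nonneg\<close>)
qed

lemma dgr_claims:
  assumes "finite F" "finite U" "F \<inter> U = {}"
  shows "dgr E (U \<union> F) f \<le> (1 + \<mu>) ^ card F * dgr E U f"
  using assms
proof (induction F)
  case (insert g F)
  have "dgr E (insert g (U \<union> F)) f \<le> (1 + \<mu>) * dgr E (U \<union> F) f"
    by (rule dgr_claim) (use insert in auto)
  also have "\<dots> \<le> (1 + \<mu>) * ((1 + \<mu>) ^ card F * dgr E U f)"
    using insert \<mu> by (intro mult_left_mono) auto
  finally show ?case using insert by (simp add: mult.assoc)
qed simp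

text \<open>Every claimed edge multiplies each danger by at most \<open>1 + \<mu>\<close>, so the
  increments are at most \<open>\<mu> * g * (1 + \<mu>) ^ j\<close> and form a geometric series.
  Only the dangers before Breaker's turn enter.\<close>

lemma breaker_block:
  assumes "finite F" "finite U" "F \<inter> U = {}" "\<And>f. f \<in> F \<Longrightarrow> dgr E U f \<le> g"
  shows "pot E (U \<union> F) \<le> pot E U + g * ((1 + \<mu>) ^ card F - 1)"
  using assms
proof (induction F)
  case (insert f F)
  have "dgr E (U \<union> F) f \<le> (1 + \<mu>) ^ card F * dgr E U f"
    by (rule dgr_claims) (use insert in auto)
  also have "\<dots> \<le> (1 + \<mu>) ^ card F * g" using insert \<mu> by (intro mult_left_mono) auto
  finally have 1: "\<mu> * dgr E (U \<union> F) f \<le> \<mu> * ((1 + \<mu>) ^ card F * g)" using \<mu> by (intro mult_left_mono)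
  have "pot E (insert f (U \<union> F)) = pot E (U \<union> F) + \<mu> * dgr E (U \<union> F) f"
    by (rule pot_claim) (use insert in auto)
  then have "pot E (U \<union> insert f F) = pot E (U \<union> F) + \<mu> * dgr E (U \<union> F) f" by simp
  also have "\<dots> \<le> pot E U + g * ((1 + \<mu>) ^ card F - 1) + \<mu> * ((1 + \<mu>) ^ card F * g)"
    using 1 insert by auto
  also have "\<dots> = pot E U + g * ((1 + \<mu>) ^ card (insert f F) - 1)"
    using insert by (simp add: algebra_simps)
  finally show ?case .
qed simp

end

section \<open>Exponential moments of Maker's edges\<close>

lemma one_plus_le_prod:
  fixes g :: "'a \<Rightarrow> real"
  assumes "finite S" "\<And>x. x \<in> S \<Longrightarrow> g x \<ge> 1"
  shows "1 + (\<Sum>x\<in>S. g x - 1) \<le> (\<Prod>x\<in>S. g x)"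
  using assms
proof (induction S)
  case (insert a S)
  have "(\<Prod>x\<in>S. g x) \<ge> 1" using insert by (intro prod_ge_1) auto
  then have "(g a - 1) * ((\<Prod>x\<in>S. g x) - 1) \<ge> 0" using insert by auto
  then show ?case using insert by (simp add: algebra_simps)
qed simp

lemma exists_le_average:
  fixes f :: "'a \<Rightarrow> real"
  assumes "finite D" "D \<noteq> {}" "(\<Sum>e\<in>D. f e) \<le> real (card D) * c"
  shows "\<exists>e\<in>D. f e \<le> c"
proof (rule ccontr)
  assume "\<not> ?thesis"
  then have "(\<Sum>e\<in>D. c) < (\<Sum>e\<in>D. f e)" using assms by (intro sum_strict_mono) auto
  then show False using assms by simp
qed

text \<open>Chernoff lower tail: the exponential moment of the number of kept edges in
  \<open>A i\<close> is divided by the bound for its mean when each exposed edge is kept with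
  probability \<open>p\<close>. The weight \<open>exp (- l i)\<close> carries the union
  bound.\<close>

definition low_pot :: "'i set \<Rightarrow> ('i \<Rightarrow> 'e set) \<Rightarrow> ('i \<Rightarrow> real) \<Rightarrow> real \<Rightarrow> real \<Rightarrow> 'e set \<Rightarrow> 'e set \<Rightarrow> real" where
  "low_pot I A l \<theta> p R E = (\<Sum>i\<in>I. exp (- l i - \<theta> * real (card (R \<inter> A i)) + (1 - exp (- \<theta>)) * p * real (card (E \<inter> A i))))"

text \<open>Conditional expectation of the variable that is \<open>exp \<theta>\<close> if all of
  \<open>S\<close> is kept and 1 otherwise: a set with a rejected edge is lost, and otherwise each
  of its \<open>card (S - R)\<close> unexposed edges survives with probability
  \<open>p\<close>.\<close>

definition fac :: "real \<Rightarrow> real \<Rightarrow> 'e set \<Rightarrow> 'e set \<Rightarrow> 'e set \<Rightarrow> real" where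
  "fac \<theta> p R E S = 1 + (exp \<theta> - 1) * (if S \<inter> E \<subseteq> R then p ^ card (S - R) else 0)"

text \<open>Chernoff upper tail for the number of members of \<open>\<F> j\<close> that are kept
  entirely. The members are pairwise disjoint where this is used, so their conditional expectations
  multiply; the normalisation is the bound \<open>1 + x \<le> exp x\<close> for the initial
  product.\<close>

definition up_pot :: "'j set \<Rightarrow> ('j \<Rightarrow> 'e set set) \<Rightarrow> ('j \<Rightarrow> real) \<Rightarrow> real \<Rightarrow> real \<Rightarrow> 'e set \<Rightarrow> 'e set \<Rightarrow> real" where
  "up_pot J \<F> l \<theta> p R E = (\<Sum>j\<in>J. exp (- l j - (exp \<theta> - 1) * (\<Sum>S\<in>\<F> j. p ^ card S)) * (\<Prod>S\<in>\<F> j. fac \<theta> p R E S))"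

text \<open>If \<open>a\<close> of the \<open>\<tau>\<close> exposed edges lie in
  \<open>A i\<close>, the factor for the kept edge averages to \<open>1 - \<kappa> * p * a\<close>,
  while the compensator contributes \<open>exp (\<kappa> * p * a)\<close>; the product is at most
  1.\<close>

lemma low_pot_step:
  assumes "finite D" "card D = \<tau>" "\<tau> > 0" "D \<inter> E = {}" "R \<subseteq> E" "finite E" "\<theta> \<ge> 0"
  shows "(\<Sum>e\<in>D. low_pot I A l \<theta> (1 / real \<tau>) (insert e R) (E \<union> D)) \<le> real \<tau> * low_pot I A l \<theta> (1 / real \<tau>) R E"
proof -
  define p where "p = 1 / real \<tau>"
  define \<kappa> where "\<kappa> = 1 - exp (- \<theta>)"
  have \<kappa>: "0 \<le> \<kappa>" using assms unfolding \<kappa>_def by simp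
  have fR: "finite R" using assms finite_subset by blast
  have "(\<Sum>e\<in>D. exp (- l i - \<theta> * real (card (insert e R \<inter> A i)) + \<kappa> * p * real (card ((E \<union> D) \<inter> A i))))
      \<le> real \<tau> * exp (- l i - \<theta> * real (card (R \<inter> A i)) + \<kappa> * p * real (card (E \<inter> A i)))" (is "?l \<le> real \<tau> * ?r") for i
  proof -
    define a where "a = card (D \<inter> A i)"
    have "(E \<union> D) \<inter> A i = (E \<inter> A i) \<union> (D \<inter> A i)" by blast
    moreover have "card \<dots> = card (E \<inter> A i) + a"
      unfolding a_def by (rule card_Un_disjoint) (use assms in auto)
    ultimately have c: "card ((E \<union> D) \<inter> A i) = card (E \<inter> A i) + a" by simp
    have t: "exp (- l i - \<theta> * real (card (insert e R \<inter> A i)) + \<kappa> * p * real (card ((E \<union> D) \<inter> A i)))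
       = ?r * exp (\<kappa> * p * a) * (1 - (if e \<in> A i then \<kappa> else 0))" if "e \<in> D" for e
    proof -
      have e: "e \<notin> R" using that assms by blast
      have "real (card (insert e R \<inter> A i)) = real (card (R \<inter> A i)) + (if e \<in> A i then 1 else 0)"
        using e fR by auto
      then show ?thesis unfolding c \<kappa>_def
        by (auto simp: exp_add[symmetric] exp_diff[symmetric] algebra_simps)
    qed
    have "?l = (\<Sum>e\<in>D. ?r * exp (\<kappa> * p * a) * (1 - (if e \<in> A i then \<kappa> else 0)))"
      by (rule sum.cong) (use t in auto)
    also have "\<dots> = ?r * exp (\<kappa> * p * a) * (real \<tau> - \<kappa> * real a)"
      unfolding sum_distrib_left[symmetric] using assms(1,2)
      by (simp add: sum_subtractf sum.inter_restrict[symmetric] a_def)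
    also have "\<dots> = ?r * real \<tau> * (exp (\<kappa> * p * a) * (1 - \<kappa> * p * a))"
      using assms(3) by (simp add: p_def field_simps)
    also have "\<dots> \<le> ?r * real \<tau> * 1"
    proof (intro mult_left_mono)
      have "exp (\<kappa> * p * a) * (1 - \<kappa> * p * a) \<le> exp (\<kappa> * p * a) * exp (- (\<kappa> * p * a))"
        using exp_ge_add_one_self[of "- (\<kappa> * p * a)"] by (intro mult_left_mono) auto
      then show "exp (\<kappa> * p * a) * (1 - \<kappa> * p * a) \<le> 1" by (simp add: exp_minus)
    qed auto
    finally show ?thesis by (simp add: mult_ac)
  qed
  then have "(\<Sum>i\<in>I. \<Sum>e\<in>D. exp (- l i - \<theta> * real (card (insert e R \<inter> A i)) + \<kappa> * p * real (card ((E \<union> D) \<inter> A i))))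
    \<le> (\<Sum>i\<in>I. real \<tau> * exp (- l i - \<theta> * real (card (R \<inter> A i)) + \<kappa> * p * real (card (E \<inter> A i))))"
    by (intro sum_mono) auto
  then show ?thesis
    unfolding low_pot_def p_def[symmetric] \<kappa>_def[symmetric] sum_distrib_left
    by (subst sum.swap) simp
qed

lemma fac_ge_1: "\<theta> \<ge> 0 \<Longrightarrow> p \<ge> 0 \<Longrightarrow> fac \<theta> p R E S \<ge> 1"
  unfolding fac_def by simp

lemma fac_nonneg: "\<theta> \<ge> 0 \<Longrightarrow> p \<ge> 0 \<Longrightarrow> fac \<theta> p R E S \<ge> 0"
  using fac_ge_1[of \<theta> p R E S] by linarith

text \<open>Exposing a block of \<open>\<tau>\<close> edges and keeping a uniformly random one is dominated by keeping each
  of them independently with probability \<open>1 / \<tau>\<close>.\<close>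
lemma prod_fac_step:
  assumes D: "finite D" "card D = \<tau>" "\<tau> > 0" "D \<inter> E = {}" and R: "R \<subseteq> E" and \<theta>: "\<theta> \<ge> 0"
    and F: "finite F" "pairwise disjnt F" "\<And>S. S \<in> F \<Longrightarrow> finite S"
  shows "(\<Sum>e\<in>D. \<Prod>S\<in>F. fac \<theta> (1 / real \<tau>) (insert e R) (E \<union> D) S) \<le> real \<tau> * (\<Prod>S\<in>F. fac \<theta> (1 / real \<tau>) R E S)"
proof -
  define p where "p = 1 / real \<tau>"
  have p: "p > 0" using D unfolding p_def by simp
  define g where "g = fac \<theta> p R E"
  have g1: "g S \<ge> 1" for S unfolding g_def using \<theta> p by (intro fac_ge_1) auto
  define af where "af = {S \<in> F. S \<inter> D \<noteq> {}}"
  define un where "un = {S \<in> F. S \<inter> D = {}}"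
  have sp: "F = un \<union> af" "un \<inter> af = {}" "finite un" "finite af" using F unfolding af_def un_def by auto
  have 1: "fac \<theta> p (insert e R) (E \<union> D) S = g S" if "S \<in> un" "e \<in> D" for S e
  proof -
    have "S \<inter> (E \<union> D) = S \<inter> E" "S - insert e R = S - R" "e \<notin> S" using that unfolding un_def by auto
    then have "S \<inter> (E \<union> D) \<subseteq> insert e R \<longleftrightarrow> S \<inter> E \<subseteq> R" by blast
    then show ?thesis unfolding g_def fac_def using \<open>S - insert e R = S - R\<close> by simp
  qed
  \<comment> \<open>A member that meets the block survives only if it meets the block in the kept
    edge alone; its exponent then drops by one, which multiplies \<open>g S - 1\<close> by
    \<open>1 / p = \<tau>\<close>. In all other cases the factor falls to 1.\<close>
  have 2: "fac \<theta> p (insert e R) (E \<union> D) S \<le> (if S \<inter> D = {e} then 1 + real \<tau> * (g S - 1) else 1)" if "S \<in> af" "e \<in> D" for S e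
  proof (cases "S \<inter> (E \<union> D) \<subseteq> insert e R")
    case True
    have dR: "D \<inter> R = {}" using D R by blast
    have "S \<inter> D \<subseteq> {e}" using True dR by blast
    then have SD: "S \<inter> D = {e}" using that unfolding af_def by blast
    have eR: "e \<notin> E" "e \<notin> R" using that D R by auto
    have "S \<inter> E \<subseteq> R" using True eR by blast
    then have gS: "g S = 1 + (exp \<theta> - 1) * p ^ card (S - R)" unfolding g_def fac_def by simp
    have "e \<in> S - R" using SD eR by blast
    moreover have "finite S" using F that unfolding af_def by auto
    moreover have "S - insert e R = S - R - {e}" by blast
    ultimately have "card (S - R) = Suc (card (S - insert e R))" by (metis card_Suc_Diff1 finite_Diff)
    then have "real \<tau> * p ^ card (S - R) = p ^ card (S - insert e R)" using D unfolding p_def by simp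
    then have "fac \<theta> p (insert e R) (E \<union> D) S = 1 + real \<tau> * (g S - 1)"
      unfolding gS fac_def using True by (simp add: algebra_simps)
    then show ?thesis using SD by simp
  next
    case False
    then have "fac \<theta> p (insert e R) (E \<union> D) S = 1" unfolding fac_def by simp
    then show ?thesis using g1[of S] by simp
  qed
  have 3: "(\<Prod>S\<in>af. fac \<theta> p (insert e R) (E \<union> D) S) \<le> 1 + (\<Sum>S\<in>af. if S \<inter> D = {e} then real \<tau> * (g S - 1) else 0)" if e: "e \<in> D" for e
  proof -
    have "(\<Prod>S\<in>af. fac \<theta> p (insert e R) (E \<union> D) S) \<le> (\<Prod>S\<in>af. if S \<inter> D = {e} then 1 + real \<tau> * (g S - 1) else 1)"
      by (rule prod_mono) (use 2 e in \<open>auto intro!: fac_nonneg[OF \<theta>] less_imp_le[OF p]\<close>)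
    also have "\<dots> \<le> 1 + (\<Sum>S\<in>af. if S \<inter> D = {e} then real \<tau> * (g S - 1) else 0)"
    \<comment> \<open>By disjointness at most one member meets the block exactly in
      \<open>e\<close>, so at most one factor of the product differs from 1.\<close>
    proof (cases "\<exists>S0\<in>af. S0 \<inter> D = {e}")
      case True
      then obtain S0 where S0: "S0 \<in> af" "S0 \<inter> D = {e}" by blast
      have un: "S \<inter> D = {e} \<longleftrightarrow> S = S0" if "S \<in> af" for S
      proof
        assume "S \<inter> D = {e}"
        then have "\<not> disjnt S S0" using S0 unfolding disjnt_def by blast
        then show "S = S0" using F(2) that S0 unfolding pairwise_def af_def by blast
      qed (use S0 in simp)
      have "(\<Prod>S\<in>af. if S \<inter> D = {e} then 1 + real \<tau> * (g S - 1) else 1) = (\<Prod>S\<in>af. if S = S0 then 1 + real \<tau> * (g S - 1) else 1)"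
        by (rule prod.cong) (use un in auto)
      moreover have "(\<Sum>S\<in>af. if S \<inter> D = {e} then real \<tau> * (g S - 1) else 0) = (\<Sum>S\<in>af. if S = S0 then real \<tau> * (g S - 1) else 0)"
        by (rule sum.cong) (use un in auto)
      ultimately show ?thesis using S0 sp by simp
    next
      case False
      then show ?thesis by (simp add: sum.neutral prod.neutral)
    qed
    finally show ?thesis .
  qed
  have gu: "(\<Prod>S\<in>un. g S) \<ge> 0" by (intro prod_nonneg) (use g1 in \<open>auto intro: order_trans[OF zero_le_one]\<close>)
  have "(\<Sum>e\<in>D. \<Prod>S\<in>F. fac \<theta> p (insert e R) (E \<union> D) S) =
     (\<Sum>e\<in>D. (\<Prod>S\<in>un. g S) * (\<Prod>S\<in>af. fac \<theta> p (insert e R) (E \<union> D) S))"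
  proof (rule sum.cong[OF refl])
    fix e assume "e \<in> D"
    then have "(\<Prod>S\<in>un. fac \<theta> p (insert e R) (E \<union> D) S) = (\<Prod>S\<in>un. g S)"
      by (intro prod.cong) (use 1 in auto)
    then show "(\<Prod>S\<in>F. fac \<theta> p (insert e R) (E \<union> D) S) = (\<Prod>S\<in>un. g S) * (\<Prod>S\<in>af. fac \<theta> p (insert e R) (E \<union> D) S)"
      using sp by (simp add: prod.union_disjoint)
  qed
  also have "\<dots> \<le> (\<Sum>e\<in>D. (\<Prod>S\<in>un. g S) * (1 + (\<Sum>S\<in>af. if S \<inter> D = {e} then real \<tau> * (g S - 1) else 0)))"
    by (intro sum_mono mult_left_mono 3 gu)
  also have "\<dots> = (\<Prod>S\<in>un. g S) * (real \<tau> + (\<Sum>S\<in>af. \<Sum>e\<in>D. if S \<inter> D = {e} then real \<tau> * (g S - 1) else 0))"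
    unfolding sum_distrib_left[symmetric] sum.distrib
    using D by (subst sum.swap) simp
  \<comment> \<open>Each member gains for at most one choice of \<open>e\<close>. The linear
    expression obtained is then dominated by the product over \<open>af\<close>, the value for
    independent choices.\<close>
  also have "\<dots> \<le> (\<Prod>S\<in>un. g S) * (real \<tau> + (\<Sum>S\<in>af. real \<tau> * (g S - 1)))"
  proof (intro mult_left_mono add_left_mono sum_mono gu)
    fix S
    have pos: "real \<tau> * (g S - 1) \<ge> 0" using g1[of S] by simp
    show "(\<Sum>e\<in>D. if S \<inter> D = {e} then real \<tau> * (g S - 1) else 0) \<le> real \<tau> * (g S - 1)"
    proof (cases "\<exists>e0. S \<inter> D = {e0}")
      case True
      then obtain e0 where "S \<inter> D = {e0}" by blast
      then have "(\<Sum>e\<in>D. if S \<inter> D = {e} then real \<tau> * (g S - 1) else 0) = (\<Sum>e\<in>D. if e = e0 then real \<tau> * (g S - 1) else 0)"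
        by (intro sum.cong) auto
      then show ?thesis using D pos by simp
    next
      case False
      then show ?thesis using pos by simp
    qed
  qed
  also have "\<dots> = real \<tau> * ((\<Prod>S\<in>un. g S) * (1 + (\<Sum>S\<in>af. g S - 1)))"
    unfolding sum_distrib_left[symmetric] by (simp only: distrib_left mult_ac mult_1_right mult_1)
  also have "\<dots> \<le> real \<tau> * ((\<Prod>S\<in>un. g S) * (\<Prod>S\<in>af. g S))"
    by (intro mult_left_mono one_plus_le_prod gu sp g1) auto
  also have "\<dots> = real \<tau> * (\<Prod>S\<in>F. g S)" using sp by (simp add: prod.union_disjoint)
  finally show ?thesis unfolding g_def p_def .
qed

lemma up_pot_step:
  assumes D: "finite D" "card D = \<tau>" "\<tau> > 0" "D \<inter> E = {}" and R: "R \<subseteq> E" and \<theta>: "\<theta> \<ge> 0"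
    and F: "\<And>j. j \<in> J \<Longrightarrow> finite (\<F> j)" "\<And>j. j \<in> J \<Longrightarrow> pairwise disjnt (\<F> j)" "\<And>j S. j \<in> J \<Longrightarrow> S \<in> \<F> j \<Longrightarrow> finite S"
  shows "(\<Sum>e\<in>D. up_pot J \<F> l \<theta> (1 / real \<tau>) (insert e R) (E \<union> D)) \<le> real \<tau> * up_pot J \<F> l \<theta> (1 / real \<tau>) R E"
  unfolding up_pot_def sum_distrib_left
  apply (subst sum.swap)
  apply (intro sum_mono)
  subgoal for j
    unfolding sum_distrib_left[symmetric]
    using mult_left_mono[OF prod_fac_step[OF D R \<theta> F(1)[of j] F(2)[of j] F(3)[of j]], of "exp (- l j - (exp \<theta> - 1) * (\<Sum>S\<in>\<F> j. (1 / real \<tau>) ^ card S))"]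
    by (simp add: mult_ac)
  done

section \<open>Rounds and outcome of the exposure game\<close>

locale game =
  fixes X :: "'e set" and b \<tau> :: nat and \<beta> \<theta> :: real
    and I :: "'i set" and A :: "'i \<Rightarrow> 'e set" and l :: "'i \<Rightarrow> real"
    and J :: "'j set" and \<F> :: "'j \<Rightarrow> 'e set set" and l' :: "'j \<Rightarrow> real"
  assumes finX: "finite X" and finI: "finite I" and finJ: "finite J"
    and A: "\<And>i. i \<in> I \<Longrightarrow> A i \<subseteq> X" and l_nonneg: "\<And>i. i \<in> I \<Longrightarrow> l i \<ge> 0"
    and F: "\<And>j S. j \<in> J \<Longrightarrow> S \<in> \<F> j \<Longrightarrow> S \<subseteq> X" "\<And>j. j \<in> J \<Longrightarrow> pairwise disjnt (\<F> j)"
    and l_sum: "(\<Sum>i\<in>I. exp (- l i)) \<le> 1" and l'_sum: "(\<Sum>j\<in>J. exp (- l' j)) \<le> 1"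
    and \<theta>: "0 < \<theta>" "\<theta> \<le> 1" and \<beta>: "\<beta> \<ge> 1" "real b \<le> \<beta>" and \<tau>: "real \<tau> \<ge> 8 * \<beta> / \<theta>"
begin

definition "p = 1 / real \<tau>"

text \<open>Both tails at once, each with an additive error proportional to the logarithmic weight
  of its index. As \<open>exp (- l i)\<close> and \<open>exp (- l' j)\<close> sum to at most 1,
  exponentially many sets can be controlled if the weights grow with the logarithm of their
  number.\<close>

definition target :: "'e set \<Rightarrow> bool" where
  "target R \<longleftrightarrow> (\<forall>i\<in>I. real (card (R \<inter> A i)) \<ge> (1 - 2 * \<theta>) * p * real (card (A i)) - (5 * l i + 2) / \<theta>)
    \<and> (\<forall>j\<in>J. real (card {S\<in>\<F> j. S \<subseteq> R}) \<le> (1 + \<theta>) * (\<Sum>S\<in>\<F> j. p ^ card S) + (l' j + 1) / \<theta>)"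

text \<open>\<open>E\<close> records the reserved edges, of which only those in \<open>R\<close>
  were claimed. A reserved but unclaimed edge counts as rejected, so it does no harm if Breaker
  takes it; therefore only \<open>U - E\<close> enters the box potential.\<close>

definition inv_main :: "'e set \<Rightarrow> 'e set \<Rightarrow> 'e set \<Rightarrow> bool" where
  "inv_main E R U \<longleftrightarrow> R \<subseteq> E \<and> E \<subseteq> X \<and>
     box_pot I A (\<lambda>i. exp (- l i)) (1 / (2 * \<beta>)) p E (U - E) \<le> 1 \<and>
     low_pot I A l \<theta> p R E + up_pot J \<F> l' \<theta> p R E \<le> 2"

lemma \<tau>_ge: "real \<tau> \<ge> 8" "real \<tau> \<ge> 8 * \<beta>"
proof -
  have "8 * \<beta> / \<theta> \<ge> 8 * \<beta>" using \<theta> \<beta> by (simp add: field_simps)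
  then show "real \<tau> \<ge> 8 * \<beta>" using \<tau> by linarith
  then show "real \<tau> \<ge> 8" using \<beta> by linarith
qed

lemma p: "0 < p" "p \<le> 1/8" using \<tau>_ge unfolding p_def by (auto simp: field_simps)

sublocale box I A "\<lambda>i. exp (- l i)" "1 / (2 * \<beta>)" p
  by unfold_locales (use finI \<beta> p in auto)

lemma fin_F: "j \<in> J \<Longrightarrow> finite (\<F> j)" "j \<in> J \<Longrightarrow> S \<in> \<F> j \<Longrightarrow> finite S"
  using F(1) finX finite_subset by (metis Pow_iff finite_Pow_iff subsetI finite_subset)+

lemma inv_start: "inv_main {} {} {}"
proof -
  have "up_pot J \<F> l' \<theta> p {} {} \<le> (\<Sum>j\<in>J. exp (- l' j))"
    unfolding up_pot_def
  proof (rule sum_mono)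
    fix j assume "j \<in> J"
    have "(\<Prod>S\<in>\<F> j. fac \<theta> p {} {} S) \<le> (\<Prod>S\<in>\<F> j. exp ((exp \<theta> - 1) * p ^ card S))"
      by (intro prod_mono conjI) (use \<theta> p in \<open>auto simp: fac_def intro!: add_nonneg_nonneg\<close>)
    also have "\<dots> = exp ((exp \<theta> - 1) * (\<Sum>S\<in>\<F> j. p ^ card S))"
      using fin_F(1)[OF \<open>j \<in> J\<close>] by (simp add: exp_sum sum_distrib_left)
    finally have "exp (- l' j - (exp \<theta> - 1) * (\<Sum>S\<in>\<F> j. p ^ card S)) * (\<Prod>S\<in>\<F> j. fac \<theta> p {} {} S)
      \<le> exp (- l' j - (exp \<theta> - 1) * (\<Sum>S\<in>\<F> j. p ^ card S)) * exp ((exp \<theta> - 1) * (\<Sum>S\<in>\<F> j. p ^ card S))"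
      by (intro mult_left_mono) auto
    then show "exp (- l' j - (exp \<theta> - 1) * (\<Sum>S\<in>\<F> j. p ^ card S)) * (\<Prod>S\<in>\<F> j. fac \<theta> p {} {} S) \<le> exp (- l' j)"
      by (simp add: exp_add[symmetric])
  qed
  moreover have "low_pot I A l \<theta> p {} {} \<le> 1" using l_sum unfolding low_pot_def by simp
  moreover have "box_pot I A (\<lambda>i. exp (- l i)) (1 / (2 * \<beta>)) p {} {} \<le> 1"
    using l_sum unfolding box_pot_def box_wt_def by simp
  ultimately show ?thesis unfolding inv_main_def using l'_sum by simp
qed

text \<open>Reserving \<open>\<tau> = 1 / p\<close> edges lowers the box potential by at least
  \<open>g\<close>, a bound for all remaining dangers. Breaker's reply raises it by at most
  \<open>g * ((1 + 1 / (2 * \<beta>)) ^ b - 1)\<close>, and the base is chosen so that the power is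
  at most \<open>exp (1 / 2) \<le> 2\<close>. The claimed edge is one at which the sum of the two
  tail potentials does not exceed its average.\<close>

lemma inv_step:
  assumes inv: "inv_main E R U" and U: "U \<subseteq> X" and fr: "card (X - (E \<union> U)) \<ge> \<tau>" and RU: "R \<inter> U = {}"
  shows "\<exists>e\<in>X - (R \<union> U). \<forall>G. G \<subseteq> X - (R \<union> U) - {e} \<longrightarrow> card G \<le> b \<longrightarrow> (\<exists>E'. inv_main E' (insert e R) (U \<union> G))"
proof -
  have E: "R \<subseteq> E" "E \<subseteq> X" "finite E" using inv finX finite_subset unfolding inv_main_def by auto
  have "\<exists>D g. D \<subseteq> X - (E \<union> U) \<and> card D = \<tau> \<and> g \<ge> 0 \<and> pot (E \<union> D) (U - E) + p * real \<tau> * g \<le> pot E (U - E)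
    \<and> (\<forall>f\<in>X - (E \<union> U) - D. dgr (E \<union> D) (U - E) f \<le> g)"
    by (rule greedy_block) (use E finX fr in auto)
  then obtain D g where D: "D \<subseteq> X - (E \<union> U)" "card D = \<tau>" "g \<ge> 0"
    "pot (E \<union> D) (U - E) + p * real \<tau> * g \<le> pot E (U - E)"
    "\<forall>f\<in>X - (E \<union> U) - D. dgr (E \<union> D) (U - E) f \<le> g" by blast
  have \<tau>p: "\<tau> > 0" "p * real \<tau> = 1" using \<tau>_ge unfolding p_def by auto
  have fD: "finite D" "D \<noteq> {}" using D(1,2) finX \<tau>p finite_subset by (auto intro: finite_subset[of D X])
  let ?P = "\<lambda>R E. low_pot I A l \<theta> p R E + up_pot J \<F> l' \<theta> p R E"
  have DE: "D \<inter> E = {}" using D by blast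
  have 1: "(\<Sum>e\<in>D. low_pot I A l \<theta> p (insert e R) (E \<union> D)) \<le> real \<tau> * low_pot I A l \<theta> p R E"
    unfolding p_def by (rule low_pot_step) (use D fD \<tau>p E \<theta> DE in auto)
  have 2: "(\<Sum>e\<in>D. up_pot J \<F> l' \<theta> p (insert e R) (E \<union> D)) \<le> real \<tau> * up_pot J \<F> l' \<theta> p R E"
    unfolding p_def by (rule up_pot_step) (use D fD \<tau>p E \<theta> DE fin_F F in auto)
  have "(\<Sum>e\<in>D. ?P (insert e R) (E \<union> D)) \<le> real (card D) * ?P R E"
    unfolding sum.distrib D(2) using 1 2 by (simp add: algebra_simps)
  then obtain e where e: "e \<in> D" "?P (insert e R) (E \<union> D) \<le> ?P R E"
    using exists_le_average[OF fD] by blast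
  have "inv_main (E \<union> D) (insert e R) (U \<union> G)" if G: "G \<subseteq> X - (R \<union> U) - {e}" "card G \<le> b" for G
  proof -
    define G0 where "G0 = G - (E \<union> D)"
    have eq: "(U \<union> G) - (E \<union> D) = (U - E) \<union> G0" unfolding G0_def using D(1) by blast
    have fG: "finite G" using G(1) finX finite_subset by (metis finite_Diff)
    have "card G0 \<le> b" using G(2) fG unfolding G0_def by (meson card_mono Diff_subset le_trans)
    have "pot (E \<union> D) ((U - E) \<union> G0) \<le> pot (E \<union> D) (U - E) + g * ((1 + 1 / (2 * \<beta>)) ^ card G0 - 1)"
    proof (rule breaker_block)
      show "finite G0" using fG unfolding G0_def by simp
      show "finite (U - E)" using U finX finite_subset by blast
      show "G0 \<inter> (U - E) = {}" using G unfolding G0_def by blast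
      show "dgr (E \<union> D) (U - E) f \<le> g" if "f \<in> G0" for f
        using that D(5) G(1) unfolding G0_def by blast
    qed
    also have "(1 + 1 / (2 * \<beta>)) ^ card G0 - 1 \<le> 1"
    proof -
      have "(1 + 1 / (2 * \<beta>)) ^ card G0 \<le> exp (1 / (2 * \<beta>)) ^ card G0"
        using \<beta> by (intro power_mono exp_ge_add_one_self) auto
      also have "\<dots> = exp (real (card G0) / (2 * \<beta>))" by (simp add: exp_of_nat_mult[symmetric])
      also have "\<dots> \<le> exp (1 / 2)" using \<beta> \<open>card G0 \<le> b\<close> by (auto simp: field_simps)
      also have "\<dots> \<le> 2" using exp_bound_half[of "1/2::real"] by simp
      finally show ?thesis by simp
    qed
    then have "pot (E \<union> D) (U - E) + g * ((1 + 1 / (2 * \<beta>)) ^ card G0 - 1) \<le> pot (E \<union> D) (U - E) + g * 1"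
      using D(3) by (intro add_left_mono mult_left_mono) auto
    also have "\<dots> \<le> pot E (U - E)" using D(4) \<tau>p by simp
    also have "\<dots> \<le> 1" using inv unfolding inv_main_def by simp
    finally have "pot (E \<union> D) ((U \<union> G) - (E \<union> D)) \<le> 1" unfolding eq .
    then show ?thesis using inv e D(1) E unfolding inv_main_def by auto
  qed
  moreover have "e \<in> X - (R \<union> U)" using e D E by blast
  ultimately show ?thesis by blast
qed

text \<open>A box potential of at most 1 shows that Breaker holds at most a proportion
  \<open>\<theta>\<close> of \<open>A i\<close> outside \<open>E\<close>, up to a multiple of
  \<open>l i\<close>, and fewer than \<open>\<tau>\<close> edges are free. Hence nearly all of
  \<open>A i\<close> is exposed, and the tail potentials, being at most
  \<open>2 \<le> exp 1\<close>, give both counts.\<close>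

lemma inv_target:
  assumes inv: "inv_main E R U" and U: "U \<subseteq> X" and fr: "card (X - (E \<union> U)) < \<tau>"
  shows "target R"
proof -
  have E: "R \<subseteq> E" "E \<subseteq> X" "finite E" "finite U" "finite R" using inv finX U finite_subset unfolding inv_main_def by (metis finite_subset)+
  have pots: "low_pot I A l \<theta> p R E \<ge> 0" "up_pot J \<F> l' \<theta> p R E \<ge> 0"
    unfolding low_pot_def up_pot_def
    using \<theta> p by (auto intro!: sum_nonneg prod_nonneg mult_nonneg_nonneg fac_nonneg)
  have low: "real (card (R \<inter> A i)) \<ge> (1 - 2 * \<theta>) * p * real (card (A i)) - (5 * l i + 2) / \<theta>" if i: "i \<in> I" for i
  proof -
    \<comment> \<open>\<open>A i\<close> splits into its exposed edges, Breaker's unexposed edges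
      and the free edges, counted by \<open>x\<close>, \<open>y\<close> and
      \<open>z\<close>.\<close>
    define x where "x = real (card (E \<inter> A i))"
    define y where "y = real (card ((U - E) \<inter> A i))"
    define z where "z = real (card (A i - (E \<union> U)))"
    define a where "a = real (card (A i))"
    have fA: "finite (A i)" using A[OF i] finX finite_subset by blast
    have "A i = (E \<inter> A i) \<union> (((U - E) \<inter> A i) \<union> (A i - (E \<union> U)))" by blast
    also have "card \<dots> = card (E \<inter> A i) + card (((U - E) \<inter> A i) \<union> (A i - (E \<union> U)))"
      by (rule card_Un_disjoint) (use fA in auto)
    also have "card (((U - E) \<inter> A i) \<union> (A i - (E \<union> U))) = card ((U - E) \<inter> A i) + card (A i - (E \<union> U))"
      by (rule card_Un_disjoint) (use fA in auto)
    finally have a: "a = x + y + z" unfolding a_def x_def y_def z_def by simp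
    have nn: "x \<ge> 0" "y \<ge> 0" "z \<ge> 0" "a \<ge> 0" unfolding x_def y_def z_def a_def by auto
    have "card (A i - (E \<union> U)) \<le> card (X - (E \<union> U))" by (rule card_mono) (use finX A[OF i] in auto)
    then have z: "z \<le> real \<tau>" unfolding z_def using fr by simp
    define \<mu> where "\<mu> = 1 / (2 * \<beta>)"
    have \<mu>: "0 < \<mu>" "\<mu> \<le> 1/2" using \<beta> unfolding \<mu>_def by (auto simp: field_simps)
    have "box_wt A (\<lambda>i. exp (- l i)) \<mu> p E (U - E) i \<le> 1"
      using inv member_le_sum[OF i, of "box_wt A (\<lambda>i. exp (- l i)) \<mu> p E (U - E)"] finI wt_nonneg
      unfolding inv_main_def box_pot_def \<mu>_def by fastforce
    then have "exp (- l i) * (1 - p) ^ card (E \<inter> A i) * (1 + \<mu>) ^ card ((U - E) \<inter> A i) \<le> 1"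
      unfolding box_wt_def .
    moreover have "(1 - p) ^ card (E \<inter> A i) = exp (x * ln (1 - p))"
      unfolding x_def using p by (simp add: exp_of_nat_mult)
    moreover have "(1 + \<mu>) ^ card ((U - E) \<inter> A i) = exp (y * ln (1 + \<mu>))"
      unfolding y_def using \<mu> by (simp add: exp_of_nat_mult)
    ultimately have "exp (- l i) * exp (x * ln (1 - p)) * exp (y * ln (1 + \<mu>)) \<le> 1" by simp
    then have "exp (- l i + x * ln (1 - p) + y * ln (1 + \<mu>)) \<le> 1" by (simp only: exp_add)
    then have *: "- l i + x * ln (1 - p) + y * ln (1 + \<mu>) \<le> 0" by simp
    have "ln (1 - p) \<ge> - p - 2 * p^2" by (rule ln_one_minus_pos_lower_bound) (use p in auto)
    moreover have "2 * p^2 \<le> p" using p by (simp add: power2_eq_square)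
    ultimately have "ln (1 - p) \<ge> - 2 * p" by linarith
    then have "x * ln (1 - p) \<ge> x * (- 2 * p)" using nn by (intro mult_left_mono) auto
    then have h1: "x * ln (1 - p) \<ge> - (2 * p * x)" by (simp add: mult_ac)
    have "ln (1 + \<mu>) \<ge> \<mu> - \<mu>^2" by (rule ln_one_plus_pos_lower_bound) (use \<mu> in auto)
    moreover have "\<mu>^2 \<le> \<mu> / 2" using \<mu> by (simp add: power2_eq_square)
    ultimately have "ln (1 + \<mu>) \<ge> \<mu> / 2" by linarith
    then have h2: "y * ln (1 + \<mu>) \<ge> y * (\<mu> / 2)" using nn by (intro mult_left_mono) auto
    have "y * (\<mu> / 2) \<le> l i + 2 * p * x" using * h1 h2 by linarith
    then have "y \<le> 4 * \<beta> * (l i + 2 * p * x)" unfolding \<mu>_def using \<beta> by (simp add: field_simps)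
    also have "\<dots> = 4 * \<beta> * l i + (8 * \<beta> * p) * x" by (simp add: algebra_simps)
    \<comment> \<open>The lower bound \<open>8 * \<beta> / \<theta>\<close> for the block length
      \<open>\<tau>\<close> is what limits Breaker to the proportion
      \<open>\<theta>\<close>.\<close>
    also have p\<beta>: "8 * \<beta> * p \<le> \<theta>" using \<tau> \<theta> \<tau>_ge unfolding p_def by (simp add: field_simps)
    then have "4 * \<beta> * l i + (8 * \<beta> * p) * x \<le> 4 * \<beta> * l i + \<theta> * x" using nn by (simp add: mult_right_mono)
    also have "\<dots> \<le> 4 * \<beta> * l i + \<theta> * a" using a nn \<theta> by simp
    finally have y: "y \<le> 4 * \<beta> * l i + \<theta> * a" .
    have x: "x \<ge> (1 - \<theta>) * a - 4 * \<beta> * l i - real \<tau>" using y z a by (simp add: algebra_simps)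
    define \<kappa> where "\<kappa> = 1 - exp (- \<theta>)"
    have \<kappa>: "\<kappa> \<ge> \<theta> * (1 - \<theta> / 2)"
    proof -
      have "exp (-\<theta>) \<le> 1 - \<theta> + \<theta>^2/2"
      proof -
        have "1 + \<theta> + \<theta>\<^sup>2 / 2 \<le> exp \<theta>" using exp_lower_Taylor_quadratic[of \<theta>] \<theta> by simp
        moreover have "(1 - \<theta> + \<theta>^2/2) * (1 + \<theta> + \<theta>\<^sup>2 / 2) \<ge> 1"
          using \<theta> by (simp add: algebra_simps power2_eq_square)
        moreover have "1 - \<theta> + \<theta>^2/2 \<ge> 0" using \<theta> by (simp)
        ultimately have "(1 - \<theta> + \<theta>^2/2) * exp \<theta> \<ge> 1" by (meson mult_left_mono order_trans)
        then show ?thesis by (simp add: exp_minus field_simps)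
      qed
      then show ?thesis unfolding \<kappa>_def by (simp add: algebra_simps power2_eq_square)
    qed
    have "exp (- l i - \<theta> * real (card (R \<inter> A i)) + \<kappa> * p * x) \<le> 2"
      using member_le_sum[OF i, of "\<lambda>i. exp (- l i - \<theta> * real (card (R \<inter> A i)) + \<kappa> * p * real (card (E \<inter> A i)))"]
        finI inv pots
      unfolding inv_main_def low_pot_def \<kappa>_def x_def by fastforce
    also have "2 \<le> exp (1::real)" using exp_ge_add_one_self[of "1::real"] by simp
    finally have "- l i - \<theta> * real (card (R \<inter> A i)) + \<kappa> * p * x \<le> 1" by simp
    moreover have "\<kappa> * p * x \<ge> \<theta> * (1 - \<theta> / 2) * p * x" using \<kappa> p nn by (intro mult_right_mono) auto
    ultimately have "\<theta> * real (card (R \<inter> A i)) \<ge> \<theta> * ((1 - \<theta>/2) * p * x) - (l i + 1)" by (simp add: algebra_simps)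
    then have r: "real (card (R \<inter> A i)) \<ge> (1 - \<theta>/2) * p * x - (l i + 1) / \<theta>" using \<theta> by (simp add: field_simps)
    have "(1 - \<theta>/2) * p * x \<ge> (1 - \<theta>/2) * p * ((1 - \<theta>) * a - 4 * \<beta> * l i - real \<tau>)"
      using x \<theta> p by (intro mult_left_mono) auto
    also have "(1 - \<theta>/2) * p * ((1 - \<theta>) * a - 4 * \<beta> * l i - real \<tau>)
       = (1 - \<theta>/2) * (1 - \<theta>) * p * a - (1 - \<theta>/2) * (4 * (\<beta> * p) * l i + p * real \<tau>)" by (simp add: field_simps)
    finally have 1: "(1 - \<theta>/2) * p * x \<ge> (1 - \<theta>/2) * (1 - \<theta>) * p * a - (1 - \<theta>/2) * (4 * (\<beta> * p) * l i + p * real \<tau>)" .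
    have 2: "(1 - \<theta>/2) * (1 - \<theta>) * p * a \<ge> (1 - 2 * \<theta>) * p * a"
    proof -
      have "(1 - \<theta>/2) * (1 - \<theta>) = 1 - 3/2 * \<theta> + \<theta>^2/2" by (simp add: field_simps power2_eq_square)
      then have "(1 - \<theta>/2) * (1 - \<theta>) \<ge> 1 - 2 * \<theta>" using \<theta> zero_le_power2[of \<theta>] by linarith
      then show ?thesis using p nn by (intro mult_right_mono) auto
    qed
    have "p * real \<tau> = 1" using \<tau>_ge unfolding p_def by simp
    moreover have "\<beta> * p * l i \<le> 1 * l i" using p\<beta> \<theta> l_nonneg[OF i] by (intro mult_right_mono) auto
    ultimately have "4 * (\<beta> * p) * l i + p * real \<tau> \<le> 4 * l i + 1" by simp
    moreover have "4 * (\<beta> * p) * l i + p * real \<tau> \<ge> 0" using \<beta> p l_nonneg[OF i] by simp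
    ultimately have "(1 - \<theta>/2) * (4 * (\<beta> * p) * l i + p * real \<tau>) \<le> 1 * (4 * l i + 1)"
      using \<theta> by (intro mult_mono) auto
    also have "\<dots> \<le> (4 * l i + 1) / \<theta>"
      using \<theta> l_nonneg[OF i] mult_left_le_one_le[of "4 * l i + 1" \<theta>] by (simp add: pos_le_divide_eq mult.commute)
    finally have "real (card (R \<inter> A i)) \<ge> (1 - 2 * \<theta>) * p * a - (4 * l i + 1) / \<theta> - (l i + 1) / \<theta>"
      using r 1 2 by linarith
    moreover have "(4 * l i + 1) / \<theta> + (l i + 1) / \<theta> = (5 * l i + 2) / \<theta>" by (simp add: add_divide_distrib[symmetric])
    ultimately show ?thesis unfolding a_def by linarith
  qed
  have up: "real (card {S\<in>\<F> j. S \<subseteq> R}) \<le> (1 + \<theta>) * (\<Sum>S\<in>\<F> j. p ^ card S) + (l' j + 1) / \<theta>" if j: "j \<in> J" for j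
  proof -
    define s where "s = (\<Sum>S\<in>\<F> j. p ^ card S)"
    define k where "k = card {S\<in>\<F> j. S \<subseteq> R}"
    have s0: "s \<ge> 0" unfolding s_def using p by (auto intro: sum_nonneg)
    \<comment> \<open>A member inside \<open>R\<close> has factor exactly
      \<open>exp \<theta>\<close> and every other one at least 1, so the product bounds the
      exponential of the count.\<close>
    have "exp (\<theta> * real k) = (\<Prod>S\<in>{S\<in>\<F> j. S \<subseteq> R}. exp \<theta>)" unfolding k_def by (simp add: exp_of_nat2_mult)
    also have "\<dots> = (\<Prod>S\<in>\<F> j. if S \<subseteq> R then exp \<theta> else 1)" using fin_F(1)[OF j] by (rule prod.inter_filter)
    also have "\<dots> \<le> (\<Prod>S\<in>\<F> j. fac \<theta> p R E S)"
    proof (intro prod_mono conjI)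
      fix S assume "S \<in> \<F> j"
      show "(if S \<subseteq> R then exp \<theta> else 1) \<le> fac \<theta> p R E S"
      proof (cases "S \<subseteq> R")
        case True
        then have "card (S - R) = 0" "S \<inter> E \<subseteq> R" by (auto simp: Diff_eq_empty_iff[THEN iffD2])
        then show ?thesis using True by (simp only: fac_def if_True power_0) simp
      next
        case False
        then show ?thesis using fac_ge_1[of \<theta> p] \<theta> p by simp
      qed
    qed auto
    finally have "exp (- l' j - (exp \<theta> - 1) * s) * exp (\<theta> * real k) \<le> exp (- l' j - (exp \<theta> - 1) * s) * (\<Prod>S\<in>\<F> j. fac \<theta> p R E S)"
      by (intro mult_left_mono) auto
    also have "\<dots> \<le> up_pot J \<F> l' \<theta> p R E"
      unfolding up_pot_def s_def
      by (rule member_le_sum[OF j, of "\<lambda>j. exp (- l' j - (exp \<theta> - 1) * (\<Sum>S\<in>\<F> j. p ^ card S)) * (\<Prod>S\<in>\<F> j. fac \<theta> p R E S)"])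
        (use finJ \<theta> p in \<open>auto intro!: mult_nonneg_nonneg prod_nonneg fac_nonneg\<close>)
    also have "\<dots> \<le> 2" using inv pots unfolding inv_main_def by linarith
    also have "2 \<le> exp (1::real)" using exp_ge_add_one_self[of "1::real"] by simp
    finally have "- l' j - (exp \<theta> - 1) * s + \<theta> * real k \<le> 1" by (simp add: exp_add[symmetric])
    moreover have "exp \<theta> - 1 \<le> \<theta> + \<theta>^2" using exp_bound[of \<theta>] \<theta> by simp
    then have "(exp \<theta> - 1) * s \<le> (\<theta> + \<theta>^2) * s" using s0 by (rule mult_right_mono)
    ultimately have "\<theta> * real k \<le> \<theta> * ((1 + \<theta>) * s) + (l' j + 1)" by (simp add: algebra_simps power2_eq_square)
    then show ?thesis using \<theta> unfolding s_def[symmetric] k_def[symmetric] by (simp add: field_simps)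
  qed
  show ?thesis unfolding target_def using low up by blast
qed

text \<open>The upper bounds in \<open>target\<close> may fail when further edges are added, so the
  goal speaks of a subset \<open>R'\<close> of the red edges: once \<open>target\<close> is reached,
  \<open>R'\<close> is frozen and any legal move will do. It is reached as soon as fewer than
  \<open>\<tau>\<close> edges are free, at the latest when the board is full.\<close>

theorem maker_wins_target: "maker_wins X b (\<lambda>R. \<exists>R'\<subseteq>R. target R')"
proof (rule maker_wins_positional[where Good = "\<lambda>R U. (\<exists>R'\<subseteq>R. target R') \<or> (\<exists>E. inv_main E R U)"])
  show "(\<exists>R'\<subseteq>{}. target R') \<or> (\<exists>E. inv_main E {} {})" using inv_start by blast
next
  fix R U assume a: "R \<subseteq> X" "U \<subseteq> X" "R \<inter> U = {}" "(\<exists>R'\<subseteq>R. target R') \<or> (\<exists>E. inv_main E R U)" "X - (R \<union> U) \<noteq> {}"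
  show "\<exists>e\<in>X - (R \<union> U). \<forall>G\<subseteq>X - (R \<union> U) - {e}. card G \<le> b \<longrightarrow>
     (\<exists>R'\<subseteq>insert e R. target R') \<or> (\<exists>E. inv_main E (insert e R) (U \<union> G))"
  proof (cases "\<exists>R'\<subseteq>R. target R'")
    case True
    then show ?thesis using a(5) by (metis ex_in_conv subset_insertI2)
  next
    case False
    then obtain E where E: "inv_main E R U" using a by blast
    have "\<not> card (X - (E \<union> U)) < \<tau>" using inv_target[OF E a(2)] False by blast
    then show ?thesis using inv_step[OF E a(2) _ a(3)] by (meson linorder_not_less)
  qed
next
  fix R U assume a: "R \<inter> U = {}" "R \<union> U = X" "(\<exists>R'\<subseteq>R. target R') \<or> (\<exists>E. inv_main E R U)"
  show "\<exists>R'\<subseteq>R. target R'"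
  proof (cases "\<exists>R'\<subseteq>R. target R'")
    case False
    then obtain E where E: "inv_main E R U" using a by blast
    then have "X - (E \<union> U) = {}" using a unfolding inv_main_def by blast
    then have "card (X - (E \<union> U)) = 0" by (simp only: card.empty)
    then have "card (X - (E \<union> U)) < \<tau>" using \<tau>_ge(1) by linarith
    moreover have "U \<subseteq> X" using a by blast
    ultimately show ?thesis using inv_target[OF E] by blast
  qed
qed

end

text \<open>Intervals get cost 3 because there are only polynomially many of them: for an interval \<open>B\<close> the
  bound below is meaningful even if \<open>A\<close> is a single vertex.\<close>
definition cost :: "nat set \<Rightarrow> real" where
  "cost B = (if \<exists>i j. B = {i..<j} then 3 else real (card B))"

lemma cost_ge_0: "cost B \<ge> 0"
  unfolding cost_def by simp

text \<open>When \<open>L x\<close> consists of the images of the neighbours of \<open>x\<close>, the last property bounds the number of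
  pairs of a vertex \<open>x\<close> and a candidate for it in \<open>Y\<close>, which is what Hall's condition needs.\<close>
locale host =
  fixes N :: nat and nb :: "nat \<Rightarrow> nat set" and p \<epsilon> K :: real and \<Delta> :: nat
  assumes N3: "N \<ge> 3"
    and nb_lt: "u \<in> nb v \<Longrightarrow> u < N" and nb_sym: "u \<in> nb v \<Longrightarrow> v \<in> nb u" and nb_irrefl: "v \<notin> nb v"
    and p: "0 < p" "p \<le> 1" and \<epsilon>: "0 < \<epsilon>" "\<epsilon> \<le> 1 / 10" and K: "K \<ge> 1"
    and many_edges: "A \<subseteq> {..<N} \<Longrightarrow> B \<subseteq> {..<N} \<Longrightarrow> A \<inter> B = {} \<Longrightarrow>
      (\<Sum>a\<in>A. real (card (nb a \<inter> B))) \<ge> (1 - \<epsilon>) * p * real (card A) * real (card B) - K * (real (card A) + cost B) * ln (real N)"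
    and few_stars: "\<And>(S :: nat set) L Y. finite S \<Longrightarrow> (\<And>x. x \<in> S \<Longrightarrow> L x \<subseteq> {..<N} \<and> card (L x) \<le> \<Delta> \<and> L x \<inter> Y = {}) \<Longrightarrow>
      (\<And>x y. x \<in> S \<Longrightarrow> y \<in> S \<Longrightarrow> x \<noteq> y \<Longrightarrow> L x \<inter> L y = {}) \<Longrightarrow> Y \<subseteq> {..<N} \<Longrightarrow>
      (\<Sum>x\<in>S. real (card {v\<in>Y. L x \<subseteq> nb v})) \<le> (1 + \<epsilon>) * real (card Y) * (\<Sum>x\<in>S. p ^ card (L x))
         + K * (real (card S) + real (card Y)) * ln (real N)"

section \<open>From the exposure game to pseudorandom hosts\<close>

definition nbr :: "nat set set \<Rightarrow> nat \<Rightarrow> nat set" where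
  "nbr R v = {u. {u, v} \<in> R}"

lemma maker_wins_mono: "maker_wins X b P \<Longrightarrow> (\<And>R. P R \<Longrightarrow> Q R) \<Longrightarrow> maker_wins X b Q"
  unfolding maker_wins_def by meson

lemma sum_Pow_prod_le:
  fixes w :: "'a \<Rightarrow> real"
  assumes "finite U" "\<And>x. x \<in> U \<Longrightarrow> w x \<ge> 0"
  shows "(\<Sum>S\<in>Pow U. \<Prod>x\<in>S. w x) \<le> exp (\<Sum>x\<in>U. w x)"
proof -
  have "(\<Sum>S\<in>Pow U. \<Prod>x\<in>S. w x) = (\<Prod>x\<in>U. w x + 1)"
    using prod_add[OF assms(1), of w "\<lambda>_. 1"] by simp
  also have "\<dots> \<le> (\<Prod>x\<in>U. exp (w x))"
    by (rule prod_mono) (use assms(2) in \<open>auto simp: add_nonneg_nonneg add.commute[of _ "1::real"]\<close>)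
  also have "\<dots> = exp (\<Sum>x\<in>U. w x)" using assms(1) by (simp add: exp_sum)
  finally show ?thesis .
qed

lemma exp_1_le_3: "exp (1::real) \<le> 3"
  using exp_le by simp

text \<open>Each vertex is charged \<open>2 * ln N\<close>, so the sum is
  \<open>(1 + 1 / N ^ 2) ^ N\<close>.\<close>

lemma sum_subsets_le:
  assumes "N \<ge> 1"
  shows "(\<Sum>B\<in>Pow {..<N}. exp (- 2 * real (card B) * ln (real N))) \<le> 3"
proof -
  have *: "exp (- 2 * real (card B) * ln (real N)) = (\<Prod>x\<in>B. exp (- 2 * ln (real N)))" if "B \<in> Pow {..<N}" for B
    using finite_subset[of B "{..<N}"] that by (simp add: exp_of_nat_mult[symmetric] mult_ac)
  have "(\<Sum>B\<in>Pow {..<N}. exp (- 2 * real (card B) * ln (real N))) = (\<Sum>B\<in>Pow {..<N}. \<Prod>x\<in>B. exp (- 2 * ln (real N)))"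
    by (rule sum.cong) (use * in auto)
  also have "\<dots> \<le> exp (\<Sum>x\<in>{..<N}. exp (- 2 * ln (real N)))"
    by (rule sum_Pow_prod_le) auto
  also have "(\<Sum>x\<in>{..<N}. exp (- 2 * ln (real N))) \<le> 1"
  proof -
    have "exp (- 2 * ln (real N)) = 1 / real N ^ 2"
      using assms by (simp add: exp_minus exp_double field_simps)
    then show ?thesis using assms by (simp add: power2_eq_square)
  qed
  then have "exp (\<Sum>x\<in>{..<N}. exp (- 2 * ln (real N))) \<le> exp 1" by simp
  also have "\<dots> \<le> 3" by (rule exp_1_le_3)
  finally show ?thesis .
qed

text \<open>The flat cost of an interval is affordable because there are at most
  \<open>(N + 1) ^ 2\<close> intervals, each of weight \<open>1 / N ^ 6\<close>.\<close>

lemma sum_cost_le: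
  assumes "N \<ge> 2"
  shows "(\<Sum>B\<in>Pow {..<N}. exp (- 2 * cost B * ln (real N))) \<le> 4"
proof -
  define Iv where "Iv = {B \<in> Pow {..<N}. \<exists>i j. B = {i..<j}}"
  have fin: "finite Iv" unfolding Iv_def by simp
  have "Iv \<subseteq> (\<lambda>(i, j). {i..<j}) ` ({..N} \<times> {..N})"
  proof
    fix B assume "B \<in> Iv"
    then obtain i j where B: "B = {i..<j}" "B \<subseteq> {..<N}" unfolding Iv_def by auto
    show "B \<in> (\<lambda>(i, j). {i..<j}) ` ({..N} \<times> {..N})"
    proof (cases "i < j")
      case True
      then have "j - 1 \<in> B" unfolding B(1) by auto
      then have "j - 1 < N" using B(2) by blast
      then have "i \<le> N" "j \<le> N" using True by auto
      then show ?thesis unfolding B(1) by auto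
    next
      case False
      then have "B = (\<lambda>(i, j). {i..<j}) (0, 0)" using B(1) by simp
      then show ?thesis by blast
    qed
  qed
  then have "card Iv \<le> card ({..N} \<times> {..N})" by (rule surj_card_le[rotated]) simp
  then have cIv: "card Iv \<le> (N + 1)^2" by (simp add: power2_eq_square)
  have "(\<Sum>B\<in>Pow {..<N}. exp (- 2 * cost B * ln (real N)))
    \<le> (\<Sum>B\<in>Pow {..<N}. exp (- 2 * real (card B) * ln (real N)) + (if B \<in> Iv then exp (- 6 * ln (real N)) else 0))"
    by (rule sum_mono) (auto simp: cost_def Iv_def)
  also have "\<dots> = (\<Sum>B\<in>Pow {..<N}. exp (- 2 * real (card B) * ln (real N))) + real (card Iv) * exp (- 6 * ln (real N))"
  proof -
    have "(\<Sum>B\<in>Pow {..<N}. if B \<in> Iv then exp (- 6 * ln (real N)) else 0) = (\<Sum>B\<in>Pow {..<N} \<inter> Iv. exp (- 6 * ln (real N)))"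
      by (rule sum.inter_restrict[symmetric]) simp
    also have "Pow {..<N} \<inter> Iv = Iv" unfolding Iv_def by auto
    finally show ?thesis by (simp add: sum.distrib)
  qed
  also have "\<dots> \<le> 3 + 1"
  proof (intro add_mono sum_subsets_le)
    have "exp (6 * ln (real N)) = real N ^ 6" using assms by (simp add: exp_of_nat_mult[of 6, simplified])
    then have e: "exp (- 6 * ln (real N)) = 1 / real N ^ 6" by (simp add: exp_minus field_simps)
    have "real (card Iv) \<le> real ((N + 1)^2)" using cIv by linarith
    also have "\<dots> \<le> (real N ^ 3)^2"
    proof -
      have "real N \<ge> 2" using assms by simp
      then have "real N ^ 3 \<ge> 4 * real N" using mult_mono[of 2 "real N" 2 "real N"] by (simp add: power3_eq_cube mult_right_mono)
      then have "real N + 1 \<le> real N ^ 3" using \<open>real N \<ge> 2\<close> by linarith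
      then show ?thesis by (simp add: power_mono del: power_mult power_mult_numeral)
    qed
    finally have "real (card Iv) \<le> real N ^ 6" by (simp add: power_mult[symmetric])
    then show "real (card Iv) * exp (- 6 * ln (real N)) \<le> 1" unfolding e using assms by (simp add: field_simps)
  qed (use assms in simp)
  finally show ?thesis by simp
qed

lemma card_edges_between:
  assumes "finite A" "finite B" "A \<inter> B = {}"
  shows "card ((\<lambda>(a, b). {a, b}) ` (A \<times> B)) = card A * card B"
    "card (R \<inter> (\<lambda>(a, b). {a, b}) ` (A \<times> B)) = (\<Sum>a\<in>A. card (nbr R a \<inter> B))"
proof -
  have inj: "inj_on (\<lambda>(a, b). {a, b}) (A \<times> B)"
    using assms(3) by (auto simp: inj_on_def doubleton_eq_iff)
  show "card ((\<lambda>(a, b). {a, b}) ` (A \<times> B)) = card A * card B"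
    using card_image[OF inj] by (simp add: card_cartesian_product)
  have "R \<inter> (\<lambda>(a, b). {a, b}) ` (A \<times> B) = (\<lambda>(a, b). {a, b}) ` (SIGMA a:A. nbr R a \<inter> B)"
    unfolding nbr_def by (auto simp: insert_commute)
  also have "card \<dots> = card (SIGMA a:A. nbr R a \<inter> B)"
    by (rule card_image) (rule inj_on_subset[OF inj], auto)
  also have "\<dots> = (\<Sum>a\<in>A. card (nbr R a \<inter> B))" using assms by simp
  finally show "card (R \<inter> (\<lambda>(a, b). {a, b}) ` (A \<times> B)) = (\<Sum>a\<in>A. card (nbr R a \<inter> B))" .
qed

definition star :: "nat \<Rightarrow> nat set \<Rightarrow> nat set set" where
  "star v T = (\<lambda>u. {u, v}) ` T"

lemma star_subset: "star v T \<subseteq> R \<longleftrightarrow> T \<subseteq> nbr R v"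
  unfolding star_def nbr_def by auto

lemma card_star: "v \<notin> T \<Longrightarrow> card (star v T) = card T"
  unfolding star_def by (rule card_image) (auto simp: inj_on_def doubleton_eq_iff)

definition stars :: "nat set set \<times> nat set \<Rightarrow> nat set set set" where
  "stars = (\<lambda>(\<T>, Y). (\<lambda>(T, v). star v T) ` (\<T> \<times> Y))"

text \<open>Disjointness within \<open>\<T>\<close> and from \<open>Y\<close> makes the stars
  edge-disjoint: no edge can be read with centre and leaf exchanged. The empty leaf set is excluded
  because all its stars coincide.\<close>

definition star_fams :: "nat \<Rightarrow> (nat set set \<times> nat set) set" where
  "star_fams N = {(\<T>, Y). \<T> \<subseteq> Pow {..<N} - {{}} \<and> Y \<subseteq> {..<N} \<and> pairwise disjnt \<T> \<and> (\<forall>T\<in>\<T>. T \<inter> Y = {})}"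

lemma stars_disjoint:
  assumes "(\<T>, Y) \<in> star_fams N" "T \<in> \<T>" "T' \<in> \<T>" "v \<in> Y" "v' \<in> Y" "(T, v) \<noteq> (T', v')"
  shows "star v T \<inter> star v' T' = {}"
proof (rule ccontr)
  assume "star v T \<inter> star v' T' \<noteq> {}"
  then obtain u u' where u: "u \<in> T" "u' \<in> T'" "{u, v} = {u', v'}" unfolding star_def by auto
  have "u \<noteq> v'" "u' \<noteq> v" using assms u unfolding star_fams_def by auto
  then have "u = u'" "v = v'" using u(3) by (auto simp: doubleton_eq_iff)
  then have "\<not> disjnt T T'" using u unfolding disjnt_def by auto
  then have "T = T'" using assms unfolding star_fams_def pairwise_def by auto
  then show False using \<open>v = v'\<close> assms by simp
qed

lemma stars_inj:
  assumes "(\<T>, Y) \<in> star_fams N"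
  shows "inj_on (\<lambda>(T, v). star v T) (\<T> \<times> Y)"
proof (rule inj_onI, clarify)
  fix T v T' v' assume a: "T \<in> \<T>" "v \<in> Y" "T' \<in> \<T>" "v' \<in> Y" "star v T = star v' T'"
  have "T \<noteq> {}" using a assms unfolding star_fams_def by auto
  then have "star v T \<inter> star v' T' \<noteq> {}" using a unfolding star_def by auto
  then show "T = T' \<and> v = v'" using stars_disjoint[OF assms a(1) a(3) a(2) a(4)] by blast
qed

lemma sum_times:
  fixes f :: "'a \<Rightarrow> real"
  shows "(\<Sum>(A, B)\<in>X \<times> Y. c * (f A * g B)) = c * (sum f X * sum g Y)"
proof -
  have "(\<Sum>(A, B)\<in>X \<times> Y. c * (f A * g B)) = (\<Sum>A\<in>X. \<Sum>B\<in>Y. c * (f A * g B))"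
    by (simp add: sum.cartesian_product)
  also have "\<dots> = c * (\<Sum>A\<in>X. \<Sum>B\<in>Y. f A * g B)" by (simp only: sum_distrib_left)
  finally show ?thesis by (simp only: sum_product)
qed

text \<open>Summed over all pairs without the disjointness conditions, the weight factors. The
  families of leaf sets contribute at most \<open>exp 3\<close> and the sets \<open>Y\<close> at
  most 3, and the constant 5 brings this to \<open>3 * exp (- 2) \<le> 1\<close>.\<close>

lemma star_fams_weight:
  assumes "N \<ge> 1"
  shows "(\<Sum>(\<T>, Y)\<in>star_fams N. exp (- (2 * (\<Sum>T\<in>\<T>. real (card T)) * ln (real N) + 2 * real (card Y) * ln (real N) + 5))) \<le> 1"
proof -
  let ?U = "Pow {..<N} - {{}} :: nat set set"
  let ?w = "\<lambda>T::nat set. exp (- 2 * real (card T) * ln (real N))"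
  have "(\<Sum>(\<T>, Y)\<in>star_fams N. exp (- (2 * (\<Sum>T\<in>\<T>. real (card T)) * ln (real N) + 2 * real (card Y) * ln (real N) + 5)))
     = (\<Sum>(\<T>, Y)\<in>star_fams N. exp (- 5) * ((\<Prod>T\<in>\<T>. ?w T) * ?w Y))"
  proof (rule sum.cong[OF refl], clarify)
    fix \<T> Y assume "(\<T>, Y) \<in> star_fams N"
    then have "finite \<T>" unfolding star_fams_def by (auto intro: finite_subset)
    then show "exp (- (2 * (\<Sum>T\<in>\<T>. real (card T)) * ln (real N) + 2 * real (card Y) * ln (real N) + 5)) = exp (- 5) * ((\<Prod>T\<in>\<T>. ?w T) * ?w Y)"
      by (simp add: exp_sum[symmetric] exp_add[symmetric] sum_distrib_left sum_distrib_right sum_negf algebra_simps)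
  qed
  also have "\<dots> \<le> (\<Sum>(\<T>, Y)\<in>Pow ?U \<times> Pow {..<N}. exp (- 5) * ((\<Prod>T\<in>\<T>. ?w T) * ?w Y))"
    by (rule sum_mono2) (auto simp: star_fams_def intro!: mult_nonneg_nonneg prod_nonneg)
  also have "\<dots> = exp (- 5) * ((\<Sum>\<T>\<in>Pow ?U. \<Prod>T\<in>\<T>. ?w T) * (\<Sum>Y\<in>Pow {..<N}. ?w Y))"
    by (rule sum_times)
  also have "\<dots> \<le> exp (- 5) * (exp 3 * 3)"
  proof (intro mult_left_mono mult_mono)
    have "(\<Sum>\<T>\<in>Pow ?U. \<Prod>T\<in>\<T>. ?w T) \<le> exp (\<Sum>T\<in>?U. ?w T)" by (rule sum_Pow_prod_le) auto
    also have "(\<Sum>T\<in>?U. ?w T) \<le> (\<Sum>T\<in>Pow {..<N}. ?w T)" by (rule sum_mono2) auto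
    also have "\<dots> \<le> 3" by (rule sum_subsets_le) (use assms in simp)
    finally show "(\<Sum>\<T>\<in>Pow ?U. \<Prod>T\<in>\<T>. ?w T) \<le> exp 3" by simp
    show "(\<Sum>Y\<in>Pow {..<N}. ?w Y) \<le> 3" by (rule sum_subsets_le) (use assms in simp)
  qed (auto intro: sum_nonneg)
  also have "\<dots> = 3 * exp (- 2)" by (simp add: exp_add[symmetric])
  also have "\<dots> \<le> 1"
  proof -
    have "exp (2::real) \<ge> 3" using exp_ge_add_one_self[of "2::real"] by simp
    then show ?thesis by (simp add: exp_minus field_simps)
  qed
  finally show ?thesis .
qed

text \<open>The two factors are at most 3 and 4, and \<open>exp 3 \<ge> 12\<close>.\<close>

lemma edge_fams_weight:
  assumes "N \<ge> 2"
  shows "(\<Sum>(A, B)\<in>{(A, B). A \<subseteq> {..<N} \<and> B \<subseteq> {..<N} \<and> A \<inter> B = {}}. exp (- (2 * (real (card A) + cost B) * ln (real N) + 3))) \<le> 1"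
proof -
  let ?w = "\<lambda>T::nat set. exp (- 2 * real (card T) * ln (real N))"
  let ?c = "\<lambda>T::nat set. exp (- 2 * cost T * ln (real N))"
  have "(\<Sum>(A, B)\<in>{(A, B). A \<subseteq> {..<N} \<and> B \<subseteq> {..<N} \<and> A \<inter> B = {}}. exp (- (2 * (real (card A) + cost B) * ln (real N) + 3)))
     = (\<Sum>(A, B)\<in>{(A, B). A \<subseteq> {..<N} \<and> B \<subseteq> {..<N} \<and> A \<inter> B = {}}. exp (- 3) * (?w A * ?c B))"
    by (rule sum.cong[OF refl], clarify) (simp add: exp_add[symmetric] algebra_simps)
  also have "\<dots> \<le> (\<Sum>(A, B)\<in>Pow {..<N} \<times> Pow {..<N}. exp (- 3) * (?w A * ?c B))"
    by (rule sum_mono2) auto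
  also have "\<dots> = exp (- 3) * ((\<Sum>A\<in>Pow {..<N}. ?w A) * (\<Sum>B\<in>Pow {..<N}. ?c B))"
    by (rule sum_times)
  also have "\<dots> \<le> exp (- 3) * (3 * 4)"
    by (intro mult_left_mono mult_mono sum_subsets_le sum_cost_le) (use assms in \<open>auto intro: sum_nonneg\<close>)
  also have "\<dots> \<le> 1"
  proof -
    have "exp (1::real) ^ 3 \<ge> (5/2)^3" by (rule power_mono) (use exp_lower_Taylor_quadratic[of "1::real"] in auto)
    then have "exp (3::real) \<ge> 12" by (simp add: exp_of_nat_mult[symmetric] power_divide)
    then show ?thesis by (simp add: exp_minus field_simps)
  qed
  finally show ?thesis .
qed

text \<open>The exposure game is played with \<open>\<theta> = \<epsilon> / 2\<close>, with lower
  bounds for the complete bipartite graphs between disjoint sets and upper bounds for families of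
  stars. The logarithmic weights are of order log N times the number of vertices involved, which
  gives the error terms of \<open>host\<close>; the bound on \<open>\<tau>\<close> is
  \<open>8 * \<beta> / \<theta>\<close>, where \<open>\<beta> = max 1 b\<close> also covers bias
  0.\<close>

theorem maker_wins_host:
  assumes N: "N \<ge> 3" and \<epsilon>: "0 < \<epsilon>" "\<epsilon> \<le> 1 / 10" and \<tau>: "real \<tau> \<ge> 16 * max 1 (real b) / \<epsilon>"
  shows "maker_wins ([{..<N}]\<^bsup>2\<^esup>) b (\<lambda>R. \<exists>R'\<subseteq>R. host N (nbr R') (1 / real \<tau>) \<epsilon> (54 * (real \<Delta> + 1) / \<epsilon>) \<Delta>)"
proof -
  let ?X = "[{..<N}]\<^bsup>2\<^esup>"
  let ?I = "{(A, B). A \<subseteq> {..<N} \<and> B \<subseteq> {..<N} \<and> A \<inter> B = {}}"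
  let ?A = "\<lambda>(A, B). (\<lambda>(a, b). {a, b}) ` (A \<times> B) :: nat set set"
  define l where "l = (\<lambda>(A, B). 2 * (real (card (A :: nat set)) + cost B) * ln (real N) + 3)"
  define l' where "l' = (\<lambda>(\<T>, Y). 2 * (\<Sum>T\<in>\<T>. real (card (T::nat set))) * ln (real N) + 2 * real (card (Y::nat set)) * ln (real N) + 5)"
  have lnN: "ln (real N) \<ge> 1"
  proof -
    have "ln (real N) \<ge> ln (exp 1)" using N exp_1_le_3 by (intro ln_mono) (auto intro: order_trans)
    then show ?thesis by simp
  qed
  have subs: "?I \<subseteq> Pow {..<N} \<times> Pow {..<N}" by auto
  interpret game ?X b \<tau> "max 1 (real b)" "\<epsilon> / 2" ?I ?A l "star_fams N" stars l'
  proof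
    show "finite ?X" by (simp add: finite_imp_finite_nsets)
    show "finite ?I" using finite_subset[OF subs] by simp
    show "finite (star_fams N)"
      by (rule finite_subset[of _ "Pow (Pow {..<N}) \<times> Pow {..<N}"]) (auto simp: star_fams_def)
    show "?A i \<subseteq> ?X" if "i \<in> ?I" for i
      using that by (auto simp: nsets_def card_insert_if)
    show "l i \<ge> 0" for i unfolding l_def using lnN cost_ge_0 by (auto split: prod.splits)
    show "S \<subseteq> ?X" if "j \<in> star_fams N" "S \<in> stars j" for j S
      using that by (auto simp: stars_def star_fams_def star_def nsets_def card_insert_if) blast+
    show "pairwise disjnt (stars j)" if "j \<in> star_fams N" for j
    proof (cases j)
      case (Pair \<T> Y)
      show ?thesis unfolding pairwise_def disjnt_def Pair stars_def
        using stars_disjoint[of \<T> Y N] that unfolding Pair by fastforce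
    qed
    show "(\<Sum>i\<in>?I. exp (- l i)) \<le> 1"
      using edge_fams_weight[of N] N unfolding l_def by (simp add: case_prod_unfold)
    show "(\<Sum>j\<in>star_fams N. exp (- l' j)) \<le> 1"
      using star_fams_weight[of N] N unfolding l'_def by (simp add: case_prod_unfold)
    show "real \<tau> \<ge> 8 * max 1 (real b) / (\<epsilon> / 2)" using \<tau> by simp
  qed (use \<epsilon> in auto)
  have p_eq: "p = 1 / real \<tau>" unfolding p_def by simp
  have host: "host N (nbr (R \<inter> ?X)) p \<epsilon> (54 * (real \<Delta> + 1) / \<epsilon>) \<Delta>" if R: "target R" for R
  proof
    show "N \<ge> 3" by (rule N)
    show "u < N" if "u \<in> nbr (R \<inter> ?X) v" for u v using that unfolding nbr_def nsets_def by auto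
    show "v \<in> nbr (R \<inter> ?X) u" if "u \<in> nbr (R \<inter> ?X) v" for u v using that unfolding nbr_def by (simp add: insert_commute)
    show "v \<notin> nbr (R \<inter> ?X) v" for v unfolding nbr_def nsets_def by auto
    show "0 < p" "p \<le> 1" using p by auto
    show "0 < \<epsilon>" "\<epsilon> \<le> 1/10" using \<epsilon> by auto
    show "1 \<le> 54 * (real \<Delta> + 1) / \<epsilon>" using \<epsilon> by (simp add: field_simps)
  next
    fix A B :: "nat set" assume AB: "A \<subseteq> {..<N}" "B \<subseteq> {..<N}" "A \<inter> B = {}"
    have fin: "finite A" "finite B" using AB finite_subset by blast+
    let ?K = "54 * (real \<Delta> + 1) / \<epsilon>"
    show "(1 - \<epsilon>) * p * real (card A) * real (card B) - ?K * (real (card A) + cost B) * ln (real N)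
       \<le> (\<Sum>a\<in>A. real (card (nbr (R \<inter> ?X) a \<inter> B)))"
    proof (cases "A = {}")
      case True
      then show ?thesis using \<epsilon> lnN cost_ge_0[of B] by simp
    next
      case False
      then have cA: "real (card A) \<ge> 1" using fin by (simp add: Suc_leI card_gt_0_iff)
      have in_I: "(A, B) \<in> ?I" using AB by simp
      then have sX: "?A (A, B) \<subseteq> ?X" using A by blast
      have "R \<inter> ?X \<inter> ?A (A, B) = R \<inter> ?A (A, B)" using sX by blast
      then have "real (card (R \<inter> ?A (A, B))) = (\<Sum>a\<in>A. real (card (nbr (R \<inter> ?X) a \<inter> B)))"
        using card_edges_between(2)[OF fin AB(3), of "R \<inter> ?X"] by simp
      moreover have "real (card (?A (A, B))) = real (card A) * real (card B)"
        using card_edges_between(1)[OF fin AB(3)] by simp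
      moreover have "real (card (R \<inter> ?A (A, B))) \<ge> (1 - 2 * (\<epsilon> / 2)) * p * real (card (?A (A, B))) - (5 * l (A, B) + 2) / (\<epsilon> / 2)"
        using R in_I unfolding target_def by blast
      moreover have "(5 * l (A, B) + 2) / (\<epsilon> / 2) \<le> ?K * (real (card A) + cost B) * ln (real N)"
      proof -
        define z where "z = (real (card A) + cost B) * ln (real N)"
        have "1 * 1 \<le> z" unfolding z_def using cA lnN cost_ge_0[of B] by (intro mult_mono) auto
        then have z: "z \<ge> 1" by simp
        \<comment> \<open>As \<open>z \<ge> 1\<close>, the constants are absorbed into 10 + 17 = 27,
          and dividing by \<open>\<epsilon> / 2\<close> doubles this to the 54 of the host
          constant.\<close>
        have "5 * l (A, B) + 2 = 10 * z + 17" unfolding l_def z_def by (simp add: algebra_simps)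
        also have "\<dots> \<le> 27 * z" using z by simp
        also have "\<dots> \<le> 27 * (real \<Delta> + 1) * z" using z by simp
        finally have "(5 * l (A, B) + 2) / (\<epsilon> / 2) \<le> 27 * (real \<Delta> + 1) * z / (\<epsilon> / 2)"
          using \<epsilon> by (intro divide_right_mono) auto
        then show ?thesis unfolding z_def by (simp add: field_simps)
      qed
      ultimately show ?thesis by (simp add: algebra_simps)
    qed
  next
    fix S :: "nat set" and L :: "nat \<Rightarrow> nat set" and Y :: "nat set"
    assume S: "finite S" and L: "\<And>x. x \<in> S \<Longrightarrow> L x \<subseteq> {..<N} \<and> card (L x) \<le> \<Delta> \<and> L x \<inter> Y = {}"
      and disj: "\<And>x y. x \<in> S \<Longrightarrow> y \<in> S \<Longrightarrow> x \<noteq> y \<Longrightarrow> L x \<inter> L y = {}" and Y: "Y \<subseteq> {..<N}"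
    let ?K = "54 * (real \<Delta> + 1) / \<epsilon>"
    let ?nb = "nbr (R \<inter> ?X)"
    have fY: "finite Y" using Y finite_subset by auto
    show "(\<Sum>x\<in>S. real (card {v\<in>Y. L x \<subseteq> ?nb v})) \<le> (1 + \<epsilon>) * real (card Y) * (\<Sum>x\<in>S. p ^ card (L x))
         + ?K * (real (card S) + real (card Y)) * ln (real N)"
    proof (cases "S = {}")
      case True
      then show ?thesis using \<epsilon> lnN by simp
    next
      case False
      then have cS: "real (card S) \<ge> 1" using S by (simp add: Suc_leI card_gt_0_iff)
      \<comment> \<open>Empty leaf sets do not occur in \<open>star_fams\<close>. For them every
        vertex of \<open>Y\<close> counts and \<open>p ^ 0 = 1\<close>, so they satisfy the
        inequality trivially and are added at the end.\<close>
      define S' where "S' = {x\<in>S. L x \<noteq> {}}"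
      define \<T> where "\<T> = L ` S'"
      have fS': "finite S'" using S unfolding S'_def by simp
      have inj: "inj_on L S'" using disj unfolding S'_def inj_on_def by blast
      have j: "(\<T>, Y) \<in> star_fams N"
      proof -
        have "L x \<inter> L y = {}" if "x \<in> S" "y \<in> S" "L x \<noteq> L y" for x y
          using disj[of x y] that by (cases "x = y") auto
        then have "pairwise disjnt \<T>" unfolding \<T>_def S'_def pairwise_def disjnt_def by blast
        then show ?thesis using L Y unfolding star_fams_def \<T>_def S'_def by auto
      qed
      have f\<T>: "finite \<T>" unfolding \<T>_def using fS' by simp
      have fS: "card {T \<in> stars (\<T>, Y). T \<subseteq> R} = (\<Sum>x\<in>S'. card {v\<in>Y. L x \<subseteq> ?nb v})"
      proof -
        have sub: "star v T \<subseteq> R \<longleftrightarrow> T \<subseteq> ?nb v" if "T \<in> \<T>" "v \<in> Y" for T v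
        proof -
          have "star v T \<subseteq> ?X" using j that by (auto simp: star_fams_def star_def nsets_def card_insert_if) blast+
          then have "star v T \<subseteq> R \<longleftrightarrow> star v T \<subseteq> R \<inter> ?X" by blast
          then show ?thesis by (simp only: star_subset)
        qed
        have "{T \<in> stars (\<T>, Y). T \<subseteq> R} = (\<lambda>(T, v). star v T) ` (SIGMA T:\<T>. {v\<in>Y. T \<subseteq> ?nb v})"
          unfolding stars_def using sub by auto
        also have "card \<dots> = card (SIGMA T:\<T>. {v\<in>Y. T \<subseteq> ?nb v})"
          by (rule card_image) (rule inj_on_subset[OF stars_inj[OF j]], auto)
        also have "\<dots> = (\<Sum>T\<in>\<T>. card {v\<in>Y. T \<subseteq> ?nb v})" using f\<T> fY by simp
        also have "\<dots> = (\<Sum>x\<in>S'. card {v\<in>Y. L x \<subseteq> ?nb v})" unfolding \<T>_def by (simp add: sum.reindex[OF inj])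
        finally show ?thesis .
      qed
      have ps: "(\<Sum>T\<in>stars (\<T>, Y). p ^ card T) = real (card Y) * (\<Sum>x\<in>S'. p ^ card (L x))"
      proof -
        have "(\<Sum>T\<in>stars (\<T>, Y). p ^ card T) = (\<Sum>(T, v)\<in>\<T> \<times> Y. p ^ card (star v T))"
          unfolding stars_def using sum.reindex[OF stars_inj[OF j], of "\<lambda>T. p ^ card T"] by (simp add: case_prod_unfold comp_def)
        also have "\<dots> = (\<Sum>(T, v)\<in>\<T> \<times> Y. p ^ card T)"
        proof (rule sum.cong[OF refl], clarify)
          fix T v assume "T \<in> \<T>" "v \<in> Y"
          then have "T \<inter> Y = {}" using j unfolding star_fams_def by auto
          then have "v \<notin> T" using \<open>v \<in> Y\<close> by blast
          then show "p ^ card (star v T) = p ^ card T" by (simp add: card_star)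
        qed
        also have "\<dots> = (\<Sum>T\<in>\<T>. \<Sum>v\<in>Y. p ^ card T)" by (simp only: sum.cartesian_product)
        also have "\<dots> = real (card Y) * (\<Sum>T\<in>\<T>. p ^ card T)" by (simp add: sum_distrib_left)
        also have "(\<Sum>T\<in>\<T>. p ^ card T) = (\<Sum>x\<in>S'. p ^ card (L x))" unfolding \<T>_def by (simp add: sum.reindex[OF inj])
        finally show ?thesis .
      qed
      have split: "(\<Sum>x\<in>S. f x) = (\<Sum>x\<in>S'. f x) + (\<Sum>x\<in>S - S'. f x)" for f :: "nat \<Rightarrow> real"
        using sum.subset_diff[of S' S f] S unfolding S'_def by auto
      have e1: "(\<Sum>x\<in>S - S'. real (card {v\<in>Y. L x \<subseteq> ?nb v})) = real (card (S - S')) * real (card Y)"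
        unfolding S'_def by (simp add: sum.cong)
      have e2: "(\<Sum>x\<in>S - S'. p ^ card (L x)) = real (card (S - S'))"
        unfolding S'_def by simp
      have "real (card {T \<in> stars (\<T>, Y). T \<subseteq> R}) \<le> (1 + \<epsilon> / 2) * (\<Sum>T\<in>stars (\<T>, Y). p ^ card T) + (l' (\<T>, Y) + 1) / (\<epsilon> / 2)"
        using R j unfolding target_def by blast
      then have 1: "(\<Sum>x\<in>S'. real (card {v\<in>Y. L x \<subseteq> ?nb v})) \<le> (1 + \<epsilon> / 2) * (real (card Y) * (\<Sum>x\<in>S'. p ^ card (L x))) + (l' (\<T>, Y) + 1) / (\<epsilon> / 2)"
        unfolding fS ps by simp
      have "(1 + \<epsilon> / 2) * (real (card Y) * (\<Sum>x\<in>S'. p ^ card (L x))) \<le> (1 + \<epsilon>) * (real (card Y) * (\<Sum>x\<in>S'. p ^ card (L x)))"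
        using \<epsilon> p by (intro mult_right_mono mult_nonneg_nonneg sum_nonneg) auto
      moreover have "real (card (S - S')) * real (card Y) \<le> (1 + \<epsilon>) * (real (card Y) * real (card (S - S')))"
        using \<epsilon> mult_right_mono[of 1 "1 + \<epsilon>" "real (card Y) * real (card (S - S'))"] by (simp add: mult.commute)
      moreover have "(l' (\<T>, Y) + 1) / (\<epsilon> / 2) \<le> ?K * (real (card S) + real (card Y)) * ln (real N)"
      proof -
        define z where "z = (real (card S) + real (card Y)) * ln (real N)"
        have "1 * 1 \<le> z" unfolding z_def using cS lnN by (intro mult_mono) auto
        then have z: "z \<ge> 1" by simp
        have "(\<Sum>T\<in>\<T>. real (card T)) = (\<Sum>x\<in>S'. real (card (L x)))" unfolding \<T>_def by (simp add: sum.reindex[OF inj])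
        also have "\<dots> \<le> (\<Sum>x\<in>S'. real \<Delta>)" by (rule sum_mono) (use L in \<open>auto simp: S'_def\<close>)
        also have "\<dots> \<le> real \<Delta> * real (card S)" using S card_mono[of S S'] unfolding S'_def by (simp add: mult_left_mono mult.commute[of _ "real \<Delta>"])
        finally have sT: "(\<Sum>T\<in>\<T>. real (card T)) \<le> real \<Delta> * real (card S)" .
        have "(\<Sum>T\<in>\<T>. real (card T)) + real (card Y) \<le> (real \<Delta> + 1) * (real (card S) + real (card Y))"
        proof -
          have "0 \<le> real \<Delta> * real (card Y)" by simp
          then show ?thesis using sT unfolding distrib_left distrib_right by linarith
        qed
        then have "((\<Sum>T\<in>\<T>. real (card T)) + real (card Y)) * ln (real N) \<le> ((real \<Delta> + 1) * (real (card S) + real (card Y))) * ln (real N)"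
          using lnN by (intro mult_right_mono) auto
        then have "l' (\<T>, Y) \<le> 2 * ((real \<Delta> + 1) * z) + 5" unfolding l'_def z_def by (simp add: algebra_simps)
        moreover have "(real \<Delta> + 1) * z \<ge> 1 * 1" using z by (intro mult_mono) auto
        ultimately have "l' (\<T>, Y) + 1 \<le> 27 * (real \<Delta> + 1) * z" unfolding mult.assoc by linarith
        then have "(l' (\<T>, Y) + 1) / (\<epsilon> / 2) \<le> 27 * (real \<Delta> + 1) * z / (\<epsilon> / 2)"
          using \<epsilon> by (intro divide_right_mono) auto
        then show ?thesis unfolding z_def by (simp add: field_simps)
      qed
      ultimately show ?thesis unfolding split e1 e2 using 1 by (simp add: algebra_simps)
    qed
  qed
  have "maker_wins ?X b (\<lambda>R. \<exists>R'\<subseteq>R. target R')" by (rule maker_wins_target)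
  then show ?thesis
  proof (rule maker_wins_mono)
    fix R assume "\<exists>R'\<subseteq>R. target R'"
    then obtain R' where "R' \<subseteq> R" "target R'" by blast
    then show "\<exists>R'\<subseteq>R. host N (nbr R') (1 / real \<tau>) \<epsilon> (54 * (real \<Delta> + 1) / \<epsilon>) \<Delta>"
      using host[of R'] unfolding p_eq by (intro exI[of _ "R' \<inter> ?X"]) auto
  qed
qed

section \<open>Systems of distinct representatives\<close>

text \<open>The Halmos-Vaughan induction. A proper nonempty subfamily with exactly as many elements
  as members is matched by itself, and the rest keeps Hall's condition after these elements are
  removed. If there is none, every proper nonempty subfamily has an element to spare, and any choice
  for one index is harmless.\<close>

theorem hall:
  assumes "finite I" "\<And>i. i \<in> I \<Longrightarrow> finite (A i)" "\<And>J. J \<subseteq> I \<Longrightarrow> card J \<le> card (\<Union>(A ` J))"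
  shows "\<exists>f. inj_on f I \<and> (\<forall>i\<in>I. f i \<in> A i)"
  using assms
proof (induction "card I" arbitrary: I A rule: less_induct)
  case less
  note fin = less.prems(1) and finA = less.prems(2) and hc = less.prems(3)
  have finU: "finite (\<Union>(A ` J))" if "J \<subseteq> I" for J using that fin finA finite_subset by blast
  show ?case
  proof (cases "I = {}")
    case False
    show ?thesis
    proof (cases "\<exists>J. J \<subset> I \<and> J \<noteq> {} \<and> card J = card (\<Union>(A ` J))")
      case True
      then obtain J where J: "J \<subset> I" "J \<noteq> {}" "card J = card (\<Union>(A ` J))" by blast
      have "card J < card I" using psubset_card_mono[OF fin J(1)] .
      then have "\<exists>f. inj_on f J \<and> (\<forall>i\<in>J. f i \<in> A i)"
        by (rule less.hyps) (use J fin finA hc finite_subset in \<open>auto dest: psubset_imp_subset\<close>)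
      then obtain f where f: "inj_on f J" "\<forall>i\<in>J. f i \<in> A i" by blast
      have "card (I - J) < card I" using J fin by (intro psubset_card_mono) auto
      then have "\<exists>g. inj_on g (I - J) \<and> (\<forall>i\<in>I - J. g i \<in> A i - \<Union>(A ` J))"
      proof (rule less.hyps)
        show "card K \<le> card (\<Union>i\<in>K. A i - \<Union>(A ` J))" if "K \<subseteq> I - J" for K
        proof -
          have "card J + card K = card (J \<union> K)"
            by (rule card_Un_disjoint[symmetric]) (use that J fin in \<open>auto intro: finite_subset\<close>)
          also have "\<dots> \<le> card (\<Union>(A ` (J \<union> K)))" by (rule hc) (use that J in auto)
          also have "\<Union>(A ` (J \<union> K)) = \<Union>(A ` J) \<union> (\<Union>i\<in>K. A i - \<Union>(A ` J))" by auto
          also have "card \<dots> \<le> card (\<Union>(A ` J)) + card (\<Union>i\<in>K. A i - \<Union>(A ` J))" by (rule card_Un_le)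
          finally show ?thesis using J(3) by simp
        qed
      qed (use fin finA in auto)
      then obtain g where g: "inj_on g (I - J)" "\<forall>i\<in>I - J. g i \<in> A i - \<Union>(A ` J)" by blast
      let ?h = "\<lambda>i. if i \<in> J then f i else g i"
      have "inj_on ?h I"
      proof (rule inj_onI)
        fix x y assume xy: "x \<in> I" "y \<in> I" "?h x = ?h y"
        show "x = y"
        proof (cases "x \<in> J \<longleftrightarrow> y \<in> J")
          case True
          then show ?thesis using xy f g by (auto dest: inj_onD split: if_splits)
        next
          case False
          then show ?thesis using xy f g by (metis DiffI DiffD2 UN_I)
        qed
      qed
      then show ?thesis using f g by (intro exI[of _ ?h]) auto
    next
      case nt: False
      obtain i where i: "i \<in> I" using False by blast
      have "card {i} \<le> card (\<Union>(A ` {i}))" by (rule hc) (use i in auto)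
      then have "A i \<noteq> {}" by auto
      then obtain a where a: "a \<in> A i" by blast
      have "card (I - {i}) < card I" using i fin by (meson card_Diff1_less)
      then have "\<exists>f. inj_on f (I - {i}) \<and> (\<forall>j\<in>I - {i}. f j \<in> A j - {a})"
      proof (rule less.hyps)
        show "card K \<le> card (\<Union>j\<in>K. A j - {a})" if K: "K \<subseteq> I - {i}" for K
        proof (cases "K = {}")
          case False
          have "K \<subset> I" using K i by blast
          then have "card K < card (\<Union>(A ` K))" using nt False hc[of K] by (metis le_neq_implies_less psubset_imp_subset)
          also have "card (\<Union>(A ` K)) \<le> card (insert a (\<Union>j\<in>K. A j - {a}))"
            by (rule card_mono) (use finU[of K] \<open>K \<subset> I\<close> in \<open>auto intro: finite_subset[of _ "\<Union>(A ` K)"]\<close>)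
          also have "\<dots> \<le> Suc (card (\<Union>j\<in>K. A j - {a}))" by (rule card_insert_le_m1[THEN le_trans]) (auto intro: card_insert_le_m1 simp: card_insert_if)
          finally show ?thesis by simp
        qed simp
      qed (use fin finA in auto)
      then obtain f where f: "inj_on f (I - {i})" "\<forall>j\<in>I - {i}. f j \<in> A j - {a}" by blast
      have "inj_on (f(i := a)) I"
        using f by (auto simp: inj_on_def)
      then show ?thesis using f a by (intro exI[of _ "f(i := a)"]) auto
    qed
  qed simp
qed

section \<open>Exceptional vertices of a host\<close>

context host
begin

definition "L = ln (real N)"
text \<open>\<open>m\<close> solves \<open>\<epsilon> * p * m = 2 * K * L\<close>: so many
  exceptional vertices cannot be excluded because of the error terms of the host. \<open>M\<close>
  and \<open>M2\<close> are the set sizes from which \<open>m + 1\<close> vertices are negligible,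
  at most a proportion \<open>\<epsilon>\<close> or \<open>\<epsilon> * p\<close> of the set;
  \<open>q\<close> and \<open>r\<close> are the densities then guaranteed to all but
  \<open>m\<close> vertices from below and from above.\<close>

definition "m = 2 * K * L / (\<epsilon> * p)"
definition "M = (m + 1) / \<epsilon>"
definition "M2 = (m + 1) / (\<epsilon> * p)"
definition "q = (1 - 3 * \<epsilon>) * p"
definition "r = (1 + 3 * \<epsilon>) * p"

lemma L_ge_1: "L \<ge> 1"
proof -
  have "ln (real N) \<ge> ln (exp 1)" using N3 exp_1_le_3 by (intro ln_mono) (auto intro: order_trans)
  then show ?thesis unfolding L_def by simp
qed

lemma q: "0 < q" "q \<le> p" "q \<le> 1" "7/10 * p \<le> q"
  using p \<epsilon> mult_mono[of "1 - 3 * \<epsilon>" 1 p 1] unfolding q_def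
  by (auto simp: mult_left_le_one_le intro: mult_right_mono)

lemma m_ge_20: "m \<ge> 20"
proof -
  have "\<epsilon> * p \<le> 1/10 * 1" using p \<epsilon> by (intro mult_mono) auto
  moreover have "K * L \<ge> 1 * 1" using K L_ge_1 by (intro mult_mono) auto
  moreover have "0 < \<epsilon> * p" using p \<epsilon> by simp
  ultimately show ?thesis unfolding m_def by (simp add: pos_le_divide_eq)
qed

lemma m_le_M: "m \<le> \<epsilon> * M" "m \<le> M" "m + 1 \<le> M" "M \<le> M2"
proof -
  have 1: "\<epsilon> * M = m + 1" unfolding M_def using \<epsilon> by simp
  then show "m \<le> \<epsilon> * M" by simp
  show "m + 1 \<le> M" unfolding M_def using \<epsilon> m_ge_20 by (simp add: pos_le_divide_eq mult_left_le)
  then show "m \<le> M" by simp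
  show "M \<le> M2" unfolding M_def M2_def using \<epsilon> p m_ge_20
    by (intro divide_left_mono) (auto simp: mult_left_le)
qed

lemma m_mult: "\<epsilon> * p * m = 2 * K * L"
  unfolding m_def using p \<epsilon> by simp

lemma fin: "finite U" if "U \<subseteq> {..<N}" using that finite_subset by blast

lemma cost_le: "finite U \<Longrightarrow> B \<subseteq> U \<Longrightarrow> 3 \<le> card U \<Longrightarrow> cost B \<le> real (card U)"
  unfolding cost_def by (auto intro: card_mono)

text \<open>Slightly more than \<open>m\<close> bad vertices \<open>A\<close> would send too few
  edges to \<open>U - A\<close>: since \<open>m < a\<close> and \<open>m \<le> u\<close>, the
  deficit \<open>\<epsilon> * p * a * u\<close> is at least the sum of the two error terms
  \<open>K * L * a\<close> and \<open>K * L * u\<close>. The size of \<open>A\<close> is kept at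
  most \<open>m + 1\<close> so that removing it from \<open>U\<close> costs only the proportion
  \<open>\<epsilon>\<close>.\<close>

lemma few_bad:
  assumes U: "U \<subseteq> {..<N}" "real (card U) \<ge> M"
  shows "real (card {v\<in>{..<N}. real (card (nb v \<inter> U)) < q * real (card U)}) \<le> m"
proof (rule ccontr)
  define Bad where "Bad = {v\<in>{..<N}. real (card (nb v \<inter> U)) < q * real (card U)}"
  assume "\<not> ?thesis"
  then have "real (card Bad) > m" unfolding Bad_def by simp
  then have "nat \<lfloor>m\<rfloor> + 1 \<le> card Bad" using m_ge_20 by linarith
  then obtain A where A: "A \<subseteq> Bad" "card A = nat \<lfloor>m\<rfloor> + 1" "finite A"
    using obtain_subset_with_card_n by blast
  define a where "a = real (card A)"
  have a: "m < a" "a \<le> m + 1" unfolding a_def A(2) using m_ge_20 by linarith+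
  define u where "u = real (card U)"
  have mu: "m + 1 \<le> \<epsilon> * u" using U(2) \<epsilon> unfolding M_def u_def by (simp add: pos_divide_le_eq mult.commute)
  have fU: "finite U" using fin U by blast
  have u3: "3 \<le> card U" using U(2) m_le_M m_ge_20 by linarith
  define B where "B = U - A"
  have "real (card U) \<le> real (card B) + a"
    unfolding B_def a_def using diff_card_le_card_Diff[OF A(3), of U] by linarith
  then have B: "real (card B) \<ge> (1 - \<epsilon>) * u" using a mu unfolding u_def by (simp add: algebra_simps)
  have AN: "A \<subseteq> {..<N}" using A unfolding Bad_def by auto
  have "(1 - \<epsilon>) * p * a * real (card B) - K * (a + cost B) * L \<le> (\<Sum>a\<in>A. real (card (nb a \<inter> B)))"
    unfolding a_def L_def by (rule many_edges) (use AN U in \<open>auto simp: B_def\<close>)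
  also have "\<dots> < (\<Sum>a\<in>A. q * u)"
  proof (rule sum_strict_mono)
    show "A \<noteq> {}" using A(2) by auto
    show "real (card (nb v \<inter> B)) < q * u" if "v \<in> A" for v
    proof -
      have "card (nb v \<inter> B) \<le> card (nb v \<inter> U)" by (rule card_mono) (use fU in \<open>auto simp: B_def\<close>)
      moreover have "real (card (nb v \<inter> U)) < q * u" using that A unfolding Bad_def u_def by blast
      ultimately show ?thesis by linarith
    qed
  qed (use A in simp)
  also have "\<dots> = a * (q * u)" unfolding a_def by simp
  finally have 1: "(1 - \<epsilon>) * p * a * real (card B) - K * (a + cost B) * L < a * (q * u)" .
  have "(1 - \<epsilon>) * p * a * ((1 - \<epsilon>) * u) \<le> (1 - \<epsilon>) * p * a * real (card B)"
    using B \<epsilon> p a m_ge_20 by (intro mult_left_mono) auto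
  moreover have "(1 - 2 * \<epsilon>) * (p * a * u) \<le> (1 - \<epsilon>) * (1 - \<epsilon>) * (p * a * u)"
    using a p m_ge_20 by (intro mult_right_mono) (auto simp: u_def algebra_simps)
  moreover have "K * (a + cost B) * L \<le> K * (a + u) * L"
    unfolding u_def using cost_le[OF fU _ u3, of B] K L_ge_1 by (intro mult_right_mono mult_left_mono) (auto simp: B_def)
  ultimately have "(1 - 2 * \<epsilon>) * (p * a * u) - K * (a + u) * L < (1 - 3 * \<epsilon>) * (p * a * u)"
    using 1 unfolding q_def by (simp add: algebra_simps)
  then have 2: "\<epsilon> * p * a * u < K * L * a + K * L * u" by (simp add: algebra_simps)
  have "\<epsilon> * p * m * u \<le> \<epsilon> * p * a * u" using a p \<epsilon> unfolding u_def by (intro mult_right_mono mult_left_mono) auto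
  moreover have "\<epsilon> * p * m * a \<le> \<epsilon> * p * u * a"
  proof -
    have "m \<le> u" using mu \<epsilon> U(2) m_le_M unfolding u_def by linarith
    then show ?thesis using a p \<epsilon> m_ge_20 by (intro mult_right_mono mult_left_mono) auto
  qed
  ultimately show False using 2 unfolding m_mult by (simp add: algebra_simps)
qed

text \<open>The mirror image of \<open>few_bad\<close>, with stars of a single leaf counting the
  edges. A vertex may have all of \<open>A\<close> among its neighbours, so \<open>m + 1\<close> has
  to be small against \<open>p * u\<close> and not only against \<open>u\<close>; this explains
  \<open>M2\<close>.\<close>

lemma few_over:
  assumes U: "U \<subseteq> {..<N}" "real (card U) \<ge> M2" and \<Delta>: "\<Delta> \<ge> 1"
  shows "real (card {v\<in>{..<N}. real (card (nb v \<inter> U)) > r * real (card U)}) \<le> m"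
proof (rule ccontr)
  define Bad where "Bad = {v\<in>{..<N}. real (card (nb v \<inter> U)) > r * real (card U)}"
  assume "\<not> ?thesis"
  then have "real (card Bad) > m" unfolding Bad_def by simp
  then have "nat \<lfloor>m\<rfloor> + 1 \<le> card Bad" using m_ge_20 by linarith
  then obtain A where A: "A \<subseteq> Bad" "card A = nat \<lfloor>m\<rfloor> + 1" "finite A"
    using obtain_subset_with_card_n by blast
  define a where "a = real (card A)"
  have a: "m < a" "a \<le> m + 1" unfolding a_def A(2) using m_ge_20 by linarith+
  define u where "u = real (card U)"
  have "0 < \<epsilon> * p" using p \<epsilon> by simp
  then have mu: "m + 1 \<le> \<epsilon> * p * u" using U(2) unfolding M2_def u_def by (simp add: pos_divide_le_eq mult.commute)
  have fU: "finite U" using fin U by blast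
  define Y where "Y = U - A"
  have Yu: "real (card Y) \<le> u" unfolding Y_def u_def using fU by (simp add: card_mono)
  have AN: "A \<subseteq> {..<N}" using A unfolding Bad_def by auto
  have "a * ((1 + 2 * \<epsilon>) * p * u) = (\<Sum>x\<in>A. (1 + 2 * \<epsilon>) * p * u)" unfolding a_def by simp
  also have "\<dots> \<le> (\<Sum>x\<in>A. real (card {v\<in>Y. {x} \<subseteq> nb v}))"
  proof (rule sum_mono)
    fix x assume x: "x \<in> A"
    have "nb x \<inter> U \<subseteq> {v\<in>Y. {x} \<subseteq> nb v} \<union> A" using nb_sym unfolding Y_def by auto
    then have "card (nb x \<inter> U) \<le> card ({v\<in>Y. {x} \<subseteq> nb v} \<union> A)"
      by (rule card_mono[rotated]) (use A fU in \<open>auto simp: Y_def\<close>)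
    also have "\<dots> \<le> card {v\<in>Y. {x} \<subseteq> nb v} + card A" by (rule card_Un_le)
    finally have "real (card (nb x \<inter> U)) \<le> real (card {v\<in>Y. {x} \<subseteq> nb v}) + a" unfolding a_def by linarith
    moreover have "real (card (nb x \<inter> U)) > r * u" using x A unfolding Bad_def u_def by blast
    ultimately show "(1 + 2 * \<epsilon>) * p * u \<le> real (card {v\<in>Y. {x} \<subseteq> nb v})"
      using a mu unfolding r_def by (simp add: algebra_simps)
  qed
  also have "\<dots> \<le> (1 + \<epsilon>) * real (card Y) * (\<Sum>x\<in>A. p ^ card {x}) + K * (real (card A) + real (card Y)) * ln (real N)"
    by (rule few_stars) (use A AN U \<Delta> in \<open>auto simp: Y_def\<close>)
  also have "\<dots> = (1 + \<epsilon>) * real (card Y) * (a * p) + K * (a + real (card Y)) * L" unfolding a_def L_def by simp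
  also have "\<dots> \<le> (1 + \<epsilon>) * u * (a * p) + K * (a + u) * L"
    using Yu \<epsilon> p K L_ge_1 unfolding a_def by (intro add_mono mult_right_mono mult_left_mono) auto
  finally have 2: "\<epsilon> * p * a * u \<le> K * L * a + K * L * u" by (simp add: algebra_simps)
  have "m \<le> u" using U(2) m_le_M unfolding u_def by linarith
  then have "\<epsilon> * p * m * a \<le> \<epsilon> * p * u * a"
    using a p \<epsilon> m_ge_20 by (intro mult_right_mono mult_left_mono) auto
  moreover have "\<epsilon> * p * m * u < \<epsilon> * p * a * u"
    using a p \<epsilon> m_ge_20 \<open>m \<le> u\<close> by (intro mult_strict_right_mono mult_strict_left_mono) auto
  ultimately show False using 2 unfolding m_mult by (simp add: algebra_simps)
qed

text \<open>For an interval the flat cost allows the choice \<open>A = {v}\<close>, so no vertex is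
  exceptional; the spanning embedding relies on this. If \<open>v\<close> lies inside, the interval
  is split at \<open>v\<close>, and two errors \<open>4 * K * L\<close> together with the lost
  vertex give the 9.\<close>

lemma interval_degree:
  assumes "{i..<j} \<subseteq> {..<N}" "v < N" and big: "9 * K * L \<le> \<epsilon> * p * real (j - i)"
  shows "real (card (nb v \<inter> {i..<j})) \<ge> q * real (j - i)"
proof -
  have iv: "real (card (nb v \<inter> {i'..<j'})) \<ge> (1 - \<epsilon>) * p * real (j' - i') - 4 * K * L"
    if "{i'..<j'} \<subseteq> {..<N}" "v \<notin> {i'..<j'}" for i' j'
  proof -
    have "cost {i'..<j'} = 3" unfolding cost_def by auto
    then show ?thesis
      using many_edges[of "{v}" "{i'..<j'}"] that assms(2) by (simp add: L_def algebra_simps)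
  qed
  have KL: "K * L \<ge> 1 * 1" using K L_ge_1 by (intro mult_mono) auto
  define w where "w = real (j - i)"
  show ?thesis
  proof (cases "v \<in> {i..<j}")
    case False
    have "real (card (nb v \<inter> {i..<j})) \<ge> (1 - \<epsilon>) * p * real (j - i) - 4 * K * L" by (rule iv) (use assms False in auto)
    moreover have "0 \<le> \<epsilon> * p * w" using \<epsilon> p unfolding w_def by simp
    ultimately show ?thesis using big KL unfolding q_def w_def[symmetric] by (simp add: algebra_simps)
  next
    case True
    have "j - 1 \<in> {i..<j}" using True by auto
    then have "j - 1 < N" using assms(1) by blast
    then have "j \<le> N" by simp
    then have sub: "{i..<v} \<subseteq> {..<N}" "{Suc v..<j} \<subseteq> {..<N}" using True by auto
    have "{i..<j} = insert v ({i..<v} \<union> {Suc v..<j})" using True by auto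
    then have "nb v \<inter> {i..<j} = (nb v \<inter> {i..<v}) \<union> (nb v \<inter> {Suc v..<j})"
      using nb_irrefl[of v] by auto
    then have "card (nb v \<inter> {i..<j}) = card ((nb v \<inter> {i..<v}) \<union> (nb v \<inter> {Suc v..<j}))" by simp
    also have "\<dots> = card (nb v \<inter> {i..<v}) + card (nb v \<inter> {Suc v..<j})"
      by (rule card_Un_disjoint) auto
    finally have "real (card (nb v \<inter> {i..<j})) \<ge> (1 - \<epsilon>) * p * real (v - i) + (1 - \<epsilon>) * p * real (j - Suc v) - 8 * K * L"
      using iv[OF sub(1)] iv[OF sub(2)] by simp
    moreover have "real (j - i) = real (v - i) + real (j - Suc v) + 1" using True by auto
    moreover have "(1 - \<epsilon>) * p \<le> 1 * 1" using \<epsilon> p by (intro mult_mono) auto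
    ultimately have "real (card (nb v \<inter> {i..<j})) \<ge> (1 - \<epsilon>) * p * w - 9 * K * L"
      using KL unfolding w_def[symmetric] by (simp add: algebra_simps)
    moreover have "0 \<le> \<epsilon> * p * w" using \<epsilon> p unfolding w_def by simp
    ultimately show ?thesis using big unfolding q_def w_def[symmetric] by (simp add: algebra_simps)
  qed
qed

end

section \<open>Partial embeddings\<close>

locale embedding = host +
  fixes n :: nat and hn :: "nat \<Rightarrow> nat set"
  assumes \<Delta>1: "\<Delta> \<ge> 1"
    and hn_sub: "x < n \<Longrightarrow> hn x \<subseteq> {..<n}" and hn_sym: "x < n \<Longrightarrow> y \<in> hn x \<Longrightarrow> x \<in> hn y"
    and hn_irrefl: "x \<notin> hn x" and hn_deg: "x < n \<Longrightarrow> card (hn x) \<le> \<Delta>"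
begin

definition cand :: "(nat \<Rightarrow> nat) \<Rightarrow> nat set \<Rightarrow> nat \<Rightarrow> nat set \<Rightarrow> nat set" where
  "cand f D y V = {v\<in>V. \<forall>z\<in>hn y \<inter> D. v \<in> nb (f z)}"

definition partial :: "(nat \<Rightarrow> nat) \<Rightarrow> nat set \<Rightarrow> bool" where
  "partial f D \<longleftrightarrow> D \<subseteq> {..<n} \<and> inj_on f D \<and> f ` D \<subseteq> {..<N} \<and> (\<forall>x\<in>D. \<forall>y\<in>hn x \<inter> D. f y \<in> nb (f x))"

definition tracked :: "(nat \<Rightarrow> nat) \<Rightarrow> nat set \<Rightarrow> nat \<Rightarrow> nat set \<Rightarrow> bool" where
  "tracked f D y V \<longleftrightarrow> q ^ card (hn y \<inter> D) * real (card V) \<le> real (card (cand f D y V))"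

lemma fin_hn: "x < n \<Longrightarrow> finite (hn x)"
  using hn_sub finite_subset by blast

lemma card_hn_less:
  assumes "y < n" "x \<in> hn y" "x \<notin> D"
  shows "card (hn y \<inter> D) < card (hn y)"
  by (rule psubset_card_mono) (use assms fin_hn in auto)

lemma q_power_le: "i \<le> j \<Longrightarrow> q ^ j \<le> q ^ i"
  using q by (intro power_decreasing) auto

lemma q_p_power: "j \<le> \<Delta> \<Longrightarrow> (1 - 3 * \<epsilon>) ^ \<Delta> * p ^ j \<le> q ^ j"
  unfolding q_def power_mult_distrib using \<epsilon> p by (intro mult_right_mono power_decreasing) auto

lemma few_choices_lost:
  assumes "finite Ys" "\<And>y. y \<in> Ys \<Longrightarrow> U y \<subseteq> {..<N} \<and> real (card (U y)) \<ge> M"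
  shows "real (card {v\<in>{..<N}. \<exists>y\<in>Ys. real (card (nb v \<inter> U y)) < q * real (card (U y))}) \<le> real (card Ys) * m"
proof -
  have "{v\<in>{..<N}. \<exists>y\<in>Ys. real (card (nb v \<inter> U y)) < q * real (card (U y))}
     = (\<Union>y\<in>Ys. {v\<in>{..<N}. real (card (nb v \<inter> U y)) < q * real (card (U y))})" by auto
  also have "card \<dots> \<le> (\<Sum>y\<in>Ys. card {v\<in>{..<N}. real (card (nb v \<inter> U y)) < q * real (card (U y))})"
    by (rule card_UN_le) (rule assms)
  finally have "real (card {v\<in>{..<N}. \<exists>y\<in>Ys. real (card (nb v \<inter> U y)) < q * real (card (U y))})
     \<le> (\<Sum>y\<in>Ys. real (card {v\<in>{..<N}. real (card (nb v \<inter> U y)) < q * real (card (U y))}))"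
    by (simp flip: of_nat_sum)
  also have "\<dots> \<le> (\<Sum>y\<in>Ys. m)" by (intro sum_mono few_bad) (use assms in auto)
  finally show ?thesis by simp
qed

text \<open>A violating set \<open>J\<close> with image \<open>Y\<close> is refuted by counting the
  pairs of \<open>x \<in> J\<close> and an admissible \<open>v \<in> Y\<close> twice: a vertex
  \<open>x\<close> with \<open>k\<close> embedded neighbours has about \<open>q ^ k * card V\<close>
  choices by tracking, but on average at most about \<open>p ^ k * card Y\<close> by
  \<open>few_stars\<close>, so \<open>Y\<close> would be as large as \<open>W\<close>. No two
  vertices of \<open>W\<close> have a common neighbour, so the leaf sets are disjoint and each later
  vertex loses only one factor \<open>q\<close>.\<close>

lemma hall_step:
  assumes f: "partial f D" and tr: "\<And>y. y < n \<Longrightarrow> y \<notin> D \<Longrightarrow> tracked f D y (Reg y)"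
    and W: "W \<subseteq> {..<n} - D" "\<And>x. x \<in> W \<Longrightarrow> Reg x = V"
    and V: "V \<subseteq> {..<N}" "V \<inter> f ` D = {}"
    and indep: "\<And>x y. x \<in> W \<Longrightarrow> y \<in> W \<Longrightarrow> y \<notin> hn x" "\<And>x y. x \<in> W \<Longrightarrow> y \<in> W \<Longrightarrow> x \<noteq> y \<Longrightarrow> hn x \<inter> hn y = {}"
    and reg: "\<And>y. y < n \<Longrightarrow> y \<notin> D \<Longrightarrow> hn y \<inter> W \<noteq> {} \<Longrightarrow> Reg y \<subseteq> {..<N} \<and> r0 \<le> real (card (Reg y))"
    and r0: "r0 \<le> real (card V)" "real \<Delta> * M \<le> q ^ (\<Delta> - 1) * r0"
    and size: "(1 + \<epsilon>) * real (card W) \<le> ((1 - \<epsilon>) * (1 - 3 * \<epsilon>) ^ \<Delta> - \<epsilon>) * real (card V)"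
  shows "\<exists>g. partial g (D \<union> W) \<and> (\<forall>x\<in>D. g x = f x) \<and> g ` W \<subseteq> V \<and>
    (\<forall>y<n. y \<notin> D \<union> W \<longrightarrow> tracked g (D \<union> W) y (Reg y))"
proof (cases "W = {}")
  case True
  then show ?thesis using f tr by auto
next
  case W_ne: False
  define later where "later x = hn x - D" for x
  \<comment> \<open>The images of \<open>x\<close> that keep all its unembedded neighbours tracked.
    Each such neighbour excludes at most \<open>m\<close> images, a small part of the candidate
    set.\<close>
  define ok where "ok x = {v\<in>cand f D x V. \<forall>y\<in>later x. q * real (card (cand f D y (Reg y))) \<le> real (card (nb v \<inter> cand f D y (Reg y)))}" for x
  have fD: "D \<subseteq> {..<n}" "inj_on f D" "f ` D \<subseteq> {..<N}" using f unfolding partial_def by auto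
  have Mpos: "M > 0" using m_le_M m_ge_20 by linarith
  have r0pos: "r0 > 0"
  proof -
    have "real \<Delta> * M > 0" using Mpos \<Delta>1 by simp
    then have "q ^ (\<Delta> - 1) * r0 > 0" using r0 by linarith
    then show ?thesis using q by (simp add: zero_less_mult_iff)
  qed
  have Wn: "x < n" "x \<notin> D" if "x \<in> W" for x using that W by auto
  have cand_big: "q ^ j * r0 \<ge> real \<Delta> * M" if "j \<le> \<Delta> - 1" for j
    using mult_right_mono[OF q_power_le[OF that], of r0] r0 r0pos by linarith
  have cV: "q ^ card (hn x \<inter> D) * real (card V) \<le> real (card (cand f D x V))" if "x \<in> W" for x
    using tr[of x] Wn[OF that] W(2)[OF that] unfolding tracked_def by simp
  have ok_size: "(1 - \<epsilon>) * (q ^ card (hn x \<inter> D) * real (card V)) \<le> real (card (ok x))" if x: "x \<in> W" for x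
  proof (cases "later x = {}")
    case True
    then have "ok x = cand f D x V" unfolding ok_def by simp
    then have "q ^ card (hn x \<inter> D) * real (card V) \<le> real (card (ok x))" using cV[OF x] by simp
    moreover have "(1 - \<epsilon>) * (q ^ card (hn x \<inter> D) * real (card V)) \<le> 1 * (q ^ card (hn x \<inter> D) * real (card V))"
      using \<epsilon> q by (intro mult_right_mono) auto
    ultimately show ?thesis by linarith
  next
    case False
    have xn: "x < n" "x \<notin> D" using Wn x by auto
    have later_sub: "later x \<subseteq> hn x" "finite (later x)" using fin_hn[OF xn(1)] unfolding later_def by auto
    have "card (later x) \<le> \<Delta>" using card_mono[OF fin_hn[OF xn(1)] later_sub(1)] hn_deg[OF xn(1)] by linarith
    define U where "U y = cand f D y (Reg y)" for y
    have U: "U y \<subseteq> {..<N} \<and> M \<le> real (card (U y))" if "y \<in> later x" for y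
    proof -
      have y: "y < n" "y \<notin> D" "x \<in> hn y" using that hn_sub[OF xn(1)] hn_sym[OF xn(1)] unfolding later_def by auto
      have ry: "Reg y \<subseteq> {..<N}" "r0 \<le> real (card (Reg y))" using reg[of y] y x by auto
      have "card (hn y \<inter> D) \<le> \<Delta> - 1" using card_hn_less[OF y(1,3) xn(2)] hn_deg[OF y(1)] by linarith
      have "M \<le> real \<Delta> * M" using Mpos \<Delta>1 by simp
      also have "\<dots> \<le> q ^ card (hn y \<inter> D) * r0" by (rule cand_big) fact
      also have "\<dots> \<le> q ^ card (hn y \<inter> D) * real (card (Reg y))" using ry q by (intro mult_left_mono) auto
      also have "\<dots> \<le> real (card (U y))" using tr[OF y(1,2)] unfolding tracked_def U_def .
      finally show ?thesis using ry unfolding U_def cand_def by auto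
    qed
    have "cand f D x V \<subseteq> ok x \<union> {v\<in>{..<N}. \<exists>y\<in>later x. real (card (nb v \<inter> U y)) < q * real (card (U y))}"
      unfolding ok_def U_def using V by (auto simp: cand_def not_less)
    then have "card (cand f D x V) \<le> card (ok x \<union> {v\<in>{..<N}. \<exists>y\<in>later x. real (card (nb v \<inter> U y)) < q * real (card (U y))})"
      by (rule card_mono[rotated]) (use fin[OF V(1)] in \<open>auto simp: ok_def cand_def\<close>)
    also have "\<dots> \<le> card (ok x) + card {v\<in>{..<N}. \<exists>y\<in>later x. real (card (nb v \<inter> U y)) < q * real (card (U y))}"
      by (rule card_Un_le)
    finally have "real (card (cand f D x V)) \<le> real (card (ok x)) + real (card (later x)) * m"
      using few_choices_lost[OF later_sub(2), of U] U by fastforce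
    also have "real (card (later x)) * m \<le> real \<Delta> * (\<epsilon> * M)"
      using \<open>card (later x) \<le> \<Delta>\<close> m_le_M m_ge_20 by (intro mult_mono) auto
    also have "\<dots> \<le> \<epsilon> * (q ^ card (hn x \<inter> D) * real (card V))"
    proof -
      obtain y where y: "y \<in> hn x" "y \<notin> D" using False unfolding later_def by blast
      have "card (hn x \<inter> D) \<le> \<Delta> - 1" using card_hn_less[OF xn(1) y] hn_deg[OF xn(1)] by linarith
      then have "real \<Delta> * M \<le> q ^ card (hn x \<inter> D) * r0" by (rule cand_big)
      also have "\<dots> \<le> q ^ card (hn x \<inter> D) * real (card V)" using r0 q by (intro mult_left_mono) auto
      finally show ?thesis using \<epsilon> by (simp add: mult.left_commute[of \<epsilon>] mult_left_mono)
    qed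
    finally show ?thesis using cV[OF x] by (simp add: algebra_simps)
  qed
  have finok: "finite (ok x)" for x unfolding ok_def cand_def using fin[OF V(1)] by simp
  have "\<exists>h. inj_on h W \<and> (\<forall>x\<in>W. h x \<in> ok x)"
  proof (rule hall)
    show finW: "finite W" using W(1) finite_subset by blast
    show "finite (ok x)" for x by (rule finok)
    show "card J \<le> card (\<Union>(ok ` J))" if J: "J \<subseteq> W" for J
    proof (rule ccontr)
      define Y where "Y = \<Union>(ok ` J)"
      assume "\<not> ?thesis"
      then have YJ: "card Y < card J" unfolding Y_def by simp
      have finJ: "finite J" using J finW finite_subset by blast
      have YV: "Y \<subseteq> V" unfolding Y_def ok_def cand_def by auto
      define s where "s = (\<Sum>x\<in>J. p ^ card (hn x \<inter> D))"
      have k: "card (hn x \<inter> D) \<le> \<Delta>" if "x \<in> J" for x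
        using that J Wn hn_deg[of x] card_mono[OF fin_hn[of x], of "hn x \<inter> D"] by (meson Int_lower1 le_trans subsetD)
      have ci: "card (f ` (hn x \<inter> D)) = card (hn x \<inter> D)" for x
        by (rule card_image) (rule inj_on_subset[OF fD(2)], simp)
      have "(\<Sum>x\<in>J. real (card (ok x))) \<le> (\<Sum>x\<in>J. real (card {v\<in>Y. f ` (hn x \<inter> D) \<subseteq> nb v}))"
      proof (intro sum_mono of_nat_mono card_mono)
        fix x assume x: "x \<in> J"
        show "finite {v\<in>Y. f ` (hn x \<inter> D) \<subseteq> nb v}" using finite_subset[OF YV fin[OF V(1)]] by simp
        show "ok x \<subseteq> {v\<in>Y. f ` (hn x \<inter> D) \<subseteq> nb v}"
          using x nb_sym unfolding Y_def ok_def cand_def by fastforce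
      qed
      also have "\<dots> \<le> (1 + \<epsilon>) * real (card Y) * (\<Sum>x\<in>J. p ^ card (f ` (hn x \<inter> D))) + K * (real (card J) + real (card Y)) * ln (real N)"
      proof (rule few_stars)
        show "f ` (hn x \<inter> D) \<subseteq> {..<N} \<and> card (f ` (hn x \<inter> D)) \<le> \<Delta> \<and> f ` (hn x \<inter> D) \<inter> Y = {}" if "x \<in> J" for x
          using fD k[OF that] YV V(2) unfolding ci by blast
        show "f ` (hn x \<inter> D) \<inter> f ` (hn y \<inter> D) = {}" if "x \<in> J" "y \<in> J" "x \<noteq> y" for x y
          using indep(2)[of x y] that J fD(2) by (auto simp: inj_on_def)
      qed (use finJ YV V in auto)
      also have "\<dots> \<le> (1 + \<epsilon>) * real (card Y) * s + \<epsilon> * s * real (card V)"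
      proof -
        have "K * (real (card J) + real (card Y)) * ln (real N) \<le> 2 * K * L * real (card J)"
          unfolding L_def[symmetric] using YJ K L_ge_1 by simp
        also have "\<dots> = (\<Sum>x\<in>J. 2 * K * L)" by simp
        \<comment> \<open>The logarithmic error of each \<open>x\<close> is charged to its own main
          term, which is smallest when \<open>x\<close> has \<open>\<Delta>\<close> embedded
          neighbours; here \<open>p ^ \<Delta>\<close> times the region size has to dominate log
          N.\<close>
        also have "\<dots> \<le> (\<Sum>x\<in>J. \<epsilon> * (p ^ card (hn x \<inter> D) * real (card V)))"
        proof (rule sum_mono)
          fix x assume x: "x \<in> J"
          have "2 * K * L = \<epsilon> * (p * m)" using m_mult by simp
          also have "\<dots> \<le> \<epsilon> * (p * (p ^ (\<Delta> - 1) * r0))"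
          proof (intro mult_left_mono)
            have "1 * M \<le> real \<Delta> * M" using Mpos \<Delta>1 by (intro mult_right_mono) auto
            then have "m \<le> real \<Delta> * M" using m_le_M(2) by linarith
            also have "\<dots> \<le> q ^ (\<Delta> - 1) * r0" by (rule r0)
            also have "\<dots> \<le> p ^ (\<Delta> - 1) * r0" using q r0pos by (intro mult_right_mono power_mono) auto
            finally show "m \<le> p ^ (\<Delta> - 1) * r0" .
          qed (use \<epsilon> p in auto)
          also have "\<dots> = \<epsilon> * (p ^ \<Delta> * r0)" using \<Delta>1 by (cases \<Delta>) auto
          also have "\<dots> \<le> \<epsilon> * (p ^ card (hn x \<inter> D) * real (card V))"
            using \<epsilon> p r0 r0pos k[OF x] by (intro mult_left_mono mult_mono power_decreasing) auto
          finally show "2 * K * L \<le> \<epsilon> * (p ^ card (hn x \<inter> D) * real (card V))" .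
        qed
        also have "\<dots> = \<epsilon> * s * real (card V)" unfolding s_def by (simp add: sum_distrib_left sum_distrib_right mult_ac)
        finally show ?thesis unfolding ci s_def by simp
      qed
      finally have up: "(\<Sum>x\<in>J. real (card (ok x))) \<le> (1 + \<epsilon>) * real (card Y) * s + \<epsilon> * s * real (card V)" .
      have "(1 - \<epsilon>) * (1 - 3 * \<epsilon>) ^ \<Delta> * s * real (card V) = (\<Sum>x\<in>J. (1 - \<epsilon>) * ((1 - 3 * \<epsilon>) ^ \<Delta> * p ^ card (hn x \<inter> D) * real (card V)))"
        unfolding s_def by (simp add: sum_distrib_left sum_distrib_right mult_ac)
      also have "\<dots> \<le> (\<Sum>x\<in>J. (1 - \<epsilon>) * (q ^ card (hn x \<inter> D) * real (card V)))"
        using \<epsilon> k by (intro sum_mono mult_left_mono mult_right_mono q_p_power) auto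
      also have "\<dots> \<le> (\<Sum>x\<in>J. real (card (ok x)))" by (intro sum_mono ok_size) (use J in auto)
      finally have "((1 - \<epsilon>) * (1 - 3 * \<epsilon>) ^ \<Delta> - \<epsilon>) * real (card V) * s \<le> (1 + \<epsilon>) * real (card Y) * s"
        using up by (simp add: algebra_simps)
      moreover have "s > 0" unfolding s_def
      proof (rule sum_pos)
        show "J \<noteq> {}" using YJ by auto
      qed (use finJ p in auto)
      ultimately have "((1 - \<epsilon>) * (1 - 3 * \<epsilon>) ^ \<Delta> - \<epsilon>) * real (card V) \<le> (1 + \<epsilon>) * real (card Y)" by simp
      then have "(1 + \<epsilon>) * real (card W) \<le> (1 + \<epsilon>) * real (card Y)" using size by linarith
      then have "card W \<le> card Y" using \<epsilon> by simp
      moreover have "card J \<le> card W" using J finW card_mono by blast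
      ultimately show False using YJ by simp
    qed
  qed
  then obtain h where h: "inj_on h W" "\<And>x. x \<in> W \<Longrightarrow> h x \<in> ok x" by blast
  define g where "g x = (if x \<in> W then h x else f x)" for x
  have gD: "g x = f x" if "x \<in> D" for x using that W unfolding g_def by auto
  have gW: "g x \<in> ok x" if "x \<in> W" for x using that h unfolding g_def by simp
  have okV: "ok x \<subseteq> V" for x unfolding ok_def cand_def by auto
  have gWV: "g ` W \<subseteq> V" using gW okV by blast
  have edge: "g y \<in> nb (g x)" if "x \<in> W" "y \<in> hn x \<inter> D" for x y
    using gW[OF that(1)] that(2) gD nb_sym unfolding ok_def cand_def by force
  have "partial g (D \<union> W)"
    unfolding partial_def
  proof (intro conjI ballI)
    show "D \<union> W \<subseteq> {..<n}" using fD W by auto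
    have "inj_on g D" using fD gD by (simp add: inj_on_def)
    moreover have "inj_on g W" using h unfolding g_def inj_on_def by simp
    moreover have "g ` D \<inter> g ` W = {}" using gWV V(2) gD by force
    ultimately show "inj_on g (D \<union> W)" by (auto simp: inj_on_Un)
    show "g ` (D \<union> W) \<subseteq> {..<N}" using gWV V fD gD by auto
    fix x y assume xy: "x \<in> D \<union> W" "y \<in> hn x \<inter> (D \<union> W)"
    show "g y \<in> nb (g x)"
    proof (cases "x \<in> W")
      case True
      then have "y \<notin> W" using indep(1) xy by blast
      then show ?thesis using edge[OF True] xy by blast
    next
      case False
      then have xD: "x \<in> D" using xy by blast
      show ?thesis
      proof (cases "y \<in> W")
        case True
        have "x \<in> hn y" using hn_sym xy xD fD by blast
        then show ?thesis using edge[OF True] xD nb_sym by blast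
      next
        case False
        then have "y \<in> D" using xy by blast
        then show ?thesis using f xD xy gD unfolding partial_def by auto
      qed
    qed
  qed
  moreover have "tracked g (D \<union> W) y (Reg y)" if y: "y < n" "y \<notin> D \<union> W" for y
  proof (cases "hn y \<inter> W = {}")
    case True
    then have "hn y \<inter> (D \<union> W) = hn y \<inter> D" by blast
    then have "cand g (D \<union> W) y (Reg y) = cand f D y (Reg y)" unfolding cand_def using gD by auto
    then show ?thesis using tr[of y] y \<open>hn y \<inter> (D \<union> W) = hn y \<inter> D\<close> unfolding tracked_def by simp
  next
    case False
    then obtain x where x: "x \<in> hn y" "x \<in> W" by blast
    have yx: "y \<in> hn x" using hn_sym y x by blast
    \<comment> \<open>Two neighbours of \<open>y\<close> in \<open>W\<close> would have
      \<open>y\<close> as a common neighbour, so exactly one factor \<open>q\<close> is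
      lost.\<close>
    have "x' = x" if "x' \<in> hn y \<inter> W" for x'
      using indep(2)[of x x'] x that yx hn_sym[OF y(1), of x'] by blast
    then have eq: "hn y \<inter> (D \<union> W) = insert x (hn y \<inter> D)" using x by blast
    have xD: "x \<notin> D" using x W by blast
    have c1: "card (hn y \<inter> (D \<union> W)) = Suc (card (hn y \<inter> D))"
      unfolding eq using xD fin_hn[OF y(1)] by simp
    have c2: "cand g (D \<union> W) y (Reg y) = nb (g x) \<inter> cand f D y (Reg y)"
      unfolding cand_def eq using gD by auto
    have "y \<in> later x" using yx y unfolding later_def by simp
    then have "q * real (card (cand f D y (Reg y))) \<le> real (card (nb (g x) \<inter> cand f D y (Reg y)))"
      using gW[OF x(2)] unfolding ok_def by blast
    moreover have "q * (q ^ card (hn y \<inter> D) * real (card (Reg y))) \<le> q * real (card (cand f D y (Reg y)))"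
      using tr[of y] y q unfolding tracked_def by (intro mult_left_mono) auto
    ultimately show ?thesis unfolding tracked_def c1 c2 by (simp add: mult.assoc)
  qed
  ultimately show ?thesis using gD gWV by (intro exI[of _ g]) auto
qed

end

section \<open>Greedy embedding along an order of small back-degree\<close>

locale greedy = embedding +
  fixes l :: nat and V :: "nat set" and Reg :: "nat \<Rightarrow> nat set" and D d' :: nat and \<sigma> \<Gamma> :: real
    and \<chi> :: "nat \<Rightarrow> nat" and cN :: nat
  assumes l_le: "l \<le> n" and V: "V \<subseteq> {..<N}" and Reg_V: "y < l \<Longrightarrow> Reg y = V"
    and back_deg: "x < l \<Longrightarrow> card (hn x \<inter> {..<x}) \<le> D" and D: "D \<le> d'" "1 \<le> d'"
    and \<sigma>: "0 < \<sigma>" "\<sigma> \<le> 1" and l_size: "real l \<le> (1 - \<sigma>) * real (card V)"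
    and Reg: "\<And>y. l \<le> y \<Longrightarrow> y < n \<Longrightarrow> hn y \<inter> {..<l} \<noteq> {} \<Longrightarrow>
       Reg y \<subseteq> {..<N} \<and> M \<le> q ^ (card (hn y \<inter> {..<l}) - 1) * real (card (Reg y))"
    and big: "\<Gamma> * (K * L) \<le> q ^ (D + d') * real (card V)"
    and \<Gamma>1: "8 * real \<Delta> \<le> \<Gamma> * (\<epsilon>^2 * \<sigma>)"
    and \<epsilon>_small: "1 + \<epsilon> \<le> (1 + \<sigma> / 64) * ((1 - \<epsilon>) * (1 - 3 * \<epsilon>) ^ D)"
    and \<chi>: "\<And>x y. x < l \<Longrightarrow> y < l \<Longrightarrow> x \<noteq> y \<Longrightarrow> \<chi> x = \<chi> y \<Longrightarrow> hn x \<inter> hn y = {}" "\<And>x. x < l \<Longrightarrow> \<chi> x < cN"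
begin

definition "\<nu> = real (card V)"
definition "bd t = card (hn t \<inter> {..<t})"
definition "cd f t y = cand f {..<t} y (Reg y)"

text \<open>The upper bound is imposed only towards vertices of the greedy phase. It keeps their
  candidate sets from growing far beyond \<open>q ^ bd t * \<nu>\<close>, so that the probability of
  hitting a given subset can be bounded from below.\<close>

definition avail :: "(nat \<Rightarrow> nat) \<Rightarrow> nat \<Rightarrow> nat set" where
  "avail f t = {v\<in>cd f t t - f ` {..<t}. \<forall>y\<in>hn t. t < y \<longrightarrow>
     q * real (card (cd f t y)) \<le> real (card (nb v \<inter> cd f t y)) \<and>
     (y < l \<longrightarrow> real (card (nb v \<inter> cd f t y)) \<le> r * real (card (cd f t y)))}"

definition valid :: "(nat \<Rightarrow> nat) \<Rightarrow> nat \<Rightarrow> bool" where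
  "valid f t \<longleftrightarrow> t \<le> l \<and> (\<forall>s<t. f s \<in> avail f s)"

lemma cand_cong: "(\<And>x. x \<in> D' \<Longrightarrow> f x = g x) \<Longrightarrow> cand f D' y W = cand g D' y W"
  unfolding cand_def by auto

lemma cd_cong: "(\<And>x. x < t \<Longrightarrow> f x = g x) \<Longrightarrow> cd f t y = cd g t y"
  unfolding cd_def by (rule cand_cong) auto

lemma avail_cong: assumes "\<And>x. x < t \<Longrightarrow> f x = g x" shows "avail f t = avail g t"
proof -
  have "cd f t = cd g t" using cd_cong[OF assms] by auto
  moreover have "f ` {..<t} = g ` {..<t}" using assms by (intro image_cong) auto
  ultimately show ?thesis unfolding avail_def by simp
qed

lemma valid_upd: "valid f t \<Longrightarrow> t < l \<Longrightarrow> v \<in> avail f t \<Longrightarrow> valid (f(t := v)) (Suc t)"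
proof -
  assume a: "valid f t" "t < l" "v \<in> avail f t"
  have "avail (f(t := v)) s = avail f s" if "s \<le> t" for s
    by (rule avail_cong) (use that in auto)
  then show ?thesis using a unfolding valid_def by (auto simp: less_Suc_eq)
qed

lemma cd_Suc:
  "cd f (Suc t) y = (if t \<in> hn y then nb (f t) \<inter> cd f t y else cd f t y)"
  unfolding cd_def cand_def by (auto simp: less_Suc_eq)

lemma hn_Suc:
  assumes "y < n"
  shows "card (hn y \<inter> {..<Suc t}) = (if t \<in> hn y then Suc (card (hn y \<inter> {..<t})) else card (hn y \<inter> {..<t}))"
proof -
  have "hn y \<inter> {..<Suc t} = (if t \<in> hn y then insert t (hn y \<inter> {..<t}) else hn y \<inter> {..<t})"
    by (auto simp: less_Suc_eq)
  then show ?thesis using fin_hn[OF assms] by simp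
qed

lemma finV: "finite V" using fin V by blast

lemma cd_V: "y < l \<Longrightarrow> cd f t y \<subseteq> V" unfolding cd_def cand_def using Reg_V by auto

lemma avail_V: "t < l \<Longrightarrow> avail f t \<subseteq> V" using cd_V[of t f t] unfolding avail_def by auto

lemma valid_mono: "valid f t \<Longrightarrow> s \<le> t \<Longrightarrow> valid f s"
  unfolding valid_def by auto

lemma valid_lt: "valid f t \<Longrightarrow> x < t \<Longrightarrow> f x \<in> V - f ` {..<x}"
  using avail_V[of x f] unfolding valid_def by (auto simp: avail_def)

lemma valid_inj: assumes "valid f t" shows "inj_on f {..<t}"
proof (rule linorder_inj_onI')
  fix i j assume "i \<in> {..<t}" "j \<in> {..<t}" "i < j"
  then show "f i \<noteq> f j" using valid_lt[OF assms, of j] by (metis DiffD2 imageI lessThan_iff)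
qed

lemma valid_partial: assumes v: "valid f t" shows "partial f {..<t}"
  unfolding partial_def
proof (intro conjI ballI)
  have tl: "t \<le> l" using v unfolding valid_def by simp
  show "{..<t} \<subseteq> {..<n}" using tl l_le by auto
  show "inj_on f {..<t}" by (rule valid_inj[OF v])
  show "f ` {..<t} \<subseteq> {..<N}" using valid_lt[OF v] V by auto
  have edge: "f y \<in> nb (f x)" if "y < t" "x < y" "x \<in> hn y" for x y
  proof -
    have "f y \<in> cd f y y" using v that unfolding valid_def avail_def by auto
    then show ?thesis using that unfolding cd_def cand_def by auto
  qed
  fix x y assume xy: "x \<in> {..<t}" "y \<in> hn x \<inter> {..<t}"
  then have "x \<in> hn y" "x \<noteq> y" using hn_sym[of x y] hn_irrefl tl l_le by auto
  then show "f y \<in> nb (f x)" using edge[of x y] edge[of y x] xy nb_sym by (cases "x < y") auto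
qed

lemma valid_tracked_aux:
  assumes "valid f t" "t \<le> y" "y < n"
  shows "q ^ card (hn y \<inter> {..<t}) * real (card (Reg y)) \<le> real (card (cd f t y)) \<and>
    (y < l \<longrightarrow> real (card (cd f t y)) \<le> r ^ card (hn y \<inter> {..<t}) * \<nu>)"
  using assms
proof (induction t)
  case 0
  then show ?case using Reg_V by (simp add: cd_def cand_def \<nu>_def)
next
  case (Suc t)
  have vt: "valid f t" using valid_mono[OF Suc.prems(1)] by simp
  note IH = Suc.IH[OF vt Suc_leD[OF Suc.prems(2)] Suc.prems(3)]
  have r0: "r > 0" unfolding r_def using p \<epsilon> by simp
  have av: "f t \<in> avail f t" using Suc.prems unfolding valid_def by auto
  show ?case
  proof (cases "t \<in> hn y")
    case True
    then have y: "y \<in> hn t" "t < y" using hn_sym Suc.prems by auto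
    have 1: "q * real (card (cd f t y)) \<le> real (card (nb (f t) \<inter> cd f t y))"
      using av y unfolding avail_def by auto
    have 2: "q * (q ^ card (hn y \<inter> {..<t}) * real (card (Reg y))) \<le> q * real (card (cd f t y))"
      using IH q by (intro mult_left_mono) auto
    have 3: "real (card (nb (f t) \<inter> cd f t y)) \<le> r * real (card (cd f t y))" if "y < l"
      using av y that unfolding avail_def by auto
    have 4: "r * real (card (cd f t y)) \<le> r * (r ^ card (hn y \<inter> {..<t}) * \<nu>)" if "y < l"
      using IH r0 that by (intro mult_left_mono) auto
    show ?thesis using True order_trans[OF 2 1] order_trans[OF 3 4]
      unfolding cd_Suc hn_Suc[OF Suc.prems(3)] by (simp add: mult.assoc)
  next
    case False
    then show ?thesis using IH unfolding cd_Suc hn_Suc[OF Suc.prems(3)] by simp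
  qed
qed

lemmas valid_tracked = valid_tracked_aux[THEN conjunct1] valid_tracked_aux[THEN conjunct2, THEN mp]

lemma KL: "K * L \<ge> 1" using mult_mono[of 1 K 1 L] K L_ge_1 by simp

lemma \<Gamma>_pos: "\<Gamma> > 0"
proof -
  have "\<Gamma> * (\<epsilon>^2 * \<sigma>) > 0" using \<Gamma>1 \<Delta>1 by linarith
  moreover have "\<epsilon>^2 * \<sigma> > 0" using \<epsilon> \<sigma> by simp
  ultimately show ?thesis by (rule zero_less_mult_pos2)
qed

lemma qV_big: "\<Gamma> * (K * L) \<le> q ^ (D + d') * \<nu>" using big unfolding \<nu>_def .

lemma \<nu>_pos: "\<nu> > 0"
proof -
  have "q ^ (D + d') * \<nu> > 0" using qV_big \<Gamma>_pos KL by (smt (verit) mult_pos_pos)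
  then show ?thesis using q by (simp add: zero_less_mult_iff)
qed

lemma m_small: "2 * real \<Delta> * m \<le> \<epsilon> * (\<sigma> / 2) * (q ^ D * \<nu>)"
proof -
  have "q ^ (D + d') * \<nu> \<le> q ^ (D + 1) * \<nu>" using D \<nu>_pos by (intro mult_right_mono q_power_le) auto
  then have "\<Gamma> * (K * L) \<le> q * (q ^ D * \<nu>)" using qV_big by (simp add: mult.assoc)
  also have "\<dots> \<le> p * (q ^ D * \<nu>)" using q \<nu>_pos by (intro mult_right_mono) auto
  finally have 1: "\<Gamma> * (K * L) \<le> p * (q ^ D * \<nu>)" .
  have "8 * real \<Delta> * (K * L) \<le> \<Gamma> * (\<epsilon>^2 * \<sigma>) * (K * L)" using \<Gamma>1 KL by (intro mult_right_mono) auto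
  also have "\<dots> = (\<epsilon>^2 * \<sigma>) * (\<Gamma> * (K * L))" by (simp add: mult_ac)
  also have "\<dots> \<le> (\<epsilon>^2 * \<sigma>) * (p * (q ^ D * \<nu>))" using 1 \<sigma> by (intro mult_left_mono) auto
  finally have 2: "8 * real \<Delta> * (K * L) \<le> (\<epsilon>^2 * \<sigma>) * (p * (q ^ D * \<nu>))" .
  have "\<epsilon> * p * (2 * real \<Delta> * m) = 4 * real \<Delta> * (K * L)" using m_mult by (simp add: algebra_simps)
  also have "\<dots> \<le> \<epsilon> * p * (\<epsilon> * (\<sigma> / 2) * (q ^ D * \<nu>))" using 2 by (simp add: power2_eq_square algebra_simps)
  finally show ?thesis using p \<epsilon> by simp
qed

lemma M2_le: "0 < k \<Longrightarrow> k \<le> D \<Longrightarrow> M2 \<le> q ^ (k - 1) * \<nu>"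
proof -
  assume k: "0 < k" "k \<le> D"
  have "\<epsilon> * p * M2 = m + 1" unfolding M2_def using p \<epsilon> by simp
  also have "\<dots> \<le> 2 * real \<Delta> * m"
  proof -
    have "1 * (2 * m) \<le> real \<Delta> * (2 * m)" using \<Delta>1 m_ge_20 by (intro mult_right_mono) auto
    then show ?thesis using m_ge_20 by linarith
  qed
  also have "\<dots> \<le> \<epsilon> * (\<sigma> / 2) * (q ^ D * \<nu>)" by (rule m_small)
  also have "\<dots> \<le> \<epsilon> * 1 * (q ^ k * \<nu>)"
    using \<epsilon> \<sigma> q \<nu>_pos k by (intro mult_mono q_power_le) auto
  also have "q ^ k = q * q ^ (k - 1)" using k by (cases k) auto
  also have "\<epsilon> * 1 * (q * q ^ (k - 1) * \<nu>) \<le> \<epsilon> * 1 * (p * q ^ (k - 1) * \<nu>)"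
    using \<epsilon> q \<nu>_pos by (intro mult_left_mono mult_right_mono) auto
  finally have "\<epsilon> * p * M2 \<le> \<epsilon> * p * (q ^ (k - 1) * \<nu>)" by (simp add: mult_ac)
  then show ?thesis using p \<epsilon> by simp
qed

text \<open>Each of the at most \<open>\<Delta>\<close> later neighbours of \<open>t\<close> rules
  out at most \<open>m\<close> images for shrinking its candidate set too much, and at most
  \<open>m\<close> for shrinking it too little.\<close>

lemma few_unsuitable:
  assumes v: "valid f t" and t: "t < l"
  shows "real (card (cd f t t - f ` {..<t} - avail f t)) \<le> 2 * real \<Delta> * m"
proof -
  have tn: "t < n" using t l_le by simp
  define Ys where "Ys = {y\<in>hn t. t < y}"
  define Ys' where "Ys' = {y\<in>hn t. t < y \<and> y < l}"
  have fY: "finite Ys" "finite Ys'" using fin_hn[OF tn] unfolding Ys_def Ys'_def by auto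
  have "card Ys \<le> card (hn t)" "card Ys' \<le> card (hn t)"
    using fin_hn[OF tn] unfolding Ys_def Ys'_def by (auto intro: card_mono)
  then have cY: "card Ys \<le> \<Delta>" "card Ys' \<le> \<Delta>" using hn_deg[OF tn] by auto
  have y: "y < n" "t \<in> hn y" if "y \<in> Ys" for y
    using that hn_sub[OF tn] hn_sym[OF tn] unfolding Ys_def by auto
  have inner: "cd f t y \<subseteq> {..<N} \<and> M2 \<le> real (card (cd f t y))" if "y \<in> Ys'" for y
  proof -
    have yY: "y \<in> Ys" and yl: "y < l" "t < y" using that unfolding Ys_def Ys'_def by auto
    have "card (hn y \<inter> {..<t}) < card (hn y \<inter> {..<y})"
      by (rule psubset_card_mono) (use fin_hn[OF y(1)[OF yY]] y[OF yY] yl in auto)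
    then have k: "0 < bd y" "bd y \<le> D" "card (hn y \<inter> {..<t}) \<le> bd y - 1"
      using back_deg[OF yl(1)] unfolding bd_def by auto
    have "M2 \<le> q ^ (bd y - 1) * \<nu>" by (rule M2_le[OF k(1,2)])
    also have "\<dots> \<le> q ^ card (hn y \<inter> {..<t}) * \<nu>" using \<nu>_pos by (intro mult_right_mono q_power_le k) auto
    also have "\<dots> \<le> real (card (cd f t y))"
      using valid_tracked(1)[OF v, of y] y[OF yY] yl Reg_V[OF yl(1)] unfolding \<nu>_def by simp
    finally show ?thesis using cd_V[OF yl(1)] V by blast
  qed
  have outer: "cd f t y \<subseteq> {..<N} \<and> M \<le> real (card (cd f t y))" if yY: "y \<in> Ys" for y
  proof (cases "y < l")
    case True
    then have "y \<in> Ys'" using that unfolding Ys_def Ys'_def by auto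
    then show ?thesis using inner m_le_M(4) by fastforce
  next
    case False
    then have yl: "l \<le> y" by simp
    have "t \<in> hn y \<inter> {..<l}" using y[OF yY] t by simp
    then have ne: "hn y \<inter> {..<l} \<noteq> {}" by blast
    have "card (hn y \<inter> {..<t}) < card (hn y \<inter> {..<l})"
      by (rule psubset_card_mono) (use fin_hn[OF y(1)[OF yY]] y[OF yY] t in auto)
    then have k: "card (hn y \<inter> {..<t}) \<le> card (hn y \<inter> {..<l}) - 1" by simp
    have "M \<le> q ^ (card (hn y \<inter> {..<l}) - 1) * real (card (Reg y))" using Reg[OF yl y(1)[OF yY] ne] by simp
    also have "\<dots> \<le> q ^ card (hn y \<inter> {..<t}) * real (card (Reg y))" by (intro mult_right_mono q_power_le k) auto
    also have "\<dots> \<le> real (card (cd f t y))"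
      using valid_tracked(1)[OF v, of y] y[OF yY] t yl by simp
    finally show ?thesis using Reg[OF yl y(1)[OF yY] ne] unfolding cd_def cand_def by auto
  qed
  let ?B1 = "{v\<in>{..<N}. \<exists>y\<in>Ys. real (card (nb v \<inter> cd f t y)) < q * real (card (cd f t y))}"
  let ?B2 = "\<Union>y\<in>Ys'. {v\<in>{..<N}. real (card (nb v \<inter> cd f t y)) > r * real (card (cd f t y))}"
  have 1: "real (card ?B1) \<le> real (card Ys) * m" by (rule few_choices_lost[OF fY(1) outer])
  have "card ?B2 \<le> (\<Sum>y\<in>Ys'. card {v\<in>{..<N}. real (card (nb v \<inter> cd f t y)) > r * real (card (cd f t y))})"
    by (rule card_UN_le[OF fY(2)])
  then have "real (card ?B2) \<le> (\<Sum>y\<in>Ys'. real (card {v\<in>{..<N}. real (card (nb v \<inter> cd f t y)) > r * real (card (cd f t y))}))"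
    by (simp flip: of_nat_sum)
  also have "\<dots> \<le> (\<Sum>y\<in>Ys'. m)" by (intro sum_mono few_over) (use inner \<Delta>1 in auto)
  finally have 2: "real (card ?B2) \<le> real (card Ys') * m" by simp
  have "cd f t t - f ` {..<t} - avail f t \<subseteq> ?B1 \<union> ?B2"
  proof
    fix v assume v: "v \<in> cd f t t - f ` {..<t} - avail f t"
    then have vN: "v < N" using cd_V[OF t, of f t] V by auto
    from v obtain y where y: "y \<in> hn t" "t < y" "\<not> (q * real (card (cd f t y)) \<le> real (card (nb v \<inter> cd f t y)) \<and>
     (y < l \<longrightarrow> real (card (nb v \<inter> cd f t y)) \<le> r * real (card (cd f t y))))"
      unfolding avail_def by blast
    show "v \<in> ?B1 \<union> ?B2"
    proof (cases "q * real (card (cd f t y)) \<le> real (card (nb v \<inter> cd f t y))")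
      case True
      then have "v \<in> ?B2" using y vN unfolding Ys'_def by (intro UN_I[of y]) auto
      then show ?thesis by (rule UnI2)
    next
      case False
      then have "y \<in> Ys" "real (card (nb v \<inter> cd f t y)) < q * real (card (cd f t y))"
        using y unfolding Ys_def by auto
      then have "v \<in> ?B1" using vN by blast
      then show ?thesis by (rule UnI1)
    qed
  qed
  then have "card (cd f t t - f ` {..<t} - avail f t) \<le> card (?B1 \<union> ?B2)"
    by (rule card_mono[rotated]) (use fY in auto)
  also have "\<dots> \<le> card ?B1 + card ?B2" by (rule card_Un_le)
  finally have "real (card (cd f t t - f ` {..<t} - avail f t)) \<le> real (card Ys) * m + real (card Ys') * m"
    using 1 2 by linarith
  also have "\<dots> \<le> real \<Delta> * m + real \<Delta> * m" using cY m_ge_20 by (intro add_mono mult_right_mono) auto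
  finally show ?thesis by simp
qed

lemma avail_large:
  assumes v: "valid f t" and t: "t < l" and \<alpha>: "\<sigma> / 2 \<le> \<alpha>"
    and free: "\<alpha> * real (card (cd f t t)) \<le> real (card (cd f t t - f ` {..<t}))"
  shows "(1 - \<epsilon>) * \<alpha> * (q ^ bd t * \<nu>) \<le> real (card (avail f t))"
proof -
  have tn: "t < n" using t l_le by simp
  have fcd: "finite (cd f t t)" using cd_V[OF t] finV finite_subset by blast
  have "card (cd f t t - f ` {..<t}) = card (avail f t \<union> (cd f t t - f ` {..<t} - avail f t))"
    by (rule arg_cong[where f = card]) (auto simp: avail_def)
  also have "\<dots> \<le> card (avail f t) + card (cd f t t - f ` {..<t} - avail f t)" by (rule card_Un_le)
  finally have 1: "real (card (cd f t t - f ` {..<t})) \<le> real (card (avail f t)) + 2 * real \<Delta> * m"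
    using few_unsuitable[OF v t] by linarith
  have "q ^ bd t * \<nu> \<le> real (card (cd f t t))"
    using valid_tracked(1)[OF v, of t] tn Reg_V[OF t] unfolding \<nu>_def bd_def by simp
  then have 2: "\<alpha> * (q ^ bd t * \<nu>) \<le> \<alpha> * real (card (cd f t t))" using \<alpha> \<sigma> by (intro mult_left_mono) auto
  have "2 * real \<Delta> * m \<le> \<epsilon> * (\<sigma> / 2) * (q ^ D * \<nu>)" by (rule m_small)
  also have "\<dots> \<le> \<epsilon> * \<alpha> * (q ^ bd t * \<nu>)"
    using \<epsilon> \<alpha> \<sigma> q \<nu>_pos back_deg[OF t] unfolding bd_def by (intro mult_mono q_power_le) auto
  finally show ?thesis using 1 2 free by (simp add: algebra_simps)
qed

end

text \<open>The order is cut into windows of length \<open>\<omega>\<close>; within one window only a small proportion of \<open>V\<close> gets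
  used, so that the loads are governed by the lower bound \<open>a\<close> for the unused proportion of each
  common neighbourhood.\<close>
locale windows = greedy +
  fixes \<xi> \<eta> \<epsilon>' :: real and \<omega> :: nat
  assumes \<xi>: "\<xi> = \<sigma> / 32" and \<eta>: "\<eta> = \<sigma>^2 / 256" and \<epsilon>': "\<epsilon>' = \<xi> * \<eta> * \<sigma> / (48 * (real cN * (real D + 1)))"
    and \<omega>: "\<omega> = nat \<lceil>\<eta> * real (card V)\<rceil>" and cN: "cN \<ge> 1"
    and \<Gamma>2: "24 \<le> \<Gamma> * (\<sigma> * \<xi> * \<epsilon>')" and \<Gamma>3: "24 * (real cN * (real D + 1)) \<le> \<Gamma> * (\<sigma> * \<xi> * \<eta>)"
    and \<Gamma>4: "2 * real d' + 3 \<le> \<Gamma> * (\<xi> * \<epsilon>')"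
begin

definition "a i = 1 - (1 + \<sigma> / 4) * (real i * real \<omega> / \<nu>)"
definition "wgt \<tau> = 1 / ((1 - \<epsilon>) * a (\<tau> div \<omega> + 1) * (q ^ bd \<tau> * \<nu>))"
text \<open>Accumulated probability, within the current window, that \<open>v\<close> is chosen. The
  term for \<open>\<tau>\<close> itself is included; it depends on earlier images only, so whether
  \<open>v\<close> is light is known before \<open>\<tau>\<close> is embedded.\<close>

definition "load f \<tau> v = (\<Sum>s\<in>{\<tau> div \<omega> * \<omega>..\<tau>}. if v \<in> cd f s s then wgt s else 0)"
text \<open>A typical vertex lies in the candidate set of \<open>\<tau>\<close> with frequency about
  \<open>q ^ bd \<tau>\<close>, so its load in a full window is about
  \<open>\<omega> / (a (i + 1) * \<nu>)\<close>.\<close>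

definition "\<Lambda> i = (1 + \<xi>) * real \<omega> / (a (i + 1) * \<nu>)"
definition "CL U = {v\<in>V. \<forall>u\<in>U. v \<in> nb u}"
definition "light f i U \<tau> = {v\<in>CL U - f ` {..<i * \<omega>}. load f \<tau> v \<le> \<Lambda> i}"
definition "win i t = {\<tau>. \<tau> < t \<and> \<tau> div \<omega> = i}"
definition "hits i U f t = card {\<tau>\<in>win i t. f \<tau> \<in> light f i U \<tau>}"
text \<open>Compensator of \<open>hits\<close>. Restricting both to light vertices bounds the
  compensator deterministically by \<open>\<Lambda> i\<close> per vertex.\<close>

definition "drift i U f t = (\<Sum>\<tau>\<in>win i t. wgt \<tau> * real (card (cd f \<tau> \<tau> \<inter> light f i U \<tau>)))"
text \<open>Exponential supermartingale for \<open>hits\<close> against its compensator, over all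
  windows and all \<open>U\<close>. Each vertex of \<open>U\<close> is charged a factor
  \<open>1 / N ^ 2\<close>; the further \<open>1 / N ^ 3\<close> pays for the number of
  windows.\<close>

definition "pot1 f t = (\<Sum>(i, U)\<in>{..l div \<omega>} \<times> Pow {..<N}.
   exp (- (2 * real (card U) + 3) * L) * exp (\<xi> * real (hits i U f t) - (exp \<xi> - 1) * drift i U f t))"
definition "\<theta> = q ^ d' * \<nu>"
definition "ctrl f t \<longleftrightarrow> (\<forall>U\<subseteq>{..<N}. card U \<le> d' \<longrightarrow> \<theta> \<le> real (card (CL U)) \<longrightarrow>
   a (t div \<omega> + 1) * real (card (CL U)) \<le> real (card (CL U - f ` {..<t})))"

lemma params: "0 < \<xi>" "\<xi> \<le> 1/32" "0 < \<eta>" "\<eta> \<le> 1/256" "0 < \<epsilon>'" "\<epsilon>' \<le> 1"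
proof -
  show x: "0 < \<xi>" "\<xi> \<le> 1/32" unfolding \<xi> using \<sigma> by auto
  have "\<sigma>^2 \<le> 1" using \<sigma> by (simp add: power_le_one)
  then show e: "0 < \<eta>" "\<eta> \<le> 1/256" unfolding \<eta> using \<sigma> by auto
  have "0 < \<xi> * \<eta> * \<sigma>" using x e \<sigma> by simp
  moreover have "\<xi> * \<eta> * \<sigma> \<le> 1 * 1 * 1" using x e \<sigma> by (intro mult_mono) auto
  moreover have "real cN * (real D + 1) \<ge> 1 * 1" using cN by (intro mult_mono) auto
  ultimately show "0 < \<epsilon>'" "\<epsilon>' \<le> 1" unfolding \<epsilon>' by (auto simp: pos_divide_le_eq)
qed

lemma \<Gamma>_le_\<nu>: "\<Gamma> \<le> q ^ (D + d') * \<nu>" "\<Gamma> \<le> \<theta>" "\<Gamma> \<le> \<nu>" "\<Gamma> * (K * L) \<le> q ^ D * \<nu>"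
proof -
  have "\<Gamma> * 1 \<le> \<Gamma> * (K * L)" using KL \<Gamma>_pos by (intro mult_left_mono) auto
  then show 1: "\<Gamma> \<le> q ^ (D + d') * \<nu>" using qV_big by simp
  have "q ^ (D + d') * \<nu> \<le> q ^ d' * \<nu>" "q ^ (D + d') * \<nu> \<le> q ^ 0 * \<nu>" "q ^ (D + d') * \<nu> \<le> q ^ D * \<nu>"
    using \<nu>_pos by (auto intro!: mult_right_mono q_power_le simp del: power_0)
  then show "\<Gamma> \<le> \<theta>" "\<Gamma> \<le> \<nu>" "\<Gamma> * (K * L) \<le> q ^ D * \<nu>" using 1 qV_big unfolding \<theta>_def by auto
qed

lemma \<Gamma>_eps: "1 \<le> \<Gamma> * \<epsilon>'" "1 \<le> \<Gamma> * \<eta>"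
proof -
  have "24 \<le> (\<sigma> * \<xi>) * (\<Gamma> * \<epsilon>')" using \<Gamma>2 by (simp add: mult_ac)
  also have "\<dots> \<le> 1 * (\<Gamma> * \<epsilon>')" using \<sigma> params \<Gamma>_pos mult_mono[of \<sigma> 1 \<xi> 1] by (intro mult_right_mono) auto
  finally show 1: "1 \<le> \<Gamma> * \<epsilon>'" by simp
  have "\<epsilon>' \<le> \<eta>"
  proof -
    have "\<xi> * \<eta> * \<sigma> \<le> 1 * \<eta> * 1" using \<sigma> params by (intro mult_mono) auto
    moreover have "real cN * (real D + 1) \<ge> 1 * 1" using cN by (intro mult_mono) auto
    then have "\<eta> * 1 \<le> \<eta> * (48 * (real cN * (real D + 1)))" using params by (intro mult_left_mono) auto
    ultimately have "\<xi> * \<eta> * \<sigma> \<le> \<eta> * (48 * (real cN * (real D + 1)))" by linarith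
    moreover have "48 * (real cN * (real D + 1)) > 0" using cN by simp
    ultimately show ?thesis unfolding \<epsilon>' by (simp only: pos_divide_le_eq)
  qed
  then have "\<Gamma> * \<epsilon>' \<le> \<Gamma> * \<eta>" using \<Gamma>_pos by (intro mult_left_mono) auto
  then show "1 \<le> \<Gamma> * \<eta>" using 1 by simp
qed

lemma \<omega>_bounds: "\<eta> * \<nu> \<le> real \<omega>" "real \<omega> \<le> 2 * (\<eta> * \<nu>)" "\<omega> > 0"
proof -
  have "1 \<le> \<Gamma> * \<eta>" by (rule \<Gamma>_eps)
  also have "\<dots> \<le> \<nu> * \<eta>" using \<Gamma>_le_\<nu> params by (intro mult_right_mono) auto
  finally have "1 \<le> \<eta> * \<nu>" by (simp add: mult.commute)
  then show "\<eta> * \<nu> \<le> real \<omega>" "real \<omega> \<le> 2 * (\<eta> * \<nu>)" "\<omega> > 0"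
    unfolding \<omega> \<nu>_def by linarith+
qed

lemma \<omega>_\<nu>: "real \<omega> / \<nu> \<le> \<sigma>^2 / 128" "\<eta> \<le> real \<omega> / \<nu>"
  using \<omega>_bounds \<nu>_pos unfolding \<eta> by (auto simp: field_simps)

text \<open>The greedy phase uses at most the proportion \<open>1 - \<sigma>\<close> of
  \<open>V\<close>, and one window at most \<open>\<sigma> / 128\<close>; multiplied by the slope
  this stays below \<open>1 - \<sigma> / 2\<close>. The extra window in the hypothesis lets the
  bound be used at the end of the window in progress.\<close>

lemma a_ge: assumes "i * \<omega> \<le> l + \<omega>" shows "\<sigma> / 2 \<le> a i"
proof -
  have "real i * real \<omega> \<le> real l + real \<omega>" using assms by (metis of_nat_add of_nat_le_iff of_nat_mult)
  also have "\<dots> \<le> (1 - \<sigma>) * \<nu> + real \<omega>" using l_size unfolding \<nu>_def by simp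
  finally have "real i * real \<omega> / \<nu> \<le> ((1 - \<sigma>) * \<nu> + real \<omega>) / \<nu>" using \<nu>_pos by (intro divide_right_mono) auto
  also have "\<dots> = 1 - \<sigma> + real \<omega> / \<nu>" using \<nu>_pos by (simp add: field_simps)
  also have "\<dots> \<le> 1 - \<sigma> + \<sigma> / 128"
  proof -
    have "\<sigma>^2 \<le> \<sigma>" using \<sigma> by (simp add: power2_eq_square mult_left_le)
    then show ?thesis using \<omega>_\<nu> by linarith
  qed
  finally have "(1 + \<sigma> / 4) * (real i * real \<omega> / \<nu>) \<le> (1 + \<sigma> / 4) * (1 - \<sigma> + \<sigma> / 128)"
    using \<sigma> by (intro mult_left_mono) auto
  also have "\<dots> = 1 - \<sigma> + \<sigma>/128 + \<sigma>/4 - (127/512) * \<sigma>^2" by (simp add: power2_eq_square algebra_simps)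
  also have "\<dots> \<le> 1 - \<sigma> / 2" using \<sigma> zero_le_power2[of \<sigma>] by linarith
  finally show ?thesis unfolding a_def by linarith
qed

lemma a_le_1: "a i \<le> 1" unfolding a_def using \<nu>_pos \<sigma> by simp

lemma a_step: "a (i + 1) = a i - (1 + \<sigma> / 4) * (real \<omega> / \<nu>)"
  unfolding a_def by (simp add: add_divide_distrib algebra_simps)

lemma a_win: "\<tau> < l \<Longrightarrow> \<sigma> / 2 \<le> a (\<tau> div \<omega> + 1)"
  using a_ge[of "\<tau> div \<omega> + 1"] by (simp add: div_times_less_eq_dividend order_trans[OF div_times_less_eq_dividend])

lemma wgt_nonneg: "\<tau> < l \<Longrightarrow> 0 \<le> wgt \<tau>"
  unfolding wgt_def using a_win[of \<tau>] \<sigma> \<epsilon> q \<nu>_pos by simp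

lemma \<Lambda>_nonneg: "i * \<omega> \<le> l \<Longrightarrow> 0 \<le> \<Lambda> i"
  unfolding \<Lambda>_def using a_ge[of "i + 1"] \<sigma> params \<nu>_pos by simp

lemma finite_win: "finite (win i t)" unfolding win_def by simp

lemma win_iff: "\<tau> \<in> win i t \<longleftrightarrow> \<tau> < t \<and> i * \<omega> \<le> \<tau> \<and> \<tau> < (i + 1) * \<omega>"
proof -
  have "\<tau> div \<omega> = i \<longleftrightarrow> i * \<omega> \<le> \<tau> \<and> \<tau> < (i + 1) * \<omega>"
    using \<omega>_bounds(3) by (metis Suc_eq_plus1 div_nat_eqI dividend_less_times_div div_times_less_eq_dividend less_eq_Suc_le mult.commute mult_Suc add.commute)
  then show ?thesis unfolding win_def by auto
qed

lemma card_win: "card (win i t) \<le> \<omega>"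
proof -
  have "win i t \<subseteq> {i * \<omega>..<(i + 1) * \<omega>}" by (auto simp: win_iff)
  then have "card (win i t) \<le> card {i * \<omega>..<(i + 1) * \<omega>}" by (rule card_mono[rotated]) simp
  then show ?thesis by simp
qed

lemma CL_V: "CL U \<subseteq> V" unfolding CL_def by auto
lemma fin_CL: "finite (CL U)" using CL_V finV finite_subset by blast

lemma load_le_total:
  assumes "t \<le> l" "\<tau> \<in> win i t" "T \<subseteq> {s\<in>win i t. v \<in> cd f s s}" "\<forall>s\<in>T. s \<le> \<tau>"
  shows "(\<Sum>s\<in>T. wgt s) \<le> load f \<tau> v"
    "load f \<tau> v \<le> (\<Sum>s\<in>win i t. if v \<in> cd f s s then wgt s else 0)"
proof -
  have i: "\<tau> div \<omega> = i" using assms unfolding win_def by simp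
  have s: "s < l" if "s \<le> \<tau>" for s using that assms unfolding win_def by auto
  have "(\<Sum>s\<in>T. wgt s) = (\<Sum>s\<in>T. if v \<in> cd f s s then wgt s else 0)"
    by (rule sum.cong) (use assms in auto)
  also have "\<dots> \<le> load f \<tau> v" unfolding load_def i
    by (rule sum_mono2) (use assms s wgt_nonneg in \<open>auto simp: win_iff subset_iff\<close>)
  finally show "(\<Sum>s\<in>T. wgt s) \<le> load f \<tau> v" .
  show "load f \<tau> v \<le> (\<Sum>s\<in>win i t. if v \<in> cd f s s then wgt s else 0)" unfolding load_def i
    by (rule sum_mono2[OF finite_win]) (use assms s wgt_nonneg in \<open>auto simp: win_iff\<close>)
qed

text \<open>After exchanging the sums, each vertex contributes only while its load is at most
  \<open>\<Lambda> i\<close>. The load includes the current term, so the load at its last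
  contributing step already bounds its whole contribution.\<close>

lemma drift_le:
  assumes "t \<le> l" "i * \<omega> \<le> l"
  shows "drift i U f t \<le> \<Lambda> i * real (card (CL U - f ` {..<i * \<omega>}))"
proof -
  let ?C = "CL U - f ` {..<i * \<omega>}"
  have fC: "finite ?C" using fin_CL by simp
  have "drift i U f t = (\<Sum>\<tau>\<in>win i t. \<Sum>v\<in>?C. if v \<in> cd f \<tau> \<tau> \<and> load f \<tau> v \<le> \<Lambda> i then wgt \<tau> else 0)"
    unfolding drift_def
  proof (rule sum.cong[OF refl])
    fix \<tau>
    have "cd f \<tau> \<tau> \<inter> light f i U \<tau> = {v\<in>?C. v \<in> cd f \<tau> \<tau> \<and> load f \<tau> v \<le> \<Lambda> i}" unfolding light_def by auto
    then show "wgt \<tau> * real (card (cd f \<tau> \<tau> \<inter> light f i U \<tau>)) = (\<Sum>v\<in>?C. if v \<in> cd f \<tau> \<tau> \<and> load f \<tau> v \<le> \<Lambda> i then wgt \<tau> else 0)"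
      using fC by (simp add: sum.inter_filter[symmetric] mult.commute)
  qed
  also have "\<dots> = (\<Sum>v\<in>?C. \<Sum>\<tau>\<in>win i t. if v \<in> cd f \<tau> \<tau> \<and> load f \<tau> v \<le> \<Lambda> i then wgt \<tau> else 0)"
    by (rule sum.swap)
  also have "\<dots> \<le> (\<Sum>v\<in>?C. \<Lambda> i)"
  proof (rule sum_mono)
    fix v
    define T where "T = {\<tau>\<in>win i t. v \<in> cd f \<tau> \<tau> \<and> load f \<tau> v \<le> \<Lambda> i}"
    have fT: "finite T" unfolding T_def using finite_win by simp
    have eq: "(\<Sum>\<tau>\<in>win i t. if v \<in> cd f \<tau> \<tau> \<and> load f \<tau> v \<le> \<Lambda> i then wgt \<tau> else 0) = (\<Sum>\<tau>\<in>T. wgt \<tau>)"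
      unfolding T_def using finite_win by (simp add: sum.inter_filter)
    show "(\<Sum>\<tau>\<in>win i t. if v \<in> cd f \<tau> \<tau> \<and> load f \<tau> v \<le> \<Lambda> i then wgt \<tau> else 0) \<le> \<Lambda> i"
    proof (cases "T = {}")
      case True
      then show ?thesis unfolding eq using \<Lambda>_nonneg[OF assms(2)] by simp
    next
      case False
      then have m: "Max T \<in> T" using fT by simp
      have "(\<Sum>\<tau>\<in>T. wgt \<tau>) \<le> load f (Max T) v"
        by (rule load_le_total(1)[OF assms(1)]) (use m fT in \<open>auto simp: T_def\<close>)
      also have "\<dots> \<le> \<Lambda> i" using m unfolding T_def by simp
      finally show ?thesis unfolding eq .
    qed
  qed
  finally show ?thesis by (simp add: mult.commute)
qed

text \<open>Double counting of the load of \<open>Y\<close> over the window. Grouped by colour and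
  back-degree, the candidate sets belong to stars with disjoint leaf sets of equal size, so
  \<open>few_stars\<close> bounds the load by its expected value and errors, below the
  \<open>\<Lambda> i * card Y\<close> that heavy vertices would need. The errors dictate both size
  bounds: \<open>Y\<close> must be large against the logarithmic error, but so small that steps
  whose leaves meet \<open>Y\<close> do not matter.\<close>

lemma few_heavy:
  assumes v: "valid f t" and i: "i * \<omega> \<le> l" and Y: "Y \<subseteq> V" "\<epsilon>' * \<theta> \<le> real (card Y)" "real (card Y) \<le> 2 * (\<epsilon>' * \<theta>)"
    and heavy: "\<And>v. v \<in> Y \<Longrightarrow> \<exists>\<tau>\<in>win i t. \<Lambda> i < load f \<tau> v"
  shows False
proof -
  have tl: "t \<le> l" using v unfolding valid_def by simp
  have fY: "finite Y" using Y(1) finV finite_subset by blast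
  have \<theta>0: "\<theta> > 0" unfolding \<theta>_def using q \<nu>_pos by simp
  have Y0: "real (card Y) > 0" using Y(2) \<theta>0 params by (smt (verit) mult_pos_pos)
  define y where "y = real (card Y)"
  define al where "al = a (i + 1)"
  have al: "\<sigma> / 2 \<le> al" "al \<le> 1" unfolding al_def using a_ge[of "i + 1"] i a_le_1 by auto
  have al0: "al > 0" using al \<sigma> by linarith
  define C where "C = real cN * (real D + 1)"
  have C1: "C > 0" unfolding C_def using cN by simp
  define w where "w k = 1 / ((1 - \<epsilon>) * al * (q ^ k * \<nu>))" for k
  \<comment> \<open>A bound for every weight in the window: the 4 combines
    \<open>1 - \<epsilon> \<ge> 1 / 2\<close> with \<open>al \<ge> \<sigma> / 2\<close>.\<close>
  define wm where "wm = 4 / (\<sigma> * (q ^ D * \<nu>))"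
  have qD: "q ^ D * \<nu> > 0" using q \<nu>_pos by simp
  have wm0: "wm > 0" unfolding wm_def using \<sigma> qD by simp
  have w0: "w k \<ge> 0" for k unfolding w_def using al0 \<epsilon> q \<nu>_pos by simp
  have w_le: "w k \<le> wm" if "k \<le> D" for k
  proof -
    have "\<sigma> * (q ^ D * \<nu>) / 4 = (1/2) * (\<sigma> / 2) * (q ^ D * \<nu>)" by simp
    also have "\<dots> \<le> (1 - \<epsilon>) * al * (q ^ k * \<nu>)"
      using \<epsilon> al \<sigma> q \<nu>_pos that by (intro mult_mono q_power_le) auto
    finally have *: "\<sigma> * (q ^ D * \<nu>) / 4 \<le> (1 - \<epsilon>) * al * (q ^ k * \<nu>)" .
    have "0 < \<sigma> * (q ^ D * \<nu>) / 4" using \<sigma> qD by simp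
    moreover have "0 < (1 - \<epsilon>) * al * (q ^ k * \<nu>)" using calculation * by linarith
    ultimately have "w k \<le> 1 / (\<sigma> * (q ^ D * \<nu>) / 4)" unfolding w_def using * by (intro divide_left_mono mult_pos_pos[of "(1 - \<epsilon>) * al * (q ^ k * \<nu>)"]) simp_all
    then show ?thesis unfolding wm_def by simp
  qed
  have w_main: "w k * ((1 + \<epsilon>) * p ^ k) \<le> (1 + \<xi> / 2) / (al * \<nu>)" if "k \<le> D" for k
  proof -
    have "1 + \<epsilon> \<le> (1 + \<xi> / 2) * ((1 - \<epsilon>) * (1 - 3 * \<epsilon>) ^ D)" using \<epsilon>_small unfolding \<xi> by simp
    also have "\<dots> \<le> (1 + \<xi> / 2) * ((1 - \<epsilon>) * (1 - 3 * \<epsilon>) ^ k)"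
      using \<epsilon> params that by (intro mult_left_mono power_decreasing) auto
    finally have "(1 + \<epsilon>) * p ^ k \<le> (1 + \<xi> / 2) * ((1 - \<epsilon>) * (1 - 3 * \<epsilon>) ^ k) * p ^ k"
      using p by (intro mult_right_mono) auto
    also have "\<dots> = (1 + \<xi> / 2) * ((1 - \<epsilon>) * q ^ k)" unfolding q_def by (simp add: power_mult_distrib)
    finally have "w k * ((1 + \<epsilon>) * p ^ k) \<le> w k * ((1 + \<xi> / 2) * ((1 - \<epsilon>) * q ^ k))" using w0 by (intro mult_left_mono) auto
    also have "\<dots> = (1 + \<xi> / 2) / (al * \<nu>)" unfolding w_def using \<epsilon> q by simp
    finally show ?thesis .
  qed
  define Tp where "Tp \<tau> = f ` (hn \<tau> \<inter> {..<\<tau>})" for \<tau>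
  define S where "S = (\<lambda>(c, k). {\<tau>\<in>win i t. \<chi> \<tau> = c \<and> bd \<tau> = k})"
  define P where "P = {..<cN} \<times> {..D}"
  have winl: "\<tau> < l" "\<tau> < t" if "\<tau> \<in> win i t" for \<tau> using that tl unfolding win_def by auto
  have wgt_w: "wgt \<tau> = w (bd \<tau>)" if "\<tau> \<in> win i t" for \<tau>
    using that unfolding wgt_def w_def al_def win_def by simp
  have part: "(\<Sum>\<tau>\<in>win i t. g \<tau>) = (\<Sum>ck\<in>P. \<Sum>\<tau>\<in>S ck. g \<tau>)" for g :: "nat \<Rightarrow> real"
  proof -
    have "win i t = (\<Union>ck\<in>P. S ck)" unfolding P_def S_def using \<chi>(2) winl back_deg unfolding bd_def by fastforce
    moreover have "sum g (\<Union>ck\<in>P. S ck) = (\<Sum>ck\<in>P. sum g (S ck))"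
      by (rule sum.UNION_disjoint) (auto simp: P_def S_def finite_win)
    ultimately show ?thesis by simp
  qed
  have cS: "(\<Sum>ck\<in>P. real (card (S ck))) \<le> real \<omega>"
    using part[of "\<lambda>_. 1"] card_win[of i t] by simp
  have tup_inj: "inj_on f {..<t}" by (rule valid_inj[OF v])
  have cTp: "card (Tp \<tau>) = bd \<tau>" if "\<tau> \<in> win i t" for \<tau>
    unfolding Tp_def bd_def by (rule card_image) (rule inj_on_subset[OF tup_inj], use winl[OF that] in auto)
  have group: "(\<Sum>\<tau>\<in>S (c, k). real (card (Y \<inter> cd f \<tau> \<tau>))) \<le> (1 + \<epsilon>) * p ^ k * y * real (card (S (c, k))) + K * L * (real (card (S (c, k))) + y) + y * y"
    if ck: "(c, k) \<in> P" for c k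
  proof -
    define S1 where "S1 = {\<tau>\<in>S (c, k). Tp \<tau> \<inter> Y = {}}"
    \<comment> \<open>\<open>few_stars\<close> demands leaves outside \<open>Y\<close>. The leaf
      sets of one class are disjoint, so at most \<open>card Y\<close> of them meet
      \<open>Y\<close>, and each of these steps contributes at most \<open>card Y\<close>.\<close>
    define S2 where "S2 = {\<tau>\<in>S (c, k). Tp \<tau> \<inter> Y \<noteq> {}}"
    have fS: "finite (S (c, k))" "finite S1" "finite S2" unfolding S1_def S2_def S_def using finite_win by auto
    have disj: "Tp \<tau> \<inter> Tp \<tau>' = {}" if "\<tau> \<in> S (c, k)" "\<tau>' \<in> S (c, k)" "\<tau> \<noteq> \<tau>'" for \<tau> \<tau>'
    proof -
      have w: "\<tau> \<in> win i t" "\<tau>' \<in> win i t" "\<chi> \<tau> = \<chi> \<tau>'" using that unfolding S_def by auto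
      have "hn \<tau> \<inter> hn \<tau>' = {}" using \<chi>(1)[of \<tau> \<tau>'] that winl w by auto
      moreover have "inj_on f ((hn \<tau> \<inter> {..<\<tau>}) \<union> (hn \<tau>' \<inter> {..<\<tau>'}))"
        by (rule inj_on_subset[OF tup_inj]) (use winl w in fastforce)
      ultimately show ?thesis unfolding Tp_def by (subst inj_on_image_Int[symmetric]) (auto simp: inj_on_Un inj_on_def)
    qed
    have "card S2 = (\<Sum>\<tau>\<in>S2. 1)" by simp
    also have "\<dots> \<le> (\<Sum>\<tau>\<in>S2. card (Tp \<tau> \<inter> Y))"
      by (intro sum_mono) (use fY in \<open>auto simp: S2_def Suc_le_eq card_gt_0_iff\<close>)
    also have "\<dots> = card (\<Union>\<tau>\<in>S2. Tp \<tau> \<inter> Y)"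
    proof (rule card_UN_disjoint[symmetric])
      show "\<forall>\<tau>\<in>S2. \<forall>\<tau>'\<in>S2. \<tau> \<noteq> \<tau>' \<longrightarrow> Tp \<tau> \<inter> Y \<inter> (Tp \<tau>' \<inter> Y) = {}"
        using disj unfolding S2_def by blast
    qed (use fS fY in auto)
    also have "\<dots> \<le> card Y" by (rule card_mono) (use fY in auto)
    finally have S2: "real (card S2) \<le> y" unfolding y_def by simp
    have "(\<Sum>\<tau>\<in>S1. real (card (Y \<inter> cd f \<tau> \<tau>))) \<le> (\<Sum>\<tau>\<in>S1. real (card {v\<in>Y. Tp \<tau> \<subseteq> nb v}))"
    proof (intro sum_mono of_nat_mono card_mono)
      fix \<tau> assume "\<tau> \<in> S1"
      show "Y \<inter> cd f \<tau> \<tau> \<subseteq> {v\<in>Y. Tp \<tau> \<subseteq> nb v}" unfolding cd_def cand_def Tp_def using nb_sym by auto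
    qed (use fY in auto)
    also have "\<dots> \<le> (1 + \<epsilon>) * real (card Y) * (\<Sum>\<tau>\<in>S1. p ^ card (Tp \<tau>)) + K * (real (card S1) + real (card Y)) * ln (real N)"
    proof (rule few_stars)
      fix \<tau> assume t: "\<tau> \<in> S1"
      then have w: "\<tau> \<in> win i t" unfolding S1_def S_def by auto
      have tn: "\<tau> < n" using winl[OF w] l_le by simp
      have "f u \<in> {..<N}" if "u < \<tau>" for u using valid_lt[OF v, of u] V winl[OF w] that by auto
      then have "Tp \<tau> \<subseteq> {..<N}" unfolding Tp_def by auto
      moreover have "card (Tp \<tau>) \<le> \<Delta>"
        using cTp[OF w] hn_deg[OF tn] card_mono[OF fin_hn[OF tn], of "hn \<tau> \<inter> {..<\<tau>}"] unfolding bd_def by auto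
      ultimately show "Tp \<tau> \<subseteq> {..<N} \<and> card (Tp \<tau>) \<le> \<Delta> \<and> Tp \<tau> \<inter> Y = {}" using t unfolding S1_def by auto
    next
      show "Tp \<tau> \<inter> Tp \<tau>' = {}" if "\<tau> \<in> S1" "\<tau>' \<in> S1" "\<tau> \<noteq> \<tau>'" for \<tau> \<tau>'
        using disj that unfolding S1_def by auto
    qed (use fS Y V in auto)
    also have "(\<Sum>\<tau>\<in>S1. p ^ card (Tp \<tau>)) = real (card S1) * p ^ k"
    proof -
      have "(\<Sum>\<tau>\<in>S1. p ^ card (Tp \<tau>)) = (\<Sum>\<tau>\<in>S1. p ^ k)"
        by (rule sum.cong[OF refl]) (use cTp in \<open>auto simp: S1_def S_def\<close>)
      then show ?thesis by simp
    qed
    also have "(1 + \<epsilon>) * real (card Y) * (real (card S1) * p ^ k) + K * (real (card S1) + real (card Y)) * ln (real N)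
       \<le> (1 + \<epsilon>) * p ^ k * y * real (card (S (c, k))) + K * L * (real (card (S (c, k))) + y)"
    proof -
      have c: "real (card S1) \<le> real (card (S (c, k)))" using fS unfolding S1_def by (auto intro: card_mono)
      have "(1 + \<epsilon>) * p ^ k * y * real (card S1) \<le> (1 + \<epsilon>) * p ^ k * y * real (card (S (c, k)))"
        using c \<epsilon> p unfolding y_def by (intro mult_left_mono) auto
      moreover have "K * L * (real (card S1) + y) \<le> K * L * (real (card (S (c, k))) + y)"
        using c KL by (intro mult_left_mono) auto
      ultimately show ?thesis unfolding y_def L_def by (simp add: mult_ac)
    qed
    finally have 1: "(\<Sum>\<tau>\<in>S1. real (card (Y \<inter> cd f \<tau> \<tau>))) \<le> (1 + \<epsilon>) * p ^ k * y * real (card (S (c, k))) + K * L * (real (card (S (c, k))) + y)" .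
    have "(\<Sum>\<tau>\<in>S2. real (card (Y \<inter> cd f \<tau> \<tau>))) \<le> (\<Sum>\<tau>\<in>S2. y)"
      unfolding y_def by (intro sum_mono of_nat_mono card_mono) (use fY in auto)
    also have "\<dots> \<le> y * y" using S2 Y0 unfolding y_def by (simp add: mult_right_mono)
    finally have 2: "(\<Sum>\<tau>\<in>S2. real (card (Y \<inter> cd f \<tau> \<tau>))) \<le> y * y" .
    have "S (c, k) = S1 \<union> S2" unfolding S1_def S2_def by auto
    moreover have "S1 \<inter> S2 = {}" unfolding S1_def S2_def by auto
    ultimately have "(\<Sum>\<tau>\<in>S (c, k). real (card (Y \<inter> cd f \<tau> \<tau>))) = (\<Sum>\<tau>\<in>S1. real (card (Y \<inter> cd f \<tau> \<tau>))) + (\<Sum>\<tau>\<in>S2. real (card (Y \<inter> cd f \<tau> \<tau>)))"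
      using fS by (simp add: sum.union_disjoint)
    then show ?thesis using 1 2 by linarith
  qed
  have grp: "(\<Sum>\<tau>\<in>S ck. wgt \<tau> * real (card (Y \<inter> cd f \<tau> \<tau>))) \<le> (1 + \<xi> / 2) / (al * \<nu>) * y * real (card (S ck)) + wm * (K * L) * real (card (S ck)) + (wm * (K * L) * y + wm * (y * y))"
    if "ck \<in> P" for ck
  proof -
    obtain c k where ck: "ck = (c, k)" by (cases ck)
    then have k: "k \<le> D" using that unfolding P_def by simp
    have "(\<Sum>\<tau>\<in>S ck. wgt \<tau> * real (card (Y \<inter> cd f \<tau> \<tau>))) = (\<Sum>\<tau>\<in>S ck. w k * real (card (Y \<inter> cd f \<tau> \<tau>)))"
      by (rule sum.cong[OF refl]) (use wgt_w in \<open>auto simp: ck S_def\<close>)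
    also have "\<dots> = w k * (\<Sum>\<tau>\<in>S ck. real (card (Y \<inter> cd f \<tau> \<tau>)))" by (simp add: sum_distrib_left)
    also have "\<dots> \<le> w k * ((1 + \<epsilon>) * p ^ k * y * real (card (S ck)) + K * L * (real (card (S ck)) + y) + y * y)"
      using group that w0 unfolding ck by (intro mult_left_mono) auto
    also have "\<dots> = w k * ((1 + \<epsilon>) * p ^ k) * (y * real (card (S ck))) + w k * (K * L * (real (card (S ck)) + y) + y * y)"
      by (simp add: algebra_simps)
    also have "\<dots> \<le> (1 + \<xi> / 2) / (al * \<nu>) * (y * real (card (S ck))) + wm * (K * L * (real (card (S ck)) + y) + y * y)"
      using w_main[OF k] w_le[OF k] KL unfolding y_def by (intro add_mono mult_right_mono) auto
    finally show ?thesis by (simp add: algebra_simps)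
  qed
  have cP: "real (card P) = C" unfolding P_def C_def by (simp add: algebra_simps)
  have collect: "(\<Sum>ck\<in>P. A * g ck + B * g ck + E) = (A + B) * (\<Sum>ck\<in>P. g ck) + C * E" for A B E and g :: "nat \<times> nat \<Rightarrow> real"
    by (simp add: sum.distrib sum_distrib_left[symmetric] cP distrib_right)
  have "\<Lambda> i * y = (\<Sum>v\<in>Y. \<Lambda> i)" unfolding y_def by simp
  also have "\<dots> < (\<Sum>v\<in>Y. \<Sum>\<tau>\<in>win i t. if v \<in> cd f \<tau> \<tau> then wgt \<tau> else 0)"
  proof (rule sum_strict_mono[OF fY])
    show "Y \<noteq> {}" using Y0 by auto
    fix v assume "v \<in> Y"
    then obtain \<tau> where "\<tau> \<in> win i t" "\<Lambda> i < load f \<tau> v" using heavy by blast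
    then show "\<Lambda> i < (\<Sum>\<tau>\<in>win i t. if v \<in> cd f \<tau> \<tau> then wgt \<tau> else 0)"
      using load_le_total(2)[OF tl, of \<tau> i "{}" v f] by auto
  qed
  also have "\<dots> = (\<Sum>\<tau>\<in>win i t. \<Sum>v\<in>Y. if v \<in> cd f \<tau> \<tau> then wgt \<tau> else 0)" by (rule sum.swap)
  also have "\<dots> = (\<Sum>\<tau>\<in>win i t. wgt \<tau> * real (card (Y \<inter> cd f \<tau> \<tau>)))"
    by (rule sum.cong[OF refl]) (use fY in \<open>simp add: sum.inter_restrict[symmetric] mult.commute\<close>)
  also have "\<dots> = (\<Sum>ck\<in>P. \<Sum>\<tau>\<in>S ck. wgt \<tau> * real (card (Y \<inter> cd f \<tau> \<tau>)))" by (rule part)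
  also have "\<dots> \<le> (\<Sum>ck\<in>P. (1 + \<xi> / 2) / (al * \<nu>) * y * real (card (S ck)) + wm * (K * L) * real (card (S ck)) + (wm * (K * L) * y + wm * (y * y)))"
    by (rule sum_mono[OF grp])
  also have "\<dots> = ((1 + \<xi> / 2) / (al * \<nu>) * y + wm * (K * L)) * (\<Sum>ck\<in>P. real (card (S ck))) + C * (wm * (K * L) * y + wm * (y * y))"
    by (rule collect)
  also have "\<dots> \<le> ((1 + \<xi> / 2) / (al * \<nu>) * y + wm * (K * L)) * real \<omega> + C * (wm * (K * L) * y + wm * (y * y))"
  proof -
    have "0 \<le> (1 + \<xi> / 2) / (al * \<nu>) * y + wm * (K * L)"
      using params al0 \<nu>_pos wm0 K L_ge_1 unfolding y_def by (intro add_nonneg_nonneg mult_nonneg_nonneg) auto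
    then show ?thesis using cS by (intro add_right_mono mult_left_mono) auto
  qed
  finally have main: "\<Lambda> i * y < (1 + \<xi> / 2) / (al * \<nu>) * y * real \<omega> + wm * (K * L) * real \<omega> + C * (wm * (K * L)) * y + C * wm * y * y"
    by (simp add: algebra_simps)
  \<comment> \<open>The gap between \<open>1 + \<xi>\<close> in \<open>\<Lambda>\<close> and
    \<open>1 + \<xi> / 2\<close> in the main term is worth at least three such units, one for each
    error term.\<close>
  define x where "x = \<xi> / 6 * (real \<omega> / \<nu>) * y"
  have x0: "x \<ge> 0" unfolding x_def y_def using params \<nu>_pos by simp
  have \<Lambda>: "\<Lambda> i * y \<ge> (1 + \<xi> / 2) / (al * \<nu>) * y * real \<omega> + 3 * x"
  proof -
    have "\<Lambda> i * y = (1 + \<xi> / 2) / (al * \<nu>) * y * real \<omega> + 3 * x * (1 / al)"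
      unfolding \<Lambda>_def al_def[symmetric] x_def using al0 \<nu>_pos by (simp add: field_simps)
    moreover have "3 * x * 1 \<le> 3 * x * (1 / al)"
      using x0 al al0 by (intro mult_left_mono) auto
    ultimately show ?thesis by simp
  qed
  \<comment> \<open>The critical estimate: the logarithmic error times the weight
    \<open>1 / (q ^ D * \<nu>)\<close> must be small against \<open>card Y / \<nu>\<close>, and
    \<open>card Y\<close> is of order \<open>q ^ d' * \<nu>\<close>. Hence the exponent
    \<open>D + d'\<close> in \<open>big\<close>.\<close>
  have e1: "wm * (K * L) * real \<omega> \<le> x"
  proof -
    have "24 * (K * L) \<le> \<Gamma> * (\<sigma> * \<xi> * \<epsilon>') * (K * L)" using \<Gamma>2 KL by (intro mult_right_mono) auto
    also have "\<dots> = (\<sigma> * \<xi> * \<epsilon>') * (\<Gamma> * (K * L))" by (simp add: mult_ac)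
    also have "\<dots> \<le> (\<sigma> * \<xi> * \<epsilon>') * (q ^ (D + d') * \<nu>)" using qV_big \<sigma> params by (intro mult_left_mono) auto
    also have "\<dots> = \<sigma> * \<xi> * q ^ D * (\<epsilon>' * \<theta>)" unfolding \<theta>_def by (simp add: power_add mult_ac)
    also have "\<dots> \<le> \<sigma> * \<xi> * q ^ D * y" using Y(2) \<sigma> params q unfolding y_def by (intro mult_left_mono) auto
    finally have "24 * (K * L) \<le> \<sigma> * \<xi> * q ^ D * y" .
    then have "wm * (K * L) \<le> \<xi> / 6 * (1 / \<nu>) * y" unfolding wm_def using \<sigma> q \<nu>_pos by (simp add: field_simps)
    then have "wm * (K * L) * real \<omega> \<le> \<xi> / 6 * (1 / \<nu>) * y * real \<omega>" by (intro mult_right_mono) auto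
    then show ?thesis unfolding x_def by (simp add: mult_ac)
  qed
  have xe: "\<xi> / 6 * \<eta> * y \<le> x" unfolding x_def y_def using \<omega>_\<nu> params by (intro mult_right_mono mult_left_mono) auto
  have e2: "C * (wm * (K * L)) * y \<le> x"
  proof -
    have "24 * C * (K * L) \<le> \<Gamma> * (\<sigma> * \<xi> * \<eta>) * (K * L)" using \<Gamma>3 KL unfolding C_def by (intro mult_right_mono) auto
    also have "\<dots> = (\<sigma> * \<xi> * \<eta>) * (\<Gamma> * (K * L))" by (simp add: mult_ac)
    also have "\<dots> \<le> (\<sigma> * \<xi> * \<eta>) * (q ^ D * \<nu>)" using \<Gamma>_le_\<nu>(4) \<sigma> params by (intro mult_left_mono) auto
    finally have "C * (wm * (K * L)) \<le> \<xi> / 6 * \<eta>" unfolding wm_def using \<sigma> qD by (simp add: field_simps)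
    then have "C * (wm * (K * L)) * y \<le> \<xi> / 6 * \<eta> * y" unfolding y_def by (intro mult_right_mono) auto
    then show ?thesis using xe by simp
  qed
  have e3: "C * wm * y * y \<le> x"
  proof -
    have "\<theta> \<le> q ^ D * \<nu>" unfolding \<theta>_def using D \<nu>_pos by (intro mult_right_mono q_power_le) auto
    then have "2 * (\<epsilon>' * \<theta>) \<le> 2 * (\<epsilon>' * (q ^ D * \<nu>))" using params by (intro mult_left_mono) auto
    then have "y \<le> 2 * (\<epsilon>' * (q ^ D * \<nu>))" using Y(3) unfolding y_def by linarith
    then have "C * wm * y \<le> C * wm * (2 * (\<epsilon>' * (q ^ D * \<nu>)))" using C1 wm0 by (intro mult_left_mono) auto
    also have "\<dots> = 8 * C * \<epsilon>' / \<sigma>" unfolding wm_def using \<sigma> q \<nu>_pos by (simp add: field_simps)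
    \<comment> \<open>\<open>\<epsilon>'\<close> is defined as the solution of this equation; its 48
      is 8 times 6.\<close>
    also have "\<dots> = \<xi> / 6 * \<eta>" unfolding \<epsilon>' C_def[symmetric] using C1 \<sigma> by (simp add: field_simps)
    finally have "C * wm * y * y \<le> \<xi> / 6 * \<eta> * y" unfolding y_def by (intro mult_right_mono) auto
    then show ?thesis using xe by simp
  qed
  show False using main \<Lambda> e1 e2 e3 by linarith
qed

end

section \<open>Consumption of common neighbourhoods\<close>

context windows
begin

lemma pot1_term:
  assumes "i \<le> l div \<omega>" "U \<subseteq> {..<N}" "pot1 f t \<le> 1"
  shows "\<xi> * real (hits i U f t) \<le> (exp \<xi> - 1) * drift i U f t + (2 * real (card U) + 3) * L"
proof -
  let ?g = "\<lambda>(i, U). exp (- (2 * real (card U) + 3) * L) * exp (\<xi> * real (hits i U f t) - (exp \<xi> - 1) * drift i U f t)"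
  have "?g (i, U) \<le> pot1 f t" unfolding pot1_def
    by (rule member_le_sum[of "(i, U)" _ ?g]) (use assms in auto)
  then have "exp (- (2 * real (card U) + 3) * L) * exp (\<xi> * real (hits i U f t) - (exp \<xi> - 1) * drift i U f t) \<le> 1"
    using assms(3) by simp
  then have "- (2 * real (card U) + 3) * L + (\<xi> * real (hits i U f t) - (exp \<xi> - 1) * drift i U f t) \<le> 0"
    by (simp only: exp_add[symmetric] exp_le_one_iff)
  then show ?thesis by (simp add: algebra_simps)
qed

text \<open>Since \<open>\<sigma> / 4 = 8 * \<xi>\<close>, the slope of \<open>a\<close> covers
  three factors \<open>1 + \<xi>\<close>, together at most \<open>1 + 7 * \<xi>\<close>, with one
  \<open>\<xi>\<close> left for \<open>3 * \<epsilon>'\<close>. The factors come from the tail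
  bound, from \<open>\<Lambda>\<close> and from comparing \<open>a i\<close> with
  \<open>a (i + 1)\<close>.\<close>

lemma a_recursion:
  assumes "i * \<omega> \<le> l"
  shows "a (i + 1) \<le> a i * (1 - (1 + \<xi>) * \<Lambda> i) - 3 * \<epsilon>'" "(1 + \<xi>) * \<Lambda> i \<le> 1"
proof -
  have al: "\<sigma> / 2 \<le> a (i + 1)" "\<sigma> / 2 \<le> a i" using a_ge[of "i + 1"] a_ge[of i] assms by auto
  have al0: "a (i + 1) > 0" using al \<sigma> by linarith
  define z where "z = real \<omega> / \<nu>"
  have z: "z \<le> \<sigma>^2 / 128" "\<eta> \<le> z" using \<omega>_\<nu> unfolding z_def by auto
  have z0: "z \<ge> 0" using z params by linarith
  have \<Lambda>: "\<Lambda> i = (1 + \<xi>) * z / a (i + 1)" unfolding \<Lambda>_def z_def using \<nu>_pos al0 by (simp add: field_simps)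
  have z\<xi>: "4 * z \<le> \<xi> * \<sigma>" using z(1) unfolding \<xi> by (simp add: power2_eq_square)
  have ratio: "a i \<le> (1 + \<xi>) * a (i + 1)"
  proof -
    have "a i = a (i + 1) + (1 + \<sigma> / 4) * z" unfolding z_def a_step by simp
    also have "(1 + \<sigma> / 4) * z \<le> 2 * z" using \<sigma> z0 by (intro mult_right_mono) auto
    also have "\<dots> \<le> \<xi> * (\<sigma> / 2)" using z\<xi> by simp
    also have "\<dots> \<le> \<xi> * a (i + 1)" using al params by (intro mult_left_mono) auto
    finally show ?thesis by (simp add: algebra_simps)
  qed
  have "3 * \<epsilon>' \<le> \<xi> * z"
  proof -
    have C: "real cN * (real D + 1) \<ge> 1 * 1" using cN by (intro mult_mono) auto
    have "\<xi> * \<eta> * \<sigma> \<le> \<xi> * \<eta> * 1" using params \<sigma> by (intro mult_left_mono) auto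
    also have "\<dots> \<le> \<xi> * \<eta> * (16 * (real cN * (real D + 1)))" using params C by (intro mult_left_mono) auto
    finally have "3 * (\<xi> * \<eta> * \<sigma>) \<le> 3 * (\<xi> * \<eta> * (16 * (real cN * (real D + 1))))" by (rule mult_left_mono) simp
    also have "\<dots> = \<xi> * \<eta> * (48 * (real cN * (real D + 1)))" by simp
    finally have "3 * (\<xi> * \<eta> * \<sigma>) \<le> \<xi> * \<eta> * (48 * (real cN * (real D + 1)))" .
    moreover have "48 * (real cN * (real D + 1)) > 0" using C by linarith
    ultimately have "3 * \<epsilon>' \<le> \<xi> * \<eta>" unfolding \<epsilon>' by (simp only: pos_divide_le_eq times_divide_eq_right)
    also have "\<dots> \<le> \<xi> * z" using z params by (intro mult_left_mono) auto
    finally show ?thesis .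
  qed
  moreover have "a i * ((1 + \<xi>) * \<Lambda> i) \<le> (1 + 7 * \<xi>) * z"
  proof -
    have "a i * ((1 + \<xi>) * \<Lambda> i) = (a i / a (i + 1)) * ((1 + \<xi>) * (1 + \<xi>) * z)" unfolding \<Lambda> by simp
    also have "\<dots> \<le> (1 + \<xi>) * ((1 + \<xi>) * (1 + \<xi>) * z)"
      using ratio al0 params z0 by (intro mult_right_mono) (auto simp: pos_divide_le_eq)
    also have "\<dots> = ((1 + \<xi>) * ((1 + \<xi>) * (1 + \<xi>))) * z" by simp
    also have "\<dots> \<le> (1 + 7 * \<xi>) * z"
    proof (intro mult_right_mono z0)
      have "\<xi> * \<xi> \<le> 1 * \<xi>" using params by (intro mult_right_mono) auto
      moreover have "\<xi> * (\<xi> * \<xi>) \<le> 1 * (1 * \<xi>)" using params by (intro mult_mono) auto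
      ultimately show "(1 + \<xi>) * ((1 + \<xi>) * (1 + \<xi>)) \<le> 1 + 7 * \<xi>" by (simp add: algebra_simps)
    qed
    finally show ?thesis .
  qed
  moreover have s4: "(1 + \<sigma> / 4) * z = (1 + 7 * \<xi>) * z + \<xi> * z" unfolding \<xi> by (simp add: algebra_simps)
  ultimately show "a (i + 1) \<le> a i * (1 - (1 + \<xi>) * \<Lambda> i) - 3 * \<epsilon>'"
    unfolding a_step z_def[symmetric] right_diff_distrib mult_1_right s4 by linarith
  have "(1 + \<xi>) * \<Lambda> i = ((1 + \<xi>) * (1 + \<xi>)) * z / a (i + 1)" unfolding \<Lambda> by simp
  also have "\<dots> \<le> 2 * z / (\<sigma> / 2)"
  proof (intro frac_le mult_right_mono z0)
    have "\<xi> * \<xi> \<le> (1/32) * (1/32)" using params by (intro mult_mono) auto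
    then show "(1 + \<xi>) * (1 + \<xi>) \<le> 2" using params by (simp add: algebra_simps)
  qed (use al \<sigma> z0 in auto)
  also have "\<dots> = 4 * z / \<sigma>" by simp
  also have "\<dots> \<le> \<xi>" using z\<xi> \<sigma> by (simp add: pos_divide_le_eq)
  finally show "(1 + \<xi>) * \<Lambda> i \<le> 1" using params by linarith
qed

text \<open>The vertices of \<open>CL U\<close> lost since the start of the window are light or
  heavy when chosen. The bound on \<open>pot1\<close> limits the light ones to about
  \<open>1 + \<xi>\<close> times the drift plus a proportion \<open>\<epsilon>'\<close>; the heavy
  ones are at most a proportion \<open>2 * \<epsilon>'\<close>, as otherwise some of them contradict
  \<open>few_heavy\<close>. The recursion for \<open>a\<close> is calibrated to this loss.\<close>

lemma free_in_window:
  assumes v: "valid f s" and i: "i * \<omega> \<le> s" "s \<le> (i + 1) * \<omega>" and pot: "pot1 f s \<le> 1"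
    and U: "U \<subseteq> {..<N}" "card U \<le> d'" "\<theta> \<le> real (card (CL U))"
    and start: "a i * real (card (CL U)) \<le> real (card (CL U - f ` {..<i * \<omega>}))"
  shows "a (i + 1) * real (card (CL U)) \<le> real (card (CL U - f ` {..<s}))"
proof -
  have sl: "s \<le> l" using v unfolding valid_def by simp
  then have il: "i * \<omega> \<le> l" using i by simp
  define Z where "Z = CL U - f ` {..<i * \<omega>}"
  have fZ: "finite Z" unfolding Z_def using fin_CL by simp
  define H where "H = {v\<in>CL U. \<exists>\<tau>\<in>win i s. \<Lambda> i < load f \<tau> v}"
  have fH: "finite H" unfolding H_def using fin_CL by simp
  define c where "c = real (card (CL U))"
  have \<theta>0: "\<theta> > 0" unfolding \<theta>_def using q \<nu>_pos by simp
  have e\<theta>: "1 \<le> \<epsilon>' * \<theta>"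
  proof -
    have "1 \<le> \<Gamma> * \<epsilon>'" by (rule \<Gamma>_eps)
    also have "\<dots> \<le> \<theta> * \<epsilon>'" using \<Gamma>_le_\<nu> params by (intro mult_right_mono) auto
    finally show ?thesis by (simp add: mult.commute)
  qed
  have cH: "real (card H) \<le> 2 * \<epsilon>' * c"
  proof (rule ccontr)
    assume "\<not> ?thesis"
    moreover have "2 * \<epsilon>' * \<theta> \<le> 2 * \<epsilon>' * c" using U(3) params unfolding c_def by (intro mult_left_mono) auto
    ultimately have "real (card H) > 2 * (\<epsilon>' * \<theta>)" by linarith
    then have "nat \<lceil>\<epsilon>' * \<theta>\<rceil> \<le> card H" using e\<theta> by linarith
    then obtain Y where Y: "Y \<subseteq> H" "card Y = nat \<lceil>\<epsilon>' * \<theta>\<rceil>" "finite Y" using obtain_subset_with_card_n by blast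
    show False
    proof (rule few_heavy[OF v il])
      show "Y \<subseteq> V" using Y(1) CL_V unfolding H_def by auto
      show "\<epsilon>' * \<theta> \<le> real (card Y)" "real (card Y) \<le> 2 * (\<epsilon>' * \<theta>)" unfolding Y(2) using e\<theta> by linarith+
      show "\<exists>\<tau>\<in>win i s. \<Lambda> i < load f \<tau> v" if "v \<in> Y" for v using that Y(1) unfolding H_def by auto
    qed
  qed
  have hit: "real (hits i U f s) \<le> (1 + \<xi>) * \<Lambda> i * real (card Z) + \<epsilon>' * c"
  proof -
    have "i \<le> l div \<omega>" using il \<omega>_bounds(3) by (simp add: less_eq_div_iff_mult_less_eq)
    then have "\<xi> * real (hits i U f s) \<le> (exp \<xi> - 1) * drift i U f s + (2 * real (card U) + 3) * L"
      by (rule pot1_term[OF _ U(1) pot])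
    also have "(exp \<xi> - 1) * drift i U f s \<le> (\<xi> * (1 + \<xi>)) * (\<Lambda> i * real (card Z))"
    proof (intro mult_mono)
      show "exp \<xi> - 1 \<le> \<xi> * (1 + \<xi>)" using exp_bound[of \<xi>] params by (simp add: power2_eq_square algebra_simps)
      show "drift i U f s \<le> \<Lambda> i * real (card Z)" unfolding Z_def by (rule drift_le[OF sl il])
      show "0 \<le> drift i U f s" unfolding drift_def using sl
        by (intro sum_nonneg mult_nonneg_nonneg wgt_nonneg) (auto simp: win_def)
    qed (use params in auto)
    also have "(2 * real (card U) + 3) * L \<le> \<xi> * (\<epsilon>' * c)"
    proof -
      have "(2 * real (card U) + 3) * L \<le> (2 * real d' + 3) * (K * L)"
        using U(2) L_ge_1 K mult_right_mono[of 1 K L] by (intro mult_mono) auto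
      also have "\<dots> \<le> \<Gamma> * (\<xi> * \<epsilon>') * (K * L)" using \<Gamma>4 KL by (intro mult_right_mono) auto
      also have "\<dots> = (\<xi> * \<epsilon>') * (\<Gamma> * (K * L))" by (simp add: mult_ac)
      also have "\<dots> \<le> (\<xi> * \<epsilon>') * \<theta>"
      proof (intro mult_left_mono)
        have "q ^ (D + d') * \<nu> \<le> \<theta>" unfolding \<theta>_def using \<nu>_pos by (intro mult_right_mono q_power_le) auto
        then show "\<Gamma> * (K * L) \<le> \<theta>" using qV_big by linarith
      qed (use params in auto)
      also have "\<dots> \<le> (\<xi> * \<epsilon>') * c" using U(3) params unfolding c_def by (intro mult_left_mono) auto
      finally show ?thesis by (simp add: mult.assoc)
    qed
    finally have "\<xi> * real (hits i U f s) \<le> \<xi> * ((1 + \<xi>) * \<Lambda> i * real (card Z) + \<epsilon>' * c)"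
      by (simp add: algebra_simps)
    then show ?thesis using params by simp
  qed
  have "Z \<subseteq> (CL U - f ` {..<s}) \<union> f ` {\<tau>\<in>win i s. f \<tau> \<in> light f i U \<tau>} \<union> H"
  proof
    fix x assume x: "x \<in> Z"
    show "x \<in> (CL U - f ` {..<s}) \<union> f ` {\<tau>\<in>win i s. f \<tau> \<in> light f i U \<tau>} \<union> H"
    proof (cases "x \<in> f ` {..<s}")
      case True
      then obtain \<tau> where \<tau>: "\<tau> < s" "x = f \<tau>" by auto
      have "i * \<omega> \<le> \<tau>" using x \<tau> unfolding Z_def by (auto simp: not_less[symmetric])
      then have w: "\<tau> \<in> win i s" using \<tau> i by (simp add: win_iff)
      show ?thesis
      proof (cases "load f \<tau> x \<le> \<Lambda> i")
        case True
        then have "f \<tau> \<in> light f i U \<tau>" using x \<tau> unfolding light_def Z_def by simp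
        then show ?thesis using w \<tau> by auto
      next
        case False
        then have "\<Lambda> i < load f \<tau> x" by simp
        then have "x \<in> H" using x w unfolding H_def Z_def by blast
        then show ?thesis by simp
      qed
    qed (use x in \<open>auto simp: Z_def\<close>)
  qed
  then have "card Z \<le> card ((CL U - f ` {..<s}) \<union> f ` {\<tau>\<in>win i s. f \<tau> \<in> light f i U \<tau>} \<union> H)"
    by (rule card_mono[rotated]) (use fin_CL fH finite_win in auto)
  also have "\<dots> \<le> card (CL U - f ` {..<s}) + card (f ` {\<tau>\<in>win i s. f \<tau> \<in> light f i U \<tau>}) + card H"
    by (meson add_le_mono card_Un_le le_refl le_trans)
  also have "card (f ` {\<tau>\<in>win i s. f \<tau> \<in> light f i U \<tau>}) \<le> hits i U f s"
    unfolding hits_def by (rule card_image_le) (use finite_win in simp)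
  finally have "real (card Z) \<le> real (card (CL U - f ` {..<s})) + real (hits i U f s) + real (card H)" by linarith
  then have 1: "real (card Z) * (1 - (1 + \<xi>) * \<Lambda> i) - 3 * \<epsilon>' * c \<le> real (card (CL U - f ` {..<s}))"
    using hit cH by (simp add: algebra_simps)
  have "a (i + 1) * c \<le> (a i * (1 - (1 + \<xi>) * \<Lambda> i) - 3 * \<epsilon>') * c"
    unfolding c_def by (intro mult_right_mono a_recursion il) auto
  also have "\<dots> = (a i * c) * (1 - (1 + \<xi>) * \<Lambda> i) - 3 * \<epsilon>' * c" by (simp add: algebra_simps)
  also have "\<dots> \<le> real (card Z) * (1 - (1 + \<xi>) * \<Lambda> i) - 3 * \<epsilon>' * c"
    using start a_recursion(2)[OF il] unfolding c_def Z_def by (intro diff_right_mono mult_right_mono) auto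
  finally show ?thesis using 1 unfolding c_def by linarith
qed

text \<open>Induction over the completed windows, then one application inside the current one; the
  end of each window needs its own bound on \<open>pot1\<close>, hence the hypothesis for all
  \<open>s \<le> t\<close>.\<close>

lemma pot1_ctrl:
  assumes v: "valid f t" and pot: "\<And>s. s \<le> t \<Longrightarrow> pot1 f s \<le> 1"
  shows "ctrl f t"
  unfolding ctrl_def
proof (intro allI impI)
  fix U assume U: "U \<subseteq> {..<N}" "card U \<le> d'" "\<theta> \<le> real (card (CL U))"
  have start: "a i * real (card (CL U)) \<le> real (card (CL U - f ` {..<i * \<omega>}))" if "i * \<omega> \<le> t" for i
    using that
  proof (induction i)
    case 0
    then show ?case by (simp add: a_def)
  next
    case (Suc i)
    have i: "i * \<omega> \<le> t" using Suc.prems by simp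
    show ?case
      using free_in_window[OF valid_mono[OF v Suc.prems] _ _ pot[OF Suc.prems] U Suc.IH[OF i]] by simp
  qed
  show "a (t div \<omega> + 1) * real (card (CL U)) \<le> real (card (CL U - f ` {..<t}))"
  proof (rule free_in_window[OF v _ _ pot[OF le_refl] U])
    show "t div \<omega> * \<omega> \<le> t" by simp
    then show "a (t div \<omega>) * real (card (CL U)) \<le> real (card (CL U - f ` {..<t div \<omega> * \<omega>}))" by (rule start)
    show "t \<le> (t div \<omega> + 1) * \<omega>" using \<omega>_bounds(3) dividend_less_div_times[of \<omega> t] by (simp add: algebra_simps)
  qed
qed

lemma cd_CL: assumes "t < l" shows "cd f t t = CL (f ` (hn t \<inter> {..<t}))"
  unfolding cd_def cand_def CL_def using Reg_V[OF assms] by auto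

text \<open>The candidate set of \<open>t\<close> is itself the common neighbourhood of at most
  \<open>D \<le> d'\<close> images and has at least \<open>\<theta>\<close> vertices, so
  \<open>ctrl\<close> applies to it. This closes the loop: controlled consumption keeps choices
  plentiful, and plentiful choices keep probabilities below \<open>wgt\<close>.\<close>

lemma avail_ctrl:
  assumes v: "valid f t" and t: "t < l" and c: "ctrl f t"
  shows "1 / wgt t \<le> real (card (avail f t))" "(1 - \<epsilon>) * (\<sigma> / 2) * (q ^ bd t * \<nu>) \<le> real (card (avail f t))"
    "avail f t \<noteq> {}" "finite (avail f t)"
proof -
  let ?U = "f ` (hn t \<inter> {..<t})"
  have tn: "t < n" using t l_le by simp
  have aw: "\<sigma> / 2 \<le> a (t div \<omega> + 1)" by (rule a_win[OF t])
  have "card ?U \<le> bd t" unfolding bd_def by (rule card_image_le) simp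
  then have cU: "card ?U \<le> d'" using back_deg[OF t] D unfolding bd_def by simp
  have UN: "?U \<subseteq> {..<N}" using valid_lt[OF v] V by auto
  have "q ^ bd t * \<nu> \<le> real (card (cd f t t))"
    using valid_tracked(1)[OF v, of t] tn Reg_V[OF t] unfolding \<nu>_def bd_def by simp
  moreover have "\<theta> \<le> q ^ bd t * \<nu>" unfolding \<theta>_def using back_deg[OF t] D \<nu>_pos unfolding bd_def
    by (intro mult_right_mono q_power_le) auto
  ultimately have "\<theta> \<le> real (card (CL ?U))" unfolding cd_CL[OF t] by linarith
  then have "a (t div \<omega> + 1) * real (card (cd f t t)) \<le> real (card (cd f t t - f ` {..<t}))"
    using c UN cU unfolding ctrl_def cd_CL[OF t] by blast
  then have 1: "(1 - \<epsilon>) * a (t div \<omega> + 1) * (q ^ bd t * \<nu>) \<le> real (card (avail f t))"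
    by (rule avail_large[OF v t aw])
  then show "1 / wgt t \<le> real (card (avail f t))" unfolding wgt_def by simp
  have "(1 - \<epsilon>) * (\<sigma> / 2) * (q ^ bd t * \<nu>) \<le> (1 - \<epsilon>) * a (t div \<omega> + 1) * (q ^ bd t * \<nu>)"
    using aw \<epsilon> q \<nu>_pos by (intro mult_right_mono mult_left_mono) auto
  then show 2: "(1 - \<epsilon>) * (\<sigma> / 2) * (q ^ bd t * \<nu>) \<le> real (card (avail f t))" using 1 by linarith
  have "0 < (1 - \<epsilon>) * (\<sigma> / 2) * (q ^ bd t * \<nu>)" using \<epsilon> \<sigma> q \<nu>_pos by simp
  then have "card (avail f t) > 0" using 2 by linarith
  then show "avail f t \<noteq> {}" "finite (avail f t)" by (auto simp: card_gt_0_iff)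
qed

lemma load_cong:
  assumes "\<And>x. x < t \<Longrightarrow> f x = g x" "\<tau> \<le> t"
  shows "load f \<tau> v = load g \<tau> v"
  unfolding load_def
proof (rule sum.cong[OF refl])
  fix s assume "s \<in> {\<tau> div \<omega> * \<omega>..\<tau>}"
  then have "cd f s s = cd g s s" by (intro cd_cong assms) (use assms in auto)
  then show "(if v \<in> cd f s s then wgt s else 0) = (if v \<in> cd g s s then wgt s else 0)" by simp
qed

lemma light_cong:
  assumes "\<And>x. x < t \<Longrightarrow> f x = g x" "\<tau> \<le> t" "i * \<omega> \<le> t"
  shows "light f i U \<tau> = light g i U \<tau>"
proof -
  have "f ` {..<i * \<omega>} = g ` {..<i * \<omega>}" by (rule image_cong) (use assms in auto)
  then show ?thesis unfolding light_def using load_cong[OF assms(1,2)] by simp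
qed

lemma hits_drift_cong:
  assumes fg: "\<And>x. x < t \<Longrightarrow> f x = g x" and "s \<le> t"
  shows "hits i U f s = hits i U g s" "drift i U f s = drift i U g s"
proof -
  have eq: "light f i U \<tau> = light g i U \<tau>" "f \<tau> = g \<tau>" "cd f \<tau> \<tau> = cd g \<tau> \<tau>" if "\<tau> \<in> win i s" for \<tau>
  proof -
    have "\<tau> < t" "i * \<omega> \<le> t" using that assms(2) by (auto simp: win_iff)
    then show "light f i U \<tau> = light g i U \<tau>" by (intro light_cong[OF fg]) auto
    show "f \<tau> = g \<tau>" "cd f \<tau> \<tau> = cd g \<tau> \<tau>" using \<open>\<tau> < t\<close> by (auto intro!: fg cd_cong)
  qed
  have "{\<tau>\<in>win i s. f \<tau> \<in> light f i U \<tau>} = {\<tau>\<in>win i s. g \<tau> \<in> light g i U \<tau>}" using eq by auto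
  then show "hits i U f s = hits i U g s" unfolding hits_def by simp
  show "drift i U f s = drift i U g s" unfolding drift_def by (rule sum.cong) (use eq in auto)
qed

lemma pot1_cong:
  assumes "\<And>x. x < t \<Longrightarrow> f x = g x" "s \<le> t"
  shows "pot1 f s = pot1 g s"
  unfolding pot1_def using hits_drift_cong[OF assms] by simp

lemma win_Suc: "win i (Suc t) = (if t div \<omega> = i then insert t (win i t) else win i t)"
  unfolding win_def by (auto simp: less_Suc_eq)

text \<open>A uniform choice from \<open>avail f t\<close> hits the light set with probability at
  most the increment \<open>x\<close> of the drift, because \<open>wgt t\<close> is at least the
  reciprocal of \<open>card (avail f t)\<close>; then
  \<open>1 + \<kappa> * x \<le> exp (\<kappa> * x)\<close>.\<close>

lemma pot1_term_step:
  assumes v: "valid f t" and t: "t < l" and c: "ctrl f t"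
  shows "(\<Sum>w\<in>avail f t. exp (\<xi> * real (hits i U (f(t := w)) (Suc t)) - (exp \<xi> - 1) * drift i U (f(t := w)) (Suc t)))
    \<le> real (card (avail f t)) * exp (\<xi> * real (hits i U f t) - (exp \<xi> - 1) * drift i U f t)" (is "?lhs \<le> ?A * ?r")
proof (cases "t div \<omega> = i")
  case False
  have "hits i U (f(t := w)) (Suc t) = hits i U f t" "drift i U (f(t := w)) (Suc t) = drift i U f t" for w
  proof -
    have "hits i U (f(t := w)) (Suc t) = hits i U (f(t := w)) t" unfolding hits_def win_Suc using False by simp
    then show "hits i U (f(t := w)) (Suc t) = hits i U f t" using hits_drift_cong(1)[of t "f(t := w)" f t] by simp
    have "drift i U (f(t := w)) (Suc t) = drift i U (f(t := w)) t" unfolding drift_def win_Suc using False by simp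
    then show "drift i U (f(t := w)) (Suc t) = drift i U f t" using hits_drift_cong(2)[of t "f(t := w)" f t] by simp
  qed
  then show ?thesis by simp
next
  case True
  have nw: "t \<notin> win i t" unfolding win_def by simp
  have it: "i * \<omega> \<le> t" using True by auto
  define E where "E = light f i U t"
  define \<kappa> where "\<kappa> = exp \<xi> - 1"
  have \<kappa>: "\<kappa> \<ge> 0" unfolding \<kappa>_def using params by simp
  define A where "A = avail f t"
  have fA: "finite A" "A \<noteq> {}" unfolding A_def using avail_ctrl[OF v t c] by auto
  have cA: "real (card A) > 0" using fA by (simp add: card_gt_0_iff)
  define x where "x = wgt t * real (card (cd f t t \<inter> E))"
  have upd: "light (f(t := w)) i U t = E" "cd (f(t := w)) t t = cd f t t" for w
    unfolding E_def by (auto intro!: light_cong[OF _ le_refl it] cd_cong)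
  have st: "{\<tau>\<in>insert t (win i t). (f(t := w)) \<tau> \<in> light (f(t := w)) i U \<tau>} =
     (if w \<in> E then insert t else id) {\<tau>\<in>win i t. (f(t := w)) \<tau> \<in> light (f(t := w)) i U \<tau>}" for w
    using upd nw by auto
  have h: "real (hits i U (f(t := w)) (Suc t)) = real (hits i U f t) + (if w \<in> E then 1 else 0)" for w
  proof -
    have "hits i U (f(t := w)) (Suc t) = hits i U (f(t := w)) t + (if w \<in> E then 1 else 0)"
      unfolding hits_def win_Suc if_P[OF True] st using nw finite_win by auto
    moreover have "hits i U (f(t := w)) t = hits i U f t" by (rule hits_drift_cong(1)[of t]) auto
    ultimately show ?thesis by simp
  qed
  have d: "drift i U (f(t := w)) (Suc t) = drift i U f t + x" for w
  proof -
    have "drift i U (f(t := w)) (Suc t) = drift i U (f(t := w)) t + x"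
      unfolding drift_def win_Suc if_P[OF True] x_def using nw finite_win upd by simp
    moreover have "drift i U (f(t := w)) t = drift i U f t" by (rule hits_drift_cong(2)[of t]) auto
    ultimately show ?thesis by simp
  qed
  have "?lhs = (\<Sum>w\<in>A. ?r * exp (- \<kappa> * x) * (1 + (if w \<in> E then \<kappa> else 0)))"
    unfolding A_def[symmetric] h d
  proof (rule sum.cong[OF refl])
    fix w
    have "\<xi> * (real (hits i U f t) + (if w \<in> E then 1 else 0)) - (exp \<xi> - 1) * (drift i U f t + x)
       = (\<xi> * real (hits i U f t) - (exp \<xi> - 1) * drift i U f t) + (- \<kappa> * x) + (if w \<in> E then \<xi> else 0)"
      unfolding \<kappa>_def by (simp add: algebra_simps)
    moreover have "exp (if w \<in> E then \<xi> else 0) = 1 + (if w \<in> E then \<kappa> else 0)" unfolding \<kappa>_def by simp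
    ultimately show "exp (\<xi> * (real (hits i U f t) + (if w \<in> E then 1 else 0)) - (exp \<xi> - 1) * (drift i U f t + x))
      = ?r * exp (- \<kappa> * x) * (1 + (if w \<in> E then \<kappa> else 0))" by (simp only: exp_add)
  qed
  also have "\<dots> = ?r * exp (- \<kappa> * x) * (real (card A) + \<kappa> * real (card (A \<inter> E)))"
    unfolding sum_distrib_left[symmetric] using fA by (simp add: sum.distrib sum.inter_restrict[symmetric])
  also have "\<dots> \<le> ?r * exp (- \<kappa> * x) * (real (card A) * (1 + \<kappa> * x))"
  proof (intro mult_left_mono)
    have w1: "1 \<le> wgt t * real (card A)"
    proof -
      have "wgt t > 0" unfolding wgt_def using a_win[OF t] \<sigma> \<epsilon> q \<nu>_pos by simp
      then show ?thesis using avail_ctrl(1)[OF v t c] unfolding A_def by (simp add: pos_divide_le_eq mult.commute)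
    qed
    have "real (card (A \<inter> E)) \<le> 1 * real (card (cd f t t \<inter> E))"
      using fA finite_subset[OF cd_V[OF t] finV, of f t] by (auto intro!: card_mono simp: A_def avail_def)
    also have "\<dots> \<le> (wgt t * real (card A)) * real (card (cd f t t \<inter> E))" using w1 by (intro mult_right_mono) auto
    finally have "real (card (A \<inter> E)) \<le> real (card A) * x" unfolding x_def by (simp add: mult_ac)
    then have "\<kappa> * real (card (A \<inter> E)) \<le> \<kappa> * (real (card A) * x)" using \<kappa> by (rule mult_left_mono)
    then show "real (card A) + \<kappa> * real (card (A \<inter> E)) \<le> real (card A) * (1 + \<kappa> * x)" by (simp add: algebra_simps)
  qed auto
  also have "\<dots> \<le> ?r * exp (- \<kappa> * x) * (real (card A) * exp (\<kappa> * x))"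
    by (intro mult_left_mono exp_ge_add_one_self) auto
  also have "\<dots> = real (card A) * ?r" by (simp add: exp_minus)
  finally show ?thesis unfolding A_def .
qed

lemma pot1_step:
  assumes v: "valid f t" and t: "t < l" and c: "ctrl f t"
  shows "(\<Sum>w\<in>avail f t. pot1 (f(t := w)) (Suc t)) \<le> real (card (avail f t)) * pot1 f t"
proof -
  have "(\<Sum>w\<in>avail f t. pot1 (f(t := w)) (Suc t)) = (\<Sum>(i, U)\<in>{..l div \<omega>} \<times> Pow {..<N}. exp (- (2 * real (card U) + 3) * L) *
     (\<Sum>w\<in>avail f t. exp (\<xi> * real (hits i U (f(t := w)) (Suc t)) - (exp \<xi> - 1) * drift i U (f(t := w)) (Suc t))))"
    unfolding pot1_def by (subst sum.swap) (simp add: sum_distrib_left case_prod_unfold)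
  also have "\<dots> \<le> (\<Sum>(i, U)\<in>{..l div \<omega>} \<times> Pow {..<N}. exp (- (2 * real (card U) + 3) * L) *
     (real (card (avail f t)) * exp (\<xi> * real (hits i U f t) - (exp \<xi> - 1) * drift i U f t)))"
    by (rule sum_mono) (auto intro!: mult_left_mono pot1_term_step[OF v t c])
  also have "\<dots> = real (card (avail f t)) * pot1 f t"
    unfolding pot1_def sum_distrib_left by (rule sum.cong) (auto simp: mult_ac)
  finally show ?thesis .
qed

text \<open>At most \<open>N + 1\<close> windows and a sum of at most 3 over \<open>U\<close> stand
  against \<open>N ^ 3\<close>. The other half of the budget 1 is left for a further
  potential.\<close>

lemma pot1_start: "pot1 f 0 \<le> 1 / 2"
proof -
  have "win i 0 = {}" for i unfolding win_def by simp
  then have "pot1 f 0 = (\<Sum>(i, U)\<in>{..l div \<omega>} \<times> Pow {..<N}. exp (- 3 * L) * (1 * exp (- 2 * real (card U) * ln (real N))))"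
    unfolding pot1_def hits_def drift_def L_def by (simp add: exp_add[symmetric] algebra_simps)
  also have "\<dots> = exp (- 3 * L) * ((\<Sum>i\<in>{..l div \<omega>}. 1) * (\<Sum>U\<in>Pow {..<N}. exp (- 2 * real (card U) * ln (real N))))"
    by (rule sum_times)
  also have "\<dots> \<le> exp (- 3 * L) * ((real N + 1) * 3)"
  proof (intro mult_left_mono mult_mono)
    have "real l \<le> (1 - \<sigma>) * \<nu>" using l_size unfolding \<nu>_def .
    also have "\<dots> \<le> 1 * \<nu>" using \<sigma> \<nu>_pos by (intro mult_right_mono) auto
    also have "\<dots> \<le> real N" using card_mono[OF _ V] unfolding \<nu>_def by simp
    finally have "l \<le> N" by simp
    then have "l div \<omega> \<le> N" by (meson div_le_dividend le_trans)
    then show "(\<Sum>i\<in>{..l div \<omega>}. 1) \<le> real N + 1" by simp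
    show "(\<Sum>U\<in>Pow {..<N}. exp (- 2 * real (card U) * ln (real N))) \<le> 3" by (rule sum_subsets_le) (use N3 in simp)
  qed (auto intro: sum_nonneg)
  also have "exp (- 3 * L) = 1 / real N ^ 3"
  proof -
    have "exp (3 * L) = real N ^ 3" unfolding L_def using N3 by (simp add: exp_of_nat_mult[of 3, simplified])
    then show ?thesis by (simp add: exp_minus field_simps)
  qed
  also have "1 / real N ^ 3 * ((real N + 1) * 3) \<le> 1 / 2"
  proof -
    have "real N \<ge> 3" using N3 by simp
    then have "real N * real N \<ge> 3 * 3" by (intro mult_mono) auto
    then have "real N ^ 3 \<ge> 9 * real N" using \<open>real N \<ge> 3\<close> by (simp add: power3_eq_cube mult_right_mono)
    moreover have "6 * (real N + 1) \<le> 9 * real N" using \<open>real N \<ge> 3\<close> by simp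
    ultimately have "6 * (real N + 1) \<le> real N ^ 3" by (rule order_trans[rotated])
    then show ?thesis using N3 by (simp add: field_simps)
  qed
  finally show ?thesis .
qed

text \<open>Additional requirements on the embedding enter through a further potential \<open>\<Psi>\<close>.\<close>
theorem greedy_run:
  fixes \<Psi> :: "(nat \<Rightarrow> nat) \<Rightarrow> nat \<Rightarrow> real"
  assumes cong: "\<And>f g t. (\<And>x. x < t \<Longrightarrow> f x = g x) \<Longrightarrow> \<Psi> f t = \<Psi> g t"
    and nonneg: "\<And>f t. \<Psi> f t \<ge> 0"
    and init: "\<And>f. \<Psi> f 0 \<le> 1 / 2"
    and step: "\<And>f t. valid f t \<Longrightarrow> t < l \<Longrightarrow> ctrl f t \<Longrightarrow>
      (\<Sum>w\<in>avail f t. \<Psi> (f(t := w)) (Suc t)) \<le> real (card (avail f t)) * \<Psi> f t"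
  shows "\<exists>f. valid f l \<and> \<Psi> f l \<le> 1"
proof -
  have pot1_nonneg: "pot1 f t \<ge> 0" for f t unfolding pot1_def by (rule sum_nonneg) auto
  \<comment> \<open>The bound is kept for all earlier times, since \<open>ctrl\<close> looks back at
    the end of every window.\<close>
  have "\<exists>f. valid f t \<and> (\<forall>s\<le>t. pot1 f s + \<Psi> f s \<le> 1)" if "t \<le> l" for t
    using that
  proof (induction t)
    case 0
    have "pot1 f 0 + \<Psi> f 0 \<le> 1" for f using pot1_start[of f] init[of f] by linarith
    then show ?case by (auto simp: valid_def)
  next
    case (Suc t)
    then obtain f where f: "valid f t" "\<forall>s\<le>t. pot1 f s + \<Psi> f s \<le> 1" by auto
    have t: "t < l" using Suc.prems by simp
    have p1: "pot1 f s \<le> 1" if "s \<le> t" for s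
    proof -
      have "pot1 f s + \<Psi> f s \<le> 1" using f(2) that by simp
      then show ?thesis using nonneg[of f s] by linarith
    qed
    have c: "ctrl f t" by (rule pot1_ctrl[OF f(1) p1])
    have "(\<Sum>w\<in>avail f t. pot1 (f(t := w)) (Suc t) + \<Psi> (f(t := w)) (Suc t)) \<le> real (card (avail f t)) * (pot1 f t + \<Psi> f t)"
      unfolding sum.distrib using pot1_step[OF f(1) t c] step[OF f(1) t c] by (simp add: algebra_simps)
    then obtain w where w: "w \<in> avail f t" "pot1 (f(t := w)) (Suc t) + \<Psi> (f(t := w)) (Suc t) \<le> pot1 f t + \<Psi> f t"
      using exists_le_average[OF avail_ctrl(4,3)[OF f(1) t c]] by blast
    have "pot1 (f(t := w)) s + \<Psi> (f(t := w)) s \<le> 1" if "s \<le> Suc t" for s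
    proof (cases "s = Suc t")
      case True
      have "pot1 f t + \<Psi> f t \<le> 1" using f(2) by simp
      then show ?thesis using w True by simp
    next
      case False
      then have s: "s \<le> t" using that by simp
      have "pot1 (f(t := w)) s = pot1 f s" by (rule pot1_cong[of t]) (use s in auto)
      moreover have "\<Psi> (f(t := w)) s = \<Psi> f s" by (rule cong) (use s in auto)
      ultimately show ?thesis using f(2) s by simp
    qed
    then show ?case using valid_upd[OF f(1) t w(1)] by blast
  qed
  then obtain f where f: "valid f l" "pot1 f l + \<Psi> f l \<le> 1" by blast
  then show ?thesis using pot1_nonneg[of f l] by (intro exI[of _ f]) auto
qed

end

section \<open>Buffer vertices\<close>

text \<open>No independence of the factors is assumed: in one step at most one of them can change,
  so averaging the product reduces to averaging that factor.\<close>

lemma prod_step: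
  fixes g :: "'b \<Rightarrow> real" and g' :: "'a \<Rightarrow> 'b \<Rightarrow> real"
  assumes fin: "finite B" "finite A"
    and one: "\<And>x y. x \<in> B \<Longrightarrow> y \<in> B \<Longrightarrow> aff x \<Longrightarrow> aff y \<Longrightarrow> x = y"
    and rest: "\<And>w x. w \<in> A \<Longrightarrow> x \<in> B \<Longrightarrow> \<not> aff x \<Longrightarrow> g' w x = g x"
    and step: "\<And>x. x \<in> B \<Longrightarrow> aff x \<Longrightarrow> (\<Sum>w\<in>A. g' w x) \<le> real (card A) * g x"
    and nonneg: "\<And>x. x \<in> B \<Longrightarrow> g x \<ge> 0"
  shows "(\<Sum>w\<in>A. \<Prod>x\<in>B. g' w x) \<le> real (card A) * (\<Prod>x\<in>B. g x)"
proof (cases "\<exists>x\<in>B. aff x")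
  case False
  then have "(\<Prod>x\<in>B. g' w x) = (\<Prod>x\<in>B. g x)" if "w \<in> A" for w
    by (intro prod.cong) (use rest that in auto)
  then show ?thesis by simp
next
  case True
  then obtain x0 where x0: "x0 \<in> B" "aff x0" by blast
  define P where "P = (\<Prod>x\<in>B - {x0}. g x)"
  have P: "P \<ge> 0" unfolding P_def by (intro prod_nonneg) (use nonneg in auto)
  have "(\<Sum>w\<in>A. \<Prod>x\<in>B. g' w x) = (\<Sum>w\<in>A. g' w x0 * P)"
  proof (rule sum.cong[OF refl])
    fix w assume w: "w \<in> A"
    have "(\<Prod>x\<in>B - {x0}. g' w x) = P" unfolding P_def
      by (rule prod.cong[OF refl]) (use rest[OF w] one x0 in auto)
    then show "(\<Prod>x\<in>B. g' w x) = g' w x0 * P" using prod.remove[OF fin(1) x0(1)] by metis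
  qed
  also have "\<dots> = (\<Sum>w\<in>A. g' w x0) * P" by (simp add: sum_distrib_right)
  also have "\<dots> \<le> real (card A) * g x0 * P" by (intro mult_right_mono step x0 P)
  also have "\<dots> = real (card A) * (\<Prod>x\<in>B. g x)" unfolding P_def using prod.remove[OF fin(1) x0(1), of g] by simp
  finally show ?thesis .
qed

text \<open>The buffer vertices \<open>B\<close> are embedded last. Every host vertex must then be able to host many of
  them, and every large set \<open>T\<close> of host vertices must meet the candidate sets of all but
  \<open>h1\<close> of them.\<close>
locale buffered = windows +
  fixes B :: "nat set" and k :: nat and h1 \<tau>0 \<rho> \<zeta> :: real
  assumes B_sub: "B \<subseteq> {..<n}" and B_deg: "\<And>x. x \<in> B \<Longrightarrow> card (hn x) = k" and B_hn: "\<And>x. x \<in> B \<Longrightarrow> hn x \<subseteq> {..<l}"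
    and B_free: "\<And>x z z'. x \<in> B \<Longrightarrow> z \<in> hn x \<Longrightarrow> z' \<in> hn x \<Longrightarrow> z' \<notin> hn z"
    and B_far: "\<And>x y. x \<in> B \<Longrightarrow> y \<in> B \<Longrightarrow> x \<noteq> y \<Longrightarrow> (hn x \<union> \<Union>(hn ` hn x)) \<inter> (hn y \<union> \<Union>(hn ` hn y)) = {}"
    and D_d': "D + 1 \<le> d'"
    and V_deg: "\<And>v. v < N \<Longrightarrow> q * real (card V) \<le> real (card (nb v \<inter> V))"
    and loss: "\<And>f t x. valid f t \<Longrightarrow> t < l \<Longrightarrow> x \<in> B \<Longrightarrow> t \<in> hn x \<Longrightarrow>
       real (card (cd f t t - f ` {..<t} - avail f t)) \<le> \<sigma> / 4 * (q ^ (D + 1) * \<nu>)"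
    and r_q: "r ^ D \<le> 2 * q ^ D" and \<epsilon>\<Delta>: "1 / 2 \<le> (1 - \<epsilon>) ^ \<Delta>\<^sup>2"
    and hB: "24 * L \<le> (\<sigma> / 8 * q) ^ k * real (card B)"
    and \<tau>0: "M \<le> q ^ (k - 1) * \<tau>0" "0 < \<tau>0" and \<zeta>: "0 \<le> \<zeta>" "exp \<rho> * \<zeta> * real \<Delta> \<le> 1" "m \<le> \<zeta> * (\<sigma> / 4 * (q ^ D * \<nu>))"
    and \<rho>: "0 \<le> \<rho>" "3 * real N \<le> \<rho> * h1"
    and BN: "card B \<le> N"
begin

section \<open>Buffer vertices that a given host vertex can receive\<close>

definition "c1 = \<sigma> / 8 * q"
definition "sec x = \<Union>(hn ` hn x) \<inter> {..<l}"
definition "todo t x = card (hn x \<inter> {t..})"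
definition "todo2 t x = card (sec x \<inter> {t..})"
text \<open>The event that all of \<open>hn x\<close> can still be mapped into \<open>nb v\<close>.
  The \<open>+ 1\<close> in the exponent counts \<open>v\<close> as one more vertex in whose
  neighbourhood the candidates must lie.\<close>

definition "alive v f t x \<longleftrightarrow> (\<forall>z\<in>hn x. if z < t then f z \<in> nb v
  else q ^ (card (hn z \<inter> {..<t}) + 1) * \<nu> \<le> real (card (cd f t z \<inter> nb v)))"
text \<open>Lower bound for the conditional probability that all neighbours of \<open>x\<close> end
  up in \<open>nb v\<close>: a factor \<open>c1\<close> for each neighbour still to come, and
  \<open>1 - \<epsilon>\<close> for each coming vertex at distance two, which may spoil a candidate
  set.\<close>

definition "Y v f t x = (if alive v f t x then c1 ^ todo t x * (1 - \<epsilon>) ^ todo2 t x else 0)"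

lemma c1: "0 < c1" "c1 \<le> 1"
  unfolding c1_def using \<sigma> q mult_mono[of "\<sigma> / 8" 1 q 1] by auto

lemma Y_bounds: "0 \<le> Y v f t x" "Y v f t x \<le> 1"
  unfolding Y_def using c1 \<epsilon> by (auto intro!: mult_le_one power_le_one)

lemma finB: "finite B" using B_sub finite_subset by blast

lemma xn: "x \<in> B \<Longrightarrow> x < n" using B_sub by auto

lemma zl: "x \<in> B \<Longrightarrow> z \<in> hn x \<Longrightarrow> z < l" using B_hn by auto

lemma fin_sec: "finite (sec x)" unfolding sec_def by simp

lemma todo_Suc: "x \<in> B \<Longrightarrow> todo t x = (if t \<in> hn x then Suc (todo (Suc t) x) else todo (Suc t) x)"
proof -
  assume x: "x \<in> B"
  have "hn x \<inter> {t..} = (if t \<in> hn x then insert t (hn x \<inter> {Suc t..}) else hn x \<inter> {Suc t..})"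
    by (auto simp: Suc_le_eq le_less)
  then show ?thesis unfolding todo_def using fin_hn[OF xn[OF x]] by simp
qed

lemma todo2_Suc: "todo2 t x = (if t \<in> sec x then Suc (todo2 (Suc t) x) else todo2 (Suc t) x)"
proof -
  have "sec x \<inter> {t..} = (if t \<in> sec x then insert t (sec x \<inter> {Suc t..}) else sec x \<inter> {Suc t..})"
    by (auto simp: Suc_le_eq le_less)
  then show ?thesis unfolding todo2_def using fin_sec by simp
qed

lemma alive_cong: assumes "\<And>y. y < t \<Longrightarrow> f y = g y" shows "alive v f t x = alive v g t x"
proof -
  have "cd f t = cd g t" using cd_cong[OF assms] by auto
  then show ?thesis unfolding alive_def using assms by auto
qed

lemma alive_Suc_other:
  assumes "t \<notin> hn x" "t \<notin> sec x" "t < l" "x \<in> B"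
  shows "alive v (f(t := w)) (Suc t) x = alive v f t x"
proof -
  have eq: "z < Suc t \<longleftrightarrow> z < t" "cd (f(t := w)) (Suc t) z = cd f t z" "hn z \<inter> {..<Suc t} = hn z \<inter> {..<t}"
    if z: "z \<in> hn x" for z
  proof -
    have "t \<notin> hn z" using assms z unfolding sec_def by auto
    then show "cd (f(t := w)) (Suc t) z = cd f t z" "hn z \<inter> {..<Suc t} = hn z \<inter> {..<t}"
      using cd_cong[of t "f(t := w)" f z] by (auto simp: cd_Suc less_Suc_eq)
    show "z < Suc t \<longleftrightarrow> z < t" using z assms by (auto simp: less_Suc_eq)
  qed
  show ?thesis unfolding alive_def by (rule ball_cong[OF refl]) (auto simp: eq)
qed

text \<open>Triangle-freeness enters here: \<open>t\<close> is not adjacent to the other neighbours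
  of \<open>x\<close>, so embedding it leaves their candidate sets untouched.\<close>

lemma alive_Suc_hn:
  assumes t: "t \<in> hn x" "x \<in> B" and al: "alive v f t x" and w: "w \<in> nb v"
  shows "alive v (f(t := w)) (Suc t) x"
  unfolding alive_def
proof
  fix z assume z: "z \<in> hn x"
  have tz: "t \<notin> hn z" using B_free[OF t(2) z t(1)] .
  have "cd (f(t := w)) (Suc t) z = cd f t z" "hn z \<inter> {..<Suc t} = hn z \<inter> {..<t}"
    using tz cd_cong[of t "f(t := w)" f z] by (auto simp: cd_Suc less_Suc_eq)
  then show "if z < Suc t then (f(t := w)) z \<in> nb v
    else q ^ (card (hn z \<inter> {..<Suc t}) + 1) * \<nu> \<le> real (card (cd (f(t := w)) (Suc t) z \<inter> nb v))"
    using al z w unfolding alive_def by (auto simp: less_Suc_eq split: if_splits)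
qed

lemma avail_le:
  assumes v: "valid f t" and t: "t < l"
  shows "real (card (avail f t)) \<le> 2 * (q ^ bd t * \<nu>)"
proof -
  have tn: "t < n" using t l_le by simp
  have bt: "bd t \<le> D" using back_deg[OF t] unfolding bd_def .
  have "avail f t \<subseteq> cd f t t" unfolding avail_def by auto
  then have "real (card (avail f t)) \<le> real (card (cd f t t))"
    using card_mono[OF finite_subset[OF cd_V[OF t] finV]] by simp
  also have "\<dots> \<le> r ^ bd t * \<nu>" using valid_tracked(2)[OF v le_refl tn t] unfolding bd_def .
  also have "r ^ bd t \<le> 2 * q ^ bd t"
  proof -
    have rq: "q \<le> r" unfolding q_def r_def using p \<epsilon> by (intro mult_right_mono) auto
    have "q ^ (D - bd t) * r ^ bd t \<le> r ^ (D - bd t) * r ^ bd t"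
      using rq q by (intro mult_right_mono power_mono) auto
    also have "\<dots> = r ^ D" using bt by (simp add: power_add[symmetric])
    also have "\<dots> \<le> 2 * q ^ D" by (rule r_q)
    also have "\<dots> = q ^ (D - bd t) * (2 * q ^ bd t)" using bt by (simp add: power_add[symmetric])
    finally show ?thesis using q by simp
  qed
  finally show ?thesis using \<nu>_pos by (simp add: mult_ac)
qed

lemma hit_prob:
  assumes v: "valid f t" and t: "t < l" and c: "ctrl f t" and x: "x \<in> B" "t \<in> hn x" and al: "alive u f t x" and u: "u < N"
  shows "c1 * real (card (avail f t)) \<le> real (card (avail f t \<inter> nb u))"
proof -
  let ?U = "insert u (f ` (hn t \<inter> {..<t}))"
  have bt: "bd t \<le> D" using back_deg[OF t] unfolding bd_def .
  have CLU: "CL ?U = cd f t t \<inter> nb u" unfolding cd_CL[OF t] CL_def by auto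
  have "card (f ` (hn t \<inter> {..<t})) \<le> bd t" unfolding bd_def by (rule card_image_le) simp
  then have cU: "card ?U \<le> d'" using bt D_d' by (simp add: card_insert_if)
  have UN: "?U \<subseteq> {..<N}" using valid_lt[OF v] V u by auto
  have big: "q ^ (bd t + 1) * \<nu> \<le> real (card (CL ?U))"
    using al x(2) unfolding alive_def CLU bd_def by auto
  have "\<theta> \<le> q ^ (bd t + 1) * \<nu>" unfolding \<theta>_def using bt D_d' \<nu>_pos by (intro mult_right_mono q_power_le) auto
  then have "\<theta> \<le> real (card (CL ?U))" using big by linarith
  then have "a (t div \<omega> + 1) * real (card (CL ?U)) \<le> real (card (CL ?U - f ` {..<t}))"
    using c UN cU unfolding ctrl_def by blast
  moreover have "\<sigma> / 2 * (q ^ (bd t + 1) * \<nu>) \<le> a (t div \<omega> + 1) * real (card (CL ?U))"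
    using a_win[OF t] \<sigma> big q \<nu>_pos by (intro mult_mono) auto
  moreover have "card (CL ?U - f ` {..<t}) \<le> card ((avail f t \<inter> nb u) \<union> (cd f t t - f ` {..<t} - avail f t))"
    unfolding CLU by (rule card_mono) (use finite_subset[OF cd_V[OF t] finV, of f t] avail_ctrl(4)[OF v t c] in auto)
  moreover have "\<dots> \<le> card (avail f t \<inter> nb u) + card (cd f t t - f ` {..<t} - avail f t)" by (rule card_Un_le)
  moreover have "real (card (cd f t t - f ` {..<t} - avail f t)) \<le> \<sigma> / 4 * (q ^ (bd t + 1) * \<nu>)"
  proof -
    have "\<sigma> / 4 * (q ^ (D + 1) * \<nu>) \<le> \<sigma> / 4 * (q ^ (bd t + 1) * \<nu>)"
      using bt \<nu>_pos \<sigma> by (intro mult_left_mono mult_right_mono q_power_le) auto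
    then show ?thesis using loss[OF v t x] by linarith
  qed
  ultimately have 1: "\<sigma> / 4 * (q ^ (bd t + 1) * \<nu>) \<le> real (card (avail f t \<inter> nb u))" by linarith
  have "c1 * real (card (avail f t)) \<le> c1 * (2 * (q ^ bd t * \<nu>))" using avail_le[OF v t] c1 by (intro mult_left_mono) auto
  also have "\<dots> = \<sigma> / 4 * (q ^ (bd t + 1) * \<nu>)" unfolding c1_def by simp
  finally show ?thesis using 1 by linarith
qed

lemma M_le_qD: "M \<le> q ^ D * \<nu>"
proof -
  have qD: "q ^ D * \<nu> > 0" using q \<nu>_pos by simp
  have "1 * (2 * m) \<le> real \<Delta> * (2 * m)" using \<Delta>1 m_ge_20 by (intro mult_right_mono) auto
  then have "m + 1 \<le> 2 * real \<Delta> * m" using m_ge_20 by linarith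
  also have "\<dots> \<le> \<epsilon> * (\<sigma> / 2) * (q ^ D * \<nu>)" by (rule m_small)
  also have "\<dots> \<le> \<epsilon> * 1 * (q ^ D * \<nu>)" using \<epsilon> \<sigma> qD by (intro mult_right_mono mult_left_mono) auto
  finally show ?thesis unfolding M_def using \<epsilon> by (simp add: pos_divide_le_eq mult.commute)
qed

text \<open>Embedding \<open>t\<close> affects \<open>x\<close> only through the later neighbours
  \<open>z\<close> of \<open>x\<close> adjacent to \<open>t\<close>. For each of them all but
  \<open>m\<close> images keep the share \<open>q\<close> of the candidates of \<open>z\<close>
  inside \<open>nb u\<close>, and \<open>\<Delta> * m\<close> is small against
  \<open>avail\<close>.\<close>

lemma survive_prob:
  assumes v: "valid f t" and t: "t < l" and c: "ctrl f t" and x: "x \<in> B" "t \<notin> hn x" and al: "alive u f t x"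
  shows "real (card {w\<in>avail f t. \<not> alive u (f(t := w)) (Suc t) x}) \<le> \<epsilon> * real (card (avail f t))"
proof -
  define Zs where "Zs = {z\<in>hn x. t < z \<and> t \<in> hn z}"
  define U where "U z = cd f t z \<inter> nb u" for z
  have fZ: "finite Zs" using fin_hn[OF xn[OF x(1)]] unfolding Zs_def by simp
  have cZ: "card Zs \<le> \<Delta>" using card_mono[OF fin_hn[OF xn[OF x(1)]], of Zs] hn_deg[OF xn[OF x(1)]] unfolding Zs_def by auto
  have UM: "U z \<subseteq> {..<N} \<and> M \<le> real (card (U z))" if z: "z \<in> Zs" for z
  proof -
    have zl: "z < l" "z \<in> hn x" "t < z" "t \<in> hn z" using z zl[OF x(1)] unfolding Zs_def by auto
    have zn: "z < n" using zl l_le by simp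
    have "card (hn z \<inter> {..<t}) < card (hn z \<inter> {..<z})"
      by (rule psubset_card_mono) (use zl fin_hn[OF zn] in auto)
    then have "card (hn z \<inter> {..<t}) + 1 \<le> D" using back_deg[OF zl(1)] by simp
    then have "q ^ D * \<nu> \<le> q ^ (card (hn z \<inter> {..<t}) + 1) * \<nu>" using \<nu>_pos by (intro mult_right_mono q_power_le) auto
    also have "\<dots> \<le> real (card (U z))" using al zl unfolding alive_def U_def by auto
    finally show ?thesis using M_le_qD cd_V[OF zl(1)] V unfolding U_def by fastforce
  qed
  have "{w\<in>avail f t. \<not> alive u (f(t := w)) (Suc t) x} \<subseteq> {w\<in>{..<N}. \<exists>z\<in>Zs. real (card (nb w \<inter> U z)) < q * real (card (U z))}"
  proof
    fix w assume "w \<in> {w\<in>avail f t. \<not> alive u (f(t := w)) (Suc t) x}"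
    then have w: "w \<in> avail f t" "\<not> alive u (f(t := w)) (Suc t) x" by auto
    have wN: "w < N" using w avail_V[OF t] V by auto
    obtain z where z: "z \<in> hn x" "\<not> (if z < Suc t then (f(t := w)) z \<in> nb u
       else q ^ (card (hn z \<inter> {..<Suc t}) + 1) * \<nu> \<le> real (card (cd (f(t := w)) (Suc t) z \<inter> nb u)))"
      using w(2) unfolding alive_def by blast
    have zt: "z \<noteq> t" using z x by auto
    have tz: "t < z"
    proof (rule ccontr)
      assume "\<not> t < z"
      then have "z < t" using zt by simp
      then show False using al z unfolding alive_def by auto
    qed
    have zn: "z < n" using zl[OF x(1) z(1)] l_le by simp
    have cdf: "cd (f(t := w)) t z = cd f t z" by (rule cd_cong) simp
    have *: "real (card (cd (f(t := w)) (Suc t) z \<inter> nb u)) < q ^ (card (hn z \<inter> {..<Suc t}) + 1) * \<nu>"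
      using z(2) tz by (auto simp: not_le)
    have old: "q ^ (card (hn z \<inter> {..<t}) + 1) * \<nu> \<le> real (card (U z))" using al z tz unfolding alive_def U_def by auto
    have thn: "t \<in> hn z"
    proof (rule ccontr)
      assume "t \<notin> hn z"
      then show False using * old unfolding U_def cd_Suc cdf hn_Suc[OF zn] by simp
    qed
    have "cd (f(t := w)) (Suc t) z \<inter> nb u = nb w \<inter> U z" unfolding cd_Suc cdf U_def using thn by auto
    then have "real (card (nb w \<inter> U z)) < q * (q ^ (card (hn z \<inter> {..<t}) + 1) * \<nu>)"
      using * thn unfolding hn_Suc[OF zn] by simp
    also have "\<dots> \<le> q * real (card (U z))" using old q by (intro mult_left_mono) auto
    finally show "w \<in> {w\<in>{..<N}. \<exists>z\<in>Zs. real (card (nb w \<inter> U z)) < q * real (card (U z))}"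
      using wN z(1) tz thn unfolding Zs_def by blast
  qed
  then have "card {w\<in>avail f t. \<not> alive u (f(t := w)) (Suc t) x} \<le> card {w\<in>{..<N}. \<exists>z\<in>Zs. real (card (nb w \<inter> U z)) < q * real (card (U z))}"
    by (rule card_mono[rotated]) simp
  then have "real (card {w\<in>avail f t. \<not> alive u (f(t := w)) (Suc t) x}) \<le> real (card Zs) * m"
    using few_choices_lost[OF fZ, of U] UM by fastforce
  also have "\<dots> \<le> real \<Delta> * m" using cZ m_ge_20 by (intro mult_right_mono) auto
  also have "\<dots> \<le> \<epsilon> * ((1 / 2) * (\<sigma> / 2) * (q ^ D * \<nu>))" using m_small by simp
  also have "\<dots> \<le> \<epsilon> * ((1 - \<epsilon>) * (\<sigma> / 2) * (q ^ bd t * \<nu>))"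
    using \<epsilon> \<sigma> q \<nu>_pos back_deg[OF t] unfolding bd_def by (intro mult_left_mono mult_mono q_power_le) auto
  also have "\<dots> \<le> \<epsilon> * real (card (avail f t))" using avail_ctrl(2)[OF v t c] \<epsilon> by (intro mult_left_mono) auto
  finally show ?thesis .
qed

lemma Y_step:
  assumes v: "valid f t" and t: "t < l" and c: "ctrl f t" and x: "x \<in> B" and u: "u < N" and zone: "t \<in> hn x \<or> t \<in> sec x"
  shows "(\<Sum>w\<in>avail f t. 1 - Y u (f(t := w)) (Suc t) x / 2) \<le> real (card (avail f t)) * (1 - Y u f t x / 2)"
proof -
  let ?A = "avail f t"
  have fA: "finite ?A" using avail_ctrl(4)[OF v t c] .
  have "real (card ?A) * Y u f t x \<le> (\<Sum>w\<in>?A. Y u (f(t := w)) (Suc t) x)"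
  proof (cases "alive u f t x")
    case False
    then have "Y u f t x = 0" unfolding Y_def by simp
    then show ?thesis using Y_bounds by (simp add: sum_nonneg)
  next
    case al: True
    define G where "G = {w\<in>?A. alive u (f(t := w)) (Suc t) x}"
    have fG: "finite G" using fA unfolding G_def by simp
    define z where "z = c1 ^ todo (Suc t) x * (1 - \<epsilon>) ^ todo2 (Suc t) x"
    have z0: "z \<ge> 0" unfolding z_def using c1 \<epsilon> by simp
    have "(\<Sum>w\<in>?A. Y u (f(t := w)) (Suc t) x) = real (card G) * z"
      unfolding Y_def z_def[symmetric] G_def using fA by (simp add: sum.inter_filter[symmetric])
    moreover have "real (card ?A) * Y u f t x \<le> real (card G) * z"
    proof (cases "t \<in> hn x")
      case True
      have ts: "t \<notin> sec x" using True B_free[OF x _ True] unfolding sec_def by auto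
      have "Y u f t x = c1 * z" unfolding Y_def z_def using al True ts todo_Suc[OF x, of t] todo2_Suc[of t x] by simp
      moreover have "c1 * real (card ?A) \<le> real (card G)"
      proof -
        have "?A \<inter> nb u \<subseteq> G" unfolding G_def using alive_Suc_hn[OF True x al] by auto
        then have "card (?A \<inter> nb u) \<le> card G" by (rule card_mono[OF fG])
        then show ?thesis using hit_prob[OF v t c x True al u] by linarith
      qed
      then have "c1 * real (card ?A) * z \<le> real (card G) * z" using z0 by (intro mult_right_mono)
      ultimately show ?thesis by (simp add: mult_ac)
    next
      case False
      then have ts: "t \<in> sec x" using zone by simp
      have "Y u f t x = (1 - \<epsilon>) * z" unfolding Y_def z_def using al False ts todo_Suc[OF x, of t] todo2_Suc[of t x] by simp
      moreover have "(1 - \<epsilon>) * real (card ?A) \<le> real (card G)"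
      proof -
        have "?A = G \<union> {w\<in>?A. \<not> alive u (f(t := w)) (Suc t) x}" unfolding G_def by auto
        then have "card ?A \<le> card G + card {w\<in>?A. \<not> alive u (f(t := w)) (Suc t) x}" by (metis card_Un_le)
        then show ?thesis using survive_prob[OF v t c x False al] by (simp add: algebra_simps)
      qed
      then have "(1 - \<epsilon>) * real (card ?A) * z \<le> real (card G) * z" using z0 by (intro mult_right_mono)
      ultimately show ?thesis by (simp add: mult_ac)
    qed
    ultimately show ?thesis by simp
  qed
  then show ?thesis by (simp add: sum_subtractf sum_divide_distrib[symmetric] algebra_simps)
qed

definition "h0 = c1 ^ k * real (card B) / 8"
text \<open>Lower tail for the number of buffer vertices that \<open>v\<close> can host. At the end
  each of them contributes a factor 1/2, which is at least \<open>exp (- 1)\<close>, so a value of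
  at most 1 forces at least \<open>h0\<close>. The initial product is at most
  \<open>exp (- 2 * h0)\<close>, half of which is spent on the prefactor.\<close>

definition "pot2 f t = (\<Sum>v<N. exp h0 * (\<Prod>x\<in>B. 1 - Y v f t x / 2))"

lemma zone_unique:
  assumes "x \<in> B" "y \<in> B" "t \<in> hn x \<or> t \<in> sec x" "t \<in> hn y \<or> t \<in> sec y"
  shows "x = y"
  using B_far[OF assms(1,2)] assms unfolding sec_def by blast

lemma Y_other: "x \<in> B \<Longrightarrow> t < l \<Longrightarrow> \<not> (t \<in> hn x \<or> t \<in> sec x) \<Longrightarrow> Y v (f(t := w)) (Suc t) x = Y v f t x"
  unfolding Y_def using alive_Suc_other[of t x v f w] todo_Suc[of x t] todo2_Suc[of t x] by simp

lemma pot2_step: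
  assumes v: "valid f t" and t: "t < l" and c: "ctrl f t"
  shows "(\<Sum>w\<in>avail f t. pot2 (f(t := w)) (Suc t)) \<le> real (card (avail f t)) * pot2 f t"
proof -
  have "(\<Sum>w\<in>avail f t. \<Prod>x\<in>B. 1 - Y u (f(t := w)) (Suc t) x / 2) \<le> real (card (avail f t)) * (\<Prod>x\<in>B. 1 - Y u f t x / 2)"
    if u: "u < N" for u
  proof (rule prod_step[where aff = "\<lambda>x. t \<in> hn x \<or> t \<in> sec x"])
    show "0 \<le> 1 - Y u f t x / 2" for x using Y_bounds(2)[of u f t x] by simp
  qed (use finB avail_ctrl(4)[OF v t c] zone_unique Y_other[OF _ t] Y_step[OF v t c _ u] in auto)
  then have "exp h0 * (\<Sum>w\<in>avail f t. \<Prod>x\<in>B. 1 - Y u (f(t := w)) (Suc t) x / 2) \<le> exp h0 * (real (card (avail f t)) * (\<Prod>x\<in>B. 1 - Y u f t x / 2))"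
    if "u < N" for u using that by (intro mult_left_mono) auto
  then have "(\<Sum>u<N. exp h0 * (\<Sum>w\<in>avail f t. \<Prod>x\<in>B. 1 - Y u (f(t := w)) (Suc t) x / 2)) \<le> (\<Sum>u<N. exp h0 * (real (card (avail f t)) * (\<Prod>x\<in>B. 1 - Y u f t x / 2)))"
    by (intro sum_mono) auto
  then have "(\<Sum>u<N. \<Sum>w\<in>avail f t. exp h0 * (\<Prod>x\<in>B. 1 - Y u (f(t := w)) (Suc t) x / 2)) \<le> (\<Sum>u<N. real (card (avail f t)) * (exp h0 * (\<Prod>x\<in>B. 1 - Y u f t x / 2)))"
    by (simp only: sum_distrib_left mult.left_commute)
  then show ?thesis unfolding pot2_def sum_distrib_left by (subst sum.swap) simp
qed

text \<open>At the start every host vertex must be alive for every buffer vertex.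
  \<open>V_deg\<close> supplies this without exceptional vertices, which is why \<open>V\<close>
  will be an interval.\<close>

lemma Y_start:
  assumes u: "u < N" and x: "x \<in> B"
  shows "c1 ^ k / 2 \<le> Y u f 0 x"
proof -
  have nx: "x < n" using xn[OF x] .
  have al: "alive u f 0 x" unfolding alive_def
  proof
    fix z assume z: "z \<in> hn x"
    have "cd f 0 z \<inter> nb u = nb u \<inter> V" using Reg_V[OF zl[OF x z]] unfolding cd_def cand_def by auto
    then show "if z < 0 then f z \<in> nb u else q ^ (card (hn z \<inter> {..<0}) + 1) * \<nu> \<le> real (card (cd f 0 z \<inter> nb u))"
      using V_deg[OF u] unfolding \<nu>_def by simp
  qed
  have t1: "todo 0 x = k" unfolding todo_def using B_deg[OF x] by simp
  have "card (sec x) \<le> card (\<Union>(hn ` hn x))"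
    unfolding sec_def by (rule card_mono) (use fin_hn[OF nx] hn_sub[OF nx] fin_hn in auto)
  also have "\<dots> \<le> (\<Sum>z\<in>hn x. card (hn z))" by (rule card_UN_le[OF fin_hn[OF nx]])
  also have "\<dots> \<le> (\<Sum>z\<in>hn x. \<Delta>)" by (intro sum_mono hn_deg) (use hn_sub[OF nx] in auto)
  also have "\<dots> \<le> \<Delta> * \<Delta>" using hn_deg[OF nx] by simp
  finally have "todo2 0 x \<le> \<Delta>\<^sup>2" unfolding todo2_def by (simp add: power2_eq_square)
  then have "(1 - \<epsilon>) ^ \<Delta>\<^sup>2 \<le> (1 - \<epsilon>) ^ todo2 0 x" using \<epsilon> by (intro power_decreasing) auto
  then have "1 / 2 \<le> (1 - \<epsilon>) ^ todo2 0 x" using \<epsilon>\<Delta> by linarith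
  then have "c1 ^ k * (1 / 2) \<le> c1 ^ k * (1 - \<epsilon>) ^ todo2 0 x" using c1 by (intro mult_left_mono) auto
  then show ?thesis unfolding Y_def t1 using al by simp
qed

lemma pot2_start: "pot2 f 0 \<le> 1 / 4"
proof -
  have "exp h0 * (\<Prod>x\<in>B. 1 - Y u f 0 x / 2) \<le> exp (- h0)" if u: "u < N" for u
  proof -
    have "(\<Prod>x\<in>B. 1 - Y u f 0 x / 2) \<le> (\<Prod>x\<in>B. exp (- (c1 ^ k / 4)))"
    proof (intro prod_mono conjI)
      fix x assume x: "x \<in> B"
      show "0 \<le> 1 - Y u f 0 x / 2" using Y_bounds(2)[of u f 0 x] by simp
      have "1 - Y u f 0 x / 2 \<le> 1 + - (c1 ^ k / 4)" using Y_start[OF u x, of f] by simp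
      also have "\<dots> \<le> exp (- (c1 ^ k / 4))" by (rule exp_ge_add_one_self)
      finally show "1 - Y u f 0 x / 2 \<le> exp (- (c1 ^ k / 4))" .
    qed
    also have "\<dots> = exp (- 2 * h0)" unfolding h0_def by (simp add: exp_of_nat_mult[symmetric])
    finally have "exp h0 * (\<Prod>x\<in>B. 1 - Y u f 0 x / 2) \<le> exp h0 * exp (- 2 * h0)" by (intro mult_left_mono) auto
    also have "\<dots> = exp (- h0)" by (simp add: exp_add[symmetric])
    finally show ?thesis .
  qed
  then have "pot2 f 0 \<le> (\<Sum>u<N. exp (- h0))" unfolding pot2_def by (intro sum_mono) auto
  also have "\<dots> = real N * exp (- h0)" by simp
  also have "\<dots> \<le> real N * exp (- (3 * L))" using hB unfolding h0_def c1_def by (intro mult_left_mono) auto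
  also have "exp (- (3 * L)) = 1 / real N ^ 3"
  proof -
    have "exp (3 * L) = real N ^ 3" unfolding L_def using N3 by (simp add: exp_of_nat_mult[of 3, simplified])
    then show ?thesis by (simp add: exp_minus field_simps)
  qed
  also have "real N * (1 / real N ^ 3) = 1 / (real N * real N)" using N3 by (simp add: power3_eq_cube)
  also have "\<dots> \<le> 1 / 4"
  proof -
    have "3 * 3 \<le> real N * real N" using N3 by (intro mult_mono) auto
    then show ?thesis by (intro divide_left_mono) auto
  qed
  finally show ?thesis .
qed

lemma pot2_end:
  assumes "pot2 f l \<le> 1" "v < N"
  shows "h0 \<le> real (card {x\<in>B. f ` hn x \<subseteq> nb v})"
proof -
  define hit where "hit = {x\<in>B. f ` hn x \<subseteq> nb v}"
  have fh: "finite hit" unfolding hit_def using finB by simp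
  have Y: "Y v f l x = (if x \<in> hit then 1 else 0)" if x: "x \<in> B" for x
  proof -
    have e: "hn x \<inter> {l..} = {}" "sec x \<inter> {l..} = {}" using B_hn[OF x] unfolding sec_def by auto
    then have "todo l x = 0" "todo2 l x = 0" unfolding todo_def todo2_def by auto
    moreover have "alive v f l x \<longleftrightarrow> x \<in> hit" unfolding alive_def hit_def using x zl[OF x] by auto
    ultimately show ?thesis unfolding Y_def by simp
  qed
  have "(\<Prod>x\<in>B. 1 - Y v f l x / 2) = (\<Prod>x\<in>B. if x \<in> hit then 1 / 2 else 1)"
    by (rule prod.cong) (use Y in auto)
  also have "\<dots> = (\<Prod>x\<in>B \<inter> hit. 1 / 2)" using finB by (rule prod.inter_restrict[symmetric])
  also have "B \<inter> hit = hit" unfolding hit_def by auto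
  also have "(\<Prod>x\<in>hit. 1 / 2 :: real) = (1 / 2) ^ card hit" by simp
  finally have pr: "(\<Prod>x\<in>B. 1 - Y v f l x / 2) = (1 / 2) ^ card hit" .
  have "exp h0 * (\<Prod>x\<in>B. 1 - Y v f l x / 2) \<le> pot2 f l"
    unfolding pot2_def
  proof (rule member_le_sum)
    show "0 \<le> exp h0 * (\<Prod>x\<in>B. 1 - Y u f l x / 2)" for u
    proof (intro mult_nonneg_nonneg prod_nonneg)
      show "0 \<le> 1 - Y u f l x / 2" for x using Y_bounds(2)[of u f l x] by simp
    qed simp
  qed (use assms in auto)
  then have "exp h0 * (1 / 2) ^ card hit \<le> 1" unfolding pr using assms by simp
  moreover have "exp (- real (card hit)) \<le> (1 / 2) ^ card hit"
  proof -
    have "exp (- 1 :: real) \<le> 1 / 2" using exp_ge_add_one_self[of "1::real"] by (simp add: exp_minus field_simps)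
    then have "exp (- 1 :: real) ^ card hit \<le> (1 / 2) ^ card hit" by (intro power_mono) auto
    then show ?thesis by (simp add: exp_of_nat_mult[symmetric])
  qed
  ultimately have "exp h0 * exp (- real (card hit)) \<le> 1" by (smt (verit) exp_gt_zero mult_left_mono)
  then have "h0 - real (card hit) \<le> 0" by (simp add: exp_add[symmetric] exp_diff)
  then show ?thesis unfolding hit_def by simp
qed

section \<open>Large host sets meet the candidates of most buffer vertices\<close>

definition "sp f t x T \<longleftrightarrow> (\<exists>z\<in>hn x. z < t \<and> real (card (nb (f z) \<inter> cand f {..<z} x T)) < q * real (card (cand f {..<z} x T)))"
definition "\<kappa> = exp \<rho> - 1"
text \<open>Upper bound for the conditional expectation of the variable that is
  \<open>exp \<rho>\<close> if \<open>x\<close> becomes spoiled for \<open>T\<close> and 1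
  otherwise: each neighbour still to come spoils it with probability at most
  \<open>\<zeta>\<close>.\<close>

definition "Q f t x T = (if sp f t x T then exp \<rho> else (1 + \<kappa> * \<zeta>) ^ todo t x)"
definition "pot3 f t = (\<Sum>T\<in>{T\<in>Pow {..<N}. \<tau>0 \<le> real (card T)}. exp (- \<rho> * h1) * (\<Prod>x\<in>B. Q f t x T))"

lemma \<kappa>: "\<kappa> \<ge> 0" unfolding \<kappa>_def using \<rho> by simp

lemma Q_nonneg: "0 \<le> Q f t x T" unfolding Q_def using \<kappa> \<zeta> by simp

lemma not_sp_size:
  assumes "\<not> sp f t x T" "x < n"
  shows "q ^ card (hn x \<inter> {..<t}) * real (card T) \<le> real (card (cand f {..<t} x T))"
  using assms(1)
proof (induction t)
  case 0
  then show ?case by (simp add: cand_def)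
next
  case (Suc t)
  have "\<not> sp f t x T" using Suc.prems unfolding sp_def by (meson less_SucI)
  note IH = Suc.IH[OF this]
  have cs: "cand f {..<Suc t} x T = (if t \<in> hn x then nb (f t) \<inter> cand f {..<t} x T else cand f {..<t} x T)"
    unfolding cand_def by (auto simp: less_Suc_eq)
  show ?case
  proof (cases "t \<in> hn x")
    case True
    have "q * real (card (cand f {..<t} x T)) \<le> real (card (nb (f t) \<inter> cand f {..<t} x T))"
      using Suc.prems True unfolding sp_def by (auto simp: not_less)
    moreover have "q * (q ^ card (hn x \<inter> {..<t}) * real (card T)) \<le> q * real (card (cand f {..<t} x T))"
      using IH q by (intro mult_left_mono) auto
    ultimately show ?thesis unfolding cs hn_Suc[OF assms(2)] using True by (simp add: mult.assoc)
  next
    case False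
    then show ?thesis using IH unfolding cs hn_Suc[OF assms(2)] by simp
  qed
qed

lemma sp_Suc: "sp (f(t := w)) (Suc t) x T \<longleftrightarrow> sp f t x T \<or> (t \<in> hn x \<and> real (card (nb w \<inter> cand f {..<t} x T)) < q * real (card (cand f {..<t} x T)))"
proof -
  have eq: "cand (f(t := w)) {..<z} x T = cand f {..<z} x T" if "z \<le> t" for z
    by (rule cand_cong) (use that in auto)
  have "z < Suc t \<and> real (card (nb ((f(t := w)) z) \<inter> cand (f(t := w)) {..<z} x T)) < q * real (card (cand (f(t := w)) {..<z} x T)) \<longleftrightarrow>
     (z < t \<and> real (card (nb (f z) \<inter> cand f {..<z} x T)) < q * real (card (cand f {..<z} x T))) \<or>
     (z = t \<and> real (card (nb w \<inter> cand f {..<t} x T)) < q * real (card (cand f {..<t} x T)))" for z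
    using eq[of z] by (cases "z = t") (auto simp: less_Suc_eq)
  then show ?thesis unfolding sp_def by blast
qed

text \<open>While \<open>x\<close> is unspoiled, its candidates inside \<open>T\<close> number at
  least \<open>q ^ (k - 1) * \<tau>0 \<ge> M\<close> before the next neighbour is embedded, so
  \<open>few_bad\<close> leaves at most \<open>m\<close> spoiling images.\<close>

lemma Q_step:
  assumes v: "valid f t" and t: "t < l" and c: "ctrl f t" and x: "x \<in> B" and tx: "t \<in> hn x"
    and T: "T \<subseteq> {..<N}" "\<tau>0 \<le> real (card T)"
  shows "(\<Sum>w\<in>avail f t. Q (f(t := w)) (Suc t) x T) \<le> real (card (avail f t)) * Q f t x T"
proof (cases "sp f t x T")
  case True
  then show ?thesis unfolding Q_def sp_Suc by simp
next
  case False
  let ?A = "avail f t"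
  define C where "C = cand f {..<t} x T"
  define Bd where "Bd = {w\<in>?A. real (card (nb w \<inter> C)) < q * real (card C)}"
  have fA: "finite ?A" using avail_ctrl(4)[OF v t c] .
  define z where "z = (1 + \<kappa> * \<zeta>) ^ todo (Suc t) x"
  have z1: "z \<ge> 1" unfolding z_def using \<kappa> \<zeta> by (intro one_le_power) simp
  have "card (hn x \<inter> {..<t}) < card (hn x)" by (rule card_hn_less) (use xn x tx in auto)
  then have "q ^ (k - 1) * \<tau>0 \<le> q ^ card (hn x \<inter> {..<t}) * real (card T)"
    using B_deg[OF x] T q \<tau>0 by (intro mult_mono q_power_le) auto
  also have "\<dots> \<le> real (card C)" unfolding C_def by (rule not_sp_size[OF False xn[OF x]])
  finally have CM: "M \<le> real (card C)" using \<tau>0 by linarith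
  have CN: "C \<subseteq> {..<N}" unfolding C_def cand_def using T by auto
  have "Bd \<subseteq> {w\<in>{..<N}. real (card (nb w \<inter> C)) < q * real (card C)}"
    unfolding Bd_def using avail_V[OF t] V by auto
  then have "card Bd \<le> card {w\<in>{..<N}. real (card (nb w \<inter> C)) < q * real (card C)}" by (rule card_mono[rotated]) simp
  then have "real (card Bd) \<le> m" using few_bad[OF CN CM] by linarith
  also have "m \<le> \<zeta> * (\<sigma> / 4 * (q ^ D * \<nu>))" by (rule \<zeta>)
  also have "\<dots> \<le> \<zeta> * ((1 - \<epsilon>) * (\<sigma> / 2) * (q ^ bd t * \<nu>))"
  proof (intro mult_left_mono)
    have "\<sigma> / 4 * (q ^ D * \<nu>) = 1 / 2 * (\<sigma> / 2) * (q ^ D * \<nu>)" by simp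
    also have "\<dots> \<le> (1 - \<epsilon>) * (\<sigma> / 2) * (q ^ bd t * \<nu>)"
      using \<epsilon> \<sigma> q \<nu>_pos back_deg[OF t] unfolding bd_def by (intro mult_mono q_power_le) auto
    finally show "\<sigma> / 4 * (q ^ D * \<nu>) \<le> (1 - \<epsilon>) * (\<sigma> / 2) * (q ^ bd t * \<nu>)" .
  qed (rule \<zeta>)
  also have "\<dots> \<le> \<zeta> * real (card ?A)" using avail_ctrl(2)[OF v t c] \<zeta> by (intro mult_left_mono) auto
  finally have bd: "real (card Bd) \<le> \<zeta> * real (card ?A)" .
  have "(\<Sum>w\<in>?A. Q (f(t := w)) (Suc t) x T) \<le> (\<Sum>w\<in>?A. z * (1 + (if w \<in> Bd then \<kappa> else 0)))"
  proof (rule sum_mono)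
    fix w assume w: "w \<in> ?A"
    show "Q (f(t := w)) (Suc t) x T \<le> z * (1 + (if w \<in> Bd then \<kappa> else 0))"
    proof (cases "w \<in> Bd")
      case True
      then have "Q (f(t := w)) (Suc t) x T = exp \<rho>" unfolding Q_def sp_Suc Bd_def C_def using tx by auto
      also have "\<dots> \<le> z * exp \<rho>" using z1 by simp
      finally show ?thesis using True unfolding \<kappa>_def by simp
    next
      case nb: False
      then have "\<not> sp (f(t := w)) (Suc t) x T" using False w unfolding sp_Suc Bd_def C_def by auto
      then show ?thesis using nb unfolding Q_def z_def by simp
    qed
  qed
  also have "\<dots> = z * (real (card ?A) + \<kappa> * real (card Bd))"
  proof -
    have "?A \<inter> Bd = Bd" unfolding Bd_def by auto
    then show ?thesis unfolding sum_distrib_left[symmetric] using fA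
      by (simp add: sum.distrib sum.inter_restrict[symmetric])
  qed
  also have "\<dots> \<le> z * (real (card ?A) + \<kappa> * (\<zeta> * real (card ?A)))"
    using bd z1 \<kappa> by (intro mult_left_mono add_left_mono) auto
  also have "\<dots> = real (card ?A) * (z * (1 + \<kappa> * \<zeta>))" by (simp add: algebra_simps)
  also have "z * (1 + \<kappa> * \<zeta>) = Q f t x T" unfolding Q_def z_def using False todo_Suc[OF x, of t] tx by simp
  finally show ?thesis .
qed

lemma pot3_step:
  assumes v: "valid f t" and t: "t < l" and c: "ctrl f t"
  shows "(\<Sum>w\<in>avail f t. pot3 (f(t := w)) (Suc t)) \<le> real (card (avail f t)) * pot3 f t"
proof -
  let ?I = "{T\<in>Pow {..<N}. \<tau>0 \<le> real (card T)}"
  have "(\<Sum>w\<in>avail f t. \<Prod>x\<in>B. Q (f(t := w)) (Suc t) x T) \<le> real (card (avail f t)) * (\<Prod>x\<in>B. Q f t x T)"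
    if T: "T \<in> ?I" for T
  proof (rule prod_step[where aff = "\<lambda>x. t \<in> hn x"])
    show "Q (f(t := w)) (Suc t) x T = Q f t x T" if "x \<in> B" "t \<notin> hn x" for w x
      unfolding Q_def sp_Suc using that todo_Suc[of x t] by simp
    show "x = y" if "x \<in> B" "y \<in> B" "t \<in> hn x" "t \<in> hn y" for x y using zone_unique[of x y t] that by simp
  qed (use T finB avail_ctrl(4)[OF v t c] Q_nonneg Q_step[OF v t c] in auto)
  then have "exp (- \<rho> * h1) * (\<Sum>w\<in>avail f t. \<Prod>x\<in>B. Q (f(t := w)) (Suc t) x T) \<le> exp (- \<rho> * h1) * (real (card (avail f t)) * (\<Prod>x\<in>B. Q f t x T))"
    if "T \<in> ?I" for T using that by (intro mult_left_mono) auto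
  then have "(\<Sum>T\<in>?I. exp (- \<rho> * h1) * (\<Sum>w\<in>avail f t. \<Prod>x\<in>B. Q (f(t := w)) (Suc t) x T)) \<le> (\<Sum>T\<in>?I. exp (- \<rho> * h1) * (real (card (avail f t)) * (\<Prod>x\<in>B. Q f t x T)))"
    by (intro sum_mono) auto
  then have "(\<Sum>T\<in>?I. \<Sum>w\<in>avail f t. exp (- \<rho> * h1) * (\<Prod>x\<in>B. Q (f(t := w)) (Suc t) x T)) \<le> (\<Sum>T\<in>?I. real (card (avail f t)) * (exp (- \<rho> * h1) * (\<Prod>x\<in>B. Q f t x T)))"
    by (simp only: sum_distrib_left mult.left_commute)
  then show ?thesis unfolding pot3_def sum_distrib_left by (subst sum.swap) simp
qed

text \<open>There are at most \<open>2 ^ N\<close> sets \<open>T\<close>, and the product over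
  \<open>B\<close> is at most \<open>exp N\<close> because
  \<open>k * \<kappa> * \<zeta> \<le> 1\<close> for nonempty \<open>B\<close>; the assumption
  \<open>3 * N \<le> \<rho> * h1\<close> outweighs both.\<close>

lemma pot3_start: "pot3 f 0 \<le> 1 / 4"
proof -
  let ?I = "{T\<in>Pow {..<N}. \<tau>0 \<le> real (card T)}"
  have "(\<Prod>x\<in>B. Q f 0 x T) \<le> exp (real N)" for T
  proof -
    have "(\<Prod>x\<in>B. Q f 0 x T) = (\<Prod>x\<in>B. (1 + \<kappa> * \<zeta>) ^ k)"
    proof (rule prod.cong[OF refl])
      fix x assume x: "x \<in> B"
      have "\<not> sp f 0 x T" unfolding sp_def by simp
      moreover have "todo 0 x = k" unfolding todo_def using B_deg[OF x] by simp
      ultimately show "Q f 0 x T = (1 + \<kappa> * \<zeta>) ^ k" unfolding Q_def by simp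
    qed
    also have "\<dots> = (1 + \<kappa> * \<zeta>) ^ (k * card B)" by (simp add: power_mult)
    also have "\<dots> \<le> exp (\<kappa> * \<zeta>) ^ (k * card B)" using \<kappa> \<zeta> by (intro power_mono exp_ge_add_one_self) auto
    also have "\<dots> = exp (real (k * card B) * (\<kappa> * \<zeta>))" by (simp add: exp_of_nat_mult[symmetric])
    also have "\<dots> \<le> exp (real N)"
    proof -
      have "real k * (\<kappa> * \<zeta>) * real (card B) \<le> 1 * real N" if ne: "B \<noteq> {}"
      proof (intro mult_mono)
        obtain x where x: "x \<in> B" using ne by blast
        have "k \<le> \<Delta>" using B_deg[OF x] hn_deg[OF xn[OF x]] by simp
        then have "real k * (\<kappa> * \<zeta>) \<le> real \<Delta> * (exp \<rho> * \<zeta>)"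
          using \<kappa> \<zeta> unfolding \<kappa>_def by (intro mult_mono mult_right_mono mult_nonneg_nonneg) auto
        then show "real k * (\<kappa> * \<zeta>) \<le> 1" using \<zeta>(2) by (simp add: mult_ac)
      qed (use BN \<kappa> \<zeta> in auto)
      then show ?thesis by (cases "B = {}") (auto simp: mult_ac)
    qed
    finally show ?thesis .
  qed
  then have "pot3 f 0 \<le> (\<Sum>T\<in>?I. exp (- \<rho> * h1) * exp (real N))" unfolding pot3_def by (intro sum_mono mult_left_mono) auto
  also have "\<dots> = real (card ?I) * (exp (- \<rho> * h1) * exp (real N))" by simp
  also have "\<dots> \<le> exp (real N) * (exp (- 3 * real N) * exp (real N))"
  proof (intro mult_mono)
    have "card ?I \<le> card (Pow {..<N})" by (rule card_mono) auto
    also have "\<dots> = 2 ^ N" by (simp add: card_Pow)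
    finally have "real (card ?I) \<le> 2 ^ N" by (metis of_nat_le_iff of_nat_numeral of_nat_power)
    also have "\<dots> \<le> exp 1 ^ N" using exp_ge_add_one_self[of "1::real"] by (intro power_mono) auto
    also have "\<dots> = exp (real N)" by (simp add: exp_of_nat_mult[symmetric])
    finally show "real (card ?I) \<le> exp (real N)" .
  qed (use \<rho> in auto)
  also have "\<dots> = exp (- real N)" by (simp add: exp_add[symmetric])
  also have "\<dots> \<le> 1 / 4"
  proof -
    have "real N + 1 \<le> exp (real N)" using exp_ge_add_one_self[of "real N"] by linarith
    then have "4 \<le> exp (real N)" using N3 by linarith
    then show ?thesis by (simp add: exp_minus field_simps)
  qed
  finally show ?thesis .
qed

lemma pot3_end:
  assumes "pot3 f l \<le> 1" "T \<subseteq> {..<N}" "\<tau>0 \<le> real (card T)"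
  shows "real (card {x\<in>B. cand f {..<l} x T = {}}) \<le> h1"
proof -
  define S where "S = {x\<in>B. sp f l x T}"
  have "{x\<in>B. cand f {..<l} x T = {}} \<subseteq> S"
  proof
    fix x assume x: "x \<in> {x\<in>B. cand f {..<l} x T = {}}"
    show "x \<in> S"
    proof (rule ccontr)
      assume "x \<notin> S"
      then have "\<not> sp f l x T" using x unfolding S_def by simp
      then have "q ^ card (hn x \<inter> {..<l}) * real (card T) \<le> real (card (cand f {..<l} x T))"
        by (rule not_sp_size) (use x xn in auto)
      moreover have "0 < q ^ card (hn x \<inter> {..<l}) * real (card T)" using q \<tau>0 assms by simp
      ultimately show False using x by simp
    qed
  qed
  then have c: "card {x\<in>B. cand f {..<l} x T = {}} \<le> card S" by (rule card_mono[rotated]) (use finB in \<open>simp add: S_def\<close>)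
  have "exp (\<rho> * real (card S)) = (\<Prod>x\<in>S. exp \<rho>)" by (simp add: exp_of_nat2_mult)
  also have "\<dots> = (\<Prod>x\<in>B. if sp f l x T then exp \<rho> else 1)" unfolding S_def using finB by (rule prod.inter_filter)
  also have "\<dots> \<le> (\<Prod>x\<in>B. Q f l x T)"
    by (intro prod_mono) (use \<kappa> \<zeta> in \<open>auto simp: Q_def intro!: one_le_power\<close>)
  finally have "exp (- \<rho> * h1) * exp (\<rho> * real (card S)) \<le> exp (- \<rho> * h1) * (\<Prod>x\<in>B. Q f l x T)" by (intro mult_left_mono) auto
  also have "\<dots> \<le> pot3 f l" unfolding pot3_def
    by (rule member_le_sum[of T]) (use assms Q_nonneg in \<open>auto intro!: mult_nonneg_nonneg prod_nonneg\<close>)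
  also have "\<dots> \<le> 1" by (rule assms)
  finally have "\<rho> * (real (card S) - h1) \<le> 0" by (simp add: exp_add[symmetric] algebra_simps)
  moreover have "\<rho> > 0"
  proof (rule ccontr)
    assume "\<not> ?thesis"
    then have "\<rho> = 0" using \<rho> by simp
    then show False using \<rho>(2) N3 by simp
  qed
  ultimately have "real (card S) \<le> h1" by (simp add: mult_le_0_iff)
  then show ?thesis using c by linarith
qed

theorem buffered_run:
  "\<exists>f. valid f l \<and> (\<forall>v<N. (\<sigma> / 8 * q) ^ k * real (card B) / 8 \<le> real (card {x\<in>B. f ` hn x \<subseteq> nb v}))
    \<and> (\<forall>T\<subseteq>{..<N}. \<tau>0 \<le> real (card T) \<longrightarrow> real (card {x\<in>B. cand f {..<l} x T = {}}) \<le> h1)"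
proof -
  have nn: "pot2 f t \<ge> 0" "pot3 f t \<ge> 0" for f t
  proof -
    have "0 \<le> 1 - Y u f t x / 2" for u x using Y_bounds(2)[of u f t x] by simp
    then show "pot2 f t \<ge> 0" unfolding pot2_def by (intro sum_nonneg mult_nonneg_nonneg prod_nonneg) auto
    show "pot3 f t \<ge> 0" unfolding pot3_def using Q_nonneg by (intro sum_nonneg mult_nonneg_nonneg prod_nonneg) auto
  qed
  have "\<exists>f. valid f l \<and> pot2 f l + pot3 f l \<le> 1"
  proof (rule greedy_run[where \<Psi> = "\<lambda>f t. pot2 f t + pot3 f t"])
    fix f g :: "nat \<Rightarrow> nat" and t assume fg: "\<And>x. x < t \<Longrightarrow> f x = g x"
    have "Y v f t x = Y v g t x" for v x unfolding Y_def using alive_cong[OF fg] by simp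
    moreover have "sp f t x T = sp g t x T" for x T
    proof -
      have "cand f {..<z} x T = cand g {..<z} x T" if "z < t" for z by (rule cand_cong) (use that fg in auto)
      then show ?thesis unfolding sp_def using fg by auto
    qed
    ultimately show "pot2 f t + pot3 f t = pot2 g t + pot3 g t" unfolding pot2_def pot3_def Q_def by simp
  next
    show "pot2 f 0 + pot3 f 0 \<le> 1 / 2" for f using pot2_start[of f] pot3_start[of f] by linarith
    show "(\<Sum>w\<in>avail f t. pot2 (f(t := w)) (Suc t) + pot3 (f(t := w)) (Suc t)) \<le> real (card (avail f t)) * (pot2 f t + pot3 f t)"
      if "valid f t" "t < l" "ctrl f t" for f t
      unfolding sum.distrib using pot2_step[OF that] pot3_step[OF that] by (simp add: algebra_simps)
  qed (use nn in auto)
  then obtain f where f: "valid f l" "pot2 f l + pot3 f l \<le> 1" by blast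
  have "pot2 f l \<le> 1" "pot3 f l \<le> 1" using f(2) nn[of f l] by linarith+
  then show ?thesis using f(1) pot2_end[of f] pot3_end[of f] unfolding h0_def c1_def by blast
qed

end

section \<open>Matchings that complete an embedding\<close>

context embedding
begin

text \<open>One Hall step for each colour. Disjoint regions keep the map injective across classes,
  and vertices outside \<open>S\<close> have no neighbours in \<open>S\<close>, so only vertices of
  \<open>S\<close> need regions large enough for the step.\<close>

lemma hall_classes:
  fixes \<chi> :: "nat \<Rightarrow> nat" and cN :: nat
  assumes f: "partial f D" and tr: "\<And>y. y < n \<Longrightarrow> y \<notin> D \<Longrightarrow> tracked f D y (Reg y)"
    and S: "S \<subseteq> {..<n} - D" "\<And>y. y \<in> S \<Longrightarrow> Reg y = VV (\<chi> y)"
    and out: "\<And>y. y < n \<Longrightarrow> y \<notin> D \<Longrightarrow> y \<notin> S \<Longrightarrow> hn y \<inter> S = {}"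
    and VV: "\<And>c. VV c \<subseteq> {..<N}" "\<And>c. VV c \<inter> f ` D = {}" "\<And>c c'. c \<noteq> c' \<Longrightarrow> VV c \<inter> VV c' = {}"
    and \<chi>: "\<And>x y. x \<in> S \<Longrightarrow> y \<in> S \<Longrightarrow> \<chi> x = \<chi> y \<Longrightarrow> y \<notin> hn x"
      "\<And>x y. x \<in> S \<Longrightarrow> y \<in> S \<Longrightarrow> x \<noteq> y \<Longrightarrow> \<chi> x = \<chi> y \<Longrightarrow> hn x \<inter> hn y = {}" "\<And>x. x \<in> S \<Longrightarrow> \<chi> x < cN"
    and r0: "\<And>c. c < cN \<Longrightarrow> r0 \<le> real (card (VV c))" "real \<Delta> * M \<le> q ^ (\<Delta> - 1) * r0"
    and size: "\<And>c. c < cN \<Longrightarrow> (1 + \<epsilon>) * real (card {y\<in>S. \<chi> y = c}) \<le> ((1 - \<epsilon>) * (1 - 3 * \<epsilon>) ^ \<Delta> - \<epsilon>) * real (card (VV c))"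
  shows "\<exists>g. partial g (D \<union> S) \<and> (\<forall>x\<in>D. g x = f x) \<and> (\<forall>x\<in>S. g x \<in> VV (\<chi> x)) \<and>
    (\<forall>y<n. y \<notin> D \<union> S \<longrightarrow> tracked g (D \<union> S) y (Reg y))"
proof -
  define E where "E c = {y\<in>S. \<chi> y < c}" for c
  have "\<exists>g. partial g (D \<union> E c) \<and> (\<forall>x\<in>D. g x = f x) \<and> (\<forall>x\<in>E c. g x \<in> VV (\<chi> x)) \<and>
    (\<forall>y<n. y \<notin> D \<union> E c \<longrightarrow> tracked g (D \<union> E c) y (Reg y))" if "c \<le> cN" for c
    using that
  proof (induction c)
    case 0
    then show ?case using f tr unfolding E_def by auto
  next
    case (Suc c)
    then obtain g where g: "partial g (D \<union> E c)" "\<forall>x\<in>D. g x = f x" "\<forall>x\<in>E c. g x \<in> VV (\<chi> x)"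
      "\<forall>y<n. y \<notin> D \<union> E c \<longrightarrow> tracked g (D \<union> E c) y (Reg y)" by auto
    define W where "W = {y\<in>S. \<chi> y = c}"
    have E: "E (Suc c) = E c \<union> W" unfolding E_def W_def by (auto simp: less_Suc_eq)
    have cN: "c < cN" using Suc.prems by simp
    have "\<exists>h. partial h ((D \<union> E c) \<union> W) \<and> (\<forall>x\<in>D \<union> E c. h x = g x) \<and> h ` W \<subseteq> VV c \<and>
      (\<forall>y<n. y \<notin> (D \<union> E c) \<union> W \<longrightarrow> tracked h ((D \<union> E c) \<union> W) y (Reg y))"
    proof (rule hall_step[where ?r0.0 = r0, OF g(1)])
      show "tracked g (D \<union> E c) y (Reg y)" if "y < n" "y \<notin> D \<union> E c" for y using g(4) that by simp
      show "W \<subseteq> {..<n} - (D \<union> E c)" using S unfolding W_def E_def by auto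
      show "Reg x = VV c" if "x \<in> W" for x using S that unfolding W_def by auto
      show "VV c \<subseteq> {..<N}" by (rule VV)
      show "VV c \<inter> g ` (D \<union> E c) = {}"
      proof -
        have "g ` D = f ` D" using g(2) by (intro image_cong) auto
        moreover have "VV c \<inter> g ` E c = {}"
        proof -
          have "g x \<notin> VV c" if "x \<in> E c" for x
            using g(3) that VV(3)[of c "\<chi> x"] unfolding E_def by auto
          then show ?thesis by auto
        qed
        ultimately show ?thesis using VV(2)[of c] by (simp add: image_Un Int_Un_distrib)
      qed
      show "Reg y \<subseteq> {..<N} \<and> r0 \<le> real (card (Reg y))" if "y < n" "y \<notin> D \<union> E c" "hn y \<inter> W \<noteq> {}" for y
      proof -
        have "y \<in> S" using out[of y] that unfolding W_def by auto
        then show ?thesis using S(2) VV(1) r0(1) \<chi>(3) by simp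
      qed
    qed (use \<chi>(1,2) r0 cN size[OF cN] in \<open>auto simp: W_def\<close>)
    then obtain h where h: "partial h (D \<union> E (Suc c))" "\<forall>x\<in>D \<union> E c. h x = g x" "h ` W \<subseteq> VV c"
      "\<forall>y<n. y \<notin> D \<union> E (Suc c) \<longrightarrow> tracked h (D \<union> E (Suc c)) y (Reg y)" unfolding E Un_assoc by blast
    have "h x \<in> VV (\<chi> x)" if "x \<in> E (Suc c)" for x
      using that h(2,3) g(3) unfolding E by (auto simp: W_def)
    then show ?case using h g(2) by (intro exI[of _ h]) auto
  qed
  moreover have "E cN = S" using \<chi>(3) unfolding E_def by auto
  ultimately show ?thesis by (metis le_refl)
qed

text \<open>A violating \<open>S\<close> with image \<open>Y\<close> is excluded in three ranges. If
  \<open>Y\<close> is small, the tracked candidates in the reserve \<open>T0\<close> give too many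
  pairs. Otherwise the complement \<open>Q\<close> of \<open>Y\<close> has fewer than
  \<open>card Q\<close> neighbours in \<open>B\<close>. If these are few, \<open>vside\<close> gives
  too many pairs; if not, \<open>Q\<close> is large and \<open>tside\<close> leaves at most
  \<open>h1\<close> vertices of \<open>B\<close> without a candidate in \<open>Q\<close>, although
  all of \<open>S\<close> is such.\<close>

lemma final_hall:
  assumes f: "partial f D" and nN: "n \<le> N" and B: "B = {..<n} - D" "\<And>x. x \<in> B \<Longrightarrow> hn x \<subseteq> D" "\<And>x. x \<in> B \<Longrightarrow> card (hn x) = k"
    "\<And>x y. x \<in> B \<Longrightarrow> y \<in> B \<Longrightarrow> x \<noteq> y \<Longrightarrow> hn x \<inter> hn y = {}"
    and T0: "T0 \<subseteq> {..<N} - f ` D" and tr: "\<And>x. x \<in> B \<Longrightarrow> tracked f D x T0"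
    and vside: "\<And>v. v < N \<Longrightarrow> h0 \<le> real (card {x\<in>B. f ` hn x \<subseteq> nb v})"
    and tside: "\<And>T. T \<subseteq> {..<N} \<Longrightarrow> \<tau>0 \<le> real (card T) \<Longrightarrow> real (card {x\<in>B. cand f D x T = {}}) \<le> h1"
    and num1: "(1 + \<epsilon>) * p ^ k * h1 + 2 * K * L \<le> q ^ k * real (card T0)"
    and num2: "(1 + \<epsilon>) * p ^ k * \<tau>0 + 2 * K * L \<le> h0"
  shows "\<exists>g. partial g {..<n}"
proof -
  have fD: "D \<subseteq> {..<n}" "inj_on f D" "f ` D \<subseteq> {..<N}" using f unfolding partial_def by auto
  define T where "T = {..<N} - f ` D"
  have finT: "finite T" "finite B" unfolding T_def B by auto
  have fD': "finite D" using fD finite_subset by blast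
  have cT: "card B \<le> card T"
  proof -
    have "card T = N - card D" unfolding T_def using fD by (simp add: card_Diff_subset[OF finite_imageI[OF fD']] card_image)
    moreover have "card B = n - card D" unfolding B using fD fD' by (simp add: card_Diff_subset)
    ultimately show ?thesis using nN by simp
  qed
  have p0: "p ^ k > 0" using p by simp
  define A where "A x = cand f D x T" for x
  have A_iff: "v \<in> A x \<longleftrightarrow> v \<in> T \<and> f ` hn x \<subseteq> nb v" if "x \<in> B" for x v
  proof -
    have "hn x \<inter> D = hn x" using B(2)[OF that] by auto
    then show ?thesis unfolding A_def cand_def using nb_sym by auto
  qed
  have ks: "card (f ` hn x) = k" "f ` hn x \<subseteq> {..<N}" "k \<le> \<Delta>" if x: "x \<in> B" for x
  proof -
    show "card (f ` hn x) = k" using card_image[OF inj_on_subset[OF fD(2) B(2)[OF x]]] B(3)[OF x] by simp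
    show "f ` hn x \<subseteq> {..<N}" using fD B(2)[OF x] by auto
    show "k \<le> \<Delta>" using B(3)[OF x] hn_deg[of x] x unfolding B(1) by auto
  qed
  have disj: "f ` hn x \<inter> f ` hn y = {}" if "x \<in> B" "y \<in> B" "x \<noteq> y" for x y
    using B(4)[OF that] B(2)[OF that(1)] B(2)[OF that(2)] fD(2) by (subst inj_on_image_Int[symmetric, OF fD(2)]) auto
  have stars: "(\<Sum>x\<in>S. real (card {v\<in>Y. f ` hn x \<subseteq> nb v})) \<le> (1 + \<epsilon>) * real (card Y) * (real (card S) * p ^ k) + K * (real (card S) + real (card Y)) * L"
    if S: "S \<subseteq> B" and Y: "Y \<subseteq> T" for S Y
  proof -
    have "(\<Sum>x\<in>S. real (card {v\<in>Y. f ` hn x \<subseteq> nb v})) \<le> (1 + \<epsilon>) * real (card Y) * (\<Sum>x\<in>S. p ^ card (f ` hn x)) + K * (real (card S) + real (card Y)) * ln (real N)"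
    proof (rule few_stars)
      show "finite S" using S finT finite_subset by blast
      show "Y \<subseteq> {..<N}" using Y unfolding T_def by auto
      fix x assume x: "x \<in> S"
      have "f ` hn x \<inter> Y = {}" using Y B(2)[of x] x S unfolding T_def by blast
      then show "f ` hn x \<subseteq> {..<N} \<and> card (f ` hn x) \<le> \<Delta> \<and> f ` hn x \<inter> Y = {}" using ks[of x] x S by auto
    qed (use disj S in blast)
    moreover have "(\<Sum>x\<in>S. p ^ card (f ` hn x)) = (\<Sum>x\<in>S. p ^ k)" by (rule sum.cong[OF refl]) (use ks S in auto)
    ultimately show ?thesis unfolding L_def by simp
  qed
  have KL0: "K * L \<ge> 0" using K L_ge_1 by simp
  have "\<exists>h. inj_on h B \<and> (\<forall>x\<in>B. h x \<in> A x)"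
  proof (rule hall)
    show "finite B" by (rule finT)
    show "finite (A x)" for x unfolding A_def cand_def using finT by simp
    show "card S \<le> card (\<Union>(A ` S))" if S: "S \<subseteq> B" for S
    proof (rule ccontr)
      define Y where "Y = \<Union>(A ` S)"
      assume "\<not> ?thesis"
      then have YS: "card Y < card S" unfolding Y_def by simp
      have finS: "finite S" using S finT finite_subset by blast
      have YT: "Y \<subseteq> T" unfolding Y_def A_def cand_def by auto
      have s0: "real (card S) > 0" using YS by simp
      have "h1 \<le> real (card Y)"
      proof (rule ccontr)
        assume c: "\<not> h1 \<le> real (card Y)"
        have "real (card S) * (q ^ k * real (card T0)) = (\<Sum>x\<in>S. q ^ k * real (card T0))" by simp
        also have "\<dots> \<le> (\<Sum>x\<in>S. real (card {v\<in>Y. f ` hn x \<subseteq> nb v}))"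
        proof (rule sum_mono)
          fix x assume x: "x \<in> S"
          then have xB: "x \<in> B" using S by auto
          have "hn x \<inter> D = hn x" using B(2)[OF xB] by auto
          then have "q ^ k * real (card T0) \<le> real (card (cand f D x T0))" using tr[OF xB] B(3)[OF xB] unfolding tracked_def by simp
          also have "card (cand f D x T0) \<le> card {v\<in>Y. f ` hn x \<subseteq> nb v}"
          proof (rule card_mono)
            show "finite {v\<in>Y. f ` hn x \<subseteq> nb v}" using finite_subset[OF YT finT(1)] by simp
            have "cand f D x T0 \<subseteq> A x" using T0 unfolding A_def cand_def T_def by auto
            then show "cand f D x T0 \<subseteq> {v\<in>Y. f ` hn x \<subseteq> nb v}" using A_iff[OF xB] x unfolding Y_def by auto
          qed
          finally show "q ^ k * real (card T0) \<le> real (card {v\<in>Y. f ` hn x \<subseteq> nb v})" by simp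
        qed
        also have "\<dots> \<le> (1 + \<epsilon>) * real (card Y) * (real (card S) * p ^ k) + K * (real (card S) + real (card Y)) * L"
          by (rule stars[OF S YT])
        also have "\<dots> = real (card S) * ((1 + \<epsilon>) * p ^ k * real (card Y)) + K * L * (real (card S) + real (card Y))"
          by (simp add: algebra_simps)
        also have "\<dots> \<le> real (card S) * ((1 + \<epsilon>) * p ^ k * real (card Y)) + K * L * (2 * real (card S))"
          using YS KL0 by (intro add_left_mono mult_left_mono) auto
        also have "\<dots> = real (card S) * ((1 + \<epsilon>) * p ^ k * real (card Y) + 2 * K * L)" by (simp add: algebra_simps)
        also have "\<dots> < real (card S) * ((1 + \<epsilon>) * p ^ k * h1 + 2 * K * L)"
          using c s0 p0 \<epsilon> by (intro mult_strict_left_mono add_strict_right_mono) auto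
        also have "\<dots> \<le> real (card S) * (q ^ k * real (card T0))" using num1 by (intro mult_left_mono) auto
        finally show False by simp
      qed
      then have hS: "h1 < real (card S)" using YS by simp
      \<comment> \<open>As \<open>card B \<le> card T\<close>, a violator on one side yields one on
        the other: the neighbours \<open>NQ\<close> of \<open>Q\<close> avoid \<open>S\<close> and
        are fewer than \<open>card Q\<close>.\<close>
      define Q where "Q = T - Y"
      define NQ where "NQ = {x\<in>B. \<exists>v\<in>Q. f ` hn x \<subseteq> nb v}"
      have QT: "Q \<subseteq> T" unfolding Q_def by auto
      have finQ: "finite Q" using QT finT finite_subset by blast
      have NB: "NQ \<subseteq> B" unfolding NQ_def by auto
      have "NQ \<inter> S = {}" using A_iff S unfolding NQ_def Q_def Y_def by blast
      then have "card NQ + card S \<le> card B"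
        using card_Un_disjoint[of NQ S] card_mono[OF finT(2), of "NQ \<union> S"] NB S finS finite_subset[OF NB finT(2)] by simp
      moreover have "card Q = card T - card Y" unfolding Q_def using YT finT finite_subset by (simp add: card_Diff_subset[OF finite_subset[OF YT finT(1)]])
      moreover have "card Y \<le> card T" using YT finT by (simp add: card_mono)
      ultimately have NQ: "card NQ < card Q" using cT YS by linarith
      have "\<tau>0 \<le> real (card NQ)"
      proof (rule ccontr)
        assume c: "\<not> \<tau>0 \<le> real (card NQ)"
        have q0: "real (card Q) > 0" using NQ by simp
        have "real (card Q) * h0 = (\<Sum>v\<in>Q. h0)" by simp
        also have "\<dots> \<le> (\<Sum>v\<in>Q. real (card {x\<in>B. f ` hn x \<subseteq> nb v}))"
          by (intro sum_mono vside) (use QT in \<open>auto simp: T_def\<close>)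
        also have "\<dots> = (\<Sum>v\<in>Q. \<Sum>x\<in>NQ. if f ` hn x \<subseteq> nb v then 1 else 0)"
        proof (rule sum.cong[OF refl])
          fix v assume v: "v \<in> Q"
          have "{x\<in>B. f ` hn x \<subseteq> nb v} = {x\<in>NQ. f ` hn x \<subseteq> nb v}" using v unfolding NQ_def by auto
          then show "real (card {x\<in>B. f ` hn x \<subseteq> nb v}) = (\<Sum>x\<in>NQ. if f ` hn x \<subseteq> nb v then 1 else 0)"
            using finite_subset[OF NB finT(2)] by (simp add: sum.inter_filter[symmetric])
        qed
        also have "\<dots> = (\<Sum>x\<in>NQ. \<Sum>v\<in>Q. if f ` hn x \<subseteq> nb v then 1 else 0)" by (rule sum.swap)
        also have "\<dots> = (\<Sum>x\<in>NQ. real (card {v\<in>Q. f ` hn x \<subseteq> nb v}))" using finQ by (simp add: sum.inter_filter[symmetric])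
        also have "\<dots> \<le> (1 + \<epsilon>) * real (card Q) * (real (card NQ) * p ^ k) + K * (real (card NQ) + real (card Q)) * L"
          by (rule stars[OF NB QT])
        also have "\<dots> = real (card Q) * ((1 + \<epsilon>) * p ^ k * real (card NQ)) + K * L * (real (card NQ) + real (card Q))"
          by (simp add: algebra_simps)
        also have "\<dots> \<le> real (card Q) * ((1 + \<epsilon>) * p ^ k * real (card NQ)) + K * L * (2 * real (card Q))"
          using NQ KL0 by (intro add_left_mono mult_left_mono) auto
        also have "\<dots> = real (card Q) * ((1 + \<epsilon>) * p ^ k * real (card NQ) + 2 * K * L)" by (simp add: algebra_simps)
        also have "\<dots> < real (card Q) * ((1 + \<epsilon>) * p ^ k * \<tau>0 + 2 * K * L)"
          using c q0 p0 \<epsilon> by (intro mult_strict_left_mono add_strict_right_mono) auto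
        also have "\<dots> \<le> real (card Q) * h0" using num2 by (intro mult_left_mono) auto
        finally show False by simp
      qed
      then have "\<tau>0 \<le> real (card Q)" using NQ by simp
      then have "real (card {x\<in>B. cand f D x Q = {}}) \<le> h1" using QT by (intro tside) (auto simp: T_def)
      moreover have "S \<subseteq> {x\<in>B. cand f D x Q = {}}"
        using S unfolding Q_def Y_def A_def cand_def by auto
      then have "card S \<le> card {x\<in>B. cand f D x Q = {}}" by (rule card_mono[rotated]) (use finT in simp)
      ultimately show False using hS by linarith
    qed
  qed
  then obtain h where h: "inj_on h B" "\<And>x. x \<in> B \<Longrightarrow> h x \<in> A x" by blast
  define g where "g x = (if x \<in> B then h x else f x)" for x
  have gD: "g x = f x" if "x \<in> D" for x using that unfolding g_def B(1) by auto
  have gB: "g x \<in> A x" if "x \<in> B" for x using h that unfolding g_def by simp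
  have un: "{..<n} = D \<union> B" using fD unfolding B(1) by auto
  have gBT: "g ` B \<subseteq> T" using gB unfolding A_def cand_def by auto
  have edge: "g y \<in> nb (g x)" if "x \<in> B" "y \<in> hn x" for x y
  proof -
    have "y \<in> D" using B(2) that by auto
    moreover have "f ` hn x \<subseteq> nb (g x)" using gB[OF that(1)] A_iff[OF that(1)] by simp
    ultimately show ?thesis using gD that(2) by auto
  qed
  have "partial g {..<n}"
    unfolding partial_def
  proof (intro conjI ballI)
    have "inj_on g D" using fD gD by (simp add: inj_on_def)
    moreover have "inj_on g B" using h unfolding g_def inj_on_def by simp
    moreover have "g ` D \<inter> g ` B = {}" using gBT gD unfolding T_def by force
    ultimately show "inj_on g {..<n}" unfolding un by (auto simp: inj_on_Un)
    show "g ` {..<n} \<subseteq> {..<N}" unfolding un using gBT gD fD(3) unfolding T_def by auto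
    fix x y assume xy: "x \<in> {..<n}" "y \<in> hn x \<inter> {..<n}"
    show "g y \<in> nb (g x)"
    proof (cases "x \<in> B")
      case True
      then show ?thesis using edge xy by auto
    next
      case False
      then have xD: "x \<in> D" using xy un by auto
      show ?thesis
      proof (cases "y \<in> B")
        case True
        have "x \<in> hn y" using hn_sym xy by auto
        then show ?thesis using edge[OF True] nb_sym by blast
      next
        case False
        then have "y \<in> D" using xy un by auto
        then show ?thesis using f xD xy gD unfolding partial_def by auto
      qed
    qed
  qed simp
  then show ?thesis by blast
qed

end

section \<open>Embedding theorems for pseudorandom host graphs\<close>

context embedding
begin

text \<open>The colour classes of \<open>S\<close> are laid out consecutively from
  \<open>base\<close>, each with \<open>slk\<close> extra places; this is where the interval for
  colour \<open>c\<close> starts.\<close>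

definition off :: "nat \<Rightarrow> nat \<Rightarrow> (nat \<Rightarrow> nat) \<Rightarrow> nat set \<Rightarrow> nat \<Rightarrow> nat" where
  "off base slk \<chi> S c = base + (\<Sum>c'<c. card {y\<in>S. \<chi> y = c'} + slk)"

definition block :: "nat \<Rightarrow> nat \<Rightarrow> (nat \<Rightarrow> nat) \<Rightarrow> nat set \<Rightarrow> nat \<Rightarrow> nat \<Rightarrow> nat set" where
  "block base slk \<chi> S cN c = (if c < cN then {off base slk \<chi> S c..<off base slk \<chi> S (Suc c)} else {})"

lemma off_mono: "c \<le> c' \<Longrightarrow> off base slk \<chi> S c \<le> off base slk \<chi> S c'"
  unfolding off_def by (intro add_left_mono sum_mono2) auto

lemma card_block: "c < cN \<Longrightarrow> card (block base slk \<chi> S cN c) = card {y\<in>S. \<chi> y = c} + slk"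
  unfolding block_def off_def by simp

lemma block_disjoint: "c \<noteq> c' \<Longrightarrow> block base slk \<chi> S cN c \<inter> block base slk \<chi> S cN c' = {}"
proof (induction c c' rule: linorder_wlog)
  case (le c c')
  then have "Suc c \<le> c'" by simp
  then have "off base slk \<chi> S (Suc c) \<le> off base slk \<chi> S c'" by (rule off_mono)
  then show ?case unfolding block_def by auto
next
  case (sym c c')
  then show ?case by (simp add: Int_commute)
qed

lemma off_top:
  assumes "finite S" "\<And>y. y \<in> S \<Longrightarrow> \<chi> y < cN"
  shows "off base slk \<chi> S cN = base + card S + cN * slk"
proof -
  have "card S = card (\<Union>c'<cN. {y\<in>S. \<chi> y = c'})" by (rule arg_cong[where f = card]) (use assms in auto)
  also have "\<dots> = (\<Sum>c'<cN. card {y\<in>S. \<chi> y = c'})" by (rule card_UN_disjoint) (use assms in auto)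
  finally show ?thesis unfolding off_def by (simp add: sum.distrib)
qed

lemma block_range:
  assumes "finite S" "\<And>y. y \<in> S \<Longrightarrow> \<chi> y < cN"
  shows "block base slk \<chi> S cN c \<subseteq> {base..<base + card S + cN * slk}"
proof (cases "c < cN")
  case True
  have "off base slk \<chi> S (Suc c) \<le> off base slk \<chi> S cN" by (rule off_mono) (use True in simp)
  moreover have "base \<le> off base slk \<chi> S c" unfolding off_def by simp
  ultimately show ?thesis using off_top[OF assms] unfolding block_def by auto
qed (simp add: block_def)

lemma hall_blocks:
  fixes \<chi> :: "nat \<Rightarrow> nat" and cN :: nat
  assumes f: "partial f D" and tr: "\<And>y. y < n \<Longrightarrow> y \<notin> D \<Longrightarrow> tracked f D y (Reg y)"
    and S: "S \<subseteq> {..<n} - D" "\<And>y. y \<in> S \<Longrightarrow> Reg y = block base slk \<chi> S cN (\<chi> y)"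
    and out: "\<And>y. y < n \<Longrightarrow> y \<notin> D \<Longrightarrow> y \<notin> S \<Longrightarrow> hn y \<inter> S = {}"
    and base: "f ` D \<subseteq> {..<base}" "base + card S + cN * slk \<le> N"
    and \<chi>: "\<And>x y. x \<in> S \<Longrightarrow> y \<in> S \<Longrightarrow> \<chi> x = \<chi> y \<Longrightarrow> y \<notin> hn x"
      "\<And>x y. x \<in> S \<Longrightarrow> y \<in> S \<Longrightarrow> x \<noteq> y \<Longrightarrow> \<chi> x = \<chi> y \<Longrightarrow> hn x \<inter> hn y = {}" "\<And>x. x \<in> S \<Longrightarrow> \<chi> x < cN"
    and r0: "real \<Delta> * M \<le> q ^ (\<Delta> - 1) * real slk"
    and slk: "\<rho>1 * real n \<le> real slk" "0 < \<rho>1" "\<rho>1 \<le> 1"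
    and size: "(1 + \<epsilon>) * (1 - \<rho>1 / 2) \<le> (1 - \<epsilon>) * (1 - 3 * \<epsilon>) ^ \<Delta> - \<epsilon>"
  shows "\<exists>g. partial g (D \<union> S) \<and> (\<forall>x\<in>D. g x = f x) \<and> g ` S \<subseteq> {base..<base + card S + cN * slk} \<and>
    (\<forall>y<n. y \<notin> D \<union> S \<longrightarrow> tracked g (D \<union> S) y (Reg y))"
proof -
  have finS: "finite S" using S(1) finite_subset by blast
  have rng: "block base slk \<chi> S cN c \<subseteq> {base..<base + card S + cN * slk}" for c
    by (rule block_range[OF finS]) (rule \<chi>(3))
  have "\<exists>g. partial g (D \<union> S) \<and> (\<forall>x\<in>D. g x = f x) \<and> (\<forall>x\<in>S. g x \<in> block base slk \<chi> S cN (\<chi> x)) \<and>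
    (\<forall>y<n. y \<notin> D \<union> S \<longrightarrow> tracked g (D \<union> S) y (Reg y))"
  proof (rule hall_classes[of f D Reg S "block base slk \<chi> S cN" \<chi> cN "real slk"])
    show "block base slk \<chi> S cN c \<subseteq> {..<N}" for c using rng[of c] base(2) by auto
    show "block base slk \<chi> S cN c \<inter> f ` D = {}" for c using rng[of c] base(1) by fastforce
    show "block base slk \<chi> S cN c \<inter> block base slk \<chi> S cN c' = {}" if "c \<noteq> c'" for c c' by (rule block_disjoint[OF that])
    show "real slk \<le> real (card (block base slk \<chi> S cN c))" if "c < cN" for c using card_block[OF that] by simp
    show "(1 + \<epsilon>) * real (card {y\<in>S. \<chi> y = c}) \<le> ((1 - \<epsilon>) * (1 - 3 * \<epsilon>) ^ \<Delta> - \<epsilon>) * real (card (block base slk \<chi> S cN c))"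
      if "c < cN" for c
    proof -
      define w where "w = real (card {y\<in>S. \<chi> y = c})"
      have "card {y\<in>S. \<chi> y = c} \<le> card {..<n}" by (rule card_mono) (use S in auto)
      then have wn: "w \<le> real n" unfolding w_def by simp
      have "\<rho>1 * w \<le> \<rho>1 * real n" using wn slk by (intro mult_left_mono) auto
      then have 1: "\<rho>1 * w \<le> real slk" using slk by linarith
      have "\<rho>1 * real slk \<le> 1 * real slk" using slk by (intro mult_right_mono) auto
      then have "w \<le> (1 - \<rho>1 / 2) * (w + real slk)" using 1 by (simp add: algebra_simps)
      then have "(1 + \<epsilon>) * w \<le> (1 + \<epsilon>) * ((1 - \<rho>1 / 2) * (w + real slk))" using \<epsilon> by (intro mult_left_mono) auto
      also have "\<dots> = ((1 + \<epsilon>) * (1 - \<rho>1 / 2)) * (w + real slk)" by simp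
      also have "\<dots> \<le> ((1 - \<epsilon>) * (1 - 3 * \<epsilon>) ^ \<Delta> - \<epsilon>) * (w + real slk)"
        using size unfolding w_def by (intro mult_right_mono) auto
      finally show ?thesis unfolding card_block[OF that] w_def by simp
    qed
  qed (fact f tr S out \<chi> r0)+
  then obtain g where g: "partial g (D \<union> S)" "\<forall>x\<in>D. g x = f x" "\<forall>x\<in>S. g x \<in> block base slk \<chi> S cN (\<chi> x)"
    "\<forall>y<n. y \<notin> D \<union> S \<longrightarrow> tracked g (D \<union> S) y (Reg y)" by blast
  then have "g ` S \<subseteq> {base..<base + card S + cN * slk}" using rng by blast
  then show ?thesis using g by blast
qed

lemma KL_ge_1: "1 \<le> K * L"
  using mult_mono[of 1 K 1 L] K L_ge_1 by simp

lemma M_le: "\<epsilon>\<^sup>2 * p * M \<le> 4 * (K * L)"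
proof -
  have "\<epsilon>\<^sup>2 * p * M = \<epsilon> * p * (m + 1)" unfolding M_def using \<epsilon> by (simp add: power2_eq_square)
  also have "\<dots> \<le> \<epsilon> * p * (2 * m)" using m_ge_20 \<epsilon> p by (intro mult_left_mono) auto
  also have "\<dots> = 4 * (K * L)" using m_mult by (simp add: algebra_simps)
  finally show ?thesis .
qed

text \<open>\<open>M\<close> is of order \<open>K * L / (\<epsilon>\<^sup>2 * p)\<close>, so it
  carries one factor \<open>1 / p\<close>: a hypothesis with \<open>q ^ j\<close> yields a
  conclusion with \<open>q ^ (j - 1)\<close>.\<close>

lemma M_bound:
  assumes "a * 4 * (K * L) \<le> \<epsilon>\<^sup>2 * (q ^ j * x)" "1 \<le> j" "0 \<le> x" "0 \<le> a"
  shows "a * M \<le> q ^ (j - 1) * x"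
proof -
  have "\<epsilon>\<^sup>2 * p * (a * M) = a * (\<epsilon>\<^sup>2 * p * M)" by (simp add: mult_ac)
  also have "\<dots> \<le> a * (4 * (K * L))" using M_le assms by (intro mult_left_mono) auto
  also have "\<dots> \<le> \<epsilon>\<^sup>2 * (q ^ j * x)" using assms by simp
  also have "q ^ j = q * q ^ (j - 1)" using assms(2) by (cases j) auto
  also have "\<epsilon>\<^sup>2 * (q * q ^ (j - 1) * x) \<le> \<epsilon>\<^sup>2 * (p * q ^ (j - 1) * x)"
    using q assms by (intro mult_left_mono mult_right_mono) auto
  also have "\<dots> = \<epsilon>\<^sup>2 * p * (q ^ (j - 1) * x)" by simp
  finally show ?thesis using p \<epsilon> by simp
qed

text \<open>Hall steps alone, from the empty embedding; every colour gets the same slack.\<close>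

theorem almost_spanning_max_degree:
  fixes \<chi> :: "nat \<Rightarrow> nat" and cN :: nat
  assumes \<chi>: "\<And>x y. x < n \<Longrightarrow> y < n \<Longrightarrow> \<chi> x = \<chi> y \<Longrightarrow> y \<notin> hn x"
      "\<And>x y. x < n \<Longrightarrow> y < n \<Longrightarrow> x \<noteq> y \<Longrightarrow> \<chi> x = \<chi> y \<Longrightarrow> hn x \<inter> hn y = {}" "\<And>x. x < n \<Longrightarrow> \<chi> x < cN"
    and slk: "n + cN * slk \<le> N" "\<rho>1 * real n \<le> real slk" "0 < \<rho>1" "\<rho>1 \<le> 1"
    and size: "(1 + \<epsilon>) * (1 - \<rho>1 / 2) \<le> (1 - \<epsilon>) * (1 - 3 * \<epsilon>) ^ \<Delta> - \<epsilon>"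
    and big: "C * (K * L) \<le> q ^ \<Delta> * real n" "4 * real \<Delta> \<le> C * (\<epsilon>\<^sup>2 * \<rho>1)"
  shows "\<exists>g. partial g {..<n}"
proof -
  have "\<exists>g. partial g ({} \<union> {..<n}) \<and> (\<forall>x\<in>{}. g x = (\<lambda>_. 0) x) \<and> g ` {..<n} \<subseteq> {0..<0 + card {..<n} + cN * slk} \<and>
    (\<forall>y<n. y \<notin> {} \<union> {..<n} \<longrightarrow> tracked g ({} \<union> {..<n}) y (block 0 slk \<chi> {..<n} cN (\<chi> y)))"
  proof (rule hall_blocks)
    show "real \<Delta> * M \<le> q ^ (\<Delta> - 1) * real slk"
    proof (rule M_bound)
      have "real \<Delta> * 4 * (K * L) \<le> C * (\<epsilon>\<^sup>2 * \<rho>1) * (K * L)" using big(2) KL_ge_1 by (intro mult_right_mono) auto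
      also have "\<dots> = \<epsilon>\<^sup>2 * \<rho>1 * (C * (K * L))" by (simp add: mult_ac)
      also have "\<dots> \<le> \<epsilon>\<^sup>2 * \<rho>1 * (q ^ \<Delta> * real n)" using big(1) slk by (intro mult_left_mono) auto
      also have "\<dots> = \<epsilon>\<^sup>2 * (q ^ \<Delta> * (\<rho>1 * real n))" by (simp add: mult_ac)
      also have "\<dots> \<le> \<epsilon>\<^sup>2 * (q ^ \<Delta> * real slk)" using slk q by (intro mult_left_mono) auto
      finally show "real \<Delta> * 4 * (K * L) \<le> \<epsilon>\<^sup>2 * (q ^ \<Delta> * real slk)" .
    qed (use \<Delta>1 in auto)
    show "hn x \<inter> hn y = {}" if "x \<in> {..<n}" "y \<in> {..<n}" "x \<noteq> y" "\<chi> x = \<chi> y" for x y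
      using \<chi>(2) that by blast
  qed (use \<chi>(1,3) slk size in \<open>auto simp: partial_def tracked_def cand_def\<close>)
  then show ?thesis by auto
qed

text \<open>The greedy phase alone, with \<open>l = n\<close> and no further potential. Only
  candidate sets have to be controlled, so \<open>d' = D\<close> and the exponent is
  \<open>2 * D\<close>.\<close>

theorem almost_spanning_degenerate:
  fixes \<chi> :: "nat \<Rightarrow> nat" and cN D :: nat
  assumes D: "1 \<le> D" "\<And>x. x < n \<Longrightarrow> card (hn x \<inter> {..<x}) \<le> D"
    and \<chi>: "\<And>x y. x < n \<Longrightarrow> y < n \<Longrightarrow> x \<noteq> y \<Longrightarrow> \<chi> x = \<chi> y \<Longrightarrow> hn x \<inter> hn y = {}" "\<And>x. x < n \<Longrightarrow> \<chi> x < cN" "1 \<le> cN"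
    and \<sigma>: "0 < \<sigma>" "\<sigma> \<le> 1" "real n \<le> (1 - \<sigma>) * real N"
    and \<epsilon>_small: "1 + \<epsilon> \<le> (1 + \<sigma> / 64) * ((1 - \<epsilon>) * (1 - 3 * \<epsilon>) ^ D)"
    and big: "C * (K * L) \<le> q ^ (2 * D) * real n"
    and C: "8 * real \<Delta> \<le> C * (\<epsilon>\<^sup>2 * \<sigma>)"
      "\<xi> = \<sigma> / 32" "\<eta> = \<sigma>\<^sup>2 / 256" "\<epsilon>' = \<xi> * \<eta> * \<sigma> / (48 * (real cN * (real D + 1)))"
      "24 \<le> C * (\<sigma> * \<xi> * \<epsilon>')" "24 * (real cN * (real D + 1)) \<le> C * (\<sigma> * \<xi> * \<eta>)" "2 * real D + 3 \<le> C * (\<xi> * \<epsilon>')"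
  shows "\<exists>g. partial g {..<n}"
proof -
  have nN: "real n \<le> real N" using \<sigma> mult_right_mono[of "1 - \<sigma>" 1 "real N"] by simp
  interpret windows N nb p \<epsilon> K \<Delta> n hn n "{..<N}" "\<lambda>_. {..<N}" D D \<sigma> C \<chi> cN \<xi> \<eta> \<epsilon>' "nat \<lceil>\<eta> * real (card {..<N})\<rceil>"
  proof unfold_locales
    have "q ^ (2 * D) * real n \<le> q ^ (2 * D) * real N" using nN q by (intro mult_left_mono) auto
    then show "C * (K * L) \<le> q ^ (D + D) * real (card {..<N})" using big by (simp add: mult_2)
  qed (use D \<chi> \<sigma> \<epsilon>_small C in auto)
  have "\<exists>f. valid f n \<and> (0::real) \<le> 1" by (rule greedy_run[where \<Psi> = "\<lambda>_ _. 0"]) auto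
  then show ?thesis using valid_partial by blast
qed

text \<open>The order consists of \<open>l\<close> greedy vertices, a middle part embedded by Hall
  steps, and \<open>bs\<close> buffer vertices. The greedy phase runs with
  \<open>d' = D + 1\<close>, whence \<open>2 * D + 1 \<le> e\<close>; the buffer needs
  \<open>k \<le> e\<close>, and the Hall steps need \<open>\<Delta> \<le> e\<close> unless the
  middle part is empty.\<close>

theorem spanning:
  fixes \<chi> :: "nat \<Rightarrow> nat" and cN D l bs k e :: nat and \<rho>0 \<Gamma> \<sigma> :: real
  assumes nN: "N = n" and parts: "l + bs \<le> n"
    and B_hn: "\<And>x. n - bs \<le> x \<Longrightarrow> x < n \<Longrightarrow> hn x \<subseteq> {..<l}" and B_deg: "\<And>x. n - bs \<le> x \<Longrightarrow> x < n \<Longrightarrow> card (hn x) = k"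
    and B_free: "\<And>x z z'. n - bs \<le> x \<Longrightarrow> x < n \<Longrightarrow> z \<in> hn x \<Longrightarrow> z' \<in> hn x \<Longrightarrow> z' \<notin> hn z"
    and B_far: "\<And>x y. n - bs \<le> x \<Longrightarrow> x < n \<Longrightarrow> n - bs \<le> y \<Longrightarrow> y < n \<Longrightarrow> x \<noteq> y \<Longrightarrow>
       (hn x \<union> \<Union>(hn ` hn x)) \<inter> (hn y \<union> \<Union>(hn ` hn y)) = {}"
    and back_le: "\<And>x. x < l \<Longrightarrow> card (hn x \<inter> {..<x}) \<le> D"
    and col: "\<And>x y. x < n \<Longrightarrow> y < n \<Longrightarrow> \<chi> x = \<chi> y \<Longrightarrow> y \<notin> hn x"
      "\<And>x y. x < n \<Longrightarrow> y < n \<Longrightarrow> x \<noteq> y \<Longrightarrow> \<chi> x = \<chi> y \<Longrightarrow> hn x \<inter> hn y = {}" "\<And>x. x < n \<Longrightarrow> \<chi> x < cN" "1 \<le> cN"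
    and e: "2 * D + 1 \<le> e" "k \<le> e" "D + 2 \<le> e \<or> \<Delta> = 1" "l + bs = n \<or> \<Delta> \<le> e"
    and \<rho>0: "0 < \<rho>0" "\<rho>0 \<le> 1" "\<rho>0 * real n \<le> real bs" and \<sigma>: "\<sigma> = \<rho>0 / 16"
    and eps: "1 + \<epsilon> \<le> (1 + \<sigma> / 64) * ((1 - \<epsilon>) * (1 - 3 * \<epsilon>) ^ D)" "(1 + 3 * \<epsilon>) ^ D \<le> 2 * (1 - 3 * \<epsilon>) ^ D"
      "1 / 2 \<le> (1 - \<epsilon>) ^ \<Delta>\<^sup>2" "1 / 2 \<le> (1 - 3 * \<epsilon>) ^ \<Delta>"
      "(1 + \<epsilon>) * (1 - \<rho>0 / (8 * real cN) / 2) \<le> (1 - \<epsilon>) * (1 - 3 * \<epsilon>) ^ \<Delta> - \<epsilon>"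
    and big: "8 * \<Gamma> * (K * L) \<le> \<rho>0 * (q ^ e * real n)"
    and \<Gamma>: "8 * real \<Delta> \<le> \<Gamma> * (\<epsilon>\<^sup>2 * \<sigma>)"
      "\<xi> = \<sigma> / 32" "\<eta> = \<sigma>\<^sup>2 / 256" "\<epsilon>' = \<xi> * \<eta> * \<sigma> / (48 * (real cN * (real D + 1)))"
      "24 \<le> \<Gamma> * (\<sigma> * \<xi> * \<epsilon>')" "24 * (real cN * (real D + 1)) \<le> \<Gamma> * (\<sigma> * \<xi> * \<eta>)" "2 * real (D + 1) + 3 \<le> \<Gamma> * (\<xi> * \<epsilon>')"
      "80 \<le> \<Gamma> * (\<epsilon>\<^sup>2 * (\<sigma> / 8) ^ \<Delta>)" "4 * real \<Delta> * real cN \<le> \<Gamma> * \<epsilon>\<^sup>2" "8 * real \<Delta> \<le> \<Gamma> * (exp (- 48 / \<rho>0) * \<sigma> * \<epsilon>)"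
  shows "\<exists>g. partial g {..<n}"
proof -
  define b where "b = real bs"
  \<comment> \<open>The places of the \<open>bs\<close> buffer vertices are divided: about a quarter
    is slack for the greedy phase, at most a quarter is slack for the blocks, and about half forms
    the reserve \<open>T0\<close>. \<open>{..<\<nu>0}\<close> and \<open>T0\<close> are intervals so
    that every host vertex has the right degree into them.\<close>
  define s0 where "s0 = bs div 4"
  define t0 where "t0 = bs div 2"
  define slk where "slk = bs div (4 * cN)"
  define \<nu>0 where "\<nu>0 = l + s0"
  define S where "S = {l..<n - bs}"
  define T0 where "T0 = {n - t0..<n}"
  define B where "B = {n - bs..<n}"
  define Reg where "Reg y = (if y < l then {..<\<nu>0} else if y < n - bs then block \<nu>0 slk \<chi> S cN (\<chi> y) else T0)" for y
  define P where "P = K * L"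
  have P1: "1 \<le> P" unfolding P_def by (rule KL_ge_1)
  have D1: "real \<Delta> \<ge> 1" using \<Delta>1 by simp
  have cN1: "real cN \<ge> 1" using col(4) by simp
  have \<sigma>01: "0 < \<sigma>" "\<sigma> \<le> 1 / 16" unfolding \<sigma> using \<rho>0 by auto
  define \<mu> where "\<mu> = (\<sigma> / 8) ^ \<Delta>"
  have \<mu>: "0 < \<mu>" "\<mu> \<le> 1" unfolding \<mu>_def using \<sigma>01 by (auto intro: power_le_one)
  have \<epsilon>2: "0 < \<epsilon>\<^sup>2" "\<epsilon>\<^sup>2 \<le> \<epsilon> / 10" using \<epsilon> by (auto simp: power2_eq_square)
  have \<Gamma>0: "\<Gamma> > 0"
  proof -
    have "\<Gamma> * (\<epsilon>\<^sup>2 * \<mu>) > 0" using \<Gamma>(8) unfolding \<mu>_def by linarith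
    moreover have "\<epsilon>\<^sup>2 * \<mu> > 0" using \<epsilon>2 \<mu> by simp
    ultimately show ?thesis by (rule zero_less_mult_pos2)
  qed
  have bigD: "\<Gamma> * P \<le> q ^ j * x" if "j \<le> e" "\<rho>0 / 8 * real n \<le> x" for j x
  proof -
    have "\<Gamma> * P \<le> q ^ e * (\<rho>0 / 8 * real n)" using big unfolding P_def by (simp add: algebra_simps)
    also have "\<dots> \<le> q ^ j * x" using that q \<rho>0 by (intro mult_mono q_power_le) auto
    finally show ?thesis .
  qed
  have \<Gamma>cN: "4 * real cN \<le> \<Gamma> * \<epsilon>\<^sup>2" "400 \<le> \<Gamma>" "4 * real cN \<le> \<Gamma>"
  proof -
    have "4 * real cN \<le> 4 * real \<Delta> * real cN" using D1 cN1 by simp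
    then show 1: "4 * real cN \<le> \<Gamma> * \<epsilon>\<^sup>2" using \<Gamma>(9) by linarith
    have e100: "\<epsilon>\<^sup>2 \<le> 1 / 100" using \<epsilon>2 \<epsilon> by linarith
    then have "\<Gamma> * \<epsilon>\<^sup>2 \<le> \<Gamma> * (1 / 100)" using \<Gamma>0 by (intro mult_left_mono) auto
    then show "400 \<le> \<Gamma>" "4 * real cN \<le> \<Gamma>" using 1 cN1 \<Gamma>0 by linarith+
  qed
  have b8: "8 * real cN \<le> b"
  proof -
    have "\<Gamma> * 1 \<le> \<Gamma> * P" using P1 \<Gamma>0 by (intro mult_left_mono) auto
    also have "\<dots> \<le> q ^ 0 * (\<rho>0 / 8 * real n)" by (rule bigD) auto
    finally have "8 * \<Gamma> \<le> b" using \<rho>0(3) unfolding b_def by simp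
    then show ?thesis using \<Gamma>cN by linarith
  qed
  have b8': "8 \<le> bs" using b8 cN1 unfolding b_def by linarith
  have s0: "b / 8 \<le> real s0" and t0: "b / 3 \<le> real t0" and s0': "4 * s0 \<le> bs" and t0': "2 * t0 \<le> bs"
    using b8' unfolding s0_def t0_def b_def by linarith+
  have slk: "b / (8 * real cN) \<le> real slk" and slk': "4 * (cN * slk) \<le> bs"
  proof -
    have "bs < (slk + 1) * (4 * cN)" unfolding slk_def using col(4) dividend_less_div_times[of "4 * cN" bs] by (simp add: algebra_simps)
    then have "real bs \<le> real ((slk + 1) * (4 * cN))" by (simp only: of_nat_le_iff less_imp_le)
    then have "b \<le> (real slk + 1) * (4 * real cN)" unfolding b_def by (simp add: algebra_simps)
    then have "b \<le> real slk * (4 * real cN) + b / 2" using b8 by (simp add: algebra_simps)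
    then show "b / (8 * real cN) \<le> real slk" using cN1 by (simp add: pos_divide_le_eq)
    show "4 * (cN * slk) \<le> bs" unfolding slk_def using times_div_less_eq_dividend[of "4 * cN" bs] by (simp add: mult_ac)
  qed
  have nb8: "\<rho>0 / 8 * real n \<le> b / 8" using \<rho>0(3) unfolding b_def by simp
  have cS: "card S = n - bs - l" unfolding S_def by simp
  have fit: "\<nu>0 + card S + cN * slk \<le> n - t0" "\<nu>0 \<le> n" using parts s0' t0' slk' unfolding cS \<nu>0_def by linarith+
  have finS: "finite S" unfolding S_def by simp
  have blk: "block \<nu>0 slk \<chi> S cN c \<subseteq> {\<nu>0..<\<nu>0 + card S + cN * slk}" for c
    by (rule block_range[OF finS]) (use col(3) in \<open>auto simp: S_def\<close>)
  have \<nu>0b: "\<rho>0 / 8 * real n \<le> real \<nu>0" using s0 nb8 unfolding \<nu>0_def by simp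
  have cT0: "card T0 = t0" unfolding T0_def using t0' parts by simp
  have t0b: "\<rho>0 / 8 * real n \<le> real t0" using t0 nb8 unfolding b_def by simp
  have ivl: "9 * K * L \<le> \<epsilon> * p * x" if "\<rho>0 / 8 * real n \<le> x" for x
  proof -
    have "\<Gamma> * \<epsilon>\<^sup>2 \<le> \<Gamma> * (\<epsilon> / 10)" using \<epsilon>2 \<Gamma>0 by (intro mult_left_mono) auto
    moreover have "\<Gamma> * (\<epsilon> / 10) = \<epsilon> * \<Gamma> / 10" by simp
    ultimately have "9 \<le> \<epsilon> * \<Gamma>" using \<Gamma>cN cN1 by linarith
    then have "9 * P \<le> \<epsilon> * \<Gamma> * P" using P1 by (intro mult_right_mono) auto
    also have "\<dots> = \<epsilon> * (\<Gamma> * P)" by simp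
    also have "\<dots> \<le> \<epsilon> * (q ^ 1 * x)" using e(1) that \<epsilon> by (intro mult_left_mono bigD) auto
    also have "\<dots> \<le> \<epsilon> * (p * x)"
    proof -
      have "0 \<le> \<rho>0 / 8 * real n" using \<rho>0 by simp
      then have "0 \<le> x" using that by linarith
      then show ?thesis using q \<epsilon> by (intro mult_left_mono mult_right_mono) auto
    qed
    finally show ?thesis unfolding P_def by simp
  qed
  have degV: "q * real \<nu>0 \<le> real (card (nb v \<inter> {..<\<nu>0}))" if "v < N" for v
  proof -
    have "q * real (\<nu>0 - 0) \<le> real (card (nb v \<inter> {0..<\<nu>0}))"
      by (rule interval_degree) (use fit nN that ivl[OF \<nu>0b] in auto)
    then show ?thesis by (simp add: atLeast0LessThan)
  qed
  have degT: "q * real (card T0) \<le> real (card (nb v \<inter> T0))" if "v < N" for v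
  proof -
    have "n - (n - t0) = t0" using t0' parts by simp
    then have "q * real (n - (n - t0)) \<le> real (card (nb v \<inter> {n - t0..<n}))"
      by (intro interval_degree) (use nN that ivl[OF t0b] in auto)
    then show ?thesis unfolding T0_def by simp
  qed
  have Reg_T0: "Reg x = T0" if "x \<in> B" for x using that parts unfolding Reg_def B_def by auto
  have l_size: "real l \<le> (1 - \<sigma>) * real \<nu>0"
  proof -
    have "\<sigma> * real \<nu>0 \<le> \<sigma> * real n" using fit \<sigma>01 by (intro mult_left_mono) auto
    also have "\<dots> \<le> b / 16" using \<rho>0(3) unfolding \<sigma> b_def by simp
    also have "\<dots> \<le> real s0" using s0 unfolding b_def by linarith
    finally show ?thesis unfolding \<nu>0_def by (simp add: algebra_simps)
  qed
  have regM: "a * M \<le> q ^ (j - 1) * x"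
    if "1 \<le> j" "j \<le> e" "b / (8 * real cN) \<le> x" "0 \<le> a" "a \<le> real \<Delta>" for j x a
  proof (rule M_bound)
    have "a * 4 * P \<le> real \<Delta> * 4 * P" using that P1 by (intro mult_right_mono) auto
    also have "\<dots> \<le> (\<Gamma> * \<epsilon>\<^sup>2 / real cN) * P" using \<Gamma>(9) cN1 P1 by (intro mult_right_mono) (auto simp: pos_le_divide_eq mult_ac)
    also have "\<dots> = \<epsilon>\<^sup>2 / real cN * (\<Gamma> * P)" by simp
    also have "\<dots> \<le> \<epsilon>\<^sup>2 / real cN * (q ^ j * (b / 8))" using that nb8 \<epsilon>2 by (intro mult_left_mono bigD) auto
    also have "\<dots> = \<epsilon>\<^sup>2 * (q ^ j * (b / (8 * real cN)))" by simp
    also have "\<dots> \<le> \<epsilon>\<^sup>2 * (q ^ j * x)" using that q \<epsilon>2 by (intro mult_left_mono) auto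
    finally show "a * 4 * (K * L) \<le> \<epsilon>\<^sup>2 * (q ^ j * x)" unfolding P_def .
    have "0 \<le> b / (8 * real cN)" unfolding b_def by simp
    then show "0 \<le> x" using that(3) by linarith
  qed (use that in auto)
  have \<rho>pos: "0 < 48 / \<rho>0" using \<rho>0 by simp
  interpret windows N nb p \<epsilon> K \<Delta> n hn l "{..<\<nu>0}" Reg D "D + 1" \<sigma> \<Gamma> \<chi> cN \<xi> \<eta> \<epsilon>' "nat \<lceil>\<eta> * real (card {..<\<nu>0})\<rceil>"
  proof (intro windows.intro windows_axioms.intro greedy.intro greedy_axioms.intro)
    show "embedding N nb p \<epsilon> K \<Delta> n hn" by unfold_locales
    show "Reg y \<subseteq> {..<N} \<and> M \<le> q ^ (card (hn y \<inter> {..<l}) - 1) * real (card (Reg y))"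
      if y: "l \<le> y" "y < n" "hn y \<inter> {..<l} \<noteq> {}" for y
    proof -
      have j: "1 \<le> card (hn y \<inter> {..<l})" using y fin_hn[OF y(2)] by (simp add: Suc_le_eq card_gt_0_iff)
      have j': "card (hn y \<inter> {..<l}) \<le> card (hn y)" by (rule card_mono[OF fin_hn[OF y(2)]]) simp
      show ?thesis
      proof (cases "y < n - bs")
        case True
        then have "\<Delta> \<le> e" using e(4) y by auto
        then have je: "card (hn y \<inter> {..<l}) \<le> e" using j' hn_deg[OF y(2)] by linarith
        have R: "Reg y = block \<nu>0 slk \<chi> S cN (\<chi> y)" using True y unfolding Reg_def by simp
        have "real slk \<le> real (card (Reg y))" unfolding R using card_block[OF col(3)[OF y(2)]] by simp
        then have "1 * M \<le> q ^ (card (hn y \<inter> {..<l}) - 1) * real (card (Reg y))"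
          using slk D1 by (intro regM j je) auto
        moreover have "{\<nu>0..<\<nu>0 + card S + cN * slk} \<subseteq> {..<N}" using fit nN by auto
        then have "Reg y \<subseteq> {..<N}" unfolding R using blk by blast
        ultimately show ?thesis by simp
      next
        case False
        then have yB: "n - bs \<le> y" by simp
        then have je: "card (hn y \<inter> {..<l}) \<le> e" using j' B_deg[OF yB y(2)] e(2) by linarith
        have R: "Reg y = T0" using False y unfolding Reg_def by simp
        have "b / (8 * real cN) \<le> b / 3" using cN1 unfolding b_def by (intro divide_left_mono) auto
        then have "1 * M \<le> q ^ (card (hn y \<inter> {..<l}) - 1) * real (card (Reg y))"
          using t0 D1 unfolding R cT0 by (intro regM j je) auto
        then show ?thesis unfolding R T0_def using nN by auto
      qed
    qed
    show "\<Gamma> * (K * L) \<le> q ^ (D + (D + 1)) * real (card {..<\<nu>0})"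
      using bigD[of "D + (D + 1)" "real \<nu>0"] e(1) \<nu>0b unfolding P_def by simp
    show "real l \<le> (1 - \<sigma>) * real (card {..<\<nu>0})" using l_size by simp
    show "hn x \<inter> hn y = {}" if "x < l" "y < l" "x \<noteq> y" "\<chi> x = \<chi> y" for x y
      using col(2)[of x y] that parts by simp
    show "\<chi> x < cN" if "x < l" for x using col(3)[of x] that parts by simp
    show "l \<le> n" "{..<\<nu>0} \<subseteq> {..<N}" "D \<le> D + 1" "1 \<le> D + 1" "0 < \<sigma>" "\<sigma> \<le> 1" "1 \<le> cN"
      using parts fit nN \<sigma>01 col(4) by auto
    show "Reg y = {..<\<nu>0}" if "y < l" for y using that unfolding Reg_def by simp
  qed (fact back_le eps \<Gamma> refl)+
  have \<nu>_eq: "\<nu> = real \<nu>0" unfolding \<nu>_def by simp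
  have qkb: "8 * (\<Gamma> * P) \<le> q ^ k * b"
  proof -
    have "\<Gamma> * P \<le> q ^ k * (b / 8)" by (rule bigD) (use e nb8 in auto)
    then show ?thesis by simp
  qed
  \<comment> \<open>In general the loss \<open>2 * \<Delta> * m\<close> is bounded using
    \<open>q ^ (D + 2)\<close>. For \<open>\<Delta> = 1\<close> the exponent \<open>e\<close> may be
    too small for that; then \<open>x\<close> is the only neighbour of \<open>t\<close>, its
    candidate set is the whole interval \<open>T0\<close>, and no choice is lost.\<close>
  have lossy: "real (card (cd f t t - f ` {..<t} - avail f t)) \<le> \<sigma> / 4 * (q ^ (D + 1) * \<nu>)"
    if a: "valid f t" "t < l" "x \<in> B" "t \<in> hn x" for f t x
  proof (cases "D + 2 \<le> e")
    case True
    have "2 * \<epsilon>\<^sup>2 \<le> \<epsilon>" using \<epsilon>2 \<epsilon> by linarith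
    then have "(\<Gamma> * \<sigma>) * (2 * \<epsilon>\<^sup>2) \<le> (\<Gamma> * \<sigma>) * \<epsilon>" using \<Gamma>0 \<sigma>01 by (intro mult_left_mono) auto
    moreover have "\<Gamma> * (\<epsilon>\<^sup>2 * \<sigma>) * 2 = (\<Gamma> * \<sigma>) * (2 * \<epsilon>\<^sup>2)" by (simp only: mult_ac)
    moreover have "\<Gamma> * (\<epsilon> * \<sigma>) = (\<Gamma> * \<sigma>) * \<epsilon>" by (simp only: mult_ac)
    ultimately have "16 * real \<Delta> \<le> \<Gamma> * (\<epsilon> * \<sigma>)" using \<Gamma>(1) by linarith
    then have "16 * real \<Delta> * P \<le> \<Gamma> * (\<epsilon> * \<sigma>) * P" using P1 by (intro mult_right_mono) auto
    also have "\<dots> = \<epsilon> * \<sigma> * (\<Gamma> * P)" by simp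
    also have "\<dots> \<le> \<epsilon> * \<sigma> * (q ^ (D + 2) * \<nu>)" unfolding \<nu>_eq using \<epsilon> \<sigma>01 by (intro mult_left_mono bigD True \<nu>0b) auto
    also have "\<dots> = \<epsilon> * \<sigma> * (q * (q ^ (D + 1) * \<nu>))" by simp
    also have "\<dots> \<le> \<epsilon> * \<sigma> * (p * (q ^ (D + 1) * \<nu>))"
      using \<epsilon> \<sigma>01 q \<nu>_pos by (intro mult_left_mono mult_right_mono) auto
    finally have 1: "16 * real \<Delta> * P \<le> \<epsilon> * \<sigma> * (p * (q ^ (D + 1) * \<nu>))" .
    have "\<epsilon> * p * (2 * real \<Delta> * m) = 4 * real \<Delta> * P" unfolding P_def using m_mult by (simp add: algebra_simps)
    also have "\<dots> \<le> \<epsilon> * p * (\<sigma> / 4 * (q ^ (D + 1) * \<nu>))" using 1 by (simp add: algebra_simps)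
    finally have "2 * real \<Delta> * m \<le> \<sigma> / 4 * (q ^ (D + 1) * \<nu>)" using p \<epsilon> by simp
    then show ?thesis using few_unsuitable[OF a(1,2)] by linarith
  next
    case False
    then have \<Delta>: "\<Delta> = 1" using e(3) by simp
    have xn: "x < n" "n - bs \<le> x" using a(3) unfolding B_def by auto
    have tn: "t < n" using a(2) parts by simp
    have xt: "x \<in> hn t" using hn_sym[OF xn(1) a(4)] .
    have one: "y = z" if "w < n" "y \<in> hn w" "z \<in> hn w" for w y z
    proof -
      have "card (hn w) \<le> Suc 0" using hn_deg[OF that(1)] \<Delta> by simp
      then show ?thesis using that(2,3) fin_hn[OF that(1)] card_le_Suc0_iff_eq by blast
    qed
    have "hn x \<inter> {..<t} = {}" using one[OF xn(1) a(4)] by auto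
    then have cdx: "cd f t x = T0" unfolding cd_def cand_def Reg_T0[OF a(3)] by auto
    have "cd f t t - f ` {..<t} \<subseteq> avail f t"
    proof
      fix v assume v: "v \<in> cd f t t - f ` {..<t}"
      then have "v < N" using cd_V[OF a(2), of f t] fit nN by auto
      moreover have "\<not> x < l" using xn parts by auto
      ultimately have "\<forall>y\<in>hn t. t < y \<longrightarrow> q * real (card (cd f t y)) \<le> real (card (nb v \<inter> cd f t y)) \<and>
         (y < l \<longrightarrow> real (card (nb v \<inter> cd f t y)) \<le> r * real (card (cd f t y)))"
        using one[OF tn xt] degT cdx by auto
      then show "v \<in> avail f t" unfolding avail_def using v by blast
    qed
    then have "cd f t t - f ` {..<t} - avail f t = {}" by blast
    then have "card (cd f t t - f ` {..<t} - avail f t) = 0" by (simp only: card.empty)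
    moreover have "0 \<le> \<sigma> / 4 * (q ^ (D + 1) * \<nu>)" using \<sigma>01 q \<nu>_pos by simp
    ultimately show ?thesis by linarith
  qed
  \<comment> \<open>The value \<open>h1 = b / 16\<close> is small against the reserve
    \<open>T0\<close>, and \<open>\<tau>0 = \<mu> * b / 40\<close> is small enough for the number of
    buffer vertices guaranteed to each host vertex. With \<open>\<rho> = 48 / \<rho>0\<close> one
    has \<open>\<rho> * h1 = 3 * b / \<rho>0 \<ge> 3 * N\<close>, and \<open>\<zeta>\<close> is
    chosen with \<open>exp \<rho> * \<zeta> * \<Delta> = 1\<close>.\<close>
  interpret buffered N nb p \<epsilon> K \<Delta> n hn l "{..<\<nu>0}" Reg D "D + 1" \<sigma> \<Gamma> \<chi> cN \<xi> \<eta> \<epsilon>' "nat \<lceil>\<eta> * real (card {..<\<nu>0})\<rceil>"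
    B k "b / 16" "\<mu> * b / 40" "48 / \<rho>0" "exp (- 48 / \<rho>0) / real \<Delta>"
  proof (intro buffered.intro buffered_axioms.intro)
    show "windows N nb p \<epsilon> K \<Delta> n hn l {..<\<nu>0} Reg D (D + 1) \<sigma> \<Gamma> \<chi> cN \<xi> \<eta> \<epsilon>' (nat \<lceil>\<eta> * real (card {..<\<nu>0})\<rceil>)"
      by unfold_locales
    show "q * real (card {..<\<nu>0}) \<le> real (card (nb v \<inter> {..<\<nu>0}))" if "v < N" for v using degV[OF that] by simp
    show "M \<le> q ^ (k - 1) * (\<mu> * b / 40)"
    proof -
      have k1: "1 \<le> max k 1" "max k 1 \<le> e" "max k 1 - 1 = k - 1" using e by auto
      have "80 * P \<le> \<Gamma> * (\<epsilon>\<^sup>2 * \<mu>) * P" using \<Gamma>(8) P1 unfolding \<mu>_def by (intro mult_right_mono) auto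
      also have "\<dots> = \<epsilon>\<^sup>2 * \<mu> * (\<Gamma> * P)" by simp
      also have "\<dots> \<le> \<epsilon>\<^sup>2 * \<mu> * (q ^ max k 1 * (b / 8))" using \<mu> nb8 k1 by (intro mult_left_mono bigD) auto
      also have "\<dots> = 5 * (\<epsilon>\<^sup>2 * (q ^ max k 1 * (\<mu> * b / 40)))" by simp
      finally have "1 * 4 * (K * L) \<le> \<epsilon>\<^sup>2 * (q ^ max k 1 * (\<mu> * b / 40))" using P1 unfolding P_def by linarith
      then have "1 * M \<le> q ^ (max k 1 - 1) * (\<mu> * b / 40)" using k1 \<mu> b_def by (intro M_bound) auto
      then show ?thesis using k1 by simp
    qed
    show "24 * L \<le> (\<sigma> / 8 * q) ^ k * real (card B)"
    proof -
      have cB: "real (card B) = b" unfolding B_def b_def using parts by simp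
      have kD: "k \<le> \<Delta>" using B_deg[of "n - 1"] hn_deg[of "n - 1"] b8' parts by simp
      have "80 * L \<le> 80 * P" unfolding P_def using K L_ge_1 mult_right_mono[of 1 K L] by simp
      also have "\<dots> \<le> \<Gamma> * (\<epsilon>\<^sup>2 * \<mu>) * P" using \<Gamma>(8) P1 unfolding \<mu>_def by (intro mult_right_mono) auto
      also have "\<dots> = \<epsilon>\<^sup>2 * (\<mu> * (\<Gamma> * P))" by simp
      also have "\<dots> \<le> 1 * (\<mu> * (\<Gamma> * P))" using \<epsilon>2 \<epsilon> \<mu> \<Gamma>0 P1 by (intro mult_right_mono) auto
      also have "\<dots> \<le> \<mu> * (q ^ k * b)"
      proof -
        have "\<Gamma> * P \<ge> 0" using \<Gamma>0 P1 by simp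
        then show ?thesis using qkb \<mu> by simp
      qed
      also have "\<dots> \<le> (\<sigma> / 8) ^ k * (q ^ k * b)"
        unfolding \<mu>_def using \<sigma>01 kD q b_def by (intro mult_right_mono power_decreasing) auto
      also have "\<dots> = (\<sigma> / 8 * q) ^ k * real (card B)" unfolding cB by (simp add: power_mult_distrib power_divide)
      finally show ?thesis using L_ge_1 by linarith
    qed
    show "m \<le> exp (- 48 / \<rho>0) / real \<Delta> * (\<sigma> / 4 * (q ^ D * \<nu>))"
    proof -
      define E where "E = exp (- 48 / \<rho>0)"
      have E0: "E > 0" unfolding E_def by simp
      have "8 * real \<Delta> * P \<le> \<Gamma> * (E * \<sigma> * \<epsilon>) * P" using \<Gamma>(10) P1 unfolding E_def by (intro mult_right_mono) auto
      also have "\<dots> = E * \<sigma> * \<epsilon> * (\<Gamma> * P)" by simp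
      also have "\<dots> \<le> E * \<sigma> * \<epsilon> * (q ^ (D + 1) * \<nu>)" unfolding \<nu>_eq using \<epsilon> \<sigma>01 E0 e(1) by (intro mult_left_mono bigD \<nu>0b) auto
      also have "\<dots> = E * \<sigma> * \<epsilon> * (q * (q ^ D * \<nu>))" by simp
      also have "\<dots> \<le> E * \<sigma> * \<epsilon> * (p * (q ^ D * \<nu>))"
        using \<epsilon> \<sigma>01 q \<nu>_pos E0 by (intro mult_left_mono mult_right_mono) auto
      finally have 1: "8 * real \<Delta> * P \<le> E * \<sigma> * \<epsilon> * (p * (q ^ D * \<nu>))" .
      have "\<epsilon> * p * m = 2 * P" unfolding P_def using m_mult by simp
      also have "\<dots> \<le> \<epsilon> * p * (E / real \<Delta> * (\<sigma> / 4 * (q ^ D * \<nu>)))" using 1 D1 by (simp add: field_simps)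
      finally have "\<epsilon> * p * m \<le> \<epsilon> * p * (E / real \<Delta> * (\<sigma> / 4 * (q ^ D * \<nu>)))" .
      moreover have "0 < \<epsilon> * p" using p \<epsilon> by simp
      ultimately show ?thesis unfolding E_def by (simp only: mult_le_cancel_left_pos)
    qed
    show "exp (48 / \<rho>0) * (exp (- 48 / \<rho>0) / real \<Delta>) * real \<Delta> \<le> 1" using \<Delta>1 by (simp add: exp_minus)
    show "3 * real N \<le> 48 / \<rho>0 * (b / 16)" using \<rho>0 unfolding nN b_def by (simp add: pos_le_divide_eq mult.commute)
    show "r ^ D \<le> 2 * q ^ D"
    proof -
      have "(1 + 3 * \<epsilon>) ^ D * p ^ D \<le> (2 * (1 - 3 * \<epsilon>) ^ D) * p ^ D" using eps(2) p by (intro mult_right_mono) auto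
      then show ?thesis unfolding r_def q_def by (simp add: power_mult_distrib)
    qed
    show "card B \<le> N" unfolding B_def nN by simp
    show "D + 1 \<le> D + 1" "0 < \<mu> * b / 40"
      "0 \<le> exp (- 48 / \<rho>0) / real \<Delta>" "0 \<le> 48 / \<rho>0" "B \<subseteq> {..<n}"
      using \<mu> b8 cN1 \<rho>pos unfolding B_def by auto
    show "card (hn x) = k" "hn x \<subseteq> {..<l}" if "x \<in> B" for x using that B_deg B_hn unfolding B_def by auto
    show "z' \<notin> hn z" if "x \<in> B" "z \<in> hn x" "z' \<in> hn x" for x z z' using that B_free unfolding B_def by auto
    show "(hn x \<union> \<Union>(hn ` hn x)) \<inter> (hn y \<union> \<Union>(hn ` hn y)) = {}" if "x \<in> B" "y \<in> B" "x \<noteq> y" for x y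
      using B_far[of x y] that unfolding B_def by simp
  qed (fact lossy eps)+
  obtain f where f: "valid f l" "\<And>v. v < N \<Longrightarrow> (\<sigma> / 8 * q) ^ k * real (card B) / 8 \<le> real (card {x\<in>B. f ` hn x \<subseteq> nb v})"
    "\<And>T. T \<subseteq> {..<N} \<Longrightarrow> \<mu> * b / 40 \<le> real (card T) \<Longrightarrow> real (card {x\<in>B. cand f {..<l} x T = {}}) \<le> b / 16"
    using buffered_run by blast
  have pf: "partial f {..<l}" by (rule valid_partial[OF f(1)])
  have trf: "tracked f {..<l} y (Reg y)" if "y < n" "y \<notin> {..<l}" for y
    using valid_tracked(1)[OF f(1), of y] that unfolding tracked_def cd_def by simp
  have fV: "f ` {..<l} \<subseteq> {..<\<nu>0}" using valid_lt[OF f(1)] by auto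
  have lS: "{..<l} \<union> S = {..<n - bs}" "l \<le> n - bs" using parts unfolding S_def by auto
  have "\<exists>g. partial g ({..<l} \<union> S) \<and> (\<forall>x\<in>{..<l}. g x = f x) \<and> g ` S \<subseteq> {\<nu>0..<\<nu>0 + card S + cN * slk} \<and>
    (\<forall>y<n. y \<notin> {..<l} \<union> S \<longrightarrow> tracked g ({..<l} \<union> S) y (Reg y))"
  proof (cases "S = {}")
    case True
    then show ?thesis using pf trf by (intro exI[of _ f]) auto
  next
    case False
    then have \<Delta>e: "\<Delta> \<le> e" using e(4) unfolding S_def by auto
    show ?thesis
    proof (rule hall_blocks[OF pf trf, of S \<nu>0 slk \<chi> cN "\<rho>0 / (8 * real cN)"])
      show "S \<subseteq> {..<n} - {..<l}" unfolding S_def by auto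
      show "Reg y = block \<nu>0 slk \<chi> S cN (\<chi> y)" if "y \<in> S" for y using that unfolding Reg_def S_def by auto
      show "hn y \<inter> S = {}" if "y < n" "y \<notin> {..<l}" "y \<notin> S" for y
      proof -
        have "y \<in> B" using that unfolding S_def B_def by auto
        then show ?thesis using B_hn[of y] unfolding S_def by fastforce
      qed
      show "\<nu>0 + card S + cN * slk \<le> N" using fit nN by simp
      show "real \<Delta> * M \<le> q ^ (\<Delta> - 1) * real slk" using \<Delta>1 \<Delta>e slk by (intro regM) auto
      show "\<rho>0 / (8 * real cN) * real n \<le> real slk"
      proof -
        have "\<rho>0 * real n / (8 * real cN) \<le> b / (8 * real cN)" using \<rho>0(3) cN1 unfolding b_def by (intro divide_right_mono) auto
        then show ?thesis using slk by simp
      qed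
      show "0 < \<rho>0 / (8 * real cN)" "\<rho>0 / (8 * real cN) \<le> 1" using \<rho>0 cN1 by (auto simp: pos_divide_le_eq)
      have Sn: "x < n" if "x \<in> S" for x using that unfolding S_def by auto
      show "y \<notin> hn x" if "x \<in> S" "y \<in> S" "\<chi> x = \<chi> y" for x y using col(1)[of x y] that Sn by blast
      show "hn x \<inter> hn y = {}" if "x \<in> S" "y \<in> S" "x \<noteq> y" "\<chi> x = \<chi> y" for x y
        using col(2)[of x y] that Sn by blast
      show "\<chi> x < cN" if "x \<in> S" for x using col(3)[of x] that Sn by blast
    qed (assumption | fact fV eps)+
  qed
  then obtain g where g: "partial g {..<n - bs}" "\<And>x. x < l \<Longrightarrow> g x = f x" "g ` S \<subseteq> {\<nu>0..<\<nu>0 + card S + cN * slk}"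
    "\<And>y. y < n \<Longrightarrow> n - bs \<le> y \<Longrightarrow> tracked g {..<n - bs} y (Reg y)"
    unfolding lS by (metis lessThan_iff not_less)
  have gimg: "g ` {..<n - bs} \<subseteq> {..<n - t0}"
  proof -
    have 1: "g ` {..<l} \<subseteq> {..<\<nu>0}" using fV g(2) by (metis (no_types, lifting) image_cong lessThan_iff)
    have 2: "{..<\<nu>0} \<subseteq> {..<n - t0}" by (rule lessThan_subset_iff[THEN iffD2]) (use fit(1) in linarith)
    have 3: "{\<nu>0..<\<nu>0 + card S + cN * slk} \<subseteq> {..<n - t0}"
      by (rule subset_trans[of _ "{..<\<nu>0 + card S + cN * slk}"], rule subsetI, simp, rule lessThan_subset_iff[THEN iffD2, OF fit(1)])
    have "g ` ({..<l} \<union> S) \<subseteq> {..<n - t0}" unfolding image_Un by (rule Un_least[OF subset_trans[OF 1 2] subset_trans[OF g(3) 3]])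
    then show ?thesis unfolding lS(1) .
  qed
  have xB: "n - bs \<le> x" "x < n" if "x \<in> B" for x using that unfolding B_def by auto
  have ghn: "g ` hn x = f ` hn x" if "x \<in> B" for x
    by (rule image_cong) (use B_hn[OF that] g(2) in auto)
  have cB: "real (card B) = b" unfolding B_def b_def using parts by simp
  have k\<Delta>: "k \<le> \<Delta>" using B_deg[of "n - 1"] hn_deg[of "n - 1"] b8' parts unfolding B_def by simp
  have pq: "p ^ k \<le> 2 * q ^ k"
  proof -
    have "1 / 2 * p ^ k \<le> (1 - 3 * \<epsilon>) ^ \<Delta> * p ^ k" using eps(4) p by (intro mult_right_mono) auto
    also have "\<dots> \<le> q ^ k" by (rule q_p_power[OF k\<Delta>])
    finally show ?thesis by simp
  qed
  define Z where "Z = q ^ k * b"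
  have Zbig: "8 * (\<Gamma> * P) \<le> Z" unfolding Z_def by (rule qkb)
  have Z0: "0 \<le> Z" unfolding Z_def b_def using q by simp
  have pb: "(1 + \<epsilon>) * p ^ k * b \<le> 22 / 10 * Z"
  proof -
    have "(1 + \<epsilon>) * p ^ k \<le> 11 / 10 * (2 * q ^ k)" using \<epsilon> pq p by (intro mult_mono) auto
    then have "(1 + \<epsilon>) * p ^ k * b \<le> 11 / 10 * (2 * q ^ k) * b" unfolding b_def by (intro mult_right_mono) auto
    then show ?thesis unfolding Z_def by simp
  qed
  show ?thesis
  proof (rule final_hall[OF g(1), of B k T0 "(\<sigma> / 8 * q) ^ k * real (card B) / 8" "\<mu> * b / 40" "b / 16"])
    show "n \<le> N" using nN by simp
    show "B = {..<n} - {..<n - bs}" unfolding B_def by auto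
    show "hn x \<subseteq> {..<n - bs}" if "x \<in> B" for x using B_hn[OF that] lS(2) by auto
    show "card (hn x) = k" if "x \<in> B" for x using B_deg[OF that] .
    show "hn x \<inter> hn y = {}" if "x \<in> B" "y \<in> B" "x \<noteq> y" for x y using B_far[OF that] by blast
    show "T0 \<subseteq> {..<N} - g ` {..<n - bs}" using gimg nN unfolding T0_def by auto
    show "tracked g {..<n - bs} x T0" if "x \<in> B" for x using g(4)[of x] xB[OF that] Reg_T0[OF that] by simp
    show "(\<sigma> / 8 * q) ^ k * real (card B) / 8 \<le> real (card {x\<in>B. g ` hn x \<subseteq> nb v})" if "v < N" for v
    proof -
      have "{x\<in>B. g ` hn x \<subseteq> nb v} = {x\<in>B. f ` hn x \<subseteq> nb v}" using ghn by auto
      then show ?thesis using f(2)[OF that] by simp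
    qed
    show "real (card {x\<in>B. cand g {..<n - bs} x T = {}}) \<le> b / 16" if "T \<subseteq> {..<N}" "\<mu> * b / 40 \<le> real (card T)" for T
    proof -
      have "cand g {..<n - bs} x T = cand f {..<l} x T" if "x \<in> B" for x
      proof -
        have "hn x \<inter> {..<n - bs} = hn x" "hn x \<inter> {..<l} = hn x" using B_hn[OF that] lS(2) by auto
        moreover have "g z = f z" if "z \<in> hn x" for z using g(2) B_hn[OF \<open>x \<in> B\<close>] that by blast
        ultimately show ?thesis unfolding cand_def by auto
      qed
      then have "{x\<in>B. cand g {..<n - bs} x T = {}} = {x\<in>B. cand f {..<l} x T = {}}" by auto
      then show ?thesis using f(3)[OF that] by simp
    qed
    have \<Gamma>P: "400 * P \<le> \<Gamma> * P" using \<Gamma>cN P1 by (intro mult_right_mono) auto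
    show "(1 + \<epsilon>) * p ^ k * (b / 16) + 2 * K * L \<le> q ^ k * real (card T0)"
    proof -
      have "q ^ k * (b / 3) \<le> q ^ k * real (card T0)" unfolding cT0 using t0 q by (intro mult_left_mono) auto
      then have 1: "Z / 3 \<le> q ^ k * real (card T0)" unfolding Z_def by simp
      have 2: "(1 + \<epsilon>) * p ^ k * (b / 16) \<le> 22 / 160 * Z" using pb by (simp add: mult_ac)
      have "2 * K * L = 2 * P" unfolding P_def by simp
      then show ?thesis using 1 2 Zbig \<Gamma>P P1 by linarith
    qed
    show "(1 + \<epsilon>) * p ^ k * (\<mu> * b / 40) + 2 * K * L \<le> (\<sigma> / 8 * q) ^ k * real (card B) / 8"
    proof -
      have "\<mu> * ((1 + \<epsilon>) * p ^ k * b) \<le> \<mu> * (22 / 10 * Z)" using pb \<mu> by (intro mult_left_mono) auto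
      then have 1: "(1 + \<epsilon>) * p ^ k * (\<mu> * b / 40) \<le> 22 / 400 * (\<mu> * Z)" by (simp add: mult_ac)
      have "\<mu> \<le> (\<sigma> / 8) ^ k" unfolding \<mu>_def using \<sigma>01 k\<Delta> by (intro power_decreasing) auto
      then have "\<mu> * Z \<le> (\<sigma> / 8) ^ k * Z" using Z0 by (intro mult_right_mono)
      then have 2: "\<mu> * Z / 8 \<le> (\<sigma> / 8 * q) ^ k * real (card B) / 8"
        unfolding cB Z_def by (simp add: power_mult_distrib power_divide mult_ac)
      have "80 \<le> \<Gamma> * (\<epsilon>\<^sup>2 * \<mu>)" using \<Gamma>(8) unfolding \<mu>_def .
      also have "\<dots> \<le> \<Gamma> * (1 * \<mu>)" using \<epsilon>2 \<epsilon> \<mu> \<Gamma>0 by (intro mult_left_mono mult_right_mono) auto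
      finally have "80 * P \<le> \<Gamma> * \<mu> * P" using P1 by (intro mult_right_mono) auto
      also have "\<dots> = \<mu> * (\<Gamma> * P)" by simp
      also have "\<dots> \<le> \<mu> * (Z / 8)" using Zbig \<mu> by (intro mult_left_mono) auto
      finally have 3: "640 * P \<le> \<mu> * Z" by simp
      have "2 * K * L = 2 * P" unfolding P_def by simp
      then show ?thesis using 1 2 3 P1 by linarith
    qed
  qed
qed

end

section \<open>Orderings and colourings of bounded degree graphs\<close>

locale nbgraph =
  fixes V :: "'a set" and gn :: "'a \<Rightarrow> 'a set" and \<Delta> :: nat
  assumes fin_V: "finite V" and gn_sub: "x \<in> V \<Longrightarrow> gn x \<subseteq> V" and gn_sym: "x \<in> V \<Longrightarrow> y \<in> gn x \<Longrightarrow> x \<in> gn y"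
    and gn_irrefl: "x \<notin> gn x" and gn_deg: "x \<in> V \<Longrightarrow> card (gn x) \<le> \<Delta>"
begin

lemma fin_gn: "x \<in> V \<Longrightarrow> finite (gn x)"
  using gn_sub fin_V finite_subset by blast

text \<open>The graph transported to the positions of the list \<open>xs\<close>, so that an order
  of the vertices becomes the order of the natural numbers.\<close>

definition rel :: "'a list \<Rightarrow> nat \<Rightarrow> nat set" where
  "rel xs i = {j. j < length xs \<and> xs ! j \<in> gn (xs ! i)}"

definition zone :: "'a \<Rightarrow> 'a set" where
  "zone x = gn x \<union> \<Union>(gn ` gn x)"

lemma zone_sub: "x \<in> V \<Longrightarrow> zone x \<subseteq> V"
  unfolding zone_def using gn_sub by blast

lemma zone_sym: "x \<in> V \<Longrightarrow> y \<in> zone x \<Longrightarrow> x \<in> zone y"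
  unfolding zone_def using gn_sub gn_sym by blast

lemma card_zone: "x \<in> V \<Longrightarrow> card (zone x) \<le> \<Delta> + \<Delta> * \<Delta>"
proof -
  assume x: "x \<in> V"
  have "card (\<Union>(gn ` gn x)) \<le> (\<Sum>y\<in>gn x. card (gn y))" by (rule card_UN_le[OF fin_gn[OF x]])
  also have "\<dots> \<le> (\<Sum>y\<in>gn x. \<Delta>)" by (intro sum_mono gn_deg) (use gn_sub x in blast)
  also have "\<dots> \<le> \<Delta> * \<Delta>" using gn_deg[OF x] by simp
  finally show ?thesis unfolding zone_def using card_Un_le[of "gn x" "\<Union>(gn ` gn x)"] gn_deg[OF x] by linarith
qed

lemma card_zone_zone: "x \<in> V \<Longrightarrow> card (\<Union>(zone ` zone x)) \<le> (\<Delta> + \<Delta> * \<Delta>) * (\<Delta> + \<Delta> * \<Delta>)"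
proof -
  assume x: "x \<in> V"
  have "card (\<Union>(zone ` zone x)) \<le> (\<Sum>y\<in>zone x. card (zone y))"
    by (rule card_UN_le) (use zone_sub[OF x] fin_V finite_subset in blast)
  also have "\<dots> \<le> (\<Sum>y\<in>zone x. \<Delta> + \<Delta> * \<Delta>)" by (intro sum_mono card_zone) (use zone_sub x in blast)
  also have "\<dots> \<le> (\<Delta> + \<Delta> * \<Delta>) * (\<Delta> + \<Delta> * \<Delta>)" using card_zone[OF x] by simp
  finally show ?thesis .
qed

text \<open>The conflict sets may contain the vertex itself, as \<open>zone x\<close> does whenever
  \<open>x\<close> has a neighbour; hence the proviso \<open>x \<noteq> y\<close>.\<close>

lemma greedy_colouring:
  assumes "\<And>x y. x \<in> V \<Longrightarrow> y \<in> cf x \<Longrightarrow> x \<in> cf y" "\<And>x. x \<in> V \<Longrightarrow> cf x \<subseteq> V" "\<And>x. x \<in> V \<Longrightarrow> card (cf x) < k"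
  shows "\<exists>\<chi> :: 'a \<Rightarrow> nat. (\<forall>x\<in>V. \<chi> x < k) \<and> (\<forall>x\<in>V. \<forall>y\<in>cf x. x \<noteq> y \<longrightarrow> \<chi> x \<noteq> \<chi> y)"
proof -
  have "\<exists>\<chi> :: 'a \<Rightarrow> nat. (\<forall>x\<in>S. \<chi> x < k) \<and> (\<forall>x\<in>S. \<forall>y\<in>cf x \<inter> S. x \<noteq> y \<longrightarrow> \<chi> x \<noteq> \<chi> y)"
    if "finite S" "S \<subseteq> V" for S
    using that
  proof (induction S rule: finite_induct)
    case (insert x S)
    then obtain \<chi> :: "'a \<Rightarrow> nat" where \<chi>: "\<forall>x\<in>S. \<chi> x < k" "\<forall>x\<in>S. \<forall>y\<in>cf x \<inter> S. x \<noteq> y \<longrightarrow> \<chi> x \<noteq> \<chi> y" by auto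
    have x: "x \<in> V" using insert.prems by simp
    have fc: "finite (cf x)" using assms(2)[OF x] fin_V finite_subset by blast
    have "card (\<chi> ` cf x) < card {..<k}" using card_image_le[OF fc, of \<chi>] assms(3)[OF x] by simp
    then have "\<not> {..<k} \<subseteq> \<chi> ` cf x" using card_mono[of "\<chi> ` cf x" "{..<k}"] fc by auto
    then obtain c where c: "c < k" "c \<notin> \<chi> ` cf x" by auto
    show ?case
    proof (intro exI[of _ "\<chi>(x := c)"] conjI ballI impI)
      fix a b assume ab: "a \<in> insert x S" "b \<in> cf a \<inter> insert x S" "a \<noteq> b"
      have "a \<in> cf b" using assms(1) ab insert.prems by blast
      then show "(\<chi>(x := c)) a \<noteq> (\<chi>(x := c)) b" using ab \<chi>(2) c insert.hyps by (cases "a = x"; cases "b = x") auto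
    qed (use \<chi> c in auto)
  qed auto
  from this[OF fin_V order.refl] obtain \<chi> :: "'a \<Rightarrow> nat" where
    "\<forall>x\<in>V. \<chi> x < k" "\<forall>x\<in>V. \<forall>y\<in>cf x \<inter> V. x \<noteq> y \<longrightarrow> \<chi> x \<noteq> \<chi> y" by blast
  then show ?thesis using assms(2) by (intro exI[of _ \<chi>]) blast
qed

lemma square_colouring:
  "\<exists>\<chi> :: 'a \<Rightarrow> nat. (\<forall>x\<in>V. \<chi> x < \<Delta> + \<Delta> * \<Delta> + 1) \<and> (\<forall>x\<in>V. \<forall>y\<in>V. \<chi> x = \<chi> y \<longrightarrow> y \<notin> gn x \<and> (x \<noteq> y \<longrightarrow> gn x \<inter> gn y = {}))"
proof -
  obtain \<chi> :: "'a \<Rightarrow> nat" where \<chi>: "\<forall>x\<in>V. \<chi> x < \<Delta> + \<Delta> * \<Delta> + 1" "\<forall>x\<in>V. \<forall>y\<in>zone x. x \<noteq> y \<longrightarrow> \<chi> x \<noteq> \<chi> y"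
    using greedy_colouring[of zone "\<Delta> + \<Delta> * \<Delta> + 1"] zone_sym zone_sub card_zone by (metis less_add_one order_le_less_trans)
  have "y \<notin> gn x \<and> (x \<noteq> y \<longrightarrow> gn x \<inter> gn y = {})" if "x \<in> V" "y \<in> V" "\<chi> x = \<chi> y" for x y
  proof (intro conjI impI)
    show "y \<notin> gn x" using \<chi>(2) that gn_irrefl[of x] unfolding zone_def by (cases "x = y") blast+
    show "gn x \<inter> gn y = {}" if "x \<noteq> y"
    proof (rule ccontr)
      assume "gn x \<inter> gn y \<noteq> {}"
      then have "y \<in> zone x" using gn_sym \<open>y \<in> V\<close> unfolding zone_def by blast
      then show False using \<chi>(2) that \<open>x \<in> V\<close> \<open>\<chi> x = \<chi> y\<close> by blast
    qed
  qed
  then show ?thesis using \<chi>(1) by blast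
qed

text \<open>A greedy colouring with boundedly many colours separates all vertices whose zones meet;
  pigeonhole over pairs of colour and degree gives a class of linear size.\<close>

lemma buffers:
  assumes W: "W \<subseteq> V"
  shows "\<exists>B k. B \<subseteq> W \<and> (\<forall>x\<in>B. card (gn x) = k) \<and> (\<forall>x\<in>B. \<forall>y\<in>B. x \<noteq> y \<longrightarrow> zone x \<inter> zone y = {}) \<and>
    card W \<le> card B * (((\<Delta> + \<Delta> * \<Delta>) * (\<Delta> + \<Delta> * \<Delta>) + 1) * (\<Delta> + 1))"
proof -
  define cN where "cN = (\<Delta> + \<Delta> * \<Delta>) * (\<Delta> + \<Delta> * \<Delta>) + 1"
  obtain \<chi> :: "'a \<Rightarrow> nat" where \<chi>: "\<forall>x\<in>V. \<chi> x < cN" "\<forall>x\<in>V. \<forall>y\<in>\<Union>(zone ` zone x). x \<noteq> y \<longrightarrow> \<chi> x \<noteq> \<chi> y"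
  proof (rule exE[OF greedy_colouring[of "\<lambda>x. \<Union>(zone ` zone x)" cN]])
    show "x \<in> \<Union> (zone ` zone y)" if "x \<in> V" "y \<in> \<Union> (zone ` zone x)" for x y
      using that zone_sym zone_sub by blast
    show "\<Union> (zone ` zone x) \<subseteq> V" if "x \<in> V" for x using that zone_sub by blast
    show "card (\<Union> (zone ` zone x)) < cN" if "x \<in> V" for x using card_zone_zone[OF that] unfolding cN_def by simp
  qed blast
  define I where "I = {..<cN} \<times> {..\<Delta>}"
  define F where "F ck = {x\<in>W. \<chi> x = fst ck \<and> card (gn x) = snd ck}" for ck
  have finW: "finite W" using W fin_V finite_subset by blast
  have "card W \<le> (\<Sum>ck\<in>I. card (F ck))"
  proof -
    have "W \<subseteq> \<Union>(F ` I)" unfolding F_def I_def using \<chi>(1) gn_deg W by fastforce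
    then have "card W \<le> card (\<Union>(F ` I))" by (rule card_mono[rotated]) (use finW in \<open>auto simp: F_def I_def\<close>)
    also have "\<dots> \<le> (\<Sum>ck\<in>I. card (F ck))" by (rule card_UN_le) (auto simp: I_def)
    finally show ?thesis .
  qed
  moreover have "\<exists>ck\<in>I. card W \<le> card (F ck) * card I"
  proof (rule ccontr)
    assume "\<not> ?thesis"
    then have "\<And>ck. ck \<in> I \<Longrightarrow> card (F ck) * card I < card W" by auto
    then have "(\<Sum>ck\<in>I. card (F ck) * card I) < (\<Sum>ck\<in>I. card W)" by (intro sum_strict_mono) (auto simp: I_def cN_def)
    then have "(\<Sum>ck\<in>I. card (F ck)) * card I < card W * card I" by (simp only: sum_distrib_right[symmetric] sum_constant of_nat_id mult.commute[of "card I" "card W"])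
    then show False using calculation by simp
  qed
  then obtain c k where ck: "card W \<le> card (F (c, k)) * card I" by auto
  show ?thesis
  proof (intro exI[of _ "F (c, k)"] exI[of _ k] conjI ballI impI)
    show "zone x \<inter> zone y = {}" if "x \<in> F (c, k)" "y \<in> F (c, k)" "x \<noteq> y" for x y
    proof (rule ccontr)
      assume "zone x \<inter> zone y \<noteq> {}"
      then obtain z where "z \<in> zone x" "z \<in> zone y" by blast
      moreover have "x \<in> V" "y \<in> V" "\<chi> x = \<chi> y" using that W unfolding F_def by auto
      ultimately have "y \<in> \<Union>(zone ` zone x)" using zone_sym by blast
      then show False using \<chi>(2) that \<open>x \<in> V\<close> \<open>\<chi> x = \<chi> y\<close> by blast
    qed
    show "card W \<le> card (F (c, k)) * (((\<Delta> + \<Delta> * \<Delta>) * (\<Delta> + \<Delta> * \<Delta>) + 1) * (\<Delta> + 1))"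
      using ck unfolding I_def cN_def by (simp add: mult_ac)
  qed (auto simp: F_def)
qed

text \<open>An edge inside \<open>B\<close> would put an endpoint into both zones. An edge between
  neighbours of \<open>B\<close> either closes a triangle at a common buffer vertex or makes the
  zones of two of them meet.\<close>

lemma buffer_nbrs:
  assumes B: "B \<subseteq> V" "\<And>x y. x \<in> B \<Longrightarrow> y \<in> B \<Longrightarrow> x \<noteq> y \<Longrightarrow> zone x \<inter> zone y = {}"
  shows "\<And>x. x \<in> B \<Longrightarrow> gn x \<inter> B = {}"
    and "(\<And>x y z. x \<in> V \<Longrightarrow> y \<in> gn x \<Longrightarrow> z \<in> gn x \<Longrightarrow> z \<notin> gn y) \<Longrightarrow> z \<in> \<Union>(gn ` B) \<Longrightarrow> gn z \<inter> \<Union>(gn ` B) = {}"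
proof -
  show "gn x \<inter> B = {}" if "x \<in> B" for x
  proof (rule ccontr)
    assume "gn x \<inter> B \<noteq> {}"
    then obtain y where y: "y \<in> gn x" "y \<in> B" by blast
    have "x \<in> gn y" using gn_sym y that B by blast
    then have "y \<in> zone x" "y \<in> zone y" using y gn_sym B unfolding zone_def by blast+
    moreover have "x \<noteq> y" using y gn_irrefl by blast
    ultimately show False using B(2)[OF that y(2)] by blast
  qed
  show "gn z \<inter> \<Union>(gn ` B) = {}" if tf: "\<And>x y z. x \<in> V \<Longrightarrow> y \<in> gn x \<Longrightarrow> z \<in> gn x \<Longrightarrow> z \<notin> gn y" and z: "z \<in> \<Union>(gn ` B)"
  proof (rule ccontr)
    assume "gn z \<inter> \<Union>(gn ` B) \<noteq> {}"
    then obtain x y w where *: "x \<in> B" "z \<in> gn x" "w \<in> gn z" "y \<in> B" "w \<in> gn y" using z by blast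
    then have "x \<noteq> y" using tf[of x z w] B by blast
    moreover have "w \<in> zone x" "w \<in> zone y" using * unfolding zone_def by blast+
    ultimately show False using B(2) * by blast
  qed
qed

text \<open>A vertex of low degree within \<open>S\<close> is put last, and the rest is ordered
  recursively.\<close>

lemma degenerate_order:
  assumes deg: "\<And>S. S \<subseteq> V \<Longrightarrow> S \<noteq> {} \<Longrightarrow> \<exists>x\<in>S. card (gn x \<inter> S) \<le> d" and S: "S \<subseteq> V"
  shows "\<exists>xs. distinct xs \<and> set xs = S \<and> (\<forall>i<length xs. card (gn (xs ! i) \<inter> set (take i xs)) \<le> d)"
  using finite_subset[OF S fin_V] S
proof (induction "card S" arbitrary: S)
  case 0
  then show ?case by (intro exI[of _ "[]"]) auto
next
  case (Suc m)
  then obtain x where x: "x \<in> S" "card (gn x \<inter> S) \<le> d" using deg[of S] by fastforce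
  obtain xs where xs: "distinct xs" "set xs = S - {x}" "\<forall>i<length xs. card (gn (xs ! i) \<inter> set (take i xs)) \<le> d"
  proof (rule exE[OF Suc.hyps(1)[of "S - {x}"]])
    show "m = card (S - {x})" "S - {x} \<subseteq> V" "finite (S - {x})" using Suc.hyps(2) Suc.prems x by auto
  qed blast
  have "gn x \<inter> (S - {x}) = gn x \<inter> S" using gn_irrefl by blast
  then show ?case using xs x by (intro exI[of _ "xs @ [x]"]) (auto simp: nth_append less_Suc_eq)
qed

text \<open>Removing vertices of degree at most \<open>d\<close> one by one shows that the degree
  sum is at most \<open>2 * d * card V\<close>; so vertices of degree at least
  \<open>2 * d + 1\<close> make up at most the proportion
  \<open>2 * d / (2 * d + 1)\<close>.\<close>

lemma many_low_degree:
  assumes deg: "\<And>S. S \<subseteq> V \<Longrightarrow> S \<noteq> {} \<Longrightarrow> \<exists>x\<in>S. card (gn x \<inter> S) \<le> d"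
  shows "card V \<le> (2 * d + 1) * card {x\<in>V. card (gn x) \<le> 2 * d}"
proof -
  have sum: "(\<Sum>x\<in>S. card (gn x \<inter> S)) \<le> 2 * d * card S" if "finite S" "S \<subseteq> V" for S
    using that
  proof (induction "card S" arbitrary: S)
    case (Suc m)
    then obtain x where x: "x \<in> S" "card (gn x \<inter> S) \<le> d" using deg[of S] by fastforce
    define T where "T = S - {x}"
    have T: "finite T" "T \<subseteq> V" "card T = m" "S = insert x T" "x \<notin> T" using Suc x unfolding T_def by auto
    have "card (gn y \<inter> S) = card (gn y \<inter> T) + (if y \<in> gn x then 1 else 0)" if "y \<in> T" for y
    proof -
      have "y \<in> V" "x \<in> V" using T x Suc.prems that by auto
      then have "y \<in> gn x \<longleftrightarrow> x \<in> gn y" using gn_sym by blast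
      moreover have "finite (gn y \<inter> T)" using T by simp
      ultimately show ?thesis unfolding T(4) using T(5) by (auto simp: Int_insert_right)
    qed
    then have "(\<Sum>y\<in>T. card (gn y \<inter> S)) = (\<Sum>y\<in>T. card (gn y \<inter> T)) + (\<Sum>y\<in>T. if y \<in> gn x then 1 else 0)"
      by (simp add: sum.distrib)
    also have "(\<Sum>y\<in>T. if y \<in> gn x then 1 else 0) = card (gn x \<inter> T)"
      using T(1) by (simp add: sum.If_cases Int_commute)
    also have "\<dots> \<le> card (gn x \<inter> S)" by (rule card_mono) (use T Suc.prems in auto)
    also have "(\<Sum>y\<in>T. card (gn y \<inter> T)) \<le> 2 * d * card T" using Suc.hyps(1)[of T] T by simp
    finally have "(\<Sum>y\<in>T. card (gn y \<inter> S)) \<le> 2 * d * m + d" using x T by simp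
    moreover have "(\<Sum>y\<in>S. card (gn y \<inter> S)) = card (gn x \<inter> S) + (\<Sum>y\<in>T. card (gn y \<inter> S))"
      unfolding T_def using x Suc.prems by (simp add: sum.remove)
    moreover have "2 * d * card S = 2 * d * m + 2 * d" using Suc.hyps(2)[symmetric] by simp
    ultimately show ?case using x(2) by linarith
  qed auto
  define Lo where "Lo = {x\<in>V. card (gn x) \<le> 2 * d}"
  have Lo: "Lo \<subseteq> V" "finite Lo" unfolding Lo_def using fin_V by auto
  have "(2 * d + 1) * card (V - Lo) = (\<Sum>x\<in>V - Lo. 2 * d + 1)" by simp
  also have "\<dots> \<le> (\<Sum>x\<in>V - Lo. card (gn x \<inter> V))"
  proof (rule sum_mono)
    fix x assume "x \<in> V - Lo"
    then show "2 * d + 1 \<le> card (gn x \<inter> V)" using gn_sub[of x] unfolding Lo_def by (auto simp: Int_absorb2)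
  qed
  also have "\<dots> \<le> (\<Sum>x\<in>V. card (gn x \<inter> V))" by (rule sum_mono2) (use fin_V in auto)
  also have "\<dots> \<le> 2 * d * card V" using sum fin_V by blast
  finally have 1: "(2 * d + 1) * card (V - Lo) \<le> 2 * d * card V" .
  have "card V = card Lo + card (V - Lo)" using card_Diff_subset[OF Lo(2,1)] card_mono[OF fin_V Lo(1)] by simp
  then have "(2 * d + 1) * card V = (2 * d + 1) * card Lo + (2 * d + 1) * card (V - Lo)" by (simp only: distrib_left)
  also have "\<dots> \<le> (2 * d + 1) * card Lo + 2 * d * card V" using 1 by simp
  finally show ?thesis unfolding Lo_def by simp
qed

context
  fixes xs :: "'a list"
  assumes xs: "distinct xs" "set xs = V"
begin

lemma rel_image: "i < length xs \<Longrightarrow> (!) xs ` rel xs i = gn (xs ! i)"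
proof -
  assume i: "i < length xs"
  then have "gn (xs ! i) \<subseteq> set xs" using gn_sub[of "xs ! i"] xs nth_mem[of i xs] by simp
  then show ?thesis unfolding rel_def by (fastforce simp: in_set_conv_nth)
qed

lemma inj_nth: "inj_on ((!) xs) (rel xs i)"
  by (rule inj_on_nth[OF xs(1)]) (auto simp: rel_def)

lemma card_rel: "i < length xs \<Longrightarrow> card (rel xs i) = card (gn (xs ! i))"
  using rel_image card_image[OF inj_nth] by metis

lemma nth_mem_V: "i < length xs \<Longrightarrow> xs ! i \<in> V"
  using xs by auto

lemma rel_disjoint:
  assumes "i < length xs" "j < length xs" "gn (xs ! i) \<inter> gn (xs ! j) = {}"
  shows "rel xs i \<inter> rel xs j = {}"
  using assms unfolding rel_def by blast

lemma zone_rel: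
  assumes "i < length xs" "j \<in> rel xs i \<union> \<Union>(rel xs ` rel xs i)"
  shows "xs ! j \<in> zone (xs ! i)"
  using assms unfolding rel_def zone_def by blast

lemma back_card:
  assumes "i < length xs"
  shows "card (rel xs i \<inter> {..<i}) = card (gn (xs ! i) \<inter> set (take i xs))"
proof -
  have "card (rel xs i \<inter> {..<i}) = card ((!) xs ` (rel xs i \<inter> {..<i}))"
    by (rule card_image[symmetric]) (rule inj_on_subset[OF inj_nth[of i]], simp)
  also have "(!) xs ` (rel xs i \<inter> {..<i}) = gn (xs ! i) \<inter> set (take i xs)"
  proof -
    have "set (take i xs) = (!) xs ` {..<i}" using assms by (auto simp: nth_image[symmetric] lessThan_atLeast0)
    then show ?thesis using assms unfolding rel_def by auto
  qed
  finally show ?thesis .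
qed

lemma embedding_rel:
  assumes "host N nb p \<epsilon> K \<Delta>" "1 \<le> \<Delta>"
  shows "embedding N nb p \<epsilon> K \<Delta> (length xs) (rel xs)"
proof (intro embedding.intro embedding_axioms.intro)
  show "x \<in> rel xs y" if "x < length xs" "y \<in> rel xs x" for x y
    using that gn_sym nth_mem_V unfolding rel_def by auto
  show "card (rel xs x) \<le> \<Delta>" if "x < length xs" for x using card_rel[OF that] gn_deg nth_mem_V[OF that] by simp
qed (use assms gn_irrefl in \<open>auto simp: rel_def\<close>)

lemma rel_colouring:
  "\<exists>\<chi> :: nat \<Rightarrow> nat. (\<forall>x<length xs. \<chi> x < \<Delta> + \<Delta> * \<Delta> + 1) \<and>
    (\<forall>x<length xs. \<forall>y<length xs. \<chi> x = \<chi> y \<longrightarrow> y \<notin> rel xs x \<and> (x \<noteq> y \<longrightarrow> rel xs x \<inter> rel xs y = {}))"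
proof -
  obtain \<chi> :: "'a \<Rightarrow> nat" where \<chi>: "\<forall>x\<in>V. \<chi> x < \<Delta> + \<Delta> * \<Delta> + 1"
    "\<forall>x\<in>V. \<forall>y\<in>V. \<chi> x = \<chi> y \<longrightarrow> y \<notin> gn x \<and> (x \<noteq> y \<longrightarrow> gn x \<inter> gn y = {})" using square_colouring by blast
  have "y \<notin> rel xs x \<and> (x \<noteq> y \<longrightarrow> rel xs x \<inter> rel xs y = {})"
    if "x < length xs" "y < length xs" "\<chi> (xs ! x) = \<chi> (xs ! y)" for x y
  proof (intro conjI impI)
    have V: "xs ! x \<in> V" "xs ! y \<in> V" using nth_mem_V that by auto
    show "y \<notin> rel xs x" using \<chi>(2) V that unfolding rel_def by auto
    show "rel xs x \<inter> rel xs y = {}" if "x \<noteq> y"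
    proof (rule rel_disjoint)
      have "xs ! x \<noteq> xs ! y" using that \<open>x < length xs\<close> \<open>y < length xs\<close> xs(1) by (simp add: nth_eq_iff_index_eq)
      then show "gn (xs ! x) \<inter> gn (xs ! y) = {}" using \<chi>(2) V \<open>\<chi> (xs ! x) = \<chi> (xs ! y)\<close> by blast
    qed fact+
  qed
  then show ?thesis using \<chi>(1) nth_mem_V by (intro exI[of _ "\<lambda>i. \<chi> (xs ! i)"]) blast
qed

end

end

section \<open>From graphs to neighbourhoods\<close>

lemma nbgraph_of:
  assumes H: "simple_graph H" "max_degree H \<le> \<Delta>" "verts H \<noteq> {}"
  shows "nbgraph (verts H) (\<lambda>x. {y. {x, y} \<in> edges H}) \<Delta>"
    and "\<And>S x. S \<subseteq> verts H \<Longrightarrow> x \<in> S \<Longrightarrow> degree (induced_subgraph H S) x = card ({y. {x, y} \<in> edges H} \<inter> S)"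
proof -
  have fin: "finite (verts H)" and e: "\<And>e. e \<in> edges H \<Longrightarrow> e \<subseteq> verts H \<and> card e = 2"
    using H(1) unfolding simple_graph_def by (auto simp: nsets_def)
  have irr: "{x} \<notin> edges H" for x using e[of "{x}"] by auto
  have sub: "x \<in> verts H" "y \<in> verts H" if "{x, y} \<in> edges H" for x y using e[OF that] by auto
  show deg: "degree (induced_subgraph H S) x = card ({y. {x, y} \<in> edges H} \<inter> S)" if "S \<subseteq> verts H" "x \<in> S" for S x
  proof -
    have "{e \<in> edges (induced_subgraph H S). x \<in> e} = (\<lambda>y. {x, y}) ` ({y. {x, y} \<in> edges H} \<inter> S)"
    proof (intro equalityI subsetI)
      fix f assume f: "f \<in> {e \<in> edges (induced_subgraph H S). x \<in> e}"
      then have "f \<in> edges H" "x \<in> f" "f \<subseteq> S" unfolding induced_subgraph_def by auto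
      moreover obtain a b where "f = {a, b}" using e[OF \<open>f \<in> edges H\<close>] by (metis card_2_iff)
      ultimately show "f \<in> (\<lambda>y. {x, y}) ` ({y. {x, y} \<in> edges H} \<inter> S)"
        by (cases "x = a") (auto simp: insert_commute)
    qed (use that in \<open>auto simp: induced_subgraph_def\<close>)
    moreover have "inj_on (\<lambda>y. {x, y}) ({y. {x, y} \<in> edges H} \<inter> S)" by (rule inj_onI) (auto simp: doubleton_eq_iff)
    ultimately show ?thesis unfolding degree_def by (simp add: card_image)
  qed
  show "nbgraph (verts H) (\<lambda>x. {y. {x, y} \<in> edges H}) \<Delta>"
  proof
    show "card {y. {x, y} \<in> edges H} \<le> \<Delta>" if "x \<in> verts H" for x
    proof -
      have "edges H = edges (induced_subgraph H (verts H))" unfolding induced_subgraph_def using e by auto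
      moreover have "{y. {x, y} \<in> edges H} \<inter> verts H = {y. {x, y} \<in> edges H}" using sub by auto
      ultimately have "card {y. {x, y} \<in> edges H} = degree H x" using deg[OF order.refl that] unfolding degree_def by simp
      also have "\<dots> \<le> max_degree H" unfolding max_degree_def by (rule Max_ge) (use fin that in auto)
      finally show ?thesis using H(2) by simp
    qed
  qed (use fin irr sub in \<open>auto simp: insert_commute\<close>)
qed

text \<open>For the least \<open>l\<close> to have its defining property some bound must exist; the
  number of edges is one.\<close>

lemma degeneracy_min_degree:
  assumes "S \<subseteq> verts H" "S \<noteq> {}" and H: "simple_graph H"
  shows "\<exists>x\<in>S. degree (induced_subgraph H S) x \<le> degeneracy H"
proof -
  let ?P = "\<lambda>l. \<forall>S. S \<subseteq> verts H \<and> S \<noteq> {} \<longrightarrow> min_degree (induced_subgraph H S) \<le> l"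
  have fin: "finite (verts H)" "finite (edges H)" using H unfolding simple_graph_def
    by (auto intro: finite_subset[OF _ finite_imp_finite_nsets])
  have min: "\<exists>x\<in>S. degree (induced_subgraph H S) x = min_degree (induced_subgraph H S)"
    if "S \<subseteq> verts H" "S \<noteq> {}" for S
  proof -
    have "Min (degree (induced_subgraph H S) ` S) \<in> degree (induced_subgraph H S) ` S"
      by (rule Min_in) (use that fin finite_subset in auto)
    then show ?thesis unfolding min_degree_def by (auto simp: induced_subgraph_def)
  qed
  have "?P (card (edges H))"
  proof (intro allI impI)
    fix S assume S: "S \<subseteq> verts H \<and> S \<noteq> {}"
    then obtain x where "degree (induced_subgraph H S) x = min_degree (induced_subgraph H S)" using min[of S] by auto
    moreover have "degree (induced_subgraph H S) x \<le> card (edges H)"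
      unfolding degree_def induced_subgraph_def by (rule card_mono) (use fin in auto)
    ultimately show "min_degree (induced_subgraph H S) \<le> card (edges H)" by simp
  qed
  then have "?P (degeneracy H)" unfolding degeneracy_def by (rule LeastI)
  then show ?thesis using min[OF assms(1,2)] assms(1,2) by metis
qed

lemma copy_of_partial:
  assumes H: "simple_graph H" and xs: "distinct xs" "set xs = verts H" and R: "R' \<subseteq> R"
    and emb: "embedding N (nbr R') p \<epsilon> K \<Delta> (length xs) (nbgraph.rel (\<lambda>x. {y. {x, y} \<in> edges H}) xs)"
    and nbg: "nbgraph (verts H) (\<lambda>x. {y. {x, y} \<in> edges H}) \<Delta>"
    and g: "embedding.partial N (nbr R') (length xs) (nbgraph.rel (\<lambda>x. {y. {x, y} \<in> edges H}) xs) g {..<length xs}"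
  shows "contains_copy ({..<N}, R) H"
proof -
  define ix where "ix = inv_into {..<length xs} ((!) xs)"
  have bij: "bij_betw ((!) xs) {..<length xs} (verts H)" using bij_betw_nth[OF xs(1) refl xs(2)[symmetric]] by simp
  have ix: "ix x < length xs" "xs ! ix x = x" if "x \<in> verts H" for x
    using that bij unfolding ix_def bij_betw_def by (auto intro: f_inv_into_f inv_into_into[of _ "(!) xs" "{..<length xs}", simplified])
  have g: "inj_on g {..<length xs}" "g ` {..<length xs} \<subseteq> {..<N}"
    "\<And>i j. i < length xs \<Longrightarrow> j < length xs \<Longrightarrow> {xs ! i, xs ! j} \<in> edges H \<Longrightarrow> {g j, g i} \<in> R'"
    using g unfolding embedding.partial_def[OF emb] nbgraph.rel_def[OF nbg] nbr_def by auto
  show ?thesis unfolding contains_copy_def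
  proof (intro exI[of _ "\<lambda>x. g (ix x)"] conjI ballI)
    show "inj_on (\<lambda>x. g (ix x)) (verts H)"
    proof (rule inj_onI)
      fix x y assume "x \<in> verts H" "y \<in> verts H" "g (ix x) = g (ix y)"
      then have "ix x = ix y" using g(1) ix by (auto dest: inj_onD)
      then show "x = y" using ix \<open>x \<in> verts H\<close> \<open>y \<in> verts H\<close> by metis
    qed
    show "(\<lambda>x. g (ix x)) ` verts H \<subseteq> verts ({..<N}, R)" using g(2) ix by auto
    fix e assume e: "e \<in> edges H"
    then have "e \<subseteq> verts H" "card e = 2" using H unfolding simple_graph_def by (auto simp: nsets_def)
    then obtain x y where xy: "e = {x, y}" "x \<in> verts H" "y \<in> verts H" by (auto simp: card_2_iff)
    have "{g (ix y), g (ix x)} \<in> R'" by (rule g(3)) (use xy ix e in auto)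
    then show "(\<lambda>x. g (ix x)) ` e \<in> edges ({..<N}, R)" using R xy by (auto simp: insert_commute)
  qed
qed

section \<open>Deterministic embedding for the four classes\<close>

text \<open>The deterministic half of the argument: \<open>\<epsilon>\<close> and
  \<open>\<Gamma>\<close> are fixed before \<open>n\<close>, \<open>p\<close> and \<open>K\<close>.
  The exponent \<open>e\<close> reappears in the bias because \<open>p\<close> is of order
  \<open>1 / b\<close>.\<close>

definition embeds :: "nat \<Rightarrow> nat \<Rightarrow> (nat \<Rightarrow> nat) \<Rightarrow> (nat \<Rightarrow> nat graph set) \<Rightarrow> bool" where
  "embeds \<Delta> e NN cls \<longleftrightarrow> (\<exists>\<epsilon> \<Gamma> n0. 0 < \<epsilon> \<and> \<epsilon> \<le> 1 / 10 \<and> 0 < \<Gamma> \<and>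
     (\<forall>n\<ge>n0. \<forall>p K R R' H. host (NN n) (nbr R') p \<epsilon> K \<Delta> \<longrightarrow> R' \<subseteq> R \<longrightarrow>
        \<Gamma> * (K * ln (real (NN n))) \<le> ((1 - 3 * \<epsilon>) * p) ^ e * real n \<longrightarrow> H \<in> cls n \<longrightarrow>
        contains_copy ({..<NN n}, R) H))"

text \<open>All smallness conditions on \<open>\<epsilon>\<close> are strict at 0 and continuous
  there, so finitely many of them hold together just to the right of 0.\<close>

lemma ex_small:
  fixes fs :: "(real \<Rightarrow> real) list"
  assumes "\<And>f. f \<in> set fs \<Longrightarrow> isCont f 0 \<and> f 0 < 0"
  shows "\<exists>\<epsilon>>0. \<epsilon> \<le> 1 / 10 \<and> (\<forall>f\<in>set fs. f \<epsilon> \<le> 0)"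
proof -
  have "eventually (\<lambda>x. f x \<le> 0) (at_right 0)" if "f \<in> set fs" for f
  proof -
    have "(f \<longlongrightarrow> f 0) (at_right 0)" using assms[OF that] unfolding isCont_def by (auto intro: filterlim_mono[OF _ order.refl at_le])
    then have "eventually (\<lambda>x. f x < 0) (at_right 0)" using assms[OF that] by (intro order_tendstoD(2)) auto
    then show ?thesis by eventually_elim simp
  qed
  then have "eventually (\<lambda>x. \<forall>f\<in>set fs. f x \<le> 0) (at_right (0::real))" by (intro eventually_ball_finite) auto
  moreover have "eventually (\<lambda>x. x \<in> {0<..<1 / 10}) (at_right (0::real))"
    by (rule eventually_at_right_real) simp
  ultimately have "eventually (\<lambda>x. 0 < x \<and> x \<le> 1 / 10 \<and> (\<forall>f\<in>set fs. f x \<le> 0)) (at_right (0::real))"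
    by eventually_elim auto
  then have "\<exists>x>0. x \<le> 1 / 10 \<and> (\<forall>f\<in>set fs. f x \<le> (0::real))"
    by (rule eventually_happens'[OF trivial_limit_at_right_real, THEN exE]) blast
  then show ?thesis .
qed

lemma ex_large:
  fixes cs :: "(real \<times> real) list"
  assumes "\<And>a b. (a, b) \<in> set cs \<Longrightarrow> b > 0"
  shows "\<exists>\<Gamma>>0. \<forall>(a, b)\<in>set cs. a \<le> \<Gamma> * b"
proof -
  have "eventually (\<lambda>\<Gamma>. a \<le> \<Gamma> * b) at_top" if "(a, b) \<in> set cs" for a b
    using eventually_ge_at_top[of "a / b"] by eventually_elim (use assms[OF that] in \<open>simp add: pos_divide_le_eq\<close>)
  then have "eventually (\<lambda>\<Gamma>. \<forall>ab\<in>set cs. fst ab \<le> \<Gamma> * snd ab) at_top" by (intro eventually_ball_finite) auto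
  then have "eventually (\<lambda>\<Gamma>. \<Gamma> > 0 \<and> (\<forall>ab\<in>set cs. fst ab \<le> \<Gamma> * snd ab)) at_top"
    using eventually_gt_at_top[of 0] by eventually_elim auto
  then have "\<exists>\<Gamma>>0. \<forall>ab\<in>set cs. fst ab \<le> \<Gamma> * snd ab" by (rule eventually_happens'[OF trivial_limit_at_top_linorder, THEN exE]) blast
  then show ?thesis by (simp add: case_prod_beta)
qed

abbreviation gnb :: "'a graph \<Rightarrow> 'a \<Rightarrow> 'a set" where
  "gnb H x \<equiv> {y. {x, y} \<in> edges H}"

lemma graphs_maxdegD:
  assumes "H \<in> graphs_maxdeg n \<Delta>" "1 \<le> n"
  shows "simple_graph H" "card (verts H) = n" "nbgraph (verts H) (gnb H) \<Delta>"
  using assms nbgraph_of(1)[of H \<Delta>] unfolding graphs_maxdeg_def by fastforce+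

lemma graphs_degenD:
  assumes "H \<in> graphs_degen_maxdeg n d \<Delta>" "1 \<le> n" "S \<subseteq> verts H" "S \<noteq> {}"
  shows "\<exists>x\<in>S. card (gnb H x \<inter> S) \<le> d"
proof -
  have H: "simple_graph H" "max_degree H \<le> \<Delta>" "verts H \<noteq> {}" "degeneracy H \<le> d"
    using assms unfolding graphs_degen_maxdeg_def graphs_maxdeg_def by auto
  obtain x where x: "x \<in> S" "degree (induced_subgraph H S) x \<le> degeneracy H"
    using degeneracy_min_degree[OF assms(3,4) H(1)] by blast
  then show ?thesis using nbgraph_of(2)[OF H(1-3) assms(3) x(1)] H(4) by (intro bexI[of _ x]) auto
qed

lemma embeds_max_degree:
  assumes \<Delta>: "1 \<le> \<Delta>" and \<delta>: "0 < \<delta>"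
  shows "embeds \<Delta> \<Delta> (\<lambda>n. nat \<lfloor>(1 + \<delta>) * real n\<rfloor>) (\<lambda>n. graphs_maxdeg n \<Delta>)"
proof -
  define cN where "cN = \<Delta> + \<Delta> * \<Delta> + 1"
  \<comment> \<open>Each of the \<open>cN\<close> colours gets slack about
    \<open>\<delta> * n / (2 * cN)\<close>; half of it is promised, which absorbs the rounding for
    large \<open>n\<close>.\<close>
  define \<rho>1 where "\<rho>1 = min 1 (\<delta> / (4 * real cN))"
  have cN: "0 < real cN" unfolding cN_def by (simp only: of_nat_0_less_iff)
  have \<rho>1: "0 < \<rho>1" "\<rho>1 \<le> 1" unfolding \<rho>1_def using \<delta> cN by auto
  obtain \<epsilon> where \<epsilon>: "0 < \<epsilon>" "\<epsilon> \<le> 1 / 10" "(1 + \<epsilon>) * (1 - \<rho>1 / 2) \<le> (1 - \<epsilon>) * (1 - 3 * \<epsilon>) ^ \<Delta> - \<epsilon>"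
    using ex_small[of "[\<lambda>\<epsilon>. (1 + \<epsilon>) * (1 - \<rho>1 / 2) - ((1 - \<epsilon>) * (1 - 3 * \<epsilon>) ^ \<Delta> - \<epsilon>)]"] \<rho>1 by auto
  obtain C where C: "0 < C" "4 * real \<Delta> \<le> C * (\<epsilon>\<^sup>2 * \<rho>1)" using ex_large[of "[(4 * real \<Delta>, \<epsilon>\<^sup>2 * \<rho>1)]"] \<epsilon> \<rho>1 by auto
  show ?thesis unfolding embeds_def
  proof (rule exI[of _ \<epsilon>], rule exI[of _ C], rule exI[of _ "nat \<lceil>4 * real cN / \<delta>\<rceil> + 1"], intro conjI allI impI)
    fix n p K and R R' :: "nat set set" and H :: "nat graph"
    let ?N = "nat \<lfloor>(1 + \<delta>) * real n\<rfloor>"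
    assume n: "n \<ge> nat \<lceil>4 * real cN / \<delta>\<rceil> + 1" and host: "host ?N (nbr R') p \<epsilon> K \<Delta>" and R: "R' \<subseteq> R"
      and big: "C * (K * ln (real ?N)) \<le> ((1 - 3 * \<epsilon>) * p) ^ \<Delta> * real n" and H: "H \<in> graphs_maxdeg n \<Delta>"
    have n1: "1 \<le> n" "4 * real cN / \<delta> \<le> real n" using n by linarith+
    note HD = graphs_maxdegD[OF H n1(1)]
    interpret G: nbgraph "verts H" "gnb H" \<Delta> by (rule HD(3))
    obtain xs where xs: "distinct xs" "set xs = verts H" using finite_distinct_list[OF G.fin_V] by blast
    have len: "length xs = n" using distinct_card[OF xs(1)] xs(2) HD(2) by simp
    have emb: "embedding ?N (nbr R') p \<epsilon> K \<Delta> (length xs) (G.rel xs)" by (rule G.embedding_rel[OF xs host \<Delta>])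
    interpret E: embedding ?N "nbr R'" p \<epsilon> K \<Delta> "length xs" "G.rel xs" by (rule emb)
    obtain \<chi> :: "nat \<Rightarrow> nat" where \<chi>: "\<forall>x<length xs. \<chi> x < cN"
      "\<forall>x<length xs. \<forall>y<length xs. \<chi> x = \<chi> y \<longrightarrow> y \<notin> G.rel xs x \<and> (x \<noteq> y \<longrightarrow> G.rel xs x \<inter> G.rel xs y = {})"
      using G.rel_colouring[OF xs] unfolding cN_def by blast
    define slk where "slk = nat \<lfloor>\<delta> * real n / (2 * real cN)\<rfloor>"
    have "\<exists>g. E.partial g {..<length xs}"
    proof (rule E.almost_spanning_max_degree[of \<chi> cN slk \<rho>1 C])
      show "length xs + cN * slk \<le> ?N"
      proof -
        have "real slk \<le> \<delta> * real n / (2 * real cN)" unfolding slk_def using \<delta> cN by simp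
        then have "real cN * real slk \<le> \<delta> * real n / 2" using cN by (simp add: field_simps)
        moreover have "0 \<le> \<delta> * real n" using \<delta> by simp
        ultimately have "real (n + cN * slk) \<le> (1 + \<delta>) * real n" by (simp add: distrib_right)
        then show ?thesis unfolding len by (simp add: le_nat_floor)
      qed
      show "\<rho>1 * real (length xs) \<le> real slk"
      proof -
        have "\<rho>1 * real n \<le> \<delta> / (4 * real cN) * real n" unfolding \<rho>1_def by (intro mult_right_mono) auto
        also have "\<dots> \<le> \<delta> * real n / (2 * real cN) - 1" using n1(2) \<delta> cN by (simp add: field_simps)
        also have "\<dots> \<le> real slk" unfolding slk_def by linarith
        finally show ?thesis unfolding len .
      qed
      show "C * (K * E.L) \<le> E.q ^ \<Delta> * real (length xs)" using big unfolding E.L_def E.q_def len .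
    qed (use \<chi> \<rho>1 \<epsilon> C in auto)
    then show "contains_copy ({..<?N}, R) H" using copy_of_partial[OF HD(1) xs R emb HD(3)] by blast
  qed (use \<epsilon> C in auto)
qed

lemma embeds_degenerate:
  assumes \<Delta>: "1 \<le> \<Delta>" and \<delta>: "0 < \<delta>" and d: "1 \<le> d"
  shows "embeds \<Delta> (2 * d) (\<lambda>n. nat \<lfloor>(1 + \<delta>) * real n\<rfloor>) (\<lambda>n. graphs_degen_maxdeg n d \<Delta>)"
proof -
  define cN where "cN = \<Delta> + \<Delta> * \<Delta> + 1"
  \<comment> \<open>This choice gives
    \<open>(1 - \<sigma>) * (1 + \<delta>) = 1 + \<delta> / 2\<close>; the surplus
    \<open>\<delta> / 2\<close> absorbs the rounding of the host size.\<close>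
  define \<sigma> where "\<sigma> = \<delta> / (2 * (1 + \<delta>))"
  define \<xi> where "\<xi> = \<sigma> / 32"
  define \<eta> where "\<eta> = \<sigma>\<^sup>2 / 256"
  define \<epsilon>' where "\<epsilon>' = \<xi> * \<eta> * \<sigma> / (48 * (real cN * (real d + 1)))"
  have cN: "0 < real cN" unfolding cN_def by (simp only: of_nat_0_less_iff)
  have \<sigma>: "0 < \<sigma>" "\<sigma> \<le> 1" unfolding \<sigma>_def using \<delta> by (auto simp: field_simps)
  have pos: "0 < \<xi>" "0 < \<eta>" "0 < \<epsilon>'" unfolding \<xi>_def \<eta>_def \<epsilon>'_def using \<sigma> cN by (auto intro!: mult_pos_pos divide_pos_pos)
  obtain \<epsilon> where \<epsilon>: "0 < \<epsilon>" "\<epsilon> \<le> 1 / 10" "1 + \<epsilon> \<le> (1 + \<sigma> / 64) * ((1 - \<epsilon>) * (1 - 3 * \<epsilon>) ^ d)"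
    using ex_small[of "[\<lambda>\<epsilon>. 1 + \<epsilon> - (1 + \<sigma> / 64) * ((1 - \<epsilon>) * (1 - 3 * \<epsilon>) ^ d)]"] \<sigma> by auto
  have "\<exists>C>0. \<forall>(a, b)\<in>set [(8 * real \<Delta>, \<epsilon>\<^sup>2 * \<sigma>), (24, \<sigma> * \<xi> * \<epsilon>'),
      (24 * (real cN * (real d + 1)), \<sigma> * \<xi> * \<eta>), (2 * real d + 3, \<xi> * \<epsilon>')]. a \<le> C * b"
    by (rule ex_large) (use \<epsilon> \<sigma> pos in auto)
  then obtain C where C: "0 < C" "8 * real \<Delta> \<le> C * (\<epsilon>\<^sup>2 * \<sigma>)" "24 \<le> C * (\<sigma> * \<xi> * \<epsilon>')"
    "24 * (real cN * (real d + 1)) \<le> C * (\<sigma> * \<xi> * \<eta>)" "2 * real d + 3 \<le> C * (\<xi> * \<epsilon>')" by auto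
  show ?thesis unfolding embeds_def
  proof (rule exI[of _ \<epsilon>], rule exI[of _ C], rule exI[of _ "nat \<lceil>2 / \<delta>\<rceil> + 1"], intro conjI allI impI)
    fix n p K and R R' :: "nat set set" and H :: "nat graph"
    let ?N = "nat \<lfloor>(1 + \<delta>) * real n\<rfloor>"
    assume n: "n \<ge> nat \<lceil>2 / \<delta>\<rceil> + 1" and host: "host ?N (nbr R') p \<epsilon> K \<Delta>" and R: "R' \<subseteq> R"
      and big: "C * (K * ln (real ?N)) \<le> ((1 - 3 * \<epsilon>) * p) ^ (2 * d) * real n" and H: "H \<in> graphs_degen_maxdeg n d \<Delta>"
    have n1: "1 \<le> n" "2 / \<delta> \<le> real n" using n by linarith+
    have "H \<in> graphs_maxdeg n \<Delta>" using H unfolding graphs_degen_maxdeg_def by simp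
    note HD = graphs_maxdegD[OF this n1(1)]
    interpret G: nbgraph "verts H" "gnb H" \<Delta> by (rule HD(3))
    obtain xs where xs: "distinct xs" "set xs = verts H"
      and ord: "\<forall>i<length xs. card (gnb H (xs ! i) \<inter> set (take i xs)) \<le> d"
      using G.degenerate_order[OF graphs_degenD[OF H n1(1)] order.refl] by blast
    have len: "length xs = n" using distinct_card[OF xs(1)] xs(2) HD(2) by simp
    have emb: "embedding ?N (nbr R') p \<epsilon> K \<Delta> (length xs) (G.rel xs)" by (rule G.embedding_rel[OF xs host \<Delta>])
    interpret E: embedding ?N "nbr R'" p \<epsilon> K \<Delta> "length xs" "G.rel xs" by (rule emb)
    obtain \<chi> :: "nat \<Rightarrow> nat" where \<chi>: "\<forall>x<length xs. \<chi> x < cN"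
      "\<forall>x<length xs. \<forall>y<length xs. \<chi> x = \<chi> y \<longrightarrow> y \<notin> G.rel xs x \<and> (x \<noteq> y \<longrightarrow> G.rel xs x \<inter> G.rel xs y = {})"
      using G.rel_colouring[OF xs] unfolding cN_def by blast
    have "\<exists>g. E.partial g {..<length xs}"
    proof (rule E.almost_spanning_degenerate[of d \<chi> cN \<sigma> C \<xi> \<eta> \<epsilon>'])
      show "card (G.rel xs x \<inter> {..<x}) \<le> d" if "x < length xs" for x
        using G.back_card[OF xs that] ord that by simp
      show "real (length xs) \<le> (1 - \<sigma>) * real ?N"
      proof -
        have "(1 + \<delta>) * real n - 1 \<le> real ?N" by linarith
        then have "(1 - \<sigma>) * ((1 + \<delta>) * real n - 1) \<le> (1 - \<sigma>) * real ?N" using \<sigma> by (intro mult_left_mono) auto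
        moreover have "\<sigma> * ((1 + \<delta>) * real n) = \<delta> * real n / 2" unfolding \<sigma>_def using \<delta> by (simp add: field_simps)
        moreover have "2 \<le> \<delta> * real n" using n1(2) \<delta> by (simp add: field_simps)
        ultimately show ?thesis unfolding len using \<sigma> by (simp add: algebra_simps)
      qed
      show "C * (K * E.L) \<le> E.q ^ (2 * d) * real (length xs)" using big unfolding E.L_def E.q_def len .
    qed (use \<chi> \<epsilon> C \<sigma> d cN in \<open>auto simp: \<xi>_def \<eta>_def \<epsilon>'_def\<close>)
    then show "contains_copy ({..<?N}, R) H" using copy_of_partial[OF HD(1) xs R emb HD(3)] by blast
  qed (use \<epsilon> C in auto)
qed

text \<open>The lists \<open>ys\<close>, \<open>zs\<close> and \<open>ws\<close> hold the greedy
  vertices, the Hall vertices and the buffer, so that for each spanning class only such an order has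
  to be exhibited.\<close>

lemma embeds_spanning:
  assumes \<Delta>: "1 \<le> \<Delta>" and e: "2 * D + 1 \<le> e" "D + 2 \<le> e \<or> \<Delta> = 1" and \<rho>0: "0 < \<rho>0" "\<rho>0 \<le> 1"
    and cls: "\<And>n H. 1 \<le> n \<Longrightarrow> H \<in> cls n \<Longrightarrow> H \<in> graphs_maxdeg n \<Delta> \<and> triangle_free H"
    and ord: "\<And>n H. 1 \<le> n \<Longrightarrow> H \<in> cls n \<Longrightarrow> \<exists>ys zs ws k. distinct (ys @ zs @ ws) \<and> set (ys @ zs @ ws) = verts H \<and>
      (zs = [] \<or> \<Delta> \<le> e) \<and> k \<le> e \<and> \<rho>0 * real n \<le> real (length ws) \<and>
      (\<forall>x\<in>set ws. card (gnb H x) = k \<and> gnb H x \<subseteq> set ys) \<and>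
      (\<forall>x\<in>set ws. \<forall>y\<in>set ws. x \<noteq> y \<longrightarrow> nbgraph.zone (gnb H) x \<inter> nbgraph.zone (gnb H) y = {}) \<and>
      (\<forall>i<length ys. card (gnb H (ys ! i) \<inter> set (take i ys)) \<le> D)"
  shows "embeds \<Delta> e (\<lambda>n. n) cls"
proof -
  define cN where "cN = \<Delta> + \<Delta> * \<Delta> + 1"
  define \<sigma> where "\<sigma> = \<rho>0 / 16"
  define \<xi> where "\<xi> = \<sigma> / 32"
  define \<eta> where "\<eta> = \<sigma>\<^sup>2 / 256"
  define \<epsilon>' where "\<epsilon>' = \<xi> * \<eta> * \<sigma> / (48 * (real cN * (real D + 1)))"
  have cN: "0 < real cN" "1 \<le> cN" unfolding cN_def by (simp_all only: of_nat_0_less_iff, simp?)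
  have \<sigma>: "0 < \<sigma>" unfolding \<sigma>_def using \<rho>0 by simp
  have pos: "0 < \<xi>" "0 < \<eta>" "0 < \<epsilon>'" unfolding \<xi>_def \<eta>_def \<epsilon>'_def using \<sigma> cN by (auto intro!: mult_pos_pos divide_pos_pos)
  have "\<exists>\<epsilon>>0. \<epsilon> \<le> 1 / 10 \<and> (\<forall>f\<in>set [\<lambda>\<epsilon>. 1 + \<epsilon> - (1 + \<sigma> / 64) * ((1 - \<epsilon>) * (1 - 3 * \<epsilon>) ^ D),
      \<lambda>\<epsilon>. (1 + 3 * \<epsilon>) ^ D - 2 * (1 - 3 * \<epsilon>) ^ D, \<lambda>\<epsilon>. 1 / 2 - (1 - \<epsilon>) ^ \<Delta>\<^sup>2, \<lambda>\<epsilon>. 1 / 2 - (1 - 3 * \<epsilon>) ^ \<Delta>,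
      \<lambda>\<epsilon>. (1 + \<epsilon>) * (1 - \<rho>0 / (8 * real cN) / 2) - ((1 - \<epsilon>) * (1 - 3 * \<epsilon>) ^ \<Delta> - \<epsilon>)]. f \<epsilon> \<le> (0::real))"
    by (rule ex_small) (use \<sigma> \<rho>0 cN in auto)
  then obtain \<epsilon> where \<epsilon>: "0 < \<epsilon>" "\<epsilon> \<le> 1 / 10"
    and eps: "1 + \<epsilon> \<le> (1 + \<sigma> / 64) * ((1 - \<epsilon>) * (1 - 3 * \<epsilon>) ^ D)" "(1 + 3 * \<epsilon>) ^ D \<le> 2 * (1 - 3 * \<epsilon>) ^ D"
      "1 / 2 \<le> (1 - \<epsilon>) ^ \<Delta>\<^sup>2" "1 / 2 \<le> (1 - 3 * \<epsilon>) ^ \<Delta>"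
      "(1 + \<epsilon>) * (1 - \<rho>0 / (8 * real cN) / 2) \<le> (1 - \<epsilon>) * (1 - 3 * \<epsilon>) ^ \<Delta> - \<epsilon>" by auto
  have "\<exists>\<Gamma>>0. \<forall>(a, b)\<in>set [(8 * real \<Delta>, \<epsilon>\<^sup>2 * \<sigma>), (24, \<sigma> * \<xi> * \<epsilon>'), (24 * (real cN * (real D + 1)), \<sigma> * \<xi> * \<eta>),
      (2 * real (D + 1) + 3, \<xi> * \<epsilon>'), (80, \<epsilon>\<^sup>2 * (\<sigma> / 8) ^ \<Delta>), (4 * real \<Delta> * real cN, \<epsilon>\<^sup>2),
      (8 * real \<Delta>, exp (- 48 / \<rho>0) * \<sigma> * \<epsilon>)]. a \<le> \<Gamma> * b"
    by (rule ex_large) (use \<epsilon> \<sigma> pos in auto)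
  then obtain \<Gamma> where \<Gamma>: "0 < \<Gamma>" "8 * real \<Delta> \<le> \<Gamma> * (\<epsilon>\<^sup>2 * \<sigma>)" "24 \<le> \<Gamma> * (\<sigma> * \<xi> * \<epsilon>')"
    "24 * (real cN * (real D + 1)) \<le> \<Gamma> * (\<sigma> * \<xi> * \<eta>)" "2 * real (D + 1) + 3 \<le> \<Gamma> * (\<xi> * \<epsilon>')"
    "80 \<le> \<Gamma> * (\<epsilon>\<^sup>2 * (\<sigma> / 8) ^ \<Delta>)" "4 * real \<Delta> * real cN \<le> \<Gamma> * \<epsilon>\<^sup>2" "8 * real \<Delta> \<le> \<Gamma> * (exp (- 48 / \<rho>0) * \<sigma> * \<epsilon>)"
    by auto
  show ?thesis unfolding embeds_def
  proof (rule exI[of _ \<epsilon>], rule exI[of _ "8 * \<Gamma> / \<rho>0"], rule exI[of _ 1], intro conjI allI impI)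
    fix n p K and R R' :: "nat set set" and H :: "nat graph"
    assume n: "n \<ge> 1" and host: "host n (nbr R') p \<epsilon> K \<Delta>" and R: "R' \<subseteq> R"
      and big: "8 * \<Gamma> / \<rho>0 * (K * ln (real n)) \<le> ((1 - 3 * \<epsilon>) * p) ^ e * real n" and H: "H \<in> cls n"
    have Hc: "H \<in> graphs_maxdeg n \<Delta>" "triangle_free H" using cls[OF n H] by auto
    note HD = graphs_maxdegD[OF Hc(1) n]
    interpret G: nbgraph "verts H" "gnb H" \<Delta> by (rule HD(3))
    obtain ys zs ws k where w: "distinct (ys @ zs @ ws)" "set (ys @ zs @ ws) = verts H" "zs = [] \<or> \<Delta> \<le> e" "k \<le> e"
        "\<rho>0 * real n \<le> real (length ws)" "\<And>x. x \<in> set ws \<Longrightarrow> card (gnb H x) = k \<and> gnb H x \<subseteq> set ys"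
        "\<And>x y. x \<in> set ws \<Longrightarrow> y \<in> set ws \<Longrightarrow> x \<noteq> y \<Longrightarrow> G.zone x \<inter> G.zone y = {}"
        "\<And>i. i < length ys \<Longrightarrow> card (gnb H (ys ! i) \<inter> set (take i ys)) \<le> D"
      using ord[OF n H] by (elim exE conjE) (rule that, (assumption | blast)+)
    define xs where "xs = ys @ zs @ ws"
    have xs: "distinct xs" "set xs = verts H" using w unfolding xs_def by auto
    have len: "length xs = n" using distinct_card[OF xs(1)] xs(2) HD(2) by simp
    have emb: "embedding n (nbr R') p \<epsilon> K \<Delta> (length xs) (G.rel xs)" by (rule G.embedding_rel[OF xs host \<Delta>])
    interpret E: embedding n "nbr R'" p \<epsilon> K \<Delta> "length xs" "G.rel xs" by (rule emb)
    obtain \<chi> :: "nat \<Rightarrow> nat" where \<chi>: "\<forall>x<length xs. \<chi> x < cN"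
      "\<forall>x<length xs. \<forall>y<length xs. \<chi> x = \<chi> y \<longrightarrow> y \<notin> G.rel xs x \<and> (x \<noteq> y \<longrightarrow> G.rel xs x \<inter> G.rel xs y = {})"
      using G.rel_colouring[OF xs] unfolding cN_def by blast
    have len': "length xs - length ws = length ys + length zs" unfolding xs_def by simp
    have ws: "xs ! x \<in> set ws" if "length xs - length ws \<le> x" "x < length xs" for x
      using that unfolding len' unfolding xs_def by (auto simp: nth_append)
    have "\<exists>g. E.partial g {..<length xs}"
    proof (rule E.spanning[of "length ys" "length ws" k D \<chi> cN e \<rho>0 \<sigma> \<Gamma> \<xi> \<eta> \<epsilon>'])
      fix x assume x: "length xs - length ws \<le> x" "x < length xs"
      note wx = w(6)[OF ws[OF x]]
      show "G.rel xs x \<subseteq> {..<length ys}"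
      proof
        fix j assume "j \<in> G.rel xs x"
        then have j: "j < length xs" "xs ! j \<in> set ys" using wx unfolding G.rel_def by auto
        show "j \<in> {..<length ys}"
        proof (rule ccontr)
          assume "j \<notin> {..<length ys}"
          then have "xs ! j \<in> set (zs @ ws)" using j(1) unfolding xs_def by (auto simp: nth_append)
          then show False using j(2) w(1) by auto
        qed
      qed
      show "card (G.rel xs x) = k" using G.card_rel[OF xs x(2)] wx by simp
      show "z' \<notin> G.rel xs z" if "z \<in> G.rel xs x" "z' \<in> G.rel xs x" for z z'
      proof
        assume "z' \<in> G.rel xs z"
        then have "{xs ! x, xs ! z} \<in> edges H" "{xs ! z, xs ! z'} \<in> edges H" "{xs ! x, xs ! z'} \<in> edges H"
          using that unfolding G.rel_def by auto
        then show False using Hc(2) unfolding triangle_free_def by blast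
      qed
      fix y assume y: "length xs - length ws \<le> y" "y < length xs" "x \<noteq> y"
      have "xs ! x \<noteq> xs ! y" using xs(1) x y by (simp add: nth_eq_iff_index_eq)
      then have "G.zone (xs ! x) \<inter> G.zone (xs ! y) = {}" using w(7) ws x y by blast
      then show "(G.rel xs x \<union> \<Union> (G.rel xs ` G.rel xs x)) \<inter> (G.rel xs y \<union> \<Union> (G.rel xs ` G.rel xs y)) = {}"
        using G.zone_rel[OF xs x(2)] G.zone_rel[OF xs y(2)] by blast
    next
      show "card (G.rel xs x \<inter> {..<x}) \<le> D" if "x < length ys" for x
      proof -
        have "x < length xs" "xs ! x = ys ! x" "take x xs = take x ys" using that unfolding xs_def by (auto simp: nth_append)
        then show ?thesis using G.back_card[OF xs, of x] w(8)[OF that] by simp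
      qed
      show "length ys + length ws = length xs \<or> \<Delta> \<le> e" using w(3) unfolding xs_def by auto
      show "8 * \<Gamma> * (K * E.L) \<le> \<rho>0 * (E.q ^ e * real (length xs))"
        using big \<rho>0 unfolding E.L_def E.q_def len by (simp add: field_simps)
      show "length ys + length ws \<le> length xs" unfolding xs_def by simp
      show "\<rho>0 * real (length xs) \<le> real (length ws)" using w(5) unfolding len .
    qed (use \<chi> e w(4) \<Gamma> eps \<rho>0 cN len in \<open>auto simp: \<xi>_def \<eta>_def \<epsilon>'_def \<sigma>_def\<close>)
    then show "contains_copy ({..<n}, R) H" using copy_of_partial[OF HD(1) xs R emb HD(3)] by blast
  qed (use \<epsilon> \<Gamma> \<rho>0 in auto)
qed

text \<open>Only the neighbours of the buffer are embedded greedily. They are pairwise nonadjacent,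
  since \<open>H\<close> is triangle-free and the zones are disjoint, so the back-degree is 0 and
  the Hall steps determine the exponent \<open>\<Delta>\<close>.\<close>

lemma tf_max_degree_order:
  assumes H: "H \<in> graphs_maxdeg n \<Delta>" "triangle_free H" and n: "1 \<le> n"
    and Z_def: "Z = ((\<Delta> + \<Delta> * \<Delta>) * (\<Delta> + \<Delta> * \<Delta>) + 1) * (\<Delta> + 1)"
  shows "\<exists>ys zs ws k. distinct (ys @ zs @ ws) \<and> set (ys @ zs @ ws) = verts H \<and>
      (zs = [] \<or> \<Delta> \<le> \<Delta>) \<and> k \<le> \<Delta> \<and>
      1 / real Z * real n \<le> real (length ws) \<and>
      (\<forall>x\<in>set ws. card (gnb H x) = k \<and> gnb H x \<subseteq> set ys) \<and>
      (\<forall>x\<in>set ws. \<forall>y\<in>set ws. x \<noteq> y \<longrightarrow> nbgraph.zone (gnb H) x \<inter> nbgraph.zone (gnb H) y = {}) \<and>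
      (\<forall>i<length ys. card (gnb H (ys ! i) \<inter> set (take i ys)) \<le> 0)"
proof -
  note HD = graphs_maxdegD[OF H(1) n]
  interpret G: nbgraph "verts H" "gnb H" \<Delta> by (rule HD(3))
  have Z: "0 < real Z" unfolding Z_def by (simp only: of_nat_0_less_iff, simp)
  obtain B k where B: "B \<subseteq> verts H" "\<forall>x\<in>B. card (gnb H x) = k"
    "\<forall>x\<in>B. \<forall>y\<in>B. x \<noteq> y \<longrightarrow> G.zone x \<inter> G.zone y = {}" "n \<le> card B * Z"
    using G.buffers[OF order.refl] unfolding HD(2) Z_def by blast
  have tf: "z \<notin> gnb H y" if "y \<in> gnb H x" "z \<in> gnb H x" for x y z
    using H(2) that unfolding triangle_free_def by blast
  define A where "A = \<Union>(gnb H ` B)"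
  have A: "A \<subseteq> verts H" "A \<inter> B = {}" "\<And>z. z \<in> A \<Longrightarrow> gnb H z \<inter> A = {}"
  proof -
    show "A \<subseteq> verts H" unfolding A_def using G.gn_sub B(1) by blast
    have far: "\<And>x y. x \<in> B \<Longrightarrow> y \<in> B \<Longrightarrow> x \<noteq> y \<Longrightarrow> G.zone x \<inter> G.zone y = {}" using B(3) by blast
    show "A \<inter> B = {}" unfolding A_def using G.buffer_nbrs(1)[OF B(1) far] by blast
    show "gnb H z \<inter> A = {}" if "z \<in> A" for z
      unfolding A_def by (rule G.buffer_nbrs(2)[OF B(1) far tf that[unfolded A_def]])
  qed
  have fin: "finite A" "finite B" "finite (verts H - A - B)" using A(1) B(1) G.fin_V finite_subset by auto
  obtain ys where ys: "distinct ys" "set ys = A" using finite_distinct_list[OF fin(1)] by blast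
  obtain zs where zs: "distinct zs" "set zs = verts H - A - B" using finite_distinct_list[OF fin(3)] by blast
  obtain ws where ws: "distinct ws" "set ws = B" using finite_distinct_list[OF fin(2)] by blast
  note w = ys zs ws
  have k: "k \<le> \<Delta>"
  proof -
    have "B \<noteq> {}" using B(4) n by auto
    then obtain x where "x \<in> B" by blast
    then show ?thesis using B(1,2) G.gn_deg[of x] by auto
  qed
  have size: "1 / real Z * real n \<le> real (length ws)"
  proof -
    have "length ws = card B" using distinct_card[OF w(5)] w(6) by simp
    moreover have "real n \<le> real (card B) * real Z" using B(4) by (simp flip: of_nat_mult)
    ultimately show ?thesis using Z by (simp add: pos_divide_le_eq)
  qed
  have bk: "\<forall>i<length ys. card (gnb H (ys ! i) \<inter> set (take i ys)) = 0"
  proof (intro allI impI)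
    fix i assume i: "i < length ys"
    have "gnb H (ys ! i) \<inter> set (take i ys) = {}" using A(3)[of "ys ! i"] w(2) nth_mem[OF i] set_take_subset[of i ys] by blast
    then show "card (gnb H (ys ! i) \<inter> set (take i ys)) = 0" by (simp only: card.empty)
  qed
  have dist: "distinct (ys @ zs @ ws)" "set (ys @ zs @ ws) = verts H" using w A(1,2) B(1) by auto
  have sub: "gnb H x \<subseteq> set ys" if "x \<in> B" for x using that unfolding ys(2) A_def by blast
  have props: "\<forall>x\<in>set ws. card (gnb H x) = k \<and> gnb H x \<subseteq> set ys"
    "\<forall>x\<in>set ws. \<forall>y\<in>set ws. x \<noteq> y \<longrightarrow> G.zone x \<inter> G.zone y = {}"
    using B(2,3) sub unfolding ws(2) by blast+
  show ?thesis
    by (rule exI[of _ ys], rule exI[of _ zs], rule exI[of _ ws], rule exI[of _ k], intro conjI)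
      (use dist k size bk props in \<open>simp_all only: order.refl le_zero_eq simp_thms\<close>)
qed

text \<open>The buffer is chosen among the vertices of degree at most \<open>2 * d\<close>. All
  others follow a degenerate order, so there are no Hall vertices and \<open>\<Delta>\<close> stays
  out of the exponent.\<close>

lemma tf_degenerate_order:
  assumes H: "H \<in> graphs_degen_maxdeg n d \<Delta>" and n: "1 \<le> n"
    and Z_def: "Z = ((\<Delta> + \<Delta> * \<Delta>) * (\<Delta> + \<Delta> * \<Delta>) + 1) * (\<Delta> + 1)"
  shows "\<exists>ys zs ws k. distinct (ys @ zs @ ws) \<and> set (ys @ zs @ ws) = verts H \<and>
      (zs = [] \<or> \<Delta> \<le> 2 * d + 1) \<and> k \<le> 2 * d + 1 \<and>
      1 / real ((2 * d + 1) * Z) * real n \<le> real (length ws) \<and>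
      (\<forall>x\<in>set ws. card (gnb H x) = k \<and> gnb H x \<subseteq> set ys) \<and>
      (\<forall>x\<in>set ws. \<forall>y\<in>set ws. x \<noteq> y \<longrightarrow> nbgraph.zone (gnb H) x \<inter> nbgraph.zone (gnb H) y = {}) \<and>
      (\<forall>i<length ys. card (gnb H (ys ! i) \<inter> set (take i ys)) \<le> d)"
proof -
  have "H \<in> graphs_maxdeg n \<Delta>" using H unfolding graphs_degen_maxdeg_def by simp
  note HD = graphs_maxdegD[OF this n]
  interpret G: nbgraph "verts H" "gnb H" \<Delta> by (rule HD(3))
  have Z: "0 < real ((2 * d + 1) * Z)" unfolding Z_def by (simp only: of_nat_0_less_iff, simp)
  define W where "W = {x\<in>verts H. card (gnb H x) \<le> 2 * d}"
  have W: "W \<subseteq> verts H" unfolding W_def by auto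
  obtain B k where B: "B \<subseteq> W" "\<forall>x\<in>B. card (gnb H x) = k"
    "\<forall>x\<in>B. \<forall>y\<in>B. x \<noteq> y \<longrightarrow> G.zone x \<inter> G.zone y = {}" "card W \<le> card B * Z"
    using G.buffers[OF W] unfolding Z_def by blast
  have BV: "B \<subseteq> verts H" using B(1) W by blast
  have "n \<le> (2 * d + 1) * card W"
    using G.many_low_degree[OF graphs_degenD[OF H n]] unfolding HD(2) W_def by blast
  also have "\<dots> \<le> (2 * d + 1) * (card B * Z)" by (rule mult_left_mono[OF B(4)]) simp
  finally have nB: "n \<le> card B * ((2 * d + 1) * Z)" by (simp only: mult_ac)
  have "verts H - B \<subseteq> verts H" by blast
  then obtain ys where ys: "distinct ys" "set ys = verts H - B" "\<forall>i<length ys. card (gnb H (ys ! i) \<inter> set (take i ys)) \<le> d"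
    using G.degenerate_order[OF graphs_degenD[OF H n]] by blast
  obtain ws where ws: "distinct ws" "set ws = B" using finite_distinct_list[OF finite_subset[OF BV G.fin_V]] by blast
  have k: "k \<le> 2 * d + 1"
  proof -
    have "B \<noteq> {}" using nB n by auto
    then show ?thesis using B(1,2) unfolding W_def by fastforce
  qed
  have size: "1 / real ((2 * d + 1) * Z) * real n \<le> real (length ws)"
  proof -
    have "length ws = card B" using distinct_card[OF ws(1)] ws(2) by simp
    moreover have "real n \<le> real (card B) * real ((2 * d + 1) * Z)" using nB by (simp only: of_nat_mult[symmetric] of_nat_le_iff)
    ultimately show ?thesis using Z by (simp only: pos_divide_le_eq times_divide_eq_left mult_1)
  qed
  have sub: "gnb H x \<subseteq> set ys" if "x \<in> B" for x
    using G.buffer_nbrs(1)[OF BV _ that] B(3) G.gn_sub[of x] BV that unfolding ys(2) by blast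
  have dist: "distinct (ys @ [] @ ws)" "set (ys @ [] @ ws) = verts H" using ys ws BV by auto
  have props: "\<forall>x\<in>set ws. card (gnb H x) = k \<and> gnb H x \<subseteq> set ys"
    "\<forall>x\<in>set ws. \<forall>y\<in>set ws. x \<noteq> y \<longrightarrow> G.zone x \<inter> G.zone y = {}"
    using B(2,3) sub unfolding ws(2) by blast+
  show ?thesis
    by (rule exI[of _ ys], rule exI[of _ "[]"], rule exI[of _ ws], rule exI[of _ k], intro conjI)
      (use dist k size ys(3) props in \<open>simp_all only: simp_thms\<close>)
qed

lemma embeds_tf_max_degree:
  assumes "1 \<le> \<Delta>"
  shows "embeds \<Delta> \<Delta> (\<lambda>n. n) (\<lambda>n. tf_graphs_maxdeg n \<Delta>)"
proof -
  define Z where "Z = ((\<Delta> + \<Delta> * \<Delta>) * (\<Delta> + \<Delta> * \<Delta>) + 1) * (\<Delta> + 1)"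
  have "1 \<le> Z" unfolding Z_def by simp
  then have Z: "0 < 1 / real Z" "1 / real Z \<le> 1" by auto
  have cls: "H \<in> graphs_maxdeg n \<Delta> \<and> triangle_free H" if "H \<in> tf_graphs_maxdeg n \<Delta>" for n H
    using that unfolding tf_graphs_maxdeg_def by simp
  have e: "2 * 0 + 1 \<le> \<Delta>" "0 + 2 \<le> \<Delta> \<or> \<Delta> = 1" using assms by linarith+
  show ?thesis
    by (rule embeds_spanning[OF assms e Z cls tf_max_degree_order[OF _ _ _ Z_def]]) (use cls in blast)+
qed

lemma embeds_tf_degenerate:
  assumes "1 \<le> \<Delta>" "1 \<le> d"
  shows "embeds \<Delta> (2 * d + 1) (\<lambda>n. n) (\<lambda>n. tf_graphs_degen_maxdeg n d \<Delta>)"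
proof -
  define Z where "Z = ((\<Delta> + \<Delta> * \<Delta>) * (\<Delta> + \<Delta> * \<Delta>) + 1) * (\<Delta> + 1)"
  have "1 \<le> (2 * d + 1) * Z" unfolding Z_def by simp
  then have Z: "0 < 1 / real ((2 * d + 1) * Z)" "1 / real ((2 * d + 1) * Z) \<le> 1"
    by (simp_all del: of_nat_mult)
  have cls: "H \<in> graphs_degen_maxdeg n d \<Delta>" "H \<in> graphs_maxdeg n \<Delta> \<and> triangle_free H"
    if "H \<in> tf_graphs_degen_maxdeg n d \<Delta>" for n H
    using that unfolding tf_graphs_degen_maxdeg_def graphs_degen_maxdeg_def by simp_all
  have e: "2 * d + 1 \<le> 2 * d + 1" "d + 2 \<le> 2 * d + 1 \<or> \<Delta> = 1" using assms by linarith+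
  show ?thesis
    by (rule embeds_spanning[OF assms(1) e Z cls(2) tf_degenerate_order[OF _ _ Z_def]]) (use cls(1) in blast)+
qed

section \<open>From deterministic embeddings to the bias\<close>

lemma maker_wins_of_embeds:
  assumes emb: "embeds \<Delta> e NN cls" and e: "1 \<le> e"
    and NN: "\<forall>\<^sub>F n in sequentially. 3 \<le> NN n \<and> real (NN n) \<le> real n ^ 2"
  shows "\<exists>c>0. \<forall>\<^sub>F n in sequentially. \<forall>b. real b \<le> c * (real n / log 2 (real n)) powr (1 / real e) \<longrightarrow>
    maker_wins_universality (NN n) b (cls n)"
proof -
  obtain \<epsilon> \<Gamma> n0 where \<epsilon>: "0 < \<epsilon>" "\<epsilon> \<le> 1 / 10" and \<Gamma>: "0 < \<Gamma>"
    and copy: "\<And>n p K R R' H. n \<ge> n0 \<Longrightarrow> host (NN n) (nbr R') p \<epsilon> K \<Delta> \<Longrightarrow> R' \<subseteq> R \<Longrightarrow>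
        \<Gamma> * (K * ln (real (NN n))) \<le> ((1 - 3 * \<epsilon>) * p) ^ e * real n \<Longrightarrow> H \<in> cls n \<Longrightarrow> contains_copy ({..<NN n}, R) H"
    using emb unfolding embeds_def by metis
  define K where "K = 54 * (real \<Delta> + 1) / \<epsilon>"
  \<comment> \<open>The 64 comes from \<open>\<tau> \<le> 32 * \<beta> / \<epsilon>\<close> and
    \<open>1 - 3 * \<epsilon> \<ge> 1 / 2\<close>, the factor 2 from
    \<open>ln (NN n) \<le> 2 * ln n\<close>. Adding 1 makes the divisor at least 1, so that its
    \<open>e\<close>-th power dominates it.\<close>
  define c where "c = \<epsilon> / 64 / (2 * (\<Gamma> * K) + 1)"
  have K: "0 < K" unfolding K_def using \<epsilon> by simp
  have \<Gamma>K: "0 < \<Gamma> * K" using K \<Gamma> by simp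
  have c: "0 < c" unfolding c_def using \<epsilon> \<Gamma>K by simp
  have c_pow: "2 * (\<Gamma> * K) * c ^ e \<le> (\<epsilon> / 64) ^ e"
  proof -
    let ?x = "2 * (\<Gamma> * K) + 1"
    have "?x ^ 1 \<le> ?x ^ e" by (rule power_increasing[OF e]) (use \<Gamma>K in simp)
    then have "2 * (\<Gamma> * K) * (\<epsilon> / 64) ^ e \<le> (\<epsilon> / 64) ^ e * ?x ^ e" using \<epsilon> by (simp add: mult.commute[of "(\<epsilon> / 64) ^ e"] mult_right_mono)
    moreover have "0 < ?x ^ e" using \<Gamma>K by (intro zero_less_power) simp
    ultimately show ?thesis unfolding c_def power_divide[of "\<epsilon> / 64" ?x] by (simp add: pos_divide_le_eq)
  qed
  have X: "\<forall>\<^sub>F n in sequentially. (1 / c) ^ e \<le> real n / log 2 (real n)"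
  proof -
    have "((\<lambda>n. ln (real n) / real n) \<longlongrightarrow> 0) sequentially"
      by (rule filterlim_compose[OF ln_x_over_x_tendsto_0 filterlim_real_sequentially])
    then have "\<forall>\<^sub>F n in sequentially. ln (real n) / real n < ln 2 / (1 / c) ^ e" using c by (intro order_tendstoD(2)[of _ 0]) auto
    then show ?thesis using eventually_ge_at_top[of 2]
    proof eventually_elim
      case (elim n)
      then have "0 < ln (real n)" by simp
      then show ?case using elim c unfolding log_def by (simp add: field_simps)
    qed
  qed
  show ?thesis
  proof (intro exI[of _ c] conjI c)
    show "\<forall>\<^sub>F n in sequentially. \<forall>b. real b \<le> c * (real n / log 2 (real n)) powr (1 / real e) \<longrightarrow>
      maker_wins_universality (NN n) b (cls n)"
      using NN X eventually_ge_at_top[of n0] eventually_ge_at_top[of 2]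
    proof eventually_elim
      case (elim n)
      define X where "X = real n / log 2 (real n)"
      have lgn: "0 < ln (real n)" "0 < log 2 (real n)" using elim by auto
      have X0: "0 < X" unfolding X_def using elim lgn by simp
      show ?case
      proof (intro allI impI)
        fix b assume b: "real b \<le> c * (real n / log 2 (real n)) powr (1 / real e)"
        \<comment> \<open>The bias may be 0; as \<open>c * X powr (1 / e)\<close> is at least 1 for
          large \<open>n\<close>, the bound on \<open>b\<close> passes to
          \<open>\<beta>\<close>.\<close>
        define \<beta> where "\<beta> = max 1 (real b)"
        have cX: "(c * X powr (1 / real e)) ^ e = c ^ e * X"
          using X0 e by (simp add: power_mult_distrib powr_power)
        have "1 \<le> c * X powr (1 / real e)"
        proof (rule ccontr)
          assume "\<not> ?thesis"
          then have "(c * X powr (1 / real e)) ^ e < 1" using c X0 e by (intro power_less_one_iff[THEN iffD2]) auto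
          moreover have "1 \<le> c ^ e * X"
            using elim(2) c unfolding X_def by (simp add: power_one_over pos_divide_le_eq mult.commute)
          ultimately show False using cX by linarith
        qed
        then have "\<beta> \<le> c * X powr (1 / real e)" using b unfolding \<beta>_def X_def by simp
        then have "\<beta> ^ e \<le> (c * X powr (1 / real e)) ^ e" by (rule power_mono) (simp add: \<beta>_def)
        then have \<beta>e: "\<beta> ^ e \<le> c ^ e * X" unfolding cX .
        have \<beta>1: "1 \<le> \<beta>" unfolding \<beta>_def by simp
        define \<tau> where "\<tau> = nat \<lceil>16 * \<beta> / \<epsilon>\<rceil>"
        have \<tau>: "16 * \<beta> / \<epsilon> \<le> real \<tau>" unfolding \<tau>_def by linarith
        have one: "1 \<le> \<beta> / \<epsilon>" using \<beta>1 \<epsilon> by (simp add: pos_le_divide_eq)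
        have "real \<tau> \<le> 16 * \<beta> / \<epsilon> + 1" using one unfolding \<tau>_def by linarith
        then have \<tau>': "real \<tau> \<le> 32 * \<beta> / \<epsilon>" using one by simp
        have \<tau>0: "0 < real \<tau>" using \<tau> one by linarith
        define Q where "Q = (1 - 3 * \<epsilon>) * (1 / real \<tau>)"
        have Q: "\<epsilon> / 64 / \<beta> \<le> Q"
        proof -
          have "\<epsilon> / (32 * \<beta>) \<le> 1 / real \<tau>" using \<tau>' \<tau>0 \<epsilon> \<beta>1 by (simp add: field_simps)
          then have "1 / 2 * (\<epsilon> / (32 * \<beta>)) \<le> Q" unfolding Q_def using \<epsilon> \<beta>1 by (intro mult_mono) auto
          then show ?thesis by simp
        qed
        have big: "\<Gamma> * (K * ln (real (NN n))) \<le> Q ^ e * real n"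
        proof -
          have "ln (real (NN n)) \<le> ln (real n ^ 2)" using elim by (subst ln_le_cancel_iff) auto
          also have "\<dots> = 2 * ln (real n)" using elim by (simp add: ln_realpow)
          also have "\<dots> \<le> 2 * log 2 (real n)" using lgn ln_2_less_1 unfolding log_def by (simp add: pos_le_divide_eq)
          finally have "\<Gamma> * (K * ln (real (NN n))) \<le> \<Gamma> * (K * (2 * log 2 (real n)))" using \<Gamma> K by (intro mult_left_mono) auto
          also have "\<dots> = 2 * (\<Gamma> * K) * log 2 (real n)" by simp
          also have "\<dots> \<le> Q ^ e * real n"
          proof -
            have "2 * (\<Gamma> * K) * \<beta> ^ e \<le> 2 * (\<Gamma> * K) * (c ^ e * X)" using \<beta>e \<Gamma>K by (intro mult_left_mono) auto
            also have "\<dots> = 2 * (\<Gamma> * K) * c ^ e * X" by simp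
            also have "\<dots> \<le> (\<epsilon> / 64) ^ e * X" using c_pow X0 by (intro mult_right_mono) auto
            also have "\<dots> \<le> (Q * \<beta>) ^ e * X"
            proof -
              have "\<epsilon> / 64 \<le> Q * \<beta>" using Q \<beta>1 by (simp add: pos_divide_le_eq)
              then show ?thesis using \<epsilon> X0 by (intro mult_right_mono power_mono) auto
            qed
            also have "\<dots> = Q ^ e * X * \<beta> ^ e" by (simp add: power_mult_distrib)
            finally have "2 * (\<Gamma> * K) \<le> Q ^ e * X" using \<beta>1 by (simp add: mult_le_cancel_right)
            then have "2 * (\<Gamma> * K) * log 2 (real n) \<le> Q ^ e * X * log 2 (real n)" using lgn by (intro mult_right_mono) auto
            then show ?thesis unfolding X_def using lgn by simp
          qed
          finally show ?thesis .
        qed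
        show "maker_wins_universality (NN n) b (cls n)" unfolding maker_wins_universality_def
        proof (rule maker_wins_mono[OF maker_wins_host[where \<Delta> = \<Delta>]])
          fix R assume "\<exists>R'\<subseteq>R. host (NN n) (nbr R') (1 / real \<tau>) \<epsilon> (54 * (real \<Delta> + 1) / \<epsilon>) \<Delta>"
          then obtain R' where "R' \<subseteq> R" "host (NN n) (nbr R') (1 / real \<tau>) \<epsilon> K \<Delta>" unfolding K_def by blast
          then show "\<forall>H\<in>cls n. contains_copy ({..<NN n}, R) H" using copy elim big unfolding Q_def by blast
        qed (use elim \<epsilon> \<tau> in \<open>auto simp: \<beta>_def\<close>)
      qed
    qed
  qed
qed

theorem theorem1p6:
  fixes d \<Delta> :: nat and \<delta> :: real
  assumes "d \<ge> 1" and "\<Delta> \<ge> 1" and "\<delta> > 0"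
  shows "\<exists>c::real. c > 0 \<and> (\<forall>\<^sub>F n::nat in sequentially. \<forall>b::nat.
    (real b \<le> c * (real n / log 2 (real n)) powr (1 / real \<Delta>) \<longrightarrow>
       maker_wins_universality (nat \<lfloor>(1 + \<delta>) * real n\<rfloor>) b (graphs_maxdeg n \<Delta>)) \<and>
    (real b \<le> c * (real n / log 2 (real n)) powr (1 / real \<Delta>) \<longrightarrow>
       maker_wins_universality n b (tf_graphs_maxdeg n \<Delta>)) \<and>
    (real b \<le> c * (real n / log 2 (real n)) powr (1 / (2 * real d)) \<longrightarrow>
       maker_wins_universality (nat \<lfloor>(1 + \<delta>) * real n\<rfloor>) b (graphs_degen_maxdeg n d \<Delta>)) \<and>
    (real b \<le> c * (real n / log 2 (real n)) powr (1 / (2 * real d + 1)) \<longrightarrow>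
       maker_wins_universality n b (tf_graphs_degen_maxdeg n d \<Delta>)))"
proof -
  let ?N = "\<lambda>n. nat \<lfloor>(1 + \<delta>) * real n\<rfloor>"
  have N: "\<forall>\<^sub>F n in sequentially. 3 \<le> ?N n \<and> real (?N n) \<le> real n ^ 2"
    using eventually_ge_at_top[of "nat \<lceil>1 + \<delta>\<rceil> + 3"]
  proof eventually_elim
    case (elim n)
    then have n: "1 + \<delta> \<le> real n" "3 \<le> real n" by linarith+
    have "1 * real n \<le> (1 + \<delta>) * real n" using assms(3) by (intro mult_right_mono) auto
    then have "3 \<le> (1 + \<delta>) * real n" using n(2) by linarith
    moreover have "(1 + \<delta>) * real n \<le> real n ^ 2" unfolding power2_eq_square using n by (intro mult_right_mono) auto
    moreover have "real (?N n) \<le> (1 + \<delta>) * real n" using assms(3) by simp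
    ultimately show ?case by linarith
  qed
  have N': "\<forall>\<^sub>F n in sequentially. 3 \<le> n \<and> real n \<le> real n ^ 2"
    using eventually_ge_at_top[of 3] by eventually_elim (simp add: power2_eq_square)
  obtain c1 where c1: "c1 > 0" "\<forall>\<^sub>F n in sequentially. \<forall>b. real b \<le> c1 * (real n / log 2 (real n)) powr (1 / real \<Delta>) \<longrightarrow>
      maker_wins_universality (?N n) b (graphs_maxdeg n \<Delta>)"
    using maker_wins_of_embeds[OF embeds_max_degree assms(2) N] assms by blast
  obtain c2 where c2: "c2 > 0" "\<forall>\<^sub>F n in sequentially. \<forall>b. real b \<le> c2 * (real n / log 2 (real n)) powr (1 / real \<Delta>) \<longrightarrow>
      maker_wins_universality n b (tf_graphs_maxdeg n \<Delta>)"
    using maker_wins_of_embeds[OF embeds_tf_max_degree assms(2) N'] assms by blast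
  have d: "1 \<le> 2 * d" "1 \<le> 2 * d + 1" using assms by auto
  obtain c3 where c3: "c3 > 0" "\<forall>\<^sub>F n in sequentially. \<forall>b. real b \<le> c3 * (real n / log 2 (real n)) powr (1 / real (2 * d)) \<longrightarrow>
      maker_wins_universality (?N n) b (graphs_degen_maxdeg n d \<Delta>)"
    using maker_wins_of_embeds[OF embeds_degenerate d(1) N] assms by blast
  obtain c4 where c4: "c4 > 0" "\<forall>\<^sub>F n in sequentially. \<forall>b. real b \<le> c4 * (real n / log 2 (real n)) powr (1 / real (2 * d + 1)) \<longrightarrow>
      maker_wins_universality n b (tf_graphs_degen_maxdeg n d \<Delta>)"
    using maker_wins_of_embeds[OF embeds_tf_degenerate d(2) N'] assms by blast
  define c where "c = min (min c1 c2) (min c3 c4)"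
  have le: "real b \<le> c' * x powr y" if "real b \<le> c * x powr y" "c \<le> c'" for b c' x y
    using that mult_right_mono[OF that(2), of "x powr y"] by simp
  have c: "c > 0" "c \<le> c1" "c \<le> c2" "c \<le> c3" "c \<le> c4" unfolding c_def using c1 c2 c3 c4 by auto
  have d': "real (2 * d) = 2 * real d" "real (2 * d + 1) = 2 * real d + 1" by simp_all
  show ?thesis
  proof (intro exI[of _ c] conjI c(1))
    show "\<forall>\<^sub>F n in sequentially. \<forall>b.
      (real b \<le> c * (real n / log 2 (real n)) powr (1 / real \<Delta>) \<longrightarrow>
         maker_wins_universality (?N n) b (graphs_maxdeg n \<Delta>)) \<and>
      (real b \<le> c * (real n / log 2 (real n)) powr (1 / real \<Delta>) \<longrightarrow>
         maker_wins_universality n b (tf_graphs_maxdeg n \<Delta>)) \<and>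
      (real b \<le> c * (real n / log 2 (real n)) powr (1 / (2 * real d)) \<longrightarrow>
         maker_wins_universality (?N n) b (graphs_degen_maxdeg n d \<Delta>)) \<and>
      (real b \<le> c * (real n / log 2 (real n)) powr (1 / (2 * real d + 1)) \<longrightarrow>
         maker_wins_universality n b (tf_graphs_degen_maxdeg n d \<Delta>))"
      using c1(2) c2(2) c3(2) c4(2) unfolding d'
    proof eventually_elim
      case (elim n)
      show ?case
      proof (intro allI conjI impI)
        fix b assume b: "real b \<le> c * (real n / log 2 (real n)) powr (1 / real \<Delta>)"
        show "maker_wins_universality (?N n) b (graphs_maxdeg n \<Delta>)" using elim(1) le[OF b c(2)] by simp
        show "maker_wins_universality n b (tf_graphs_maxdeg n \<Delta>)" using elim(2) le[OF b c(3)] by simp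
      next
        fix b assume b: "real b \<le> c * (real n / log 2 (real n)) powr (1 / (2 * real d))"
        show "maker_wins_universality (?N n) b (graphs_degen_maxdeg n d \<Delta>)" using elim(3) le[OF b c(4)] by simp
      next
        fix b assume b: "real b \<le> c * (real n / log 2 (real n)) powr (1 / (2 * real d + 1))"
        show "maker_wins_universality n b (tf_graphs_degen_maxdeg n d \<Delta>)" using elim(4) le[OF b c(5)] by simp
      qed
    qed
  qed
qed

end
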